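(* Let $H$ be a hyperfinite integer and let $A\subseteq[0,H]$ be an internal set. Suppose $0=\min A$, $H=\max A$, $|A|\succ 0$, $\gcd(A)=1$, and $|2A|=3|A|-3+b$ with $0\leqslant b\sim 0$. Then either $H+1\leqslant 2|A|-1+2b$ or $A$ is a subset of a bi-arithmetic progression of length at most $|A|+b$.
   Context: Work in a fixed countably saturated nonstandard universe. Hyperfinite integers are the elements of ${}^*\mathbb N\smallsetminus\mathbb N$, where $\mathbb N$ is the set of non-negative integers. For integers $m,n$, $[m,n]$ is the (internal) interval of integers between them; $|A|$ is the internal cardinality of $A$; $2A=A+A=\{a+a':a,a'\in A\}$. With $H$ fixed, for real numbers $r,s\in{}^*\mathbb R$: $r\sim s$ means $(s-r)/H$ is infinitesimal; $r\prec s$ (equivalently $s\succ r$) means $r<s$ and not $r\sim s$. For $a,d,k\in{}^*\mathbb N$ with $d,k\geqslant 1$, the set $\{a,a+d,\ldots,a+(k-1)d\}$ is an arithmetic progression of length $k$ with difference $d$. A bi-arithmetic progression of length $k$ with difference $d$ is a set of the form $I\cup J$ where $I$ and $J$ are arithmetic progressions of difference $d$, $|I|+|J|=k$, and $I+I$, $I+J$, $J+J$ are pairwise disjoint. When $A$ is said to be a subset of a bi-arithmetic progression $I\cup J$, it is understood that $A\cap I$ and $A\cap J$ are both non-empty. *)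

theory Defs
  imports Complex_Main "HOL-Library.Set_Algebras"
begin

text \<open>
  A nonstandard universe is a map \<open>*\<close> from the superstructure over the reals to the
  superstructure over a set \<open>*\<real>\<close> that satisfies the transfer principle.  The whole superstructure
  is not a HOL type, so the definitions below describe the part of the universe that concerns the
  objects of rank at most one, \<open>V\<^sub>1(\<real>) = \<real> \<union> Pow \<real>\<close>, and all finitary relations between them
  (internal cardinality and gcd, for instance, are extensions of such relations).  Every countably
  saturated nonstandard universe restricts to a structure of this kind.  The set \<open>*\<real>\<close> is
  represented by a type \<open>'r\<close> of class \<open>linordered_field\<close>, whose operations are required to be the
  extensions of the operations of \<open>\<real>\<close>.
\<close>

datatype 'a level1 = Atom 'a | SetOf "'a set"

text \<open>
  First-order formulas over \<open>'a\<close>.  A finitary relation is a set of lists; only its lists of the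
  appropriate length matter in \<open>FRel R xs\<close>.  Every relation on \<open>'a\<close> is an atomic symbol.
\<close>

datatype 'a fm =
    FRel "'a list set" "nat list"
  | FNot "'a fm"
  | FAnd "'a fm" "'a fm"
  | FEx nat "'a fm"

primrec sat :: "'u set \<Rightarrow> ('a list set \<Rightarrow> 'u list set) \<Rightarrow> (nat \<Rightarrow> 'u) \<Rightarrow> 'a fm \<Rightarrow> bool" where
  "sat U J v (FRel R xs) \<longleftrightarrow> map v xs \<in> J R"
| "sat U J v (FNot p) \<longleftrightarrow> \<not> sat U J v p"
| "sat U J v (FAnd p q) \<longleftrightarrow> sat U J v p \<and> sat U J v q"
| "sat U J v (FEx i p) \<longleftrightarrow> (\<exists>u\<in>U. sat U J (v(i := u)) p)"

type_synonym 'r ext = "real level1 list set \<Rightarrow> 'r level1 list set"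

text \<open>The set \<open>*(V\<^sub>1(\<real>))\<close>: all elements of \<open>*\<real>\<close> and the internal subsets of \<open>*\<real>\<close>.\<close>

definition internals :: "'r ext \<Rightarrow> 'r level1 set" where
  "internals star = {z. [z] \<in> star {[x] | x. True}}"

definition internal :: "'r ext \<Rightarrow> 'r set \<Rightarrow> bool" where
  "internal star A \<longleftrightarrow> SetOf A \<in> internals star"

text \<open>
  \<open>emb\<close> is the map \<open>*\<close> on the objects of \<open>V\<^sub>1(\<real>)\<close>, and \<open>star\<close> is the map \<open>*\<close> on the
  finitary relations on \<open>V\<^sub>1(\<real>)\<close>.  In the transfer principle quantifiers range over \<open>V\<^sub>1(\<real>)\<close> on the
  standard side and over \<open>*(V\<^sub>1(\<real>))\<close> on the nonstandard side.
\<close>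

definition nonstandard_universe ::
    "(real level1 \<Rightarrow> 'r::linordered_field level1) \<Rightarrow> 'r ext \<Rightarrow> bool" where
  "nonstandard_universe emb star \<longleftrightarrow>
     range emb \<subseteq> internals star \<and>
     (\<forall>z. [z] \<in> star {[Atom x] | x. True} \<longleftrightarrow> z \<in> range Atom) \<and>
     range Atom \<subseteq> internals star \<and>
     (\<forall>z\<in>internals star. \<forall>w\<in>internals star. [z, w] \<in> star {[x, x] | x. True} \<longleftrightarrow> z = w) \<and>
     (\<forall>z\<in>internals star. \<forall>w\<in>internals star.
        [z, w] \<in> star {[Atom x, SetOf X] | x X. x \<in> X} \<longleftrightarrow>
        (\<exists>x X. z = Atom x \<and> w = SetOf X \<and> x \<in> X)) \<and>
     (\<forall>x y z. [Atom x, Atom y, Atom z] \<in> star {[Atom s, Atom t, Atom (s + t)] | s t. True}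
        \<longleftrightarrow> z = x + y) \<and>
     (\<forall>x y z. [Atom x, Atom y, Atom z] \<in> star {[Atom s, Atom t, Atom (s * t)] | s t. True}
        \<longleftrightarrow> z = x * y) \<and>
     (\<forall>x y. [Atom x, Atom y] \<in> star {[Atom s, Atom t] | s t. s \<le> t} \<longleftrightarrow> x \<le> y) \<and>
     (\<forall>p v. sat UNIV (\<lambda>R. R) v p \<longleftrightarrow> sat (internals star) star (\<lambda>i. emb (v i)) p)"

text \<open>
  The internal subsets of \<open>*(V\<^sub>1(\<real>))\<close> are obtained from the extensions of standard relations by
  fixing internal parameters.
\<close>

definition internal_class :: "'r ext \<Rightarrow> 'r level1 set \<Rightarrow> bool" where
  "internal_class star X \<longleftrightarrow>
     (\<exists>R ps. set ps \<subseteq> internals star \<and> X = {z \<in> internals star. z # ps \<in> star R})"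

definition countably_saturated :: "'r ext \<Rightarrow> bool" where
  "countably_saturated star \<longleftrightarrow>
     (\<forall>F :: nat \<Rightarrow> 'r level1 set.
        (\<forall>n. internal_class star (F n)) \<and> (\<forall>n. (\<Inter>i\<le>n. F i) \<noteq> {}) \<longrightarrow> (\<Inter>n. F n) \<noteq> {})"

definition hypernats :: "'r ext \<Rightarrow> 'r set" where
  "hypernats star = {x. [Atom x] \<in> star {[Atom (real n)] | n. True}}"

definition hyperints :: "'r ext \<Rightarrow> 'r set" where
  "hyperints star = {x. [Atom x] \<in> star {[Atom (real_of_int m)] | m. True}}"

definition hyperfinite_integers :: "'r::linordered_field ext \<Rightarrow> 'r set" where
  "hyperfinite_integers star = hypernats star - \<nat>"

definition interval :: "'r::linordered_field ext \<Rightarrow> 'r \<Rightarrow> 'r \<Rightarrow> 'r set" where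
  "interval star m n = {x \<in> hyperints star. m \<le> x \<and> x \<le> n}"

text \<open>
  Internal cardinality and gcd: the extensions of the standard functions.  They are used for
  internal (hyperfinite) sets, which are in general infinite, so \<^const>\<open>card\<close> and \<^const>\<open>Gcd\<close>
  do not apply.
\<close>

definition icard :: "'r ext \<Rightarrow> 'r set \<Rightarrow> 'r" where
  "icard star A =
     (THE n. [SetOf A, Atom n] \<in> star {[SetOf X, Atom (real (card X))] | X. finite X})"

definition igcd :: "'r ext \<Rightarrow> 'r set \<Rightarrow> 'r" where
  "igcd star A =
     (THE g. [SetOf A, Atom g] \<in> star {[SetOf (real ` X), Atom (real (Gcd X))] | X. True})"

definition is_min :: "'r::linordered_field \<Rightarrow> 'r set \<Rightarrow> bool" where
  "is_min m A \<longleftrightarrow> m \<in> A \<and> (\<forall>a\<in>A. m \<le> a)"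

definition is_max :: "'r::linordered_field \<Rightarrow> 'r set \<Rightarrow> bool" where
  "is_max m A \<longleftrightarrow> m \<in> A \<and> (\<forall>a\<in>A. a \<le> m)"

definition infinitesimal :: "'r::linordered_field \<Rightarrow> bool" where
  "infinitesimal x \<longleftrightarrow> (\<forall>n::nat. n > 0 \<longrightarrow> \<bar>x\<bar> < 1 / of_nat n)"

definition near :: "'r::linordered_field \<Rightarrow> 'r \<Rightarrow> 'r \<Rightarrow> bool" where
  "near H r s \<longleftrightarrow> infinitesimal ((s - r) / H)"

definition much_less :: "'r::linordered_field \<Rightarrow> 'r \<Rightarrow> 'r \<Rightarrow> bool" where
  "much_less H r s \<longleftrightarrow> r < s \<and> \<not> near H r s"

definition is_ap :: "'r::linordered_field ext \<Rightarrow> 'r \<Rightarrow> 'r \<Rightarrow> 'r set \<Rightarrow> bool" where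
  "is_ap star d k P \<longleftrightarrow>
     d \<in> hypernats star \<and> k \<in> hypernats star \<and> d \<ge> 1 \<and> k \<ge> 1 \<and>
     (\<exists>a\<in>hypernats star. P = {a + i * d | i. i \<in> hypernats star \<and> i < k})"

definition is_bi_ap :: "'r::linordered_field ext \<Rightarrow> 'r \<Rightarrow> 'r \<Rightarrow> 'r set \<Rightarrow> 'r set \<Rightarrow> bool" where
  "is_bi_ap star d k I J \<longleftrightarrow>
     (\<exists>l. is_ap star d l I) \<and> (\<exists>l. is_ap star d l J) \<and> icard star I + icard star J = k \<and>
     (I + I) \<inter> (I + J) = {} \<and> (I + I) \<inter> (J + J) = {} \<and> (I + J) \<inter> (J + J) = {}"

text \<open>Being a subset of \<open>I \<union> J\<close> includes that both parts are met.\<close>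

definition subset_of_bi_ap :: "'r::linordered_field ext \<Rightarrow> 'r set \<Rightarrow> 'r \<Rightarrow> bool" where
  "subset_of_bi_ap star A k \<longleftrightarrow>
     (\<exists>d I J. is_bi_ap star d k I J \<and> A \<subseteq> I \<union> J \<and> A \<inter> I \<noteq> {} \<and> A \<inter> J \<noteq> {})"

end

theory Submission
  imports Defs
begin

text \<open>
  By transfer it suffices to prove the theorem for finite sets of integers with \<open>H \<le> q (|A| - 1)\<close> and
  \<open>b + 1\<close> at most a small multiple, depending on \<open>q\<close>, of \<open>H\<close>.  Let \<open>S\<close> be the reduction of \<open>A\<close>
  modulo \<open>H\<close>.  Then \<open>|2A| = |2S| + |D| + 1\<close>, where \<open>D\<close> is the set of residues with two
  representatives in \<open>2A\<close>, and \<open>S \<subseteq> D\<close>.  Suppose \<open>2|A| - 1 + 2b \<le> H\<close>, and let \<open>X\<close> be an atom in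
  Hamidoune's sense: it minimizes \<open>|X + S| - |X|\<close> among the sets with \<open>|X| \<ge> b + 2\<close> and
  \<open>|X + S| \<le> H - b - 2\<close>, and is as small as possible.  Translates of an atom meet in at most \<open>b + 1\<close>
  elements, so \<open>X\<close> is a subgroup or \<open>|X|\<^sup>2 \<le> 2 (b + 1) H\<close>.  In the first case
  counting the cosets met by \<open>S\<close> leaves two cosets, and a second count, of the holes of \<open>A\<close> in them,
  finishes.  In the second case \<open>D\<close> is almost as small as \<open>S\<close>.  Going around the circle in steps of
  \<open>t \<le> H / 2\<close> then shows that \<open>S\<close> is concentrated on a coset, which leads back to two cosets, unless
  \<open>|(S + t) - S|\<close> is at least proportional to \<open>t\<close>.  So \<open>X\<close> lies in a short interval, and the
  multiples of the greatest common divisor \<open>d\<close> of its elements nearly preserve \<open>S\<close>.  Therefore \<open>S\<close> is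
  a progression of difference \<open>d\<close> modulo \<open>H\<close> with few holes.  It cannot wrap around, since otherwise
  \<open>D\<close> would be too large, and lifting it to integers gives the two progressions.
\<close>

section \<open>Periodic sets of integers\<close>

text \<open>The conclusion is exact in \<open>b\<close>, although \<open>b\<close> is only known to
  be small against \<open>H\<close>. The structural steps may therefore lose constant factors: they
  only locate \<open>A\<close>. The length \<open>|A| + b\<close> comes from counts without loss,
  \<open>holes_bound\<close> for two cosets and \<open>lam_half\<close>, \<open>nh_le_b\<close> for
  a progression. The obstacle is that \<open>2A\<close> is not recovered from a sumset in the cyclic
  group. Identifying \<open>0\<close> with \<open>H\<close> moves part of the information into
  \<open>D\<close>, which is not a sumset, so theorems on small doubling in groups do not apply to
  it. The arguments about rotation and wrapping exist to control \<open>D\<close>. The threshold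
  \<open>b + 2\<close> for atoms is the largest one for which the available bounds let
  \<open>S\<close> itself compete. All constants depend on the density bound \<open>q\<close> only;
  the factor exponential in \<open>q\<close> comes from the number of doublings that produce all
  multiples of \<open>d\<close> from the differences in an atom. Since the finite statement has a
  threshold \<open>scale q\<close> for \<open>H / (b + 1)\<close>, it can be transferred for each
  standard \<open>q\<close> separately.\<close>

text \<open>Subsets of the cyclic group of order \<open>N\<close> are represented by \<open>N\<close>-periodic sets of integers.\<close>

definition per :: "int \<Rightarrow> int set \<Rightarrow> bool" where
  "per N X \<longleftrightarrow> (\<forall>x. x + N \<in> X \<longleftrightarrow> x \<in> X)"

definition sz :: "int \<Rightarrow> int set \<Rightarrow> int" where
  "sz N X = int (card (X \<inter> {0..<N}))"

definition tr :: "int \<Rightarrow> int set \<Rightarrow> int set" where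
  "tr t X = {x. x - t \<in> X}"

definition subgp :: "int set \<Rightarrow> bool" where
  "subgp K \<longleftrightarrow> 0 \<in> K \<and> (\<forall>x\<in>K. \<forall>y\<in>K. x - y \<in> K)"

lemma in_tr [simp]: "x \<in> tr t X \<longleftrightarrow> x - t \<in> X"
  by (simp add: tr_def)

lemma in_plus: "(c::int) \<in> X + Y \<longleftrightarrow> (\<exists>x\<in>X. c - x \<in> Y)"
  by (auto simp: set_plus_def intro: bexI[where x = "c - _"])

lemma plusI: "(x::int) \<in> X \<Longrightarrow> y \<in> Y \<Longrightarrow> x + y \<in> X + Y"
  by (rule set_plus_intro)

lemma per_add_mult: assumes "per N X" shows "x + i * N \<in> X \<longleftrightarrow> x \<in> X"
proof -
  have up: "x + int k * N \<in> X \<longleftrightarrow> x \<in> X" for x k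
  proof (induction k)
    case (Suc k)
    have "x + int (Suc k) * N = (x + int k * N) + N" by (simp add: algebra_simps)
    then show ?case using Suc assms unfolding per_def by metis
  qed simp
  show ?thesis
  proof (cases "i \<ge> 0")
    case True
    then show ?thesis using up[of x "nat i"] by simp
  next
    case False
    then show ?thesis using up[of "x + i * N" "nat (- i)"] by simp
  qed
qed

lemma per_cong: assumes "per N X" "N dvd x - y" shows "x \<in> X \<longleftrightarrow> y \<in> X"
proof -
  obtain k where "x - y = N * k" using assms(2) by (auto simp: dvd_def)
  then have "x = y + k * N" by (simp add: algebra_simps)
  then show ?thesis using per_add_mult[OF assms(1)] by simp
qed

lemma per_mod: assumes "per N X" shows "x mod N \<in> X \<longleftrightarrow> x \<in> X"
  by (rule per_cong[OF assms]) (simp add: mod_eq_dvd_iff[symmetric])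

lemma per_plus: "per N X \<Longrightarrow> per N (X + Y)"
proof -
  assume p: "per N X"
  show "per N (X + Y)"
    unfolding per_def
  proof (intro allI iffI)
    fix c assume "c + N \<in> X + Y"
    then obtain x where "x \<in> X" "c + N - x \<in> Y" by (auto simp: in_plus)
    then show "c \<in> X + Y" using p per_add_mult[OF p, of x "-1"]
      by (auto simp: in_plus algebra_simps intro!: bexI[of _ "x - N"])
  next
    fix c assume "c \<in> X + Y"
    then obtain x where "x \<in> X" "c - x \<in> Y" by (auto simp: in_plus)
    then show "c + N \<in> X + Y" using p
      by (auto simp: in_plus per_def algebra_simps intro!: bexI[of _ "x + N"])
  qed
qed

lemma per_tr: "per N X \<Longrightarrow> per N (tr t X)"
  unfolding per_def by (simp add: tr_def) (metis add_diff_eq diff_add_eq)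

lemma per_Un: "per N X \<Longrightarrow> per N Y \<Longrightarrow> per N (X \<union> Y)" by (auto simp: per_def)
lemma per_Int: "per N X \<Longrightarrow> per N Y \<Longrightarrow> per N (X \<inter> Y)" by (auto simp: per_def)
lemma per_Diff: "per N X \<Longrightarrow> per N Y \<Longrightarrow> per N (X - Y)" by (auto simp: per_def)
lemma per_Compl: "per N X \<Longrightarrow> per N (- X)" by (auto simp: per_def)
lemma per_refl: assumes "per N X" shows "per N {x. c - x \<in> X}"
proof -
  have "c - (x + N) \<in> X \<longleftrightarrow> c - x \<in> X" for x
    using per_add_mult[OF assms, of "c - x" "-1"] by (simp add: algebra_simps)
  then show ?thesis by (simp add: per_def)
qed
lemma inj_modD: "inj_on (\<lambda>x. x mod N) F \<Longrightarrow> x \<in> F \<Longrightarrow> y \<in> F \<Longrightarrow> (N::int) dvd x - y \<Longrightarrow> x = y"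
  by (simp add: inj_on_def mod_eq_dvd_iff)

text \<open>Representatives may be taken anywhere in the integers: a set injective modulo
  \<open>N\<close> bounds the number of residues from below, and in \<open>sz_le\<close> a set
  meeting every residue bounds it from above. Later counts mostly use this pair instead of the
  window \<open>{0..<N}\<close>.\<close>

lemma sz_ge:
  assumes "N > 0" "per N X" "F \<subseteq> X" "inj_on (\<lambda>x. x mod N) F"
  shows "int (card F) \<le> sz N X" "finite F"
proof -
  have s: "(\<lambda>x. x mod N) ` F \<subseteq> X \<inter> {0..<N}" using assms per_mod by auto
  then show "finite F" using assms(4) by (meson finite_Int finite_atLeastLessThan_int finite_imageD finite_subset)
  have "card F = card ((\<lambda>x. x mod N) ` F)" using assms(4) by (simp add: card_image)
  also have "\<dots> \<le> card (X \<inter> {0..<N})" by (rule card_mono[OF _ s]) simp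
  finally show "int (card F) \<le> sz N X" by (simp add: sz_def)
qed

lemma sz_le:
  assumes "N > 0" "finite F" "\<And>x. x \<in> X \<Longrightarrow> \<exists>f\<in>F. N dvd x - f"
  shows "sz N X \<le> int (card F)"
proof -
  have "X \<inter> {0..<N} \<subseteq> (\<lambda>x. x mod N) ` F"
  proof
    fix x assume x: "x \<in> X \<inter> {0..<N}"
    then obtain f where "f \<in> F" "N dvd x - f" using assms(3) by auto
    then show "x \<in> (\<lambda>x. x mod N) ` F" using x by (force simp: mod_eq_dvd_iff[symmetric] image_iff)
  qed
  then have "card (X \<inter> {0..<N}) \<le> card ((\<lambda>x. x mod N) ` F)" using assms(2) by (intro card_mono) auto
  also have "\<dots> \<le> card F" using assms(2) by (rule card_image_le)
  finally show ?thesis by (simp add: sz_def)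
qed

lemma inj_mod_window: "N > 0 \<Longrightarrow> inj_on (\<lambda>x. x mod N) {a..<a + (N::int)}"
proof (rule inj_onI)
  fix x y assume "N > 0" "x \<in> {a..<a + N}" "y \<in> {a..<a + N}" "x mod N = y mod N"
  then have "N dvd x - y" "\<bar>x - y\<bar> < N" by (auto simp: mod_eq_dvd_iff)
  then show "x = y" using dvd_imp_le_int[of "x - y" N] by fastforce
qed

lemma sz_window:
  assumes "N > 0" "per N X" shows "sz N X = int (card (X \<inter> {a..<a + N}))"
proof (rule antisym)
  show "sz N X \<le> int (card (X \<inter> {a..<a + N}))"
  proof (rule sz_le)
    fix x assume x: "x \<in> X"
    let ?f = "a + (x - a) mod N"
    have d: "N dvd x - ?f" by (simp add: mod_eq_dvd_iff[symmetric] mod_simps)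
    then have "?f \<in> X" using per_cong[OF assms(2) d] x by simp
    then show "\<exists>f\<in>X \<inter> {a..<a + N}. N dvd x - f" using d assms(1) by (intro bexI[of _ ?f]) auto
  qed (use assms in auto)
  show "int (card (X \<inter> {a..<a + N})) \<le> sz N X"
    by (rule sz_ge[OF assms]) (auto intro: inj_on_subset[OF inj_mod_window[OF assms(1)]])
qed

lemma sz_nonneg [simp]: "0 \<le> sz N X" by (simp add: sz_def)

lemma sz_mono: "X \<subseteq> Y \<Longrightarrow> sz N X \<le> sz N Y"
  by (auto simp: sz_def intro!: card_mono)

lemma sz_Un_Int: "sz N (X \<union> Y) + sz N (X \<inter> Y) = sz N X + sz N Y"
proof -
  have "card (X \<inter> {0..<N}) + card (Y \<inter> {0..<N}) =
     card ((X \<inter> {0..<N}) \<union> (Y \<inter> {0..<N})) + card ((X \<inter> {0..<N}) \<inter> (Y \<inter> {0..<N}))"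
    by (rule card_Un_Int) auto
  moreover have "(X \<inter> {0..<N}) \<union> (Y \<inter> {0..<N}) = (X \<union> Y) \<inter> {0..<N}"
    "(X \<inter> {0..<N}) \<inter> (Y \<inter> {0..<N}) = (X \<inter> Y) \<inter> {0..<N}" by auto
  ultimately show ?thesis by (simp add: sz_def)
qed

lemma sz_empty [simp]: "sz N {} = 0" by (simp add: sz_def)

lemma sz_Un: "X \<inter> Y = {} \<Longrightarrow> sz N (X \<union> Y) = sz N X + sz N Y"
  using sz_Un_Int[of N X Y] by simp

lemma sz_Un_le: "sz N (X \<union> Y) \<le> sz N X + sz N Y"
  using sz_Un_Int[of N X Y] sz_nonneg[of N "X \<inter> Y"] by linarith

lemma sz_Diff: "sz N (X - Y) = sz N X - sz N (X \<inter> Y)"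
proof -
  have "(X - Y) \<inter> (X \<inter> Y) = {}" by auto
  from sz_Un[OF this, of N] show ?thesis by (simp add: Un_Diff_Int)
qed

lemma sz_UNIV: "N > 0 \<Longrightarrow> sz N UNIV = N" by (simp add: sz_def)

lemma sz_Compl: "N > 0 \<Longrightarrow> sz N (- X) = N - sz N X"
  using sz_Diff[of N UNIV X] by (simp add: sz_UNIV Compl_eq_Diff_UNIV)

lemma sz_le_N: "N > 0 \<Longrightarrow> sz N X \<le> N" using sz_mono[of X UNIV N] by (simp add: sz_UNIV)

lemma sz_pos: assumes "N > 0" "per N X" "x \<in> X" shows "sz N X \<ge> 1"
proof -
  have "int (card {x}) \<le> sz N X" by (rule sz_ge(1)[OF assms(1,2)]) (use assms in auto)
  then show ?thesis by simp
qed

lemma sz_0_iff: assumes "N > 0" "per N X" shows "sz N X = 0 \<longleftrightarrow> X = {}"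
  using sz_pos[OF assms] by fastforce

lemma sz_subset_eq: assumes "N > 0" "per N X" "per N Y" "X \<subseteq> Y" "sz N Y \<le> sz N X" shows "X = Y"
proof -
  have "sz N (Y - X) = sz N Y - sz N X" using assms(4) by (simp add: sz_Diff Int_absorb1)
  then have "sz N (Y - X) = 0" using assms(5) sz_nonneg[of N "Y - X"] by linarith
  then have "Y - X = {}" using sz_0_iff[OF assms(1) per_Diff[OF assms(3,2)]] by simp
  then show ?thesis using assms(4) by auto
qed

lemma sz_tr: assumes "N > 0" "per N X" shows "sz N (tr t X) = sz N X"
proof -
  have "tr t X \<inter> {t..<t+N} = (\<lambda>x. x + t) ` (X \<inter> {0..<N})"
    by (auto simp: image_iff intro!: bexI[where x = "_ - t"])
  then have "card (tr t X \<inter> {t..<t+N}) = card (X \<inter> {0..<N})" by (simp add: card_image)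
  then show ?thesis using sz_window[OF assms(1) per_tr[OF assms(2)], of t t] by (simp add: sz_def)
qed

lemma sz_refl: assumes "N > 0" "per N X" shows "sz N {x. c - x \<in> X} = sz N X"
proof -
  have "{x. c - x \<in> X} \<inter> {c-N+1..<c-N+1+N} = (\<lambda>x. c - x) ` (X \<inter> {0..<N})"
    by (auto simp: image_iff intro!: bexI[where x = "c - _"])
  then have "card ({x. c - x \<in> X} \<inter> {c-N+1..<c-N+1+N}) = card (X \<inter> {0..<N})"
    by (simp add: card_image inj_on_def)
  then show ?thesis using sz_window[OF assms(1) per_refl[OF assms(2)], of c "c-N+1"] by (simp add: sz_def)
qed

section \<open>Pigeonhole and double counting over translates\<close>

lemma sz_inter: assumes "sz N X + sz N Y > sz N Z" "X \<subseteq> Z" "Y \<subseteq> Z" shows "X \<inter> Y \<noteq> {}"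
proof
  assume "X \<inter> Y = {}"
  then have "sz N (X \<union> Y) = sz N X + sz N Y" by (rule sz_Un)
  moreover have "sz N (X \<union> Y) \<le> sz N Z" using assms by (intro sz_mono) auto
  ultimately show False using assms(1) by linarith
qed

lemma sz_sum: "sz N X = (\<Sum>x\<in>{0..<N}. of_bool (x \<in> X))"
proof -
  have "(\<Sum>x\<in>{0..<N} \<inter> X. 1::int) = (\<Sum>x\<in>{0..<N}. if x \<in> X then 1 else 0)"
    by (rule sum.inter_restrict) simp
  then show ?thesis by (simp add: sz_def Int_commute of_bool_def)
qed

text \<open>Exchange of summation: a pair \<open>x\<close>, \<open>y\<close> is counted exactly at
  the residue \<open>g\<close> of \<open>x - y\<close>. This drives the averaging in
  \<open>three_halves\<close> and \<open>small_or_subgroup\<close>.\<close>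

lemma sum_sz_inter:
  assumes "N > 0" "per N X" "per N Y"
  shows "(\<Sum>g\<in>{0..<N}. sz N (X \<inter> tr g Y)) = sz N X * sz N Y"
proof -
  have "(\<Sum>g\<in>{0..<N}. sz N (X \<inter> tr g Y)) =
      (\<Sum>g\<in>{0..<N}. \<Sum>x\<in>{0..<N}. of_bool (x \<in> X) * of_bool (x - g \<in> Y))"
    unfolding sz_sum by (simp only: Int_iff in_tr of_bool_conj)
  also have "\<dots> = (\<Sum>x\<in>{0..<N}. of_bool (x \<in> X) * (\<Sum>g\<in>{0..<N}. of_bool (x - g \<in> Y)))"
    unfolding sum_distrib_left by (rule sum.swap)
  also have "\<dots> = (\<Sum>x\<in>{0..<N}. of_bool (x \<in> X) * sz N Y)"
    using sz_refl[OF assms(1,3)] unfolding sz_sum by simp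
  also have "\<dots> = sz N X * sz N Y" unfolding sz_sum[of N X] by (simp only: sum_distrib_right)
  finally show ?thesis .
qed

section \<open>Subgroups and doubling below 3/2\<close>

lemma subgp_neg: "subgp K \<Longrightarrow> x \<in> K \<Longrightarrow> - x \<in> K"
  unfolding subgp_def by (metis diff_0)

lemma subgp_add: "subgp K \<Longrightarrow> x \<in> K \<Longrightarrow> y \<in> K \<Longrightarrow> x + y \<in> K"
  using subgp_neg[of K y] unfolding subgp_def by (metis diff_minus_eq_add)

lemma subgp_diff: "subgp K \<Longrightarrow> x \<in> K \<Longrightarrow> y \<in> K \<Longrightarrow> x - y \<in> K"
  by (simp add: subgp_def)

text \<open>Freiman's 3/2 theorem. The translates of \<open>Y\<close> by two of its elements lie in
  \<open>Y + Y\<close>, so they share more than half of \<open>Y\<close>. Hence each difference has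
  more than \<open>|Y| / 2\<close> representations, the representations of two differences have a
  common member, and \<open>Y - Y\<close> is closed under subtraction. As \<open>K\<close> is less
  than twice as large as \<open>Y\<close>, pigeonhole in a coset makes \<open>Y + Y\<close> a full
  coset.\<close>

lemma three_halves:
  assumes N: "N > 0" and Y: "per N Y" "y0 \<in> Y" and dbl: "2 * sz N (Y + Y) < 3 * sz N Y"
  obtains K where "subgp K" "per N K" "\<And>y. y \<in> Y \<Longrightarrow> Y \<subseteq> tr y K"
    "\<And>y. y \<in> Y \<Longrightarrow> Y + Y = tr (2*y) K" "K = {y - y' | y y'. y \<in> Y \<and> y' \<in> Y}"
proof -
  define K where "K = {y - y' | y y'. y \<in> Y \<and> y' \<in> Y}"
  have half: "2 * sz N (Y \<inter> tr z Y) > sz N Y" if "z \<in> K" for z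
  proof -
    obtain y1 y2 where z: "z = y1 - y2" "y1 \<in> Y" "y2 \<in> Y" using \<open>z \<in> K\<close> by (auto simp: K_def)
    have e: "tr y2 (Y \<inter> tr z Y) = tr y2 Y \<inter> tr y1 Y" by (auto simp: z algebra_simps)
    have "tr y2 Y \<union> tr y1 Y \<subseteq> Y + Y" using z by (auto simp: in_plus)
    then have "sz N (tr y2 Y \<union> tr y1 Y) \<le> sz N (Y + Y)" by (rule sz_mono)
    then show ?thesis using sz_Un_Int[of N "tr y2 Y" "tr y1 Y"] sz_tr[OF N Y(1)] dbl
      sz_tr[OF N per_Int[OF Y(1) per_tr[OF Y(1)]], of y2 z] e by simp
  qed
  have dK: "z - z' \<in> K" if "z \<in> K" "z' \<in> K" for z z'
  proof -
    have "(Y \<inter> tr z Y) \<inter> (Y \<inter> tr z' Y) \<noteq> {}"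
      using half[OF that(1)] half[OF that(2)] by (intro sz_inter[where Z = Y and N = N]) auto
    then obtain x where "x - z' \<in> Y" "x - z \<in> Y" by auto
    then show ?thesis unfolding K_def by (intro CollectI exI[of _ "x - z'"] exI[of _ "x - z"]) auto
  qed
  have sg: "subgp K" unfolding subgp_def using dK Y(2) by (auto simp: K_def)
  have pK: "per N K"
  proof -
    have "N \<in> K" unfolding K_def using Y per_def[of N Y] by (intro CollectI exI[of _ "y0+N"] exI[of _ y0]) auto
    then show ?thesis unfolding per_def using subgp_add[OF sg] subgp_diff[OF sg] by (metis add_diff_cancel_right')
  qed
  have sub: "Y \<subseteq> tr y K" if "y \<in> Y" for y using that unfolding K_def tr_def by blast
  have szK: "sz N K < 2 * sz N Y"
  proof -
    \<comment> \<open>Each \<open>g\<close> in \<open>K\<close> contributes at least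
      \<open>(|Y| + 1) / 2\<close> to a total of \<open>|Y| * |Y|\<close>; the unit gained by
      integrality makes the final inequality strict.\<close>
    have "sz N K * (sz N Y + 1) = (\<Sum>g\<in>{0..<N}. of_bool (g \<in> K) * (sz N Y + 1))"
      by (simp only: sz_sum[of N K] sum_distrib_right)
    also have "\<dots> \<le> (\<Sum>g\<in>{0..<N}. 2 * sz N (Y \<inter> tr g Y))"
      by (rule sum_mono) (use half in \<open>force simp: of_bool_def\<close>)
    also have "\<dots> = 2 * sz N Y * sz N Y" using sum_sz_inter[OF N Y(1) Y(1)] by (simp add: sum_distrib_left[symmetric])
    finally have *: "sz N K * (sz N Y + 1) \<le> 2 * sz N Y * sz N Y" .
    have y1: "sz N Y \<ge> 1" using sz_pos[OF N Y] .
    show ?thesis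
    proof (rule ccontr)
      assume "\<not> ?thesis"
      then have "2 * sz N Y * (sz N Y + 1) \<le> sz N K * (sz N Y + 1)" using y1 by (intro mult_right_mono) auto
      with * y1 show False by (simp add: algebra_simps)
    qed
  qed
  have "Y + Y = tr (2*y) K" if y: "y \<in> Y" for y
  proof
    show "Y + Y \<subseteq> tr (2*y) K"
    proof
      fix c assume "c \<in> Y + Y"
      then obtain u where u: "u \<in> Y" "c - u \<in> Y" by (auto simp: in_plus)
      have "u - y \<in> K" "c - u - y \<in> K" using sub[OF y] u by auto
      then have "(u - y) + (c - u - y) \<in> K" by (rule subgp_add[OF sg])
      moreover have "(u - y) + (c - u - y) = c - 2*y" by simp
      ultimately show "c \<in> tr (2*y) K" by simp
    qed
    show "tr (2*y) K \<subseteq> Y + Y"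
    proof
      fix c assume c: "c \<in> tr (2*y) K"
      have "{x. c - x \<in> Y} \<subseteq> tr y K"
      proof
        fix x assume "x \<in> {x. c - x \<in> Y}"
        then have "c - x - y \<in> K" using sub[OF y] by auto
        moreover have "c - 2*y \<in> K" using c by simp
        ultimately have "(c - 2*y) - (c - x - y) \<in> K" using subgp_diff[OF sg] by blast
        moreover have "(c - 2*y) - (c - x - y) = x - y" by simp
        ultimately show "x \<in> tr y K" by simp
      qed
      then have "Y \<inter> {x. c - x \<in> Y} \<noteq> {}" using sub[OF y] szK sz_refl[OF N Y(1)] sz_tr[OF N pK]
        by (intro sz_inter[where N = N and Z = "tr y K"]) auto
      then show "c \<in> Y + Y" by (auto simp: in_plus)
    qed
  qed
  then show ?thesis using that sg pK sub K_def by blast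
qed

lemma subgp_multiples:
  assumes "subgp K" "N \<in> K" "N > 0"
  obtains g where "g > 0" "g dvd N" "K = {z. g dvd z}"
proof -
  define g where "g = int (LEAST m. m > 0 \<and> int m \<in> K)"
  have ex: "nat N > 0 \<and> int (nat N) \<in> K" using assms by auto
  have g: "g > 0" "g \<in> K"
    using LeastI[of "\<lambda>m. m > 0 \<and> int m \<in> K", OF ex] by (auto simp: g_def)
  have mult: "g * i \<in> K" for i
  proof -
    have nn: "g * int k \<in> K" for k
      by (induction k) (use assms(1) g(2) subgp_add[OF assms(1)] in \<open>auto simp: subgp_def algebra_simps\<close>)
    show ?thesis using nn[of "nat i"] subgp_neg[OF assms(1) nn[of "nat (-i)"]] by (cases "i \<ge> 0") auto
  qed
  have "K = {z. g dvd z}"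
  proof (intro set_eqI iffI)
    fix z assume z: "z \<in> K"
    have "z mod g = z - g * (z div g)" by (simp add: minus_mult_div_eq_mod)
    then have m: "z mod g \<in> K" using subgp_diff[OF assms(1) z mult] by simp
    have "z mod g = 0"
    proof (rule ccontr)
      assume "z mod g \<noteq> 0"
      then have "z mod g > 0" using pos_mod_sign[OF g(1), of z] by linarith
      then have "nat (z mod g) > 0 \<and> int (nat (z mod g)) \<in> K" using m by simp
      then have "(LEAST m. m > 0 \<and> int m \<in> K) \<le> nat (z mod g)" by (rule Least_le)
      then show False using pos_mod_bound[OF g(1), of z] pos_mod_sign[OF g(1), of z] g_def by linarith
    qed
    then show "z \<in> {z. g dvd z}" by auto
  next
    fix z assume "z \<in> {z. g dvd z}"
    then show "z \<in> K" using mult by auto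
  qed
  then show ?thesis using that g(1) assms(2) by auto
qed

lemma sz_multiples: assumes "g > 0" "g dvd N" "N > 0" shows "sz N {z. g dvd z} = N div g"
proof -
  obtain L where L: "N = g * L" using assms(2) by auto
  then have "L > 0" using assms by (simp add: zero_less_mult_iff)
  have "{z. g dvd z} \<inter> {0..<N} = (\<lambda>i. g * i) ` {0..<L}"
    using assms(1) L by (auto simp: image_iff zero_le_mult_iff)
  then have "card ({z. g dvd z} \<inter> {0..<N}) = card {0..<L}"
    using assms(1) by (simp add: card_image inj_on_def)
  then show ?thesis using L assms(1) \<open>L > 0\<close> by (simp add: sz_def)
qed

lemma tr_plus: "tr t X + Y = tr t (X + Y)"
  by (auto simp: in_plus) (metis diff_right_commute diff_diff_eq2 add.commute diff_add_cancel in_tr)+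

lemma plus_Un: "(X \<union> X') + Y = (X + Y) \<union> (X' + Y)" for X :: "int set"
  by (auto simp: in_plus)

lemma plus_mono: "X \<subseteq> X' \<Longrightarrow> Y \<subseteq> Y' \<Longrightarrow> X + Y \<subseteq> X' + Y'" for X :: "int set"
  unfolding set_plus_def by blast

lemma mod_below_twice: "0 \<le> x \<Longrightarrow> x < 2 * N \<Longrightarrow> x mod N = (if x < N then x else x - N)" for x N :: int
proof -
  assume x: "0 \<le> x" "x < 2 * N"
  show ?thesis
  proof (cases "x < N")
    case False
    have "x mod N = (x - N) mod N" by simp
    also have "\<dots> = x - N" using x False by (intro mod_pos_pos_trivial) auto
    finally show ?thesis using False by simp
  qed (use x in simp)
qed

lemma sz_UN_le: "finite I \<Longrightarrow> sz N (\<Union>i\<in>I. X i) \<le> (\<Sum>i\<in>I. sz N (X i))"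
proof (induction I rule: finite_induct)
  case (insert i I)
  then show ?case using sz_Un_le[of N "X i" "\<Union>i\<in>I. X i"] by simp
qed simp

section \<open>Reduction modulo the largest element, and atoms\<close>

text \<open>Finite form of the hypotheses: \<open>Hq\<close> is a density bound replacing the
  condition that \<open>|A|\<close> is not negligible against \<open>H\<close>, and
  \<open>Hbig\<close> is the negation of the first alternative of the conclusion. The smallness of
  \<open>b\<close> is added only where it is needed.\<close>

locale dense_sum =
  fixes H :: int and A :: "int set" and b q :: int
  assumes A_sub: "A \<subseteq> {0..H}" and A0: "0 \<in> A" and AH: "H \<in> A"
    and gcdA: "\<And>g. (\<And>a. a \<in> A \<Longrightarrow> g dvd a) \<Longrightarrow> g dvd 1"
    and cardAA: "int (card (A + A)) = 3 * int (card A) - 3 + b"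
    and b0: "0 \<le> b" and Hbig: "2 * int (card A) - 1 + 2 * b \<le> H"
    and Hq: "H \<le> q * (int (card A) - 1)"
begin

definition n where "n = int (card A) - 1"
definition S where "S = {z. z mod H \<in> A}"
definition D where "D = {c. c mod H \<in> A + A \<and> c mod H + H \<in> A + A}"
text \<open>A defect of periodicity, symmetric and subadditive in \<open>t\<close>; residues with
  small \<open>p\<close> behave as almost periods of \<open>S\<close> that can be added and
  multiplied.\<close>

definition p where "p t = sz H (tr t S - S)"

lemma finA: "finite A" using A_sub finite_subset by blast

lemma cardA_pos: "int (card A) \<ge> 1"
  using finA A0 by (metis One_nat_def Suc_leI card_gt_0_iff empty_iff of_nat_1 of_nat_le_iff)

lemma Hpos: "H > 0" using Hbig cardA_pos b0 by linarith

lemma n_pos: "n \<ge> 1"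
proof -
  have "card {0,H} \<le> card A" using A0 AH by (intro card_mono finA) auto
  then show ?thesis using Hpos by (simp add: n_def)
qed

lemma H_ge: "2 * n + 1 + 2 * b \<le> H" using Hbig by (simp add: n_def)
lemma H_le: "H \<le> q * n" using Hq by (simp add: n_def)

lemma q_ge: "q \<ge> 3"
proof (rule ccontr)
  assume "\<not> q \<ge> 3"
  then have "q * n \<le> 2 * n" using n_pos by (intro mult_right_mono) auto
  then show False using H_ge H_le b0 by linarith
qed

lemma perS: "per H S" by (simp add: per_def S_def)
lemma perD: "per H D" by (simp add: per_def D_def)

lemma S_iff: "0 \<le> z \<Longrightarrow> z < H \<Longrightarrow> z \<in> S \<longleftrightarrow> z \<in> A" by (simp add: S_def)

lemma A_sub_S: "A \<subseteq> S"
proof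
  fix a assume a: "a \<in> A"
  then have "0 \<le> a" "a \<le> H" using A_sub by auto
  then show "a \<in> S" using a A0 by (cases "a = H") (auto simp: S_def)
qed

lemma S0: "0 \<in> S" using A_sub_S A0 by auto

lemma szS: "sz H S = n"
proof -
  have "S \<inter> {0..<H} = A - {H}" using A_sub by (auto simp: S_def)
  then show ?thesis using AH finA cardA_pos by (simp add: sz_def n_def card_Diff_singleton of_nat_diff)
qed

lemma in_SS: "c \<in> S + S \<longleftrightarrow> c mod H \<in> A + A \<or> c mod H + H \<in> A + A"
proof
  assume "c \<in> S + S"
  then obtain x where x: "x \<in> S" "c - x \<in> S" by (auto simp: in_plus)
  define u v where "u = x mod H" and "v = (c - x) mod H"
  have uv: "u \<in> A" "v \<in> A" "0 \<le> u" "u < H" "0 \<le> v" "v < H" using x Hpos by (auto simp: S_def u_def v_def)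
  have "(u + v) mod H = c mod H" by (simp add: u_def v_def mod_simps)
  moreover have "(u + v) mod H = (if u + v < H then u + v else u + v - H)"
    using uv by (intro mod_below_twice) auto
  ultimately have "u + v = c mod H \<or> u + v = c mod H + H" by (auto split: if_splits)
  then show "c mod H \<in> A + A \<or> c mod H + H \<in> A + A" using plusI[OF uv(1,2)] by auto
next
  assume "c mod H \<in> A + A \<or> c mod H + H \<in> A + A"
  then have "c mod H \<in> S + S \<or> c mod H + H \<in> S + S" using plus_mono[OF A_sub_S A_sub_S] by blast
  then show "c \<in> S + S" using per_plus[OF perS, of S] per_mod by (auto simp: per_def)
qed

text \<open>Adding \<open>0\<close> and adding \<open>H\<close> to the same element gives both
  lifts.\<close>

lemma S_sub_D: "S \<subseteq> D"
  using plusI[OF _ A0] plusI[OF _ AH] by (force simp: S_def D_def)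

text \<open>\<open>A + A\<close> lies in \<open>{0..2 * H}\<close>, where a residue has the lifts
  \<open>c\<close> and \<open>c + H\<close>; only the residue \<open>0\<close> has a third lift
  \<open>2 * H\<close>, which accounts for the \<open>+ 1\<close>.\<close>

lemma card_AA: "3 * n + b = sz H (S + S) + sz H D + 1"
proof -
  define R0 R1 where "R0 = (A + A) \<inter> {0..<H}" and "R1 = {r \<in> {0..<H}. r + H \<in> A + A}"
  have AA: "A + A = R0 \<union> ((\<lambda>r. r + H) ` R1 \<union> {2*H})"
  proof (intro set_eqI iffI)
    fix c assume c: "c \<in> A + A"
    then obtain u where "u \<in> A" "c - u \<in> A" by (auto simp: in_plus)
    then have "u \<in> {0..H}" "c - u \<in> {0..H}" using A_sub by auto
    then have "0 \<le> c" "c \<le> 2 * H" by auto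
    then consider "c \<in> R0" | "c - H \<in> R1" | "c = 2 * H" using c
      by (cases "c < H"; cases "c = 2*H") (auto simp: R0_def R1_def)
    then show "c \<in> R0 \<union> ((\<lambda>r. r + H) ` R1 \<union> {2*H})"
      by cases (auto simp: image_iff intro!: bexI[of _ "c - H"])
  next
    fix c assume "c \<in> R0 \<union> ((\<lambda>r. r + H) ` R1 \<union> {2*H})"
    then show "c \<in> A + A" using plusI[OF AH AH] by (auto simp: R0_def R1_def)
  qed
  have fin: "finite R0" "finite R1" by (auto simp: R0_def R1_def intro: finite_subset[of _ "{0..<H}"])
  have "card (A + A) = card R0 + (card R1 + 1)"
    unfolding AA
    by (subst card_Un_disjoint card_image | use fin in \<open>force simp: R0_def R1_def inj_on_def\<close>)+
  moreover have "sz H (S + S) = int (card (R0 \<union> R1))"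
    unfolding sz_def by (intro arg_cong[where f = "\<lambda>x. int (card x)"]) (auto simp: in_SS R0_def R1_def)
  moreover have "sz H D = int (card (R0 \<inter> R1))"
    unfolding sz_def by (intro arg_cong[where f = "\<lambda>x. int (card x)"]) (auto simp: D_def R0_def R1_def)
  moreover have "card R0 + card R1 = card (R0 \<union> R1) + card (R0 \<inter> R1)" by (rule card_Un_Int[OF fin])
  ultimately show ?thesis using cardAA by (simp add: n_def)
qed

lemma szD_ge: "sz H D \<ge> n" using sz_mono[OF S_sub_D, of H] szS by simp

lemma szSS: "sz H (S + S) \<le> 2 * n - 1 + b" using card_AA szD_ge by linarith

lemma p_nonneg: "p t \<ge> 0" by (simp add: p_def)

lemma p_minus: "p (- t) = p t"
proof -
  have e: "tr t S - S = tr t (S - tr (-t) S)" by auto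
  have "p t = sz H (S - tr (-t) S)" unfolding p_def e
    by (intro sz_tr Hpos per_Diff per_tr perS)
  also have "\<dots> = sz H (tr (-t) S - S)"
    using sz_Diff[of H S "tr (-t) S"] sz_Diff[of H "tr (-t) S" S] sz_tr[OF Hpos perS] by (simp add: Int_commute)
  finally show ?thesis by (simp add: p_def)
qed

lemma p_add: "p (s + t) \<le> p s + p t"
proof -
  have "tr (s + t) S - S \<subseteq> tr t (tr s S - S) \<union> (tr t S - S)" by (auto simp: algebra_simps)
  then have "p (s + t) \<le> sz H (tr t (tr s S - S) \<union> (tr t S - S))" unfolding p_def by (rule sz_mono)
  also have "\<dots> \<le> sz H (tr t (tr s S - S)) + sz H (tr t S - S)" by (rule sz_Un_le)
  also have "sz H (tr t (tr s S - S)) = p s" unfolding p_def by (intro sz_tr Hpos per_Diff per_tr perS)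
  finally show ?thesis by (simp add: p_def)
qed

text \<open>A split with \<open>u\<close> not exceeding \<open>c\<close> stays below
  \<open>H\<close> and yields \<open>c\<close>; a split with \<open>w\<close> beyond
  \<open>c\<close> goes around once and yields \<open>c + H\<close>.\<close>

lemma D_I:
  assumes "0 \<le> c" "c < H" "u \<in> S" "c - u \<in> S" "0 \<le> u" "u \<le> c" "w \<in> S" "c - w \<in> S" "c < w" "w < H"
  shows "c \<in> D"
proof -
  have "c - u \<in> A" "u \<in> A" "w \<in> A" using assms S_iff by auto
  moreover have "c - w + H \<in> A" using assms perS by (subst S_iff[symmetric]) (auto simp: per_def)
  ultimately have "c \<in> A + A" "c + H \<in> A + A" using plusI[of u A "c - u" A] plusI[of w A "c - w + H" A] by auto
  then show ?thesis using assms by (simp add: D_def)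
qed

text \<open>\<open>E\<close> consists of the elements whose orbit under steps of \<open>t\<close>
  stays in \<open>S\<close> for a full turn. A sum of two of them can be rewritten by moving one
  summand forwards and the other backwards. Only sums within \<open>t\<close> of the point
  \<open>0\<close> can then fail to be in \<open>D\<close>, and for such a sum \<open>c\<close> the
  residue \<open>c + t\<close> is in \<open>D\<close> but not in \<open>E\<close>. So at most
  \<open>|D| - |E|\<close> elements of \<open>E + E\<close> lie outside \<open>D\<close>.\<close>

lemma rotation:
  assumes t: "1 \<le> t" "2 * t \<le> H"
  obtains E where "per H E" "E \<subseteq> S" "n - 2 * (H div t + 2) * p t \<le> sz H E"
    "sz H (E + E) \<le> 2 * sz H D - sz H E"
proof -
  \<comment> \<open>A turn takes about \<open>H div t\<close> steps; the additional ones leave room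
    to pass the cut at \<open>0\<close>.\<close>
  define J where "J = H div t + 2"
  have J0: "J \<ge> 0" using t by (simp add: J_def pos_imp_zdiv_nonneg_iff)
  define E where "E = {a. \<forall>j. \<bar>j\<bar> \<le> J \<longrightarrow> a + j * t \<in> S}"
  have ES: "E \<subseteq> S"
  proof
    fix a assume "a \<in> E"
    then have "\<bar>0\<bar> \<le> J \<longrightarrow> a + 0 * t \<in> S" unfolding E_def by blast
    then show "a \<in> S" using J0 by simp
  qed
  have perE: "per H E" using perS by (simp add: per_def E_def algebra_simps) (metis add.assoc add.commute)
  define P where "P = S - tr (-t) S"
  define Q where "Q = S - tr t S"
  have perPQ: "per H P" "per H Q" unfolding P_def Q_def by (intro per_Diff per_tr perS)+
  have "p t = sz H P" "p t = sz H Q"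
  proof -
    show "p t = sz H P"
      unfolding P_def
      using p_minus[of t, unfolded p_def[of "- t"]] sz_Diff[of H S "tr (-t) S"] sz_Diff[of H "tr (-t) S" S] sz_tr[OF Hpos perS]
      by (simp add: Int_commute)
    show "p t = sz H Q"
      using sz_Diff[of H S "tr t S"] sz_Diff[of H "tr t S" S] sz_tr[OF Hpos perS]
      by (simp add: Int_commute p_def Q_def)
  qed
  note pPQ = this
  \<comment> \<open>An orbit that leaves \<open>S\<close> has a first step at which it does so, at a
    point of \<open>P\<close> going forwards or of \<open>Q\<close> going backwards; both sets have
    \<open>p t\<close> elements.\<close>
  have "S - E \<subseteq> (\<Union>i\<in>{0..<J}. tr (- (i*t)) P) \<union> (\<Union>i\<in>{0..<J}. tr (i*t) Q)"
  proof
    fix a assume a: "a \<in> S - E"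
    then obtain j where j: "\<bar>j\<bar> \<le> J" "a + j * t \<notin> S" by (auto simp: E_def)
    show "a \<in> (\<Union>i\<in>{0..<J}. tr (- (i*t)) P) \<union> (\<Union>i\<in>{0..<J}. tr (i*t) Q)"
    proof (cases "j \<ge> 0")
      case True
      define m where "m = (LEAST m. a + int m * t \<notin> S)"
      have ex: "a + int (nat j) * t \<notin> S" using True j by simp
      have m: "a + int m * t \<notin> S" "m \<le> nat j"
        unfolding m_def by (rule LeastI[of "\<lambda>m. a + int m * t \<notin> S", OF ex], rule Least_le[of "\<lambda>m. a + int m * t \<notin> S", OF ex])
      have "m \<noteq> 0" using m(1) a by (metis DiffD1 add_0_right mult_zero_left of_nat_0)
      then have "a + int (m - 1) * t \<in> S" using not_less_Least[of "m-1" "\<lambda>m. a + int m * t \<notin> S"] m_def by fastforce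
      then have "a \<in> tr (- (int (m - 1) * t)) P" using m(1) \<open>m \<noteq> 0\<close>
        by (simp add: P_def of_nat_diff algebra_simps)
      moreover have "int (m - 1) \<in> {0..<J}" using m(2) \<open>m \<noteq> 0\<close> j True by (auto simp: of_nat_diff)
      ultimately show ?thesis by blast
    next
      case False
      define m where "m = (LEAST m. a - int m * t \<notin> S)"
      have ex: "a - int (nat (- j)) * t \<notin> S" using False j by simp
      have m: "a - int m * t \<notin> S" "m \<le> nat (- j)"
        unfolding m_def by (rule LeastI[of "\<lambda>m. a - int m * t \<notin> S", OF ex], rule Least_le[of "\<lambda>m. a - int m * t \<notin> S", OF ex])
      have "m \<noteq> 0" using m(1) a by (metis DiffD1 diff_zero mult_zero_left of_nat_0)
      then have "a - int (m - 1) * t \<in> S" using not_less_Least[of "m-1" "\<lambda>m. a - int m * t \<notin> S"] m_def by fastforce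
      then have "a \<in> tr (int (m - 1) * t) Q" using m(1) \<open>m \<noteq> 0\<close>
        by (simp add: Q_def of_nat_diff algebra_simps)
      moreover have "int (m - 1) \<in> {0..<J}" using m(2) \<open>m \<noteq> 0\<close> j False by (auto simp: of_nat_diff)
      ultimately show ?thesis by blast
    qed
  qed
  then have "sz H (S - E) \<le> sz H (\<Union>i\<in>{0..<J}. tr (- (i*t)) P) + sz H (\<Union>i\<in>{0..<J}. tr (i*t) Q)"
    by (rule order_trans[OF sz_mono sz_Un_le])
  also have "\<dots> \<le> (\<Sum>i\<in>{0..<J}. sz H (tr (- (i*t)) P)) + (\<Sum>i\<in>{0..<J}. sz H (tr (i*t) Q))"
    by (intro add_mono sz_UN_le) auto
  also have "\<dots> = 2 * J * p t" using J0 by (simp add: sz_tr[OF Hpos perPQ(1)] sz_tr[OF Hpos perPQ(2)] pPQ[symmetric])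
  finally have "sz H (S - E) \<le> 2 * J * p t" .
  then have szE: "n - 2 * J * p t \<le> sz H E" using ES szS by (simp add: sz_Diff Int_absorb1)
  have inj: "tr t ((E + E) - D) \<subseteq> D - E"
  proof
    fix c' assume c': "c' \<in> tr t ((E + E) - D)"
    define c where "c = (c' - t) mod H"
    have c0: "0 \<le> c" "c < H" using Hpos by (auto simp: c_def)
    have cD: "c \<notin> D" using c' per_mod[OF perD] by (simp add: c_def)
    have "c \<in> E + E" using c' per_mod[OF per_plus[OF perE]] by (simp add: c_def)
    then obtain a' where a': "a' \<in> E" "c - a' \<in> E" by (auto simp: in_plus)
    define a where "a = a' mod H"
    have a: "a \<in> E" "0 \<le> a" "a < H" using a' per_mod[OF perE] Hpos by (auto simp: a_def)
    have "c - a \<in> E" using a'(2) by (subst per_cong[OF perE, of "c - a" "c - a'"]) (auto simp: a_def mod_eq_dvd_iff[symmetric])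
    note a = a this
    \<comment> \<open>Moving the summands by \<open>i\<close> steps in opposite directions brings
      the first one to \<open>a mod t\<close>, next to the cut.\<close>
    define i where "i = a div t"
    have i: "0 \<le> i" "i + 1 \<le> J" using a t zdiv_mono1[of a H t] by (auto simp: i_def J_def pos_imp_zdiv_nonneg_iff)
    define a0 where "a0 = a mod t"
    have a0: "a0 = a - i * t" "0 \<le> a0" "a0 < t" using t by (auto simp: a0_def i_def minus_div_mult_eq_mod)
    have mem: "a - j * t \<in> S" "c - a + j * t \<in> S" if "\<bar>j\<bar> \<le> J" for j
    proof -
      show "a - j * t \<in> S" using a(1) that unfolding E_def by (auto dest: spec[of _ "-j"])
      show "c - a + j * t \<in> S" using a(4) that unfolding E_def by auto
    qed
    have s0: "a0 \<in> S" "c - a0 \<in> S" using mem[of i] i a0 by (auto simp: algebra_simps)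
    have s1: "a0 - t \<in> S" "c - a0 + t \<in> S" using mem[of "i+1"] i a0 by (auto simp: algebra_simps)
    have s2: "a0 + t \<in> S" using mem[of "i-1"] i a0 by (auto simp: algebra_simps)
    have "\<not> (a0 \<le> c \<and> c < a0 - t + H)"
    proof
      assume "a0 \<le> c \<and> c < a0 - t + H"
      then have "a0 \<le> c" "c < a0 - t + H" by auto
      moreover have "a0 - t + H \<in> S" using s1 perS by (simp add: per_def)
      moreover have "c - (a0 - t + H) \<in> S"
        using per_add_mult[OF perS, of "c - a0 + t" "-1"] s1(2) by (simp add: algebra_simps)
      ultimately have "c \<in> D" using D_I[OF c0 s0 a0(2), of "a0 - t + H"] a0 t by simp
      with cD show False by simp
    qed
    then consider "c < a0" | "a0 - t + H \<le> c" by linarith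
    then have "c + t \<in> D"
    proof cases
      case 1
      have "c + t - a0 \<in> S" using s1(2) by (simp add: algebra_simps)
      moreover have "c + t - (a0 + t) \<in> S" using s0(2) by simp
      ultimately show ?thesis using D_I[of "c + t" a0 "a0 + t"] 1 s0 s2 c0 a0 t by simp
    next
      case 2
      have "c + t - H - a0 \<in> S"
        using per_add_mult[OF perS, of "c - a0 + t" "-1"] s1(2) by (simp add: algebra_simps)
      moreover have "c + t - H - (a0 + t) \<in> S"
        using per_add_mult[OF perS, of "c - a0" "-1"] s0(2) by (simp add: algebra_simps)
      ultimately have "c + t - H \<in> D" using D_I[of "c + t - H" a0 "a0 + t"] 2 s0 s2 c0 a0 t by simp
      then show ?thesis using per_add_mult[OF perD, of "c + t" "-1"] by simp
    qed
    then have "c' \<in> D" using per_cong[OF perD, of "c + t" c'] by (simp add: c_def mod_eq_dvd_iff[symmetric] mod_simps)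
    moreover have "c' \<notin> E"
    proof
      assume "c' \<in> E"
      then have "\<bar>-1\<bar> \<le> J \<longrightarrow> c' + (-1) * t \<in> S" unfolding E_def by blast
      moreover have "J \<ge> 1" using t by (simp add: J_def pos_imp_zdiv_nonneg_iff add_nonneg_pos)
      ultimately have "c' - t \<in> S" by simp
      then have "c \<in> S" using per_mod[OF perS] by (simp add: c_def)
      with cD S_sub_D show False by auto
    qed
    ultimately show "c' \<in> D - E" by simp
  qed
  have "sz H ((E + E) - D) = sz H (tr t ((E + E) - D))"
    by (rule sz_tr[symmetric, OF Hpos per_Diff[OF per_plus[OF perE] perD]])
  also have "\<dots> \<le> sz H (D - E)" by (rule sz_mono[OF inj])
  also have "\<dots> = sz H D - sz H E" using ES S_sub_D by (subst sz_Diff) (auto simp: Int_absorb1 intro!: arg_cong[where f="sz H"])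
  finally have "sz H ((E + E) - D) \<le> sz H D - sz H E" .
  moreover have "sz H ((E + E) \<inter> D) \<le> sz H D" by (rule sz_mono) auto
  ultimately have "sz H (E + E) \<le> 2 * sz H D - sz H E" using sz_Diff[of H "E + E" D] by linarith
  then show ?thesis using that[OF perE ES] szE by (simp add: J_def)
qed


section \<open>Admissible sets and atoms\<close>

text \<open>With \<open>|S + S|\<close> at most \<open>2 * n - 1 + b\<close> and \<open>H\<close> at
  least \<open>2 * n + 1 + 2 * b\<close>, this is the largest threshold for which \<open>S\<close>
  is certain to satisfy the upper bound in \<open>adm\<close>.\<close>

definition k where "k = b + 2"

text \<open>The competitors in Hamidoune's isoperimetric problem for \<open>S\<close>, in which the
  boundary \<open>|Y + S| - |Y|\<close> is minimized.\<close>

definition adm where "adm Y \<longleftrightarrow> per H Y \<and> k \<le> sz H Y \<and> sz H (Y + S) \<le> H - k"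

lemma sub_plus_S: "Y \<subseteq> Y + S"
  using plusI[OF _ S0] by fastforce

lemma k_pos: "k \<ge> 2" using b0 by (simp add: k_def)

lemma adm_S: "k \<le> n \<Longrightarrow> adm S"
  using szS szSS H_ge perS by (simp add: adm_def k_def)

lemma sz_tr_plus: "per H Y \<Longrightarrow> sz H (tr t Y + S) = sz H (Y + S)"
  using sz_tr[OF Hpos per_plus] by (simp add: tr_plus)

text \<open>The two minimizations are lexicographic. As sizes are at most \<open>H\<close>, the
  factor \<open>H + 1\<close> in the weight \<open>w\<close> lets the boundary dominate. A
  translation brings an element of the minimizer to \<open>0\<close>.\<close>

lemma atom_exists:
  assumes "k \<le> n"
  obtains X where "adm X" "0 \<in> X"
    "\<And>Y. adm Y \<Longrightarrow> sz H (X + S) - sz H X \<le> sz H (Y + S) - sz H Y"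
    "\<And>Y. adm Y \<Longrightarrow> sz H (Y + S) - sz H Y \<le> sz H (X + S) - sz H X \<Longrightarrow> sz H X \<le> sz H Y"
proof -
  define c where "c Y = sz H (Y + S) - sz H Y" for Y
  define w where "w Y = nat (c Y * (H + 1) + sz H Y)" for Y
  have c0: "c Y \<ge> 0" for Y using sz_mono[OF sub_plus_S, of H Y] by (simp add: c_def)
  obtain X where X: "adm X" "\<And>Y. adm Y \<Longrightarrow> w X \<le> w Y"
    using ex_has_least_nat[of adm S w] adm_S[OF assms] by blast
  have wle: "c X * (H + 1) + sz H X \<le> c Y * (H + 1) + sz H Y" if "adm Y" for Y
  proof -
    have "0 \<le> c Y * (H + 1) + sz H Y" using c0[of Y] Hpos by (intro add_nonneg_nonneg mult_nonneg_nonneg) auto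
    then show ?thesis using X(2)[OF that] by (auto simp: w_def nat_le_iff le_nat_iff)
  qed
  have mc: "c X \<le> c Y" if "adm Y" for Y
  proof (rule ccontr)
    assume "\<not> c X \<le> c Y"
    then have "(c Y + 1) * (H + 1) \<le> c X * (H + 1)" using Hpos by (intro mult_right_mono) auto
    moreover have "sz H Y \<le> H" by (rule sz_le_N[OF Hpos])
    ultimately show False using wle[OF that] sz_nonneg[of H X] by (simp add: algebra_simps)
  qed
  have ms: "sz H X \<le> sz H Y" if "adm Y" "c Y \<le> c X" for Y
    using wle[OF that(1)] mc[OF that(1)] that(2) by simp
  have "sz H X \<ge> 1" using X(1) k_pos by (simp add: adm_def)
  then have "X \<noteq> {}" by auto
  then obtain x where x: "x \<in> X" by blast
  have perX: "per H X" using X(1) by (simp add: adm_def)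
  have t: "sz H (tr (-x) X) = sz H X" "sz H (tr (-x) X + S) = sz H (X + S)"
    using sz_tr[OF Hpos perX] sz_tr_plus[OF perX] by auto
  show ?thesis
  proof (rule that[of "tr (-x) X"])
    show "adm (tr (-x) X)" using X(1) t per_tr[OF perX] by (simp add: adm_def)
    show "0 \<in> tr (-x) X" using x by simp
  qed (use mc ms t in \<open>auto simp: c_def\<close>)
qed

end

locale atom = dense_sum +
  fixes X :: "int set"
  assumes X_adm: "adm X" and X0: "0 \<in> X"
    and X_min: "\<And>Y. adm Y \<Longrightarrow> sz H (X + S) - sz H X \<le> sz H (Y + S) - sz H Y"
    and X_least: "\<And>Y. adm Y \<Longrightarrow> sz H (Y + S) - sz H Y \<le> sz H (X + S) - sz H X \<Longrightarrow> sz H X \<le> sz H Y"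
    and k_le_n: "k \<le> n"
begin

definition x where "x = sz H X"
definition kap where "kap = sz H (X + S) - sz H X"

lemma perX: "per H X" using X_adm by (simp add: adm_def)
lemma x_ge: "x \<ge> b + 2" using X_adm by (simp add: adm_def x_def k_def)

lemma kap_le: "kap \<le> n - 1 + b"
  using X_min[OF adm_S[OF k_le_n]] szSS szS by (simp add: kap_def)

lemma kap_ge: "kap \<ge> n - x"
proof -
  have "S \<subseteq> X + S" using plusI[OF X0] by fastforce
  then show ?thesis using sz_mono[of S "X + S" H] szS by (simp add: kap_def x_def)
qed

lemma adm_kap: "adm Y \<Longrightarrow> sz H Y + kap \<le> sz H (Y + S)"
  using X_min[of Y] by (simp add: kap_def)

text \<open>Minimality tested on \<open>S\<close> gives \<open>|S + S| \<ge> n + kap\<close>, and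
  \<open>kap \<ge> n - x\<close>. Through \<open>card_AA\<close> this lower bound becomes an upper
  bound for \<open>D\<close>: a small atom makes \<open>D\<close> almost as small as
  \<open>S\<close>.\<close>

lemma szD_le: "sz H D \<le> n + x + b - 1"
  using adm_kap[OF adm_S[OF k_le_n]] kap_ge card_AA szS by linarith

text \<open>The translates of \<open>S\<close> by \<open>u\<close> and by \<open>v\<close> both lie
  in \<open>X + S\<close>, which has at most \<open>n + x + b - 1\<close> elements.\<close>

lemma p_X: "u \<in> X \<Longrightarrow> v \<in> X \<Longrightarrow> p (u - v) \<le> x + b - 1"
proof -
  assume uv: "u \<in> X" "v \<in> X"
  have e: "tr (u - v) S - S = tr (-v) (tr u S - tr v S)" by (auto simp: algebra_simps)
  have "p (u - v) = sz H (tr u S - tr v S)"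
    unfolding p_def e by (intro sz_tr Hpos per_Diff per_tr perS)
  also have "\<dots> = sz H (tr u S \<union> tr v S) - n"
    using sz_Diff[of H "tr u S" "tr v S"] sz_Un_Int[of H "tr u S" "tr v S"] sz_tr[OF Hpos perS] szS by simp
  also have "sz H (tr u S \<union> tr v S) \<le> sz H (X + S)"
    by (rule sz_mono) (use uv in \<open>auto simp: in_plus\<close>)
  finally show ?thesis using kap_le by (simp add: kap_def x_def)
qed

text \<open>The reflected complement \<open>C\<close> of \<open>X + S\<close> is admissible, and
  \<open>C + S\<close> avoids the reflection of \<open>X\<close>, so its boundary is no larger than
  that of \<open>X\<close>. Being smallest, the atom is no larger than \<open>C\<close>.\<close>

lemma dual: "x \<le> H - sz H (X + S)"
proof -
  define C where "C = {z. - z \<notin> X + S}"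
  have per: "per H (X + S)" by (rule per_plus[OF perX])
  have C: "C = {z. 0 - z \<in> - (X + S)}" by (auto simp: C_def)
  have szC: "sz H C = H - sz H (X + S)"
    unfolding C using sz_refl[OF Hpos per_Compl[OF per], of 0] sz_Compl[OF Hpos] by simp
  have "C + S \<subseteq> {z. 0 - z \<in> - X}"
  proof
    fix z assume "z \<in> C + S"
    then obtain c where c: "- c \<notin> X + S" "z - c \<in> S" by (auto simp: in_plus C_def)
    have "- z \<notin> X"
    proof
      assume "- z \<in> X"
      then have "- z + (z - c) \<in> X + S" using c(2) by (rule plusI)
      with c(1) show False by simp
    qed
    then show "z \<in> {z. 0 - z \<in> - X}" by simp
  qed
  then have "sz H (C + S) \<le> sz H {z. 0 - z \<in> - X}" by (rule sz_mono)
  also have "\<dots> = H - x" using sz_refl[OF Hpos per_Compl[OF perX], of 0] sz_Compl[OF Hpos] by (simp add: x_def)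
  finally have CS: "sz H (C + S) \<le> H - x" .
  have "per H C" unfolding C by (intro per_refl per_Compl per)
  then have "adm C" using X_adm CS szC x_ge by (simp add: adm_def k_def)
  then show ?thesis using X_least[of C] CS szC by (simp add: x_def)
qed

text \<open>Submodularity. If the translate differs from \<open>X\<close>, the intersection
  \<open>Y\<close> is admissible and smaller than the atom, so its boundary exceeds
  \<open>kap\<close>. Then the union \<open>U\<close> has boundary below \<open>kap\<close>, while
  \<open>dual\<close> keeps \<open>U\<close> admissible, against minimality.\<close>

lemma inter_translate: assumes "k \<le> sz H (X \<inter> tr g X)" shows "tr g X = X"
proof (rule ccontr)
  assume ne: "tr g X \<noteq> X"
  define Y where "Y = X \<inter> tr g X"
  have pg: "per H (tr g X)" by (rule per_tr[OF perX])
  have pY: "per H Y" unfolding Y_def by (rule per_Int[OF perX pg])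
  have sg: "sz H (tr g X) = x" using sz_tr[OF Hpos perX] by (simp add: x_def)
  have YX: "sz H Y < x"
  proof (rule ccontr)
    assume "\<not> sz H Y < x"
    then have "Y = X" "Y = tr g X"
      using sz_subset_eq[OF Hpos pY perX] sz_subset_eq[OF Hpos pY pg] sg by (auto simp: Y_def x_def)
    with ne show False by simp
  qed
  have "Y + S \<subseteq> X + S" by (rule plus_mono) (auto simp: Y_def)
  then have "sz H (Y + S) \<le> sz H (X + S)" by (rule sz_mono)
  then have admY: "adm Y" using pY assms X_adm by (simp add: adm_def Y_def)
  have cY: "sz H (Y + S) - sz H Y > kap" using X_least[OF admY] YX by (force simp: kap_def x_def)
  define U where "U = X \<union> tr g X"
  have szU: "sz H U = 2 * x - sz H Y" using sz_Un_Int[of H X "tr g X"] sg by (simp add: U_def Y_def x_def)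
  have "U + S = (X + S) \<union> (tr g X + S)" by (simp add: U_def plus_Un)
  moreover have "Y + S \<subseteq> (X + S) \<inter> (tr g X + S)" using plus_mono[of Y X S S] plus_mono[of Y "tr g X" S S] by (auto simp: Y_def)
  ultimately have "sz H (U + S) + sz H (Y + S) \<le> 2 * (x + kap)"
    using sz_Un_Int[of H "X + S" "tr g X + S"] sz_mono[of "Y + S" "(X + S) \<inter> (tr g X + S)" H] sz_tr_plus[OF perX, of g]
    by (simp add: kap_def x_def)
  then have US: "sz H (U + S) \<le> sz H U + kap - 1" using szU cY by (simp add: algebra_simps)
  have "sz H (U + S) \<le> H - k" using US szU dual assms by (simp add: kap_def x_def Y_def)
  moreover have "k \<le> sz H U" using szU YX x_ge by (simp add: k_def)
  ultimately have "adm U" using per_Un[OF perX pg] by (simp add: adm_def U_def)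
  then show False using adm_kap[of U] US by simp
qed

text \<open>A translation outside the stabilizer \<open>T\<close> leaves at most
  \<open>b + 1\<close> common elements. Averaging bounds \<open>x * x\<close> by
  \<open>|T| * x + (b + 1) * H\<close>, so a large atom has \<open>|T| > x / 2\<close>. As
  \<open>X\<close> is a union of cosets of \<open>T\<close> and contains \<open>0\<close>, it equals
  \<open>T\<close>.\<close>

lemma small_or_subgroup:
  assumes "x * x > 2 * (b + 1) * H" shows "subgp X"
proof -
  define T where "T = {g. tr g X = X}"
  have sgT: "subgp T"
    unfolding subgp_def
  proof (intro conjI ballI)
    show "0 \<in> T" by (simp add: T_def tr_def)
    fix u v assume "u \<in> T" "v \<in> T"
    then have uv: "z - u \<in> X \<longleftrightarrow> z \<in> X" "z - v \<in> X \<longleftrightarrow> z \<in> X" for z by (auto simp: T_def tr_def set_eq_iff)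
    have "z - (u - v) \<in> X \<longleftrightarrow> z \<in> X" for z
      using uv(1)[of "z + v"] uv(2)[of "z + v"] by (simp add: algebra_simps)
    then have "tr (u - v) X = X" by (intro set_eqI) (simp only: in_tr)
    then show "u - v \<in> T" by (simp add: T_def)
  qed
  have perT: "per H T"
  proof -
    have "z - (g + H) \<in> X \<longleftrightarrow> z - g \<in> X" for z g
      using per_add_mult[OF perX, of "z - g" "-1"] by (simp add: algebra_simps)
    then have "tr (g + H) X = tr g X" for g by (intro set_eqI) (simp only: in_tr)
    then show ?thesis by (simp add: per_def T_def)
  qed
  have TX: "T \<subseteq> X"
  proof
    fix g assume "g \<in> T"
    then have "g \<in> tr g X \<longleftrightarrow> g \<in> X" by (simp add: T_def)
    then show "g \<in> X" using X0 by simp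
  qed
  have "x * x = (\<Sum>g\<in>{0..<H}. sz H (X \<inter> tr g X))" using sum_sz_inter[OF Hpos perX perX] by (simp add: x_def)
  also have "\<dots> \<le> (\<Sum>g\<in>{0..<H}. of_bool (g \<in> T) * x + (b + 1))"
  proof (rule sum_mono)
    fix g
    show "sz H (X \<inter> tr g X) \<le> of_bool (g \<in> T) * x + (b + 1)"
    proof (cases "g \<in> T")
      case True
      then show ?thesis using b0 by (simp add: T_def x_def)
    next
      case False
      then show ?thesis using inter_translate[of g] by (force simp: T_def k_def)
    qed
  qed
  also have "\<dots> = sz H T * x + (b + 1) * H"
    using Hpos by (simp add: sum.distrib sum_distrib_right[symmetric] sz_sum[symmetric])
  finally have "x * x \<le> sz H T * x + (b + 1) * H" .
  then have "x * x < 2 * (sz H T) * x" using assms by (simp add: algebra_simps)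
  then have big: "x < 2 * sz H T" using x_ge b0 by (simp add: mult_less_cancel_right)
  have "X \<subseteq> T"
  proof
    fix z assume z: "z \<in> X"
    have "tr z T \<subseteq> X"
    proof
      fix y assume "y \<in> tr z T"
      then have "y \<in> tr (y - z) X \<longleftrightarrow> y \<in> X" by (simp add: T_def)
      then show "y \<in> X" using z by simp
    qed
    then have "T \<inter> tr z T \<noteq> {}" using TX big sz_tr[OF Hpos perT, of z]
      by (intro sz_inter[where N = H and Z = X]) (auto simp: x_def)
    then obtain y where "y \<in> T" "y - z \<in> T" by auto
    then have "y - (y - z) \<in> T" by (rule subgp_diff[OF sgT])
    then show "z \<in> T" by simp
  qed
  then show ?thesis using TX sgT by simp
qed

end

section \<open>Sumsets in intervals and two residue classes\<close>

definition prog :: "int \<Rightarrow> int \<Rightarrow> int \<Rightarrow> int set" where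
  "prog d a l = {a + i * d | i. 0 \<le> i \<and> i < l}"

text \<open>The second alternative for finite sets of integers, given by starts and lengths; since
  \<open>d\<close> is at least 1, lengths are cardinalities.\<close>

definition bi_covered :: "int set \<Rightarrow> int \<Rightarrow> bool" where
  "bi_covered A m \<longleftrightarrow> (\<exists>d a1 l1 a2 l2. 1 \<le> d \<and> 0 \<le> a1 \<and> 0 \<le> a2 \<and> 1 \<le> l1 \<and> 1 \<le> l2 \<and> l1 + l2 \<le> m \<and>
     A \<subseteq> prog d a1 l1 \<union> prog d a2 l2 \<and> A \<inter> prog d a1 l1 \<noteq> {} \<and> A \<inter> prog d a2 l2 \<noteq> {} \<and>
     (prog d a1 l1 + prog d a1 l1) \<inter> (prog d a1 l1 + prog d a2 l2) = {} \<and>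
     (prog d a1 l1 + prog d a1 l1) \<inter> (prog d a2 l2 + prog d a2 l2) = {} \<and>
     (prog d a1 l1 + prog d a2 l2) \<inter> (prog d a2 l2 + prog d a2 l2) = {})"

text \<open>The translates \<open>X + Min Y\<close> and \<open>Max X + Y\<close> lie in the sumset
  and share only \<open>Max X + Min Y\<close>.\<close>

lemma card_plus_ge:
  fixes X Y :: "int set"
  assumes "finite X" "finite Y" "X \<noteq> {}" "Y \<noteq> {}"
  shows "card X + card Y \<le> card (X + Y) + 1"
proof -
  define u v where "u = Max X" and "v = Min Y"
  have uv: "u \<in> X" "v \<in> Y" using assms by (auto simp: u_def v_def)
  have le: "x \<le> u" if "x \<in> X" for x using that assms by (simp add: u_def)
  have ge: "v \<le> y" if "y \<in> Y" for y using that assms by (simp add: v_def)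
  have int: "(\<lambda>x. x + v) ` X \<inter> (\<lambda>y. u + y) ` Y \<subseteq> {u + v}" using le ge by force
  have "card X + card Y = card ((\<lambda>x. x + v) ` X) + card ((\<lambda>y. u + y) ` Y)" by (simp add: card_image)
  also have "\<dots> = card ((\<lambda>x. x + v) ` X \<union> (\<lambda>y. u + y) ` Y) + card ((\<lambda>x. x + v) ` X \<inter> (\<lambda>y. u + y) ` Y)"
    using assms by (intro card_Un_Int) auto
  also have "\<dots> \<le> card (X + Y) + card {u + v}"
    using uv assms int by (intro add_mono card_mono finite_set_plus) (auto intro: set_plus_intro)
  finally show ?thesis by simp
qed

text \<open>The reflection of \<open>i\<close> to \<open>z - i\<close> maps elements of
  \<open>B\<close> to holes, so holes are at least half of \<open>{0..z}\<close>.\<close>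

lemma missing_low:
  fixes B :: "int set"
  assumes z: "0 \<le> z" "z \<notin> B + B"
  shows "z + 1 \<le> 2 * int (card ({0..z} - B))"
proof -
  have "card ({0..z} \<inter> B) = card ((\<lambda>i. z - i) ` ({0..z} \<inter> B))" by (simp add: card_image inj_on_def)
  also have "\<dots> \<le> card ({0..z} - B)"
    using z(2) by (intro card_mono) (auto simp: in_plus)
  finally have "card ({0..z} \<inter> B) \<le> card ({0..z} - B)" .
  moreover have "card {0..z} = card ({0..z} \<inter> B) + card ({0..z} - B)"
    by (rule card_Int_Diff) simp
  ultimately show ?thesis using z by simp
qed

text \<open>The sums missing from \<open>{0..2 * L}\<close> correspond to holes of \<open>B\<close> inside two end zones,
  and holes fill at least half of each zone.\<close>

lemma double_card:
  fixes B :: "int set"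
  assumes B: "B \<subseteq> {0..L}" "0 \<in> B" "L \<in> B" and h: "4 * int (card ({0..L} - B)) \<le> L"
  obtains n1 n2 where "-1 \<le> n1" "-1 \<le> n2"
    "n1 + 1 \<le> 2 * int (card ({0..n1} - B))" "n2 + 1 \<le> 2 * int (card ({L - n2..L} - B))"
    "n1 + 1 \<le> 2 * int (card ({0..L} - B))" "n2 + 1 \<le> 2 * int (card ({0..L} - B))"
    "2 * L + 1 \<le> int (card (B + B)) + int (card ({0..n1} - B)) + int (card ({L - n2..L} - B))"
proof -
  define U where "U = {0..2*L} - (B + B)"
  define h where "h = int (card ({0..L} - B))"
  have finU: "finite U" by (simp add: U_def)
  have L0: "0 \<le> L" using B by auto
  have finB: "finite B" using B finite_subset by blast
  define U1 U2 where "U1 = U \<inter> {..L}" and "U2 = U \<inter> {L<..}"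
  \<comment> \<open>The value -1 encodes that no sum is missing on this side; the zone
    \<open>{0..n1}\<close> is then empty and the bounds on \<open>n1\<close> are trivial.\<close>
  define n1 where "n1 = (if U1 = {} then -1 else Max U1)"
  define n2 where "n2 = (if U2 = {} then -1 else 2*L - Min U2)"
  have fin12: "finite U1" "finite U2" using finU by (auto simp: U1_def U2_def)
  have n1m: "z \<le> n1" if "z \<in> U1" for z using that fin12 by (auto simp: n1_def)
  have n2m: "2*L - n2 \<le> z" if "z \<in> U2" for z using that fin12 by (auto simp: n2_def)
  have n1U: "n1 \<in> U1" if "U1 \<noteq> {}" using that fin12 by (simp add: n1_def)
  have n2U: "2*L - n2 \<in> U2" if "U2 \<noteq> {}" using that fin12 by (simp add: n2_def)
  have a1: "-1 \<le> n1" using n1U by (cases "U1 = {}") (auto simp: n1_def U1_def U_def)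
  have a2: "-1 \<le> n2" using n2U by (cases "U2 = {}") (auto simp: n2_def U2_def U_def)
  have b1: "n1 + 1 \<le> 2 * int (card ({0..n1} - B))"
  proof (cases "U1 = {}")
    case False
    then have "0 \<le> n1" "n1 \<notin> B + B" using n1U by (auto simp: U1_def U_def)
    then show ?thesis by (rule missing_low)
  qed (simp add: n1_def)
  have b2: "n2 + 1 \<le> 2 * int (card ({L - n2..L} - B))"
  proof (cases "U2 = {}")
    case False
    define B' where "B' = (\<lambda>z. L - z) ` B"
    have m: "z \<in> B' \<longleftrightarrow> L - z \<in> B" for z by (auto simp: B'_def image_iff intro: bexI[of _ "L - z"])
    have "0 \<le> n2" "2*L - n2 \<notin> B + B" using n2U[OF False] by (auto simp: U2_def U_def)
    moreover have "n2 \<notin> B' + B'"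
    proof
      assume "n2 \<in> B' + B'"
      then obtain u where "L - u \<in> B" "L - (n2 - u) \<in> B" by (auto simp: in_plus m)
      then have "(L - u) + (L - (n2 - u)) \<in> B + B" by (rule plusI)
      then show False using \<open>2*L - n2 \<notin> B + B\<close> by (simp add: algebra_simps)
    qed
    ultimately have "n2 + 1 \<le> 2 * int (card ({0..n2} - B'))" by (intro missing_low)
    moreover have "{L - n2..L} - B = (\<lambda>z. L - z) ` ({0..n2} - B')"
      by (auto simp: m image_iff intro!: bexI[of _ "L - _"])
    then have "card ({L - n2..L} - B) = card ({0..n2} - B')" by (simp add: card_image inj_on_def)
    ultimately show ?thesis by simp
  qed (simp add: n2_def)
  have n1L: "n1 \<le> L" using n1U L0 by (cases "U1 = {}") (auto simp: n1_def U1_def)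
  have n2L: "n2 \<le> L" using n2U L0 by (cases "U2 = {}") (auto simp: n2_def U2_def)
  have c1: "n1 + 1 \<le> 2 * h"
  proof -
    have "card ({0..n1} - B) \<le> card ({0..L} - B)" using n1L by (intro card_mono) auto
    then show ?thesis using b1 by (simp add: h_def)
  qed
  have c2: "n2 + 1 \<le> 2 * h"
  proof -
    have "card ({L - n2..L} - B) \<le> card ({0..L} - B)" using n2L by (intro card_mono) auto
    then show ?thesis using b2 by (simp add: h_def)
  qed
  have "U1 \<subseteq> {0..n1} - B"
  proof
    fix z assume z: "z \<in> U1"
    have "z \<notin> B" using z plusI[OF _ B(2), of z B] by (auto simp: U1_def U_def)
    then show "z \<in> {0..n1} - B" using z n1m by (auto simp: U1_def U_def)
  qed
  then have "card U1 \<le> card ({0..n1} - B)" by (intro card_mono) auto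
  moreover have "(\<lambda>z. z - L) ` U2 \<subseteq> {L - n2..L} - B"
  proof
    fix y assume "y \<in> (\<lambda>z. z - L) ` U2"
    then obtain z where z: "z \<in> U2" "y = z - L" by auto
    have "z - L \<notin> B" using z plusI[OF _ B(3), of "z - L" B] by (auto simp: U2_def U_def)
    then show "y \<in> {L - n2..L} - B" using z n2m[OF z(1)] by (auto simp: U2_def U_def)
  qed
  then have "card ((\<lambda>z. z - L) ` U2) \<le> card ({L - n2..L} - B)" by (intro card_mono) auto
  then have "card U2 \<le> card ({L - n2..L} - B)" by (simp add: card_image inj_on_def)
  moreover have "card U = card U1 + card U2"
    using fin12 by (subst card_Un_disjoint[symmetric]) (auto simp: U1_def U2_def intro: arg_cong[where f = card])
  moreover have "B + B \<subseteq> {0..2*L}"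
  proof
    fix c assume "c \<in> B + B"
    then obtain u where "u \<in> B" "c - u \<in> B" by (auto simp: in_plus)
    then have "u \<in> {0..L}" "c - u \<in> {0..L}" using B(1) by auto
    then show "c \<in> {0..2*L}" by auto
  qed
  then have "card {0..2*L} = card (B + B) + card U"
    unfolding U_def using card_Int_Diff[of "{0..2*L}" "B + B"] by (simp add: Int_absorb1)
  ultimately have "2 * L + 1 \<le> int (card (B + B)) + int (card ({0..n1} - B)) + int (card ({L - n2..L} - B))"
    using L0 by simp
  then show ?thesis using that[OF a1 a2 b1 b2] c1 c2 by (simp add: h_def)
qed

text \<open>In each class modulo \<open>j\<close> met by \<open>B + J\<close> the largest element is
  not in \<open>B\<close>, since adding \<open>j\<close> would give a larger one. These maxima are
  new elements, one for each class.\<close>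

lemma card_plus_mod:
  fixes B J :: "int set"
  assumes fin: "finite B" "finite J" and J: "0 \<in> J" "j \<in> J" "j \<ge> 1"
  shows "card B + card ((\<lambda>z. z mod j) ` (B + J)) \<le> card (B + J)"
proof -
  define C where "C = (\<lambda>z. z mod j) ` (B + J)"
  define m where "m c = Max {z \<in> B + J. z mod j = c}" for c
  have finBJ: "finite (B + J)" using fin by (rule finite_set_plus)
  have m: "m c \<in> B + J" "m c mod j = c" "\<And>z. z \<in> B + J \<Longrightarrow> z mod j = c \<Longrightarrow> z \<le> m c" if "c \<in> C" for c
  proof -
    have "{z \<in> B + J. z mod j = c} \<noteq> {}" using that by (auto simp: C_def)
    then have "m c \<in> {z \<in> B + J. z mod j = c}" unfolding m_def using finBJ by (intro Max_in) auto
    then show "m c \<in> B + J" "m c mod j = c" by auto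
    show "\<And>z. z \<in> B + J \<Longrightarrow> z mod j = c \<Longrightarrow> z \<le> m c" unfolding m_def using finBJ by simp
  qed
  have "m c \<notin> B" if c: "c \<in> C" for c
  proof
    assume "m c \<in> B"
    then have "m c + j \<in> B + J" using J(2) by (rule plusI)
    moreover have "(m c + j) mod j = c" using m(2)[OF c] by simp
    ultimately show False using m(3)[OF c] J(3) by fastforce
  qed
  then have sub: "m ` C \<subseteq> (B + J) - B" using m(1) by auto
  have inj: "inj_on m C" by (rule inj_onI) (metis m(2))
  have BJ: "B \<subseteq> B + J" using plusI[OF _ J(1)] by fastforce
  have "card C = card (m ` C)" using inj by (simp add: card_image)
  also have "\<dots> \<le> card ((B + J) - B)" using sub finBJ by (intro card_mono) auto
  also have "\<dots> = card (B + J) - card B" using BJ fin finBJ by (intro card_Diff_subset) auto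
  finally show ?thesis using card_mono[OF finBJ BJ] by (simp add: C_def)
qed

text \<open>Among all pairs with the same total size and with sums inside \<open>V + B\<close>, one
  with the smallest second member is taken. Dyson's e-transform with \<open>e = v - b\<close>
  preserves both conditions; if it cannot shrink \<open>B'\<close>, the translate of
  \<open>B'\<close> by \<open>e\<close> already lies in \<open>V'\<close>.\<close>

lemma e_transform:
  assumes N: "N > 0" and V: "per N V" "V \<noteq> {}" and B: "per N B" "B \<noteq> {}"
  obtains V' B' where "per N V'" "V' \<noteq> {}" "per N B'" "B' \<noteq> {}" "sz N V' + sz N B' = sz N V + sz N B"
    "V' + B' \<subseteq> V + B" "\<And>v b b'. v \<in> V' \<Longrightarrow> b \<in> B' \<Longrightarrow> b' \<in> B' \<Longrightarrow> v - b + b' \<in> V'"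
proof -
  define P where "P VB \<longleftrightarrow> (case VB of (V', B') \<Rightarrow> per N V' \<and> V' \<noteq> {} \<and> per N B' \<and> B' \<noteq> {} \<and>
     sz N V' + sz N B' = sz N V + sz N B \<and> V' + B' \<subseteq> V + B)" for VB
  have "P (V, B)" using V B by (simp add: P_def)
  then obtain VB where PVB: "P VB" "\<And>VB'. P VB' \<Longrightarrow> nat (sz N (snd VB)) \<le> nat (sz N (snd VB'))"
    using ex_has_least_nat[of P "(V, B)" "\<lambda>VB. nat (sz N (snd VB))"] by blast
  obtain V' B' where VB: "VB = (V', B')" by (cases VB)
  have p: "per N V'" "V' \<noteq> {}" "per N B'" "B' \<noteq> {}" "sz N V' + sz N B' = sz N V + sz N B" "V' + B' \<subseteq> V + B"
    using PVB(1) by (auto simp: P_def VB)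
  have "v - b + b' \<in> V'" if h: "v \<in> V'" "b \<in> B'" "b' \<in> B'" for v b b'
  proof (rule ccontr)
    assume no: "v - b + b' \<notin> V'"
    define e where "e = v - b"
    define V2 B2 where "V2 = V' \<union> tr e B'" and "B2 = B' \<inter> tr (-e) V'"
    have perB2: "per N B2" "per N V2" unfolding B2_def V2_def by (intro per_Int per_Un per_tr p)+
    have "tr e B2 = V' \<inter> tr e B'" by (auto simp: B2_def)
    then have "sz N V2 + sz N B2 = sz N V' + sz N B'"
      using sz_Un_Int[of N V' "tr e B'"] sz_tr[OF N p(3), of e] sz_tr[OF N perB2(1), of e] by (simp add: V2_def)
    moreover have "V2 + B2 \<subseteq> V' + B'"
    proof
      fix c assume "c \<in> V2 + B2"
      then obtain u where u: "u \<in> V2" "c - u \<in> B2" by (auto simp: in_plus)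
      show "c \<in> V' + B'"
      proof (cases "u \<in> V'")
        case True
        then have "u + (c - u) \<in> V' + B'" using u(2) by (intro plusI) (auto simp: B2_def)
        then show ?thesis by simp
      next
        case False
        then have "u - e \<in> B'" "c - u + e \<in> V'" using u by (auto simp: V2_def B2_def)
        then have "(c - u + e) + (u - e) \<in> V' + B'" by (intro plusI)
        then show ?thesis by simp
      qed
    qed
    moreover have "b \<in> B2" using h by (simp add: B2_def e_def)
    ultimately have "P (V2, B2)" using p perB2 by (auto simp: P_def V2_def)
    then have "sz N B' \<le> sz N B2" using PVB(2)[of "(V2, B2)"] by (simp add: VB nat_le_eq_zle)
    moreover have "B2 \<subseteq> B'" by (auto simp: B2_def)
    ultimately have "B2 = B'" using sz_subset_eq[OF N perB2(1) p(3)] by simp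
    then have "b' \<in> B2" using h by simp
    then show False using no by (simp add: B2_def e_def algebra_simps)
  qed
  then show ?thesis using that p by blast
qed

text \<open>The window is covered by \<open>(w + s - 1) div s\<close> full periods; multiplication
  by \<open>s\<close> turns the rounding into the term \<open>s - 1\<close>.\<close>

lemma card_window_le:
  assumes s: "s > 0" "per s X" and w: "w \<ge> 0"
  shows "s * int (card (X \<inter> {a..<a + w})) \<le> sz s X * (w + s - 1)"
proof -
  define m where "m = (w + s - 1) div s"
  have m0: "m \<ge> 0" using s w by (simp add: m_def pos_imp_zdiv_nonneg_iff)
  have ms: "m * s \<le> w + s - 1" "w \<le> m * s"
    using s pos_mod_bound[of s "w + s - 1"] pos_mod_sign[of s "w + s - 1"] minus_mod_eq_div_mult[of "w + s - 1" s]
    unfolding m_def by linarith+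
  have "int (card (X \<inter> {a..<a + int k * s})) \<le> int k * sz s X" for k
  proof (induction k)
    case (Suc k)
    have e: "X \<inter> {a..<a + int (Suc k) * s} = (X \<inter> {a..<a + int k * s}) \<union> (X \<inter> {a + int k * s..<a + int k * s + s})"
      using s by (auto simp: algebra_simps) (smt (verit) mult_nonneg_nonneg of_nat_0_le_iff)
    have "card (X \<inter> {a..<a + int (Suc k) * s}) \<le> card (X \<inter> {a..<a + int k * s}) + card (X \<inter> {a + int k * s..<a + int k * s + s})"
      unfolding e by (rule card_Un_le)
    then show ?case using Suc sz_window[OF s, of "a + int k * s"] by (simp add: algebra_simps)
  qed simp
  from this[of "nat m"] have "int (card (X \<inter> {a..<a + m * s})) \<le> m * sz s X" using m0 by simp
  moreover have "card (X \<inter> {a..<a + w}) \<le> card (X \<inter> {a..<a + m * s})" using ms by (intro card_mono) auto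
  ultimately have "int (card (X \<inter> {a..<a + w})) \<le> m * sz s X" by linarith
  then have "s * int (card (X \<inter> {a..<a + w})) \<le> s * (m * sz s X)" using s by (intro mult_left_mono) auto
  also have "\<dots> = (m * s) * sz s X" by simp
  also have "\<dots> \<le> (w + s - 1) * sz s X" using ms by (intro mult_right_mono) auto
  finally show ?thesis by (simp add: mult.commute)
qed

lemma sz_mult:
  assumes s: "s > 0" "per s X" and m: "m \<ge> 0" shows "sz (s * m) X = m * sz s X"
proof -
  have "int (card (X \<inter> {0..<int k * s})) = int k * sz s X" for k
  proof (induction k)
    case (Suc k)
    have e: "X \<inter> {0..<int (Suc k) * s} = (X \<inter> {0..<int k * s}) \<union> (X \<inter> {int k * s..<int k * s + s})"
      using s by (auto simp: algebra_simps) (smt (verit) mult_nonneg_nonneg of_nat_0_le_iff)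
    have "card (X \<inter> {0..<int (Suc k) * s}) = card (X \<inter> {0..<int k * s}) + card (X \<inter> {int k * s..<int k * s + s})"
      unfolding e by (rule card_Un_disjoint) auto
    then show ?case using Suc sz_window[OF s, of "int k * s"] by (simp add: algebra_simps)
  qed simp
  from this[of "nat m"] show ?thesis using m by (simp add: sz_def mult.commute)
qed

lemma prog_cong: "x \<in> prog d a l \<Longrightarrow> d dvd x - a"
  by (auto simp: prog_def)

text \<open>The bookkeeping of \<open>card_AA\<close> for a general set with at most two lifts per
  residue: residues hit at all, and again those hit twice.\<close>

lemma two_levels:
  assumes T: "T \<subseteq> {0..<2*N}" and N: "N > 0"
  shows "int (card T) = sz N {c. c mod N \<in> T \<or> c mod N + N \<in> T} + sz N {c. c mod N \<in> T \<and> c mod N + N \<in> T}"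
proof -
  define R0 R1 where "R0 = T \<inter> {0..<N}" and "R1 = {c \<in> {0..<N}. c + N \<in> T}"
  have fin: "finite R0" "finite R1" by (auto simp: R0_def R1_def intro: finite_subset[of _ "{0..<N}"])
  have e: "T = R0 \<union> (\<lambda>c. c + N) ` R1"
  proof (intro set_eqI iffI)
    fix c assume c: "c \<in> T"
    then have "0 \<le> c" "c < 2 * N" using T by auto
    then have "c \<in> R0 \<or> c - N \<in> R1" using c by (auto simp: R0_def R1_def)
    then show "c \<in> R0 \<union> (\<lambda>c. c + N) ` R1" by (auto simp: image_iff intro!: bexI[of _ "c - N"])
  qed (auto simp: R0_def R1_def)
  have "card T = card R0 + card ((\<lambda>c. c + N) ` R1)"
    by (subst e, rule card_Un_disjoint) (use fin in \<open>auto simp: R0_def R1_def\<close>)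
  then have "card T = card R0 + card R1" by (simp add: card_image)
  also have "\<dots> = card (R0 \<union> R1) + card (R0 \<inter> R1)" by (rule card_Un_Int[OF fin])
  finally have "card T = card (R0 \<union> R1) + card (R0 \<inter> R1)" .
  moreover have "sz N {c. c mod N \<in> T \<or> c mod N + N \<in> T} = int (card (R0 \<union> R1))"
    unfolding sz_def by (intro arg_cong[where f = "\<lambda>x. int (card x)"]) (auto simp: R0_def R1_def)
  moreover have "sz N {c. c mod N \<in> T \<and> c mod N + N \<in> T} = int (card (R0 \<inter> R1))"
    unfolding sz_def by (intro arg_cong[where f = "\<lambda>x. int (card x)"]) (auto simp: R0_def R1_def)
  ultimately show ?thesis by simp
qed

section \<open>Sets in two residue classes, one of them nearly full\<close>

locale two_classes = dense_sum +
  fixes g r :: int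
  assumes g2: "g \<ge> 2" and gH: "g dvd H"
    and cls: "\<And>a. a \<in> A \<Longrightarrow> g dvd a \<or> g dvd a - r" and rA: "r \<in> A" and gr: "\<not> g dvd r"
    and few_holes: "100 * (H div g - sz H {z \<in> S. g dvd z}) \<le> H div g" and b_small: "100 * b \<le> H div g"
begin

definition L where "L = H div g"
definition B where "B = {z. g * z \<in> A}"
definition r0 where "r0 = Min {a \<in> A. \<not> g dvd a}"
definition J where "J = {z. r0 + g * z \<in> A}"
definition h0 where "h0 = int (card ({0..L} - B))"

lemma H_eq: "H = g * L" using gH by (simp add: L_def)
lemma Lpos: "L > 0"
proof -
  have "0 < g * L" using Hpos H_eq by simp
  then show ?thesis using g2 zero_less_mult_pos[of g L] by linarith
qed

lemma r0: "r0 \<in> A" "\<not> g dvd r0" "\<And>a. a \<in> A \<Longrightarrow> \<not> g dvd a \<Longrightarrow> r0 \<le> a"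
proof -
  have f: "finite {a \<in> A. \<not> g dvd a}" "{a \<in> A. \<not> g dvd a} \<noteq> {}" using finA rA gr by auto
  from Min_in[OF f] show "r0 \<in> A" "\<not> g dvd r0" by (auto simp: r0_def)
  show "\<And>a. a \<in> A \<Longrightarrow> \<not> g dvd a \<Longrightarrow> r0 \<le> a" using f by (simp add: r0_def)
qed

lemma cls0: assumes "a \<in> A" "\<not> g dvd a" shows "g dvd a - r0"
proof -
  have "g dvd a - r" "g dvd r0 - r" using cls assms r0 by auto
  then have "g dvd (a - r) - (r0 - r)" by (rule dvd_diff)
  then show ?thesis by simp
qed

lemma B_sub: "B \<subseteq> {0..L}"
proof
  fix z assume "z \<in> B"
  then have "0 \<le> g * z" "g * z \<le> g * L" using A_sub H_eq by (auto simp: B_def)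
  then show "z \<in> {0..L}" using g2 by (simp add: zero_le_mult_iff)
qed

lemma B0: "0 \<in> B" and BL: "L \<in> B" using A0 AH H_eq by (auto simp: B_def)
lemma finB: "finite B" using B_sub finite_subset by blast

lemma J_sub: "z \<in> J \<Longrightarrow> 0 \<le> z \<and> z \<le> L"
proof -
  assume z: "z \<in> J"
  have a: "r0 + g * z \<in> A" using z by (simp add: J_def)
  have nd: "\<not> g dvd r0 + g * z" using r0(2) by (simp add: dvd_add_left_iff)
  have "r0 \<le> r0 + g * z" by (rule r0(3)[OF a nd])
  moreover have "0 \<le> r0" "r0 + g * z \<le> g * L" using A_sub a r0(1) H_eq by auto
  ultimately have "0 \<le> g * z" "g * z \<le> g * L" by auto
  then show ?thesis using g2 by (simp add: zero_le_mult_iff)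
qed

lemma finJ: "finite J" by (rule finite_subset[of _ "{0..L}"]) (use J_sub in auto)
lemma J0: "0 \<in> J" using r0 by (simp add: J_def)

lemma A_split: "A = (\<lambda>z. g * z) ` B \<union> (\<lambda>z. r0 + g * z) ` J"
proof (intro set_eqI iffI)
  fix a assume a: "a \<in> A"
  show "a \<in> (\<lambda>z. g * z) ` B \<union> (\<lambda>z. r0 + g * z) ` J"
  proof (cases "g dvd a")
    case True
    then show ?thesis using a by (auto simp: B_def)
  next
    case False
    then obtain z where "a - r0 = g * z" using cls0[OF a] by (auto simp: dvd_def)
    then have "a = r0 + g * z" by simp
    then show ?thesis using a by (auto simp: J_def)
  qed
qed (auto simp: B_def J_def)

lemma cardA: "card A = card B + card J"
proof -
  have "(\<lambda>z. g * z) ` B \<inter> (\<lambda>z. r0 + g * z) ` J = {}"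
    using r0(2) by (auto simp: image_iff) (metis dvd_add_left_iff dvd_triv_left)
  then have "card A = card ((\<lambda>z. g * z) ` B) + card ((\<lambda>z. r0 + g * z) ` J)"
    unfolding A_split[THEN arg_cong[where f = card]] using finB finJ by (intro card_Un_disjoint) auto
  then show ?thesis using g2 by (simp add: card_image inj_on_def)
qed

lemma cardB: "int (card B) = L + 1 - h0"
proof -
  have "card {0..L} = card ({0..L} \<inter> B) + card ({0..L} - B)" by (rule card_Int_Diff) simp
  then show ?thesis using B_sub Lpos by (simp add: h0_def Int_absorb1)
qed

lemma h0_small: "100 * h0 \<le> L"
proof -
  have "{z \<in> S. g dvd z} \<inter> {0..<H} = (\<lambda>z. g * z) ` (B - {L})"
  proof (intro set_eqI iffI)
    fix y assume y: "y \<in> {z \<in> S. g dvd z} \<inter> {0..<H}"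
    then obtain z where z: "y = g * z" by auto
    then have "z \<in> B - {L}" using y H_eq by (auto simp: B_def S_def)
    then show "y \<in> (\<lambda>z. g * z) ` (B - {L})" using z by auto
  next
    fix y assume "y \<in> (\<lambda>z. g * z) ` (B - {L})"
    then obtain z where z: "y = g * z" "z \<in> B" "z \<noteq> L" by auto
    then have "0 \<le> z" "z < L" using B_sub by force+
    then have "0 \<le> y" "y < H" using z H_eq g2 mult_strict_left_mono[of z L g] by auto
    then show "y \<in> {z \<in> S. g dvd z} \<inter> {0..<H}" using z by (auto simp: B_def S_def)
  qed
  then have "card ({z \<in> S. g dvd z} \<inter> {0..<H}) = card (B - {L})" using g2 by (simp add: card_image inj_on_def)
  then have "sz H {z \<in> S. g dvd z} = int (card B) - 1"
    using BL finB by (simp add: sz_def card_Diff_singleton) (metis One_nat_def Suc_leI card_gt_0_iff empty_iff of_nat_1 of_nat_diff)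
  then show ?thesis using few_holes cardB by (simp add: L_def)
qed

lemma h0_nonneg: "0 \<le> h0" by (simp add: h0_def)

lemma coprime_r0: "coprime r0 g"
proof -
  have "gcd r0 g dvd 1"
  proof (rule gcdA)
    fix a assume "a \<in> A"
    then have "a \<in> (\<lambda>z. g * z) ` B \<union> (\<lambda>z. r0 + g * z) ` J" by (rule subst[OF A_split])
    then show "gcd r0 g dvd a" by auto
  qed
  then show ?thesis by (simp add: coprime_iff_gcd_eq_1)
qed

definition jm where "jm = Max J"
lemma jm: "jm \<in> J" "\<And>z. z \<in> J \<Longrightarrow> z \<le> jm" using Max_in[OF finJ] Max_ge[OF finJ] J0 by (auto simp: jm_def)
lemma jm_nonneg: "0 \<le> jm" using jm J0 by blast
lemma jm_le: "jm \<le> L" using jm J_sub by blast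

text \<open>The left side counts the holes of \<open>B\<close> in \<open>{0..L}\<close> and of
  \<open>J\<close> in \<open>{0..jm}\<close>. As \<open>g\<close> does not divide
  \<open>2 * r0\<close>, the sums \<open>B + B\<close>, \<open>B + J\<close> and
  \<open>J + J\<close> fill distinct classes. \<open>double_card\<close> charges the sums missing
  from \<open>B + B\<close> to holes in two end zones, so the middle holes \<open>M\<close> remain
  to pay for the sums missing from \<open>B + J\<close>, which are estimated by classes modulo
  \<open>jm\<close>.\<close>

lemma holes_bound:
  assumes g3: "g \<ge> 3"
  shows "h0 + jm + 1 - int (card J) \<le> b"
proof -
  have g2r: "\<not> g dvd 2 * r0"
  proof
    assume "g dvd 2 * r0"
    then have "g dvd 2" using coprime_r0 coprime_dvd_mult_left_iff[of g r0 2] by (simp add: coprime_commute mult.commute)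
    then show False using g3 zdvd_imp_le[of g 2] by simp
  qed
  obtain n1 n2 where z: "-1 \<le> n1" "-1 \<le> n2"
    "n1 + 1 \<le> 2 * h0" "n2 + 1 \<le> 2 * h0"
    "2 * L + 1 \<le> int (card (B + B)) + int (card ({0..n1} - B)) + int (card ({L - n2..L} - B))"
    using double_card[OF B_sub B0 BL] h0_small h0_nonneg unfolding h0_def[symmetric] by (smt (verit, best))
  define M where "M = {n1 + 1..L - n2 - 1} - B"
  have hM: "h0 = int (card ({0..n1} - B)) + int (card ({L - n2..L} - B)) + int (card M)"
  proof -
    have e: "{0..L} - B = (({0..n1} - B) \<union> ({L - n2..L} - B)) \<union> M"
      using z h0_small h0_nonneg by (auto simp: M_def)
    have "card ({0..L} - B) = card (({0..n1} - B) \<union> ({L - n2..L} - B)) + card M"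
      unfolding e using z h0_small h0_nonneg by (intro card_Un_disjoint) (auto simp: M_def)
    also have "card (({0..n1} - B) \<union> ({L - n2..L} - B)) = card ({0..n1} - B) + card ({L - n2..L} - B)"
      using z h0_small h0_nonneg by (intro card_Un_disjoint) auto
    finally show ?thesis by (simp add: h0_def)
  qed
  define G2 G1 G0 where "G2 = (\<lambda>z. g * z) ` (B + B)" and "G1 = (\<lambda>z. r0 + g * z) ` (B + J)"
    and "G0 = (\<lambda>z. 2 * r0 + g * z) ` (J + J)"
  have sub: "G2 \<subseteq> A + A" "G1 \<subseteq> A + A" "G0 \<subseteq> A + A"
  proof -
    have "g * (u + v) \<in> A + A" if "u \<in> B" "v \<in> B" for u v
      using plusI[of "g*u" A "g*v" A] that by (simp add: B_def algebra_simps)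
    then show "G2 \<subseteq> A + A" by (auto simp: G2_def elim!: set_plus_elim)
    have "r0 + g * (u + v) \<in> A + A" if "u \<in> B" "v \<in> J" for u v
      using plusI[of "g*u" A "r0 + g*v" A] that by (simp add: B_def J_def algebra_simps)
    then show "G1 \<subseteq> A + A" by (auto simp: G1_def elim!: set_plus_elim)
    have "2 * r0 + g * (u + v) \<in> A + A" if "u \<in> J" "v \<in> J" for u v
      using plusI[of "r0 + g*u" A "r0 + g*v" A] that by (simp add: B_def J_def algebra_simps)
    then show "G0 \<subseteq> A + A" by (auto simp: G0_def elim!: set_plus_elim)
  qed
  have cls3: "x \<in> G2 \<Longrightarrow> g dvd x" "x \<in> G1 \<Longrightarrow> g dvd x - r0" "x \<in> G0 \<Longrightarrow> g dvd x - 2 * r0" for x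
    by (auto simp: G2_def G1_def G0_def)
  have disj: "G2 \<inter> G1 = {}" "(G2 \<union> G1) \<inter> G0 = {}"
  proof -
    have "False" if "x \<in> G2" "x \<in> G1" for x
      using dvd_diff[OF cls3(1)[OF that(1)] cls3(2)[OF that(2)]] r0(2) by simp
    then show "G2 \<inter> G1 = {}" by auto
    have "False" if "x \<in> G2" "x \<in> G0" for x
      using dvd_diff[OF cls3(1)[OF that(1)] cls3(3)[OF that(2)]] g2r by simp
    moreover have "False" if "x \<in> G1" "x \<in> G0" for x
      using dvd_diff[OF cls3(2)[OF that(1)] cls3(3)[OF that(2)]] r0(2) by simp
    ultimately show "(G2 \<union> G1) \<inter> G0 = {}" by auto
  qed
  have fin: "finite G2" "finite G1" "finite G0" using finB finJ by (auto simp: G2_def G1_def G0_def intro!: finite_set_plus)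
  have "card (G2 \<union> G1 \<union> G0) \<le> card (A + A)" using sub finA by (intro card_mono finite_set_plus) auto
  moreover have "card (G2 \<union> G1 \<union> G0) = card (G2 \<union> G1) + card G0" using fin disj by (intro card_Un_disjoint) auto
  moreover have "card (G2 \<union> G1) = card G2 + card G1" using fin disj by (intro card_Un_disjoint) auto
  moreover have "card G2 = card (B + B)" "card G1 = card (B + J)" "card G0 = card (J + J)"
    using g2 by (auto simp: G2_def G1_def G0_def card_image inj_on_def)
  ultimately have "card (B + B) + card (B + J) + card (J + J) \<le> card (A + A)" by simp
  from of_nat_mono[OF this, where 'a = int]
  have "int (card (B + B)) + int (card (B + J)) + int (card (J + J)) \<le> int (card (A + A))" by simp
  moreover have "card J + card J \<le> card (J + J) + 1" using card_plus_ge[OF finJ finJ] J0 by blast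
  from of_nat_mono[OF this, where 'a = int] have "2 * int (card J) \<le> int (card (J + J)) + 1" by simp
  moreover have "int (card A) = int (card B) + int (card J)" by (simp add: cardA)
  moreover define cBB cBJ a0 a1 where "cBB = int (card (B + B))" and "cBJ = int (card (B + J))"
    and "a0 = int (card B)" and "a1 = int (card J)"
  ultimately have tot: "cBB + cBJ + 2 * a1 - 1 \<le> 3 * a0 + 3 * a1 - 3 + b"
    using cardAA by simp
  define z1 z2 m where "z1 = int (card ({0..n1} - B))" and "z2 = int (card ({L - n2..L} - B))" and "m = int (card M)"
  have z5: "2 * L + 1 \<le> cBB + z1 + z2" using z(5) by (simp add: cBB_def z1_def z2_def)
  have hM: "h0 = z1 + z2 + m" using hM by (simp add: z1_def z2_def m_def)
  have cB: "a0 = L + 1 - h0" using cardB by (simp add: a0_def)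
  have goal: "h0 + jm + 1 - a1 \<le> b \<Longrightarrow> ?thesis" by (simp add: a1_def)
  show ?thesis
  proof (cases "jm = 0")
    case True
    have "z = 0" if "z \<in> J" for z using J_sub[OF that] jm(2)[OF that] True by simp
    then have "J = {0}" using J0 by blast
    then have "B + J = B" by (auto simp: set_plus_def)
    then have "cBJ = a0" by (simp add: cBJ_def a0_def)
    then show ?thesis using tot z5 hM cB True by (intro goal) (simp add: m_def)
  next
    case False
    then have j1: "jm \<ge> 1" using jm_nonneg by simp
    define I where "I = (\<lambda>z. z mod jm) ` (B + J)"
    define U where "U = {0..<jm} - I"
    have Isub: "I \<subseteq> {0..<jm}" using j1 by (auto simp: I_def)
    have cU: "int (card U) = jm - int (card I)"
      using Isub j1 card_mono[OF _ Isub] unfolding U_def by (subst card_Diff_subset) (auto intro: finite_subset)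
    have BJ: "card B + card I \<le> card (B + J)"
      unfolding I_def by (rule card_plus_mod[OF finB finJ J0 jm(1) j1])
    then have BJ: "a0 + int (card I) \<le> cBJ"
      using of_nat_mono[OF BJ, where 'a = int] by (simp add: a0_def cBJ_def)
    have BI: "z mod jm \<in> I" if "z \<in> B" for z using plusI[OF that J0] by (auto simp: I_def)
    \<comment> \<open>It is enough that \<open>B + J\<close> misses at most as many classes modulo
      \<open>jm\<close> as there are middle holes.\<close>
    have main: "int (card U) \<le> m \<Longrightarrow> ?thesis" using tot z5 hM cB BJ cU by (intro goal) linarith
    show ?thesis
    proof (cases "jm \<le> L - n2 - n1 - 1")
      case True
      \<comment> \<open>The representative of \<open>c\<close> among the first \<open>jm\<close>
        places of the middle zone; for a missed class it must be a hole.\<close>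
      define f where "f c = n1 + 1 + (c - n1 - 1) mod jm" for c
      have "f ` U \<subseteq> M"
      proof
        fix y assume "y \<in> f ` U"
        then obtain c where c: "c \<in> U" "y = f c" by auto
        have "y mod jm = c" using c by (simp add: f_def mod_simps U_def)
        then have "y \<notin> B" using BI[of y] c by (auto simp: U_def)
        moreover have "0 \<le> (c - n1 - 1) mod jm" "(c - n1 - 1) mod jm < jm" using j1 by auto
        ultimately show "y \<in> M" using c True by (auto simp: f_def M_def)
      qed
      moreover have "inj_on f U"
      proof (rule inj_onI)
        fix c c' assume c: "c \<in> U" "c' \<in> U" "f c = f c'"
        then have "f c mod jm = f c' mod jm" by simp
        then show "c = c'" using c by (simp add: f_def mod_simps U_def)
      qed
      ultimately have "card U \<le> card M" by (intro card_inj_on_le[of f]) (auto simp: M_def)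
      then show ?thesis by (intro main) (simp add: m_def)
    next
      case jbig: False
      show ?thesis
      proof (cases "U = {}")
        case True
        then show ?thesis by (intro main) (simp add: m_def)
      next
        case False
        then obtain c where c: "c \<in> U" by blast
        have "U \<subseteq> {0..L} - B" using BI jm_le by (force simp: U_def)
        then have Uh: "int (card U) \<le> h0" unfolding h0_def by (simp add: card_mono)
        \<comment> \<open>Since \<open>c\<close> is missed by all sums, \<open>c - y\<close> reduced
          modulo \<open>jm\<close> is a hole of \<open>B\<close>. So \<open>J\<close> is tiny, and
          the total count bounds \<open>jm\<close> by about \<open>h0 + b\<close>, whereas
          \<open>jm\<close> exceeds the length of the middle zone.\<close>
        define f where "f y = (c - y) mod jm" for y
        have "f ` (J - {jm}) \<subseteq> {0..L} - B"
        proof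
          fix w assume "w \<in> f ` (J - {jm})"
          then obtain y where y: "y \<in> J" "w = f y" by auto
          have w: "0 \<le> w" "w < jm" using y j1 by (auto simp: f_def)
          have "w \<notin> B"
          proof
            assume "w \<in> B"
            then have "(w + y) mod jm \<in> I" using plusI[of w B y J] y by (auto simp: I_def)
            moreover have "(w + y) mod jm = c" using c by (simp add: y f_def mod_simps U_def)
            ultimately show False using c by (simp add: U_def)
          qed
          then show "w \<in> {0..L} - B" using w jm_le by auto
        qed
        moreover have "inj_on f (J - {jm})"
        proof (rule inj_onI)
          fix y y' assume y: "y \<in> J - {jm}" "y' \<in> J - {jm}" "f y = f y'"
          then have "jm dvd (c - y) - (c - y')" by (simp add: f_def mod_eq_dvd_iff)
          then have "jm dvd y' - y" by simp
          moreover have "\<bar>y' - y\<bar> < jm" using y J_sub jm(2) by (smt (verit) Diff_iff insertI1)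
          ultimately show "y = y'" using dvd_imp_le_int[of "y' - y" jm] j1 by force
        qed
        ultimately have "card (J - {jm}) \<le> card ({0..L} - B)" by (intro card_inj_on_le[of f]) auto
        then have "a1 \<le> h0 + 1" using jm(1) finJ by (simp add: h0_def a1_def card_Diff_singleton)
        moreover have "100 * b \<le> L" using b_small by (simp add: L_def)
        moreover have "0 \<le> m" by (simp add: m_def)
        ultimately have False using tot z(1-4) z5 hM cB BJ cU Uh jbig h0_small b0 Lpos by linarith
        then show ?thesis ..
      qed
    qed
  qed
qed

text \<open>The progressions are the hulls of the two classes, and \<open>holes_bound\<close> is
  exactly the bound on their total length.\<close>

lemma covered: assumes g3: "g \<ge> 3" shows "bi_covered A (int (card A) + b)"
proof -
  have g2r: "\<not> g dvd 2 * r0"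
  proof
    assume "g dvd 2 * r0"
    then have "g dvd 2" using coprime_r0 coprime_dvd_mult_left_iff[of g r0 2] by (simp add: coprime_commute mult.commute)
    then show False using g3 zdvd_imp_le[of g 2] by simp
  qed
  let ?I = "prog g 0 (L + 1)" and ?J = "prog g r0 (jm + 1)"
  have sI: "g dvd x" if "x \<in> ?I" for x using prog_cong[OF that] by simp
  have sJ: "g dvd x - r0" if "x \<in> ?J" for x using prog_cong[OF that] .
  have II: "g dvd x" if xx: "x \<in> ?I + ?I" for x
  proof -
    obtain u where "u \<in> ?I" "x - u \<in> ?I" using xx by (auto simp: in_plus)
    then show ?thesis using dvd_add[OF sI sI] by fastforce
  qed
  have IJ: "g dvd x - r0" if xx: "x \<in> ?I + ?J" for x
  proof -
    obtain u where u: "u \<in> ?I" "x - u \<in> ?J" using xx by (auto simp: in_plus)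
    have "g dvd u + (x - u - r0)" by (rule dvd_add[OF sI[OF u(1)] sJ[OF u(2)]])
    then show ?thesis by simp
  qed
  have JJ: "g dvd x - 2 * r0" if xx: "x \<in> ?J + ?J" for x
  proof -
    obtain u where u: "u \<in> ?J" "x - u \<in> ?J" using xx by (auto simp: in_plus)
    have "g dvd (u - r0) + (x - u - r0)" by (rule dvd_add[OF sJ[OF u(1)] sJ[OF u(2)]])
    then show ?thesis by (simp add: algebra_simps)
  qed
  have d1: "(?I + ?I) \<inter> (?I + ?J) = {}"
    using r0(2) dvd_diff[OF II IJ] by fastforce
  have d2: "(?I + ?I) \<inter> (?J + ?J) = {}"
    using g2r dvd_diff[OF II JJ] by fastforce
  have d3: "(?I + ?J) \<inter> (?J + ?J) = {}"
  proof -
    have False if "x \<in> ?I + ?J" "x \<in> ?J + ?J" for x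
      using dvd_diff[OF IJ[OF that(1)] JJ[OF that(2)]] r0(2) by simp
    then show ?thesis by auto
  qed
  have BI: "(\<lambda>z. g * z) ` B \<subseteq> ?I" using B_sub by (auto simp: prog_def intro!: exI[of _ "_::int"])
  have JJ': "(\<lambda>z. r0 + g * z) ` J \<subseteq> ?J" using J_sub jm(2) by (force simp: prog_def)
  have cov: "A \<subseteq> ?I \<union> ?J" using A_split BI JJ' by blast
  have "g * 0 \<in> ?I" using BI B0 by blast
  then have m1: "A \<inter> ?I \<noteq> {}" using A0 by auto
  have "r0 + g * 0 \<in> ?J" using JJ' J0 by blast
  then have m2: "A \<inter> ?J \<noteq> {}" using r0(1) by auto
  have r0': "0 \<le> r0" using r0(1) A_sub by auto
  have len: "L + 1 + (jm + 1) \<le> int (card A) + b" using holes_bound[OF g3] cardA cardB by simp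
  have pos: "1 \<le> g" "1 \<le> L + 1" "1 \<le> jm + 1" "(0::int) \<le> 0" using g3 Lpos jm_nonneg by auto
  show ?thesis unfolding bi_covered_def
    by (rule exI[of _ g], rule exI[of _ 0], rule exI[of _ "L + 1"], rule exI[of _ r0], rule exI[of _ "jm + 1"])
      (intro conjI pos r0' len cov m1 m2 d1 d2 d3)
qed

end

text \<open>Index two is impossible: passing to the residues modulo \<open>L\<close>, the odd sums miss a set \<open>V\<close>
  with \<open>V - J\<close> inside the holes of \<open>B\<close>, and the e-transform makes these holes periodic, so that they
  cannot sit in the end zones of \<open>double_card\<close>.\<close>

lemma (in dense_sum) no_index_two:
  assumes HL: "H = 2 * L" and few: "100 * int (card ({0..L} - {z. 2 * z \<in> A})) \<le> L" and r: "r \<in> A" "odd r"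
  shows False
proof -
  have Lpos: "L > 0" using HL Hpos by simp
  define B where "B = {z. 2 * z \<in> A}"
  define h0 where "h0 = int (card ({0..L} - B))"
  have h0_small: "100 * h0 \<le> L" using few by (simp add: h0_def B_def)
  have h0_nonneg: "0 \<le> h0" by (simp add: h0_def)
  have B_sub: "B \<subseteq> {0..L}" using A_sub HL by (auto simp: B_def)
  have B0: "0 \<in> B" and BL: "L \<in> B" using A0 AH HL by (auto simp: B_def)
  have finB: "finite B" using B_sub finite_subset by blast
  have cardB: "int (card B) = L + 1 - h0"
  proof -
    have "card {0..L} = card ({0..L} \<inter> B) + card ({0..L} - B)" by (rule card_Int_Diff) simp
    then show ?thesis using B_sub Lpos by (simp add: h0_def Int_absorb1)
  qed
  define Bp Jp where "Bp = {z. 2 * z \<in> S}" and "Jp = {z. 2 * z + 1 \<in> S}"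
  have pS: "z + H \<in> S \<longleftrightarrow> z \<in> S" for z using perS by (simp add: per_def)
  have e2: "2 * (z + L) = 2 * z + H" "2 * (z + L) + 1 = (2 * z + 1) + H" for z using HL by simp_all
  have perBp: "per L Bp" unfolding per_def Bp_def mem_Collect_eq by (simp only: e2(1) pS) simp
  have perJp: "per L Jp" unfolding per_def Jp_def mem_Collect_eq by (simp only: e2(2) pS) simp
  have BpB: "z \<in> Bp \<longleftrightarrow> z \<in> B" if "0 \<le> z" "z < L" for z
    using S_iff[of "2 * z"] that by (simp add: Bp_def B_def HL)
  have "(- Bp) \<inter> {0..<L} = {0..L} - B"
  proof (intro set_eqI iffI)
    fix z assume "z \<in> (- Bp) \<inter> {0..<L}"
    then show "z \<in> {0..L} - B" using BpB[of z] by auto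
  next
    fix z assume z: "z \<in> {0..L} - B"
    then have "z \<noteq> L" using BL by auto
    then show "z \<in> (- Bp) \<inter> {0..<L}" using z BpB[of z] by auto
  qed
  then have szBp: "sz L (- Bp) = h0" by (simp add: sz_def h0_def)
  define A1 where "A1 = {a \<in> A. odd a}"
  have A1H: "a \<noteq> H" "0 \<le> a" "a < H" if "a \<in> A1" for a
    using that A_sub HL by (auto simp: A1_def order_less_le)
  have finA1: "finite A1" using finA by (simp add: A1_def)
  have A_split: "A = (\<lambda>z. 2 * z) ` B \<union> A1" by (auto simp: B_def A1_def elim!: evenE)
  have cardA: "card A = card B + card A1"
  proof -
    have "card A = card ((\<lambda>z. 2 * z) ` B) + card A1"
      by (subst A_split, rule card_Un_disjoint) (use finB finA1 in \<open>auto simp: A1_def\<close>)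
    then show ?thesis by (simp add: card_image inj_on_def)
  qed
  have "A1 = (\<lambda>z. 2 * z + 1) ` (Jp \<inter> {0..<L})"
  proof (intro set_eqI iffI)
    fix a assume a: "a \<in> A1"
    then obtain z where z: "a = 2 * z + 1" by (auto simp: A1_def elim: oddE)
    then have "z \<in> Jp \<inter> {0..<L}" using a A1H[OF a] A_sub_S HL by (auto simp: A1_def Jp_def)
    then show "a \<in> (\<lambda>z. 2 * z + 1) ` (Jp \<inter> {0..<L})" using z by auto
  next
    fix a assume "a \<in> (\<lambda>z. 2 * z + 1) ` (Jp \<inter> {0..<L})"
    then obtain z where z: "a = 2 * z + 1" "2 * z + 1 \<in> S" "0 \<le> z" "z < L" by (auto simp: Jp_def)
    then show "a \<in> A1" using S_iff[of a] HL by (auto simp: A1_def)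
  qed
  then have szJp: "sz L Jp = int (card A1)" by (simp add: sz_def card_image inj_on_def)
  define A0' where "A0' = (\<lambda>z. 2 * z) ` B"
  define T where "T = A0' + A1"
  have A0A: "a \<in> A" "even a" "0 \<le> a" "a \<le> H" if "a \<in> A0'" for a
    using that A_sub by (auto simp: A0'_def B_def)
  have T_sub: "T \<subseteq> {0..<2*H}"
  proof
    fix c assume "c \<in> T"
    then obtain u where u: "u \<in> A0'" "c - u \<in> A1" by (auto simp: T_def in_plus)
    show "c \<in> {0..<2*H}" using A0A[OF u(1)] A1H[OF u(2)] by auto
  qed
  \<comment> \<open>Odd sums are counted once per residue and again for residues with two lifts.
    \<open>W2\<close> contains all odd elements, because \<open>0\<close> and \<open>H\<close> are
    both even elements of \<open>A\<close>.\<close>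
  define W1 W2 where "W1 = {c. c mod H \<in> T \<or> c mod H + H \<in> T}" and "W2 = {c. c mod H \<in> T \<and> c mod H + H \<in> T}"
  have cT: "int (card T) = sz H W1 + sz H W2" unfolding W1_def W2_def by (rule two_levels[OF T_sub Hpos])
  define Q where "Q = Bp + Jp"
  have perQ: "per L Q" unfolding Q_def by (rule per_plus[OF perBp])
  have "sz L Q \<le> sz H W1"
  proof -
    have "(\<lambda>z. 2 * z + 1) ` (Q \<inter> {0..<L}) \<subseteq> W1 \<inter> {0..<H}"
    proof
      fix y assume "y \<in> (\<lambda>z. 2 * z + 1) ` (Q \<inter> {0..<L})"
      then obtain z where z: "y = 2 * z + 1" "z \<in> Q" "0 \<le> z" "z < L" by auto
      then obtain u where u: "2 * u \<in> S" "2 * (z - u) + 1 \<in> S" by (auto simp: Q_def in_plus Bp_def Jp_def)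
      define s t where "s = (2 * u) mod H" and "t = (2 * (z - u) + 1) mod H"
      have st: "s \<in> A" "t \<in> A" "0 \<le> s" "s < H" "0 \<le> t" "t < H" using u Hpos by (auto simp: S_def s_def t_def)
      have "even s" "odd t" by (auto simp: s_def t_def HL dvd_mod_iff)
      then have sA: "s \<in> A0'" "t \<in> A1" using st by (auto simp: A0'_def B_def A1_def elim!: evenE)
      have "(s + t) mod H = (2 * u + (2 * (z - u) + 1)) mod H" by (simp only: s_def t_def mod_simps)
      also have "\<dots> = y" using z HL by simp
      finally have "(s + t) mod H = y" .
      moreover have "(s + t) mod H = (if s + t < H then s + t else s + t - H)" using st by (intro mod_below_twice) auto
      ultimately have "s + t = y \<or> s + t = y + H" by (auto split: if_splits)
      moreover have "s + t \<in> T" unfolding T_def by (rule plusI[OF sA])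
      moreover have "y mod H = y" "0 \<le> y" "y < H" using z HL by auto
      ultimately show "y \<in> W1 \<inter> {0..<H}" by (auto simp: W1_def)
    qed
    then have "card ((\<lambda>z. 2 * z + 1) ` (Q \<inter> {0..<L})) \<le> card (W1 \<inter> {0..<H})" by (intro card_mono) auto
    then show ?thesis by (simp add: sz_def card_image inj_on_def)
  qed
  moreover have "int (card A1) \<le> sz H W2"
  proof -
    have "0 \<in> A0'" "H \<in> A0'" using B0 BL HL by (auto simp: A0'_def image_iff intro: bexI[of _ 0] bexI[of _ L])
    then have "a \<in> W2 \<inter> {0..<H}" if "a \<in> A1" for a
      using plusI[of 0 A0' a A1] plusI[of H A0' a A1] that A1H[OF that] by (auto simp: W2_def T_def add.commute)
    then have "card A1 \<le> card (W2 \<inter> {0..<H})" by (intro card_mono) auto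
    then show ?thesis by (simp add: sz_def)
  qed
  ultimately have cT': "sz L Q + int (card A1) \<le> int (card T)" using cT by simp
  obtain n1 n2 where z: "-1 \<le> n1" "-1 \<le> n2"
    "n1 + 1 \<le> 2 * int (card ({0..n1} - B))" "n2 + 1 \<le> 2 * int (card ({L - n2..L} - B))"
    "n1 + 1 \<le> 2 * h0" "n2 + 1 \<le> 2 * h0"
    "2 * L + 1 \<le> int (card (B + B)) + int (card ({0..n1} - B)) + int (card ({L - n2..L} - B))"
    using double_card[OF B_sub B0 BL] h0_small h0_nonneg unfolding h0_def[symmetric] by (smt (verit, best))
  define M where "M = {n1 + 1..L - n2 - 1} - B"
  define Zh where "Zh = int (card ({0..n1} - B)) + int (card ({L - n2..L} - B))"
  have hM: "h0 = Zh + int (card M)"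
  proof -
    have e: "{0..L} - B = (({0..n1} - B) \<union> ({L - n2..L} - B)) \<union> M"
      using z h0_small h0_nonneg by (auto simp: M_def)
    have "card ({0..L} - B) = card (({0..n1} - B) \<union> ({L - n2..L} - B)) + card M"
      unfolding e using z h0_small h0_nonneg by (intro card_Un_disjoint) (auto simp: M_def)
    also have "card (({0..n1} - B) \<union> ({L - n2..L} - B)) = card ({0..n1} - B) + card ({L - n2..L} - B)"
      using z h0_small h0_nonneg by (intro card_Un_disjoint) auto
    finally show ?thesis by (simp add: h0_def Zh_def)
  qed
  define G2 where "G2 = (\<lambda>z. 2 * z) ` (B + B)"
  have cG2: "card G2 = card (B + B)" by (simp add: G2_def card_image inj_on_def)
  have "card (G2 \<union> T) = card G2 + card T"
  proof (rule card_Un_disjoint)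
    show "finite G2" using finB by (simp add: G2_def finite_set_plus)
    show "finite T" using finB finA1 by (simp add: T_def A0'_def finite_set_plus)
    show "G2 \<inter> T = {}"
    proof -
      have "even c" if "c \<in> G2" for c using that by (auto simp: G2_def)
      moreover have "odd c" if cT: "c \<in> T" for c
      proof -
        obtain u where u: "u \<in> A0'" "c - u \<in> A1" using cT by (auto simp: T_def in_plus)
        then show ?thesis using A0A(2)[OF u(1)] by (auto simp: A1_def)
      qed
      ultimately show ?thesis by blast
    qed
  qed
  moreover have "card (G2 \<union> T) \<le> card (A + A)"
  proof (intro card_mono finite_set_plus finA)
    have "2 * (u + v) \<in> A + A" if "u \<in> B" "v \<in> B" for u v
      using plusI[of "2*u" A "2*v" A] that by (simp add: B_def algebra_simps)
    then have "G2 \<subseteq> A + A" by (auto simp: G2_def elim!: set_plus_elim)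
    moreover have "T \<subseteq> A + A" unfolding T_def by (rule plus_mono) (use A0A in \<open>auto simp: A1_def\<close>)
    ultimately show "G2 \<union> T \<subseteq> A + A" by simp
  qed
  ultimately have "card (B + B) + card T \<le> card (A + A)" using cG2 by simp
  from of_nat_mono[OF this, where 'a = int] have tot0: "int (card (B + B)) + int (card T) \<le> 3 * int (card A) - 3 + b"
    using cardAA by simp
  define a0 a1 where "a0 = int (card B)" and "a1 = int (card A1)"
  have cA: "int (card A) = a0 + a1" using cardA by (simp add: a0_def a1_def)
  have cB: "a0 = L + 1 - h0" using cardB by (simp add: a0_def)
  define V where "V = - Q"
  have perV: "per L V" unfolding V_def by (rule per_Compl[OF perQ])
  have szV: "sz L V = L - sz L Q" unfolding V_def by (rule sz_Compl[OF Lpos])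
  define BB TT where "BB = int (card (B + B))" and "TT = int (card T)"
  have "BB + TT \<le> 3 * a0 + 3 * a1 - 3 + b" "2 * L + 1 \<le> BB + Zh" "L - sz L V + a1 \<le> TT"
    using tot0 z(7) cT' szV cA by (simp_all add: BB_def TT_def Zh_def a1_def)
  \<comment> \<open>\<open>Hbig\<close> turned into a lower bound: the even class has more holes
    than there are odd elements.\<close>
  moreover have hh: "h0 \<ge> a1 + b + 1" using Hbig HL cA cB by linarith
  ultimately have Vbig: "sz L V + a1 \<ge> 2 * h0 + 2 - Zh" using cB by linarith
  have Zh0: "Zh \<le> h0" using hM by simp
  have "sz L V \<ge> 1" using Vbig Zh0 hh b0 by linarith
  then have V_ne: "V \<noteq> {}" by auto
  define Nj where "Nj = {z. 0 - z \<in> Jp}"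
  have perNj: "per L Nj" unfolding Nj_def by (rule per_refl[OF perJp])
  have szNj: "sz L Nj = a1" unfolding Nj_def using sz_refl[OF Lpos perJp, of 0] szJp by (simp only: a1_def)
  have "a1 \<ge> 1" using r finA1 card_gt_0_iff[of A1] by (auto simp: a1_def A1_def intro!: Suc_leI)
  then have Nj_ne: "Nj \<noteq> {}" using szNj by auto
  have VN: "V + Nj \<subseteq> - Bp"
  proof
    fix c assume "c \<in> V + Nj"
    then obtain v where v: "v \<notin> Bp + Jp" "v - c \<in> Jp" by (auto simp: in_plus V_def Q_def Nj_def)
    show "c \<in> - Bp"
    proof
      assume "c \<in> Bp"
      then have "c + (v - c) \<in> Bp + Jp" using v(2) by (rule plusI)
      then show False using v(1) by simp
    qed
  qed
  \<comment> \<open>\<open>V + Nj\<close> consists of holes of \<open>Bp\<close>, of which there are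
    \<open>h0\<close> modulo \<open>L\<close>, although \<open>|V| + |Nj|\<close> is larger than
    \<open>h0\<close>. The e-transform converts this excess into invariance under
    translations.\<close>
  obtain V' B' where VB: "per L V'" "V' \<noteq> {}" "per L B'" "B' \<noteq> {}" "sz L V' + sz L B' = sz L V + sz L Nj"
    "V' + B' \<subseteq> V + Nj" "\<And>v u u'. v \<in> V' \<Longrightarrow> u \<in> B' \<Longrightarrow> u' \<in> B' \<Longrightarrow> v - u + u' \<in> V'"
    using e_transform[OF Lpos perV V_ne perNj Nj_ne] by metis
  obtain b1 where b1: "b1 \<in> B'" using VB(4) by blast
  define E where "E = tr b1 V'"
  have perE: "per L E" unfolding E_def by (rule per_tr[OF VB(1)])
  have szE: "sz L E = sz L V'" unfolding E_def by (rule sz_tr[OF Lpos VB(1)])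
  have Ehole: "E \<subseteq> - Bp"
  proof
    fix c assume "c \<in> E"
    then have "(c - b1) + b1 \<in> V' + B'" using b1 by (intro plusI) (auto simp: E_def)
    then show "c \<in> - Bp" using VB(6) VN by auto
  qed
  define P where "P = {m. tr m E = E}"
  have sgP: "subgp P"
    unfolding subgp_def
  proof (intro conjI ballI)
    show "0 \<in> P" by (simp add: P_def tr_def)
    fix u v assume "u \<in> P" "v \<in> P"
    then have uv: "z - u \<in> E \<longleftrightarrow> z \<in> E" "z - v \<in> E \<longleftrightarrow> z \<in> E" for z by (auto simp: P_def tr_def set_eq_iff)
    have "z - (u - v) \<in> E \<longleftrightarrow> z \<in> E" for z
      using uv(1)[of "z + v"] uv(2)[of "z + v"] by (simp add: algebra_simps)
    then have "tr (u - v) E = E" by (intro set_eqI) (simp only: in_tr)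
    then show "u - v \<in> P" by (simp add: P_def)
  qed
  have LP: "L \<in> P"
  proof -
    have "z - L \<in> E \<longleftrightarrow> z \<in> E" for z using per_add_mult[OF perE, of z "-1"] by simp
    then have "tr L E = E" by (intro set_eqI) (simp only: in_tr)
    then show ?thesis by (simp add: P_def)
  qed
  \<comment> \<open>The invariance puts \<open>B' - b1\<close> into the stabilizer of
    \<open>E\<close>, which bounds \<open>|B'|\<close> by the number \<open>m\<close> of multiples
    of \<open>s\<close> modulo \<open>L\<close>.\<close>
  have BP: "tr (- b1) B' \<subseteq> P"
  proof
    fix u assume u: "u \<in> tr (- b1) B'"
    have "tr u E \<subseteq> E"
    proof
      fix z assume "z \<in> tr u E"
      then have "z - u - b1 - b1 + (u + b1) \<in> V'" using u b1 by (intro VB(7)) (auto simp: E_def)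
      then show "z \<in> E" by (simp add: E_def)
    qed
    then have "tr u E = E" using sz_tr[OF Lpos perE, of u] by (intro sz_subset_eq[OF Lpos per_tr[OF perE] perE]) auto
    then show "u \<in> P" by (simp add: P_def)
  qed
  obtain s where s: "s > 0" "s dvd L" "P = {z. s dvd z}" using subgp_multiples[OF sgP LP Lpos] by blast
  define m where "m = L div s"
  have Lm: "L = s * m" using s(2) by (simp add: m_def)
  have "0 < s * m" using Lm Lpos by simp
  then have m0: "m > 0" using zero_less_mult_pos[of s m] s(1) by blast
  have szB': "sz L B' \<le> m"
    using sz_mono[OF BP, of L] sz_tr[OF Lpos VB(3)] sz_multiples[OF s(1,2) Lpos] s(3) by (simp add: m_def)
  have perEs: "per s E"
  proof -
    have "s \<in> P" using s(3) by simp
    then have "z - s \<in> E \<longleftrightarrow> z \<in> E" for z by (auto simp: P_def tr_def set_eq_iff)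
    from this[of "_ + s"] show ?thesis by (simp add: per_def)
  qed
  define e where "e = sz s E"
  have szLE: "sz L E = m * e" unfolding Lm e_def using sz_mult[OF s(1) perEs] m0 by simp
  have "E \<noteq> {}" using VB(2) szE sz_0_iff[OF Lpos VB(1)] sz_0_iff[OF Lpos perE] by simp
  then have e1: "e \<ge> 1" unfolding e_def using sz_pos[OF s(1) perEs] by blast
  have meh: "m * e \<le> h0" using sz_mono[OF Ehole, of L] szBp szLE by simp
  \<comment> \<open>Modulo \<open>L\<close> the two end zones merge, as \<open>L\<close> becomes
    \<open>0\<close>: together they form one window of \<open>n1 + n2 + 1\<close> residues starting
    at \<open>- n2\<close>.\<close>
  define w where "w = n1 + n2 + 1"
  define lE where "lE = int (card (E \<inter> {- n2..<- n2 + w}))"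
  have split: "sz L E \<le> lE + int (card M)"
  proof -
    have "sz L E = int (card (E \<inter> {- n2..<- n2 + L}))" by (rule sz_window[OF Lpos perE])
    also have "E \<inter> {- n2..<- n2 + L} \<subseteq> (E \<inter> {- n2..<- n2 + w}) \<union> M"
    proof
      fix y assume y: "y \<in> E \<inter> {- n2..<- n2 + L}"
      show "y \<in> (E \<inter> {- n2..<- n2 + w}) \<union> M"
      proof (cases "y < - n2 + w")
        case False
        have "L \<in> Bp" using A_sub_S AH HL by (auto simp: Bp_def)
        then have "y \<noteq> L" using Ehole y by auto
        then have "0 \<le> y" "y < L" using y z(1,2) False by (auto simp: w_def)
        then have "y \<notin> B" using Ehole y BpB[of y] by auto
        then show ?thesis using y False by (auto simp: M_def w_def)
      qed (use y in auto)
    qed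
    then have "card (E \<inter> {- n2..<- n2 + L}) \<le> card ((E \<inter> {- n2..<- n2 + w}) \<union> M)" by (intro card_mono) (auto simp: M_def)
    also have "\<dots> \<le> card (E \<inter> {- n2..<- n2 + w}) + card M" by (rule card_Un_le)
    finally show ?thesis by (simp add: lE_def)
  qed
  have Zw: "w + 1 \<le> 2 * Zh" using z(3,4) by (simp add: w_def Zh_def)
  have lEZ: "s * lE \<le> e * (s + 2 * Zh)"
  proof (cases "w \<ge> 0")
    case True
    have "s * lE \<le> e * (w + s - 1)" unfolding lE_def e_def by (rule card_window_le[OF s(1) perEs True])
    also have "\<dots> \<le> e * (s + 2 * Zh)" using Zw e1 by (intro mult_left_mono) auto
    finally show ?thesis .
  next
    case False
    then have "lE = 0" by (simp add: lE_def)
    moreover have "0 \<le> e * (s + 2 * Zh)" using e1 s(1) by (auto simp: Zh_def)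
    ultimately show ?thesis by simp
  qed
  \<comment> \<open>\<open>E\<close> has density \<open>e / s\<close>, at most 1/100, so it has at
    most \<open>e + Zh / 50\<close> elements in the window. The bounds on \<open>|E|\<close> require
    \<open>e + Zh / 2\<close> of them; this leaves \<open>Zh = 0\<close> only, and then
    \<open>|E|\<close> exceeds \<open>h0\<close>.\<close>
  have es: "100 * e \<le> s"
  proof -
    have "m * (100 * e) \<le> m * s" using meh h0_small Lm by (simp add: algebra_simps)
    then show ?thesis using m0 by simp
  qed
  have Zh_nonneg: "0 \<le> Zh" by (simp add: Zh_def)
  have "50 * lE \<le> 50 * e + Zh"
  proof -
    have "100 * e * Zh \<le> s * Zh" using es Zh_nonneg by (intro mult_right_mono) auto
    then have "s * (50 * lE) \<le> s * (50 * e + Zh)" using lEZ by (simp add: algebra_simps)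
    then show ?thesis using s(1) by simp
  qed
  moreover have lb: "m + m * e \<ge> 2 * h0 + 2 - Zh" using VB(5) szB' szE szLE szNj Vbig by linarith
  moreover have "lE \<ge> m * e - h0 + Zh" using split hM szLE by linarith
  moreover have "m * e \<ge> m + 2 * e - 2"
  proof -
    have "m \<ge> 2" using lb Zh0 meh by linarith
    then have "0 \<le> (m - 2) * (e - 1)" using e1 by (intro mult_nonneg_nonneg) auto
    then show ?thesis by (simp add: algebra_simps)
  qed
  ultimately show False using e1 meh by linarith
qed

lemma (in two_classes) g_ge_3: "g \<ge> 3"
proof (rule ccontr)
  assume "\<not> g \<ge> 3"
  then have g: "2 = g" using g2 by simp
  show False
  proof (rule no_index_two)
    show "H = 2 * L" unfolding g by (rule H_eq)
    show "100 * int (card ({0..L} - {z. 2 * z \<in> A})) \<le> L"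
      unfolding g using h0_small by (simp only: h0_def B_def)
    show "r \<in> A" by (rule rA)
    show "odd r" unfolding g by (rule gr)
  qed
qed

lemma (in two_classes) conclusion: "bi_covered A (int (card A) + b)"
  by (rule covered[OF g_ge_3])

text \<open>If almost all of \<open>S\<close> lies in one coset of a proper subgroup, the sums with \<open>0\<close> and \<open>H\<close>
  force this coset to be the subgroup itself and leave room for only one further coset.\<close>

lemma (in dense_sum) one_coset:
  assumes g: "g \<ge> 2" "g dvd H" "2 \<le> H div g" and b: "100 * b \<le> H div g"
    and n0: "99 * (H div g) \<le> 100 * sz H {z \<in> S. g dvd z - c}"
    and rest: "100 * (n - sz H {z \<in> S. g dvd z - c}) \<le> H div g"
  shows "bi_covered A (int (card A) + b)"
proof -
  define L where "L = H div g"
  have HL: "H = g * L" using g by (simp add: L_def)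
  have "0 < g * L" using HL Hpos by simp
  then have L0: "L > 0" using zero_less_mult_pos[of g L] g by linarith
  define m where "m = sz H {z \<in> S. g dvd z - c}"
  define Y where "Y = {a \<in> A. g dvd a - c}"
  have finY: "finite Y" using finA by (simp add: Y_def)
  have mY: "m \<le> int (card Y)"
  proof -
    have "card ({z \<in> S. g dvd z - c} \<inter> {0..<H}) \<le> card Y"
      using finY by (intro card_mono) (auto simp: Y_def S_def)
    then show ?thesis by (simp add: m_def sz_def)
  qed
  have m: "99 * L \<le> 100 * m" "100 * n - 100 * m \<le> L" using n0 rest by (simp_all add: m_def L_def algebra_simps)
  have bL: "100 * b \<le> L" "2 \<le> L" using b g(3) by (simp_all add: L_def)
  have m1: "m \<ge> 1" using m L0 by linarith
  then have Y_ne: "Y \<noteq> {}" using mY by auto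
  have finAA: "finite (A + A)" using finA by (rule finite_set_plus[OF _ finA])
  have YY: "2 * int (card Y) - 1 \<le> int (card (Y + Y))"
    using of_nat_mono[OF card_plus_ge[OF finY finY Y_ne Y_ne], where 'a = int] by simp
  define tot where "tot = int (card (A + A))"
  have tot: "tot = 3 * n + b" using cardAA by (simp add: tot_def n_def)
  have YYA: "Y + Y \<subseteq> A + A" by (rule plus_mono) (auto simp: Y_def)
  have YYc: "g dvd z - 2 * c" if zz: "z \<in> Y + Y" for z
  proof -
    obtain u where "u \<in> Y" "z - u \<in> Y" using zz by (auto simp: in_plus)
    then have "g dvd (u - c) + (z - u - c)" by (intro dvd_add) (auto simp: Y_def)
    then show ?thesis by (simp add: algebra_simps)
  qed
  have c0: "g dvd c"
  proof (rule ccontr)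
    assume nc: "\<not> g dvd c"
    \<comment> \<open>The sums of \<open>Y\<close> with \<open>0\<close> and with \<open>H\<close>.
      If \<open>c\<close> is not a multiple of \<open>g\<close> they are disjoint from
      \<open>Y + Y\<close>, and together these sets have at least \<open>4 * |Y| - 1\<close>
      elements, more than \<open>3 * n + b\<close>.\<close>
    define Z where "Z = Y \<union> (\<lambda>y. y + H) ` Y"
    have YH: "y < H" if "y \<in> Y" for y
    proof -
      have "y \<noteq> H"
      proof
        assume "y = H"
        then have "g dvd H - c" using that by (simp add: Y_def)
        then have "g dvd H - (H - c)" by (rule dvd_diff[OF g(2)])
        then show False using nc by simp
      qed
      moreover have "y \<le> H" using that A_sub by (auto simp: Y_def)
      ultimately show ?thesis by simp
    qed
    have Y0: "0 \<le> y" if "y \<in> Y" for y using that A_sub by (auto simp: Y_def)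
    have "card Z = card Y + card ((\<lambda>y. y + H) ` Y)"
      unfolding Z_def using finY YH Y0 by (intro card_Un_disjoint) force+
    then have cZ: "card Z = 2 * card Y" by (simp add: card_image)
    have ZA: "Z \<subseteq> A + A"
      using plusI[of _ A 0 A] plusI[of _ A H A] A0 AH by (force simp: Z_def Y_def)
    have Zc: "g dvd z - c" if "z \<in> Z" for z
    proof -
      have "g dvd y + H - c" if "y \<in> Y" for y
        using dvd_add[of g "y - c" H] that g(2) by (simp add: Y_def algebra_simps)
      then show ?thesis using that by (auto simp: Z_def Y_def)
    qed
    have "(Y + Y) \<inter> Z = {}"
    proof -
      have False if "z \<in> Y + Y" "z \<in> Z" for z
        using dvd_diff[OF Zc[OF that(2)] YYc[OF that(1)]] nc by simp
      then show ?thesis by blast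
    qed
    then have "card (Y + Y) + card Z = card ((Y + Y) \<union> Z)"
      using finY by (intro card_Un_disjoint[symmetric]) (auto simp: Z_def finite_set_plus)
    also have "\<dots> \<le> card (A + A)" using YYA ZA finAA by (intro card_mono) auto
    finally have "card (Y + Y) + 2 * card Y \<le> card (A + A)" using cZ by simp
    from of_nat_mono[OF this, where 'a = int] have "int (card (Y + Y)) + 2 * int (card Y) \<le> tot" by (simp add: tot_def)
    then show False using tot YY mY m bL L0 by linarith
  qed
  have Ydvd: "a \<in> Y \<longleftrightarrow> a \<in> A \<and> g dvd a" for a
    using c0 by (auto simp: Y_def dvd_diff_left_iff)
  have "\<exists>r\<in>A. \<not> g dvd r"
  proof (rule ccontr)
    assume "\<not> ?thesis"
    then have "g dvd 1" using gcdA[of g] by blast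
    then show False using g by (simp add: zdvd1_eq)
  qed
  then obtain r where r: "r \<in> A" "\<not> g dvd r" by blast
  have "g dvd a \<or> g dvd a - r" if aA: "a \<in> A" for a
  proof (rule ccontr)
    assume no: "\<not> (g dvd a \<or> g dvd a - r)"
    define Y1 Y2 where "Y1 = (\<lambda>y. y + r) ` Y" and "Y2 = (\<lambda>y. y + a) ` Y"
    have c12: "card Y1 = card Y" "card Y2 = card Y" by (auto simp: Y1_def Y2_def card_image)
    have fin12: "finite Y1" "finite Y2" using finY by (auto simp: Y1_def Y2_def)
    have YYd: "g dvd z" if "z \<in> Y + Y" for z
      using dvd_add[OF YYc[OF that] dvd_mult[OF c0, of 2]] by simp
    have Yd: "g dvd y" "y \<in> A" if "y \<in> Y" for y using Ydvd that by blast+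
    have d1: "g dvd z - r" if zz: "z \<in> Y1" for z
    proof -
      obtain y where "y \<in> Y" "z = y + r" using zz by (auto simp: Y1_def)
      then show ?thesis using Yd(1) by simp
    qed
    have d2: "g dvd z - a" if zz: "z \<in> Y2" for z
    proof -
      obtain y where "y \<in> Y" "z = y + a" using zz by (auto simp: Y2_def)
      then show ?thesis using Yd(1) by simp
    qed
    have A12: "Y1 \<subseteq> A + A" "Y2 \<subseteq> A + A"
      unfolding Y1_def Y2_def using plusI[OF Yd(2) r(1)] plusI[OF Yd(2) aA] by blast+
    have i1: "(Y + Y) \<inter> Y1 = {}"
    proof -
      have False if "z \<in> Y + Y" "z \<in> Y1" for z
        using dvd_diff[OF YYd[OF that(1)] d1[OF that(2)]] r by simp
      then show ?thesis by blast
    qed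
    have i2: "((Y + Y) \<union> Y1) \<inter> Y2 = {}"
    proof -
      have False if "z \<in> Y + Y" "z \<in> Y2" for z
        using dvd_diff[OF YYd[OF that(1)] d2[OF that(2)]] no by simp
      moreover have False if "z \<in> Y1" "z \<in> Y2" for z
        using dvd_diff[OF d1[OF that(1)] d2[OF that(2)]] no by simp
      ultimately show ?thesis by blast
    qed
    have "card (((Y + Y) \<union> Y1) \<union> Y2) = card ((Y + Y) \<union> Y1) + card Y2"
      using finY fin12 i2 by (intro card_Un_disjoint) (auto simp: finite_set_plus)
    moreover have "card ((Y + Y) \<union> Y1) = card (Y + Y) + card Y1"
      using finY fin12 i1 by (intro card_Un_disjoint) (auto simp: finite_set_plus)
    moreover have "card (((Y + Y) \<union> Y1) \<union> Y2) \<le> card (A + A)" using YYA A12 finAA by (intro card_mono) auto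
    ultimately have "card (Y + Y) + 2 * card Y \<le> card (A + A)" using c12 by simp
    from of_nat_mono[OF this, where 'a = int] have "int (card (Y + Y)) + 2 * int (card Y) \<le> tot" by (simp add: tot_def)
    then show False using tot YY mY m bL L0 by linarith
  qed
  moreover have "{z \<in> S. g dvd z - c} = {z \<in> S. g dvd z}" using c0 by (auto simp: dvd_diff_left_iff)
  then have "100 * (H div g - sz H {z \<in> S. g dvd z}) \<le> H div g" using n0 by simp
  ultimately interpret two_classes H A b q g r
    using g r b by unfold_locales auto
  show ?thesis by (rule conclusion)
qed

section \<open>Atoms that are subgroups\<close>

lemma sum_card_classes_le:
  fixes T :: "int set"
  assumes "finite T" "finite C"
  shows "(\<Sum>c\<in>C. int (card {z \<in> T. z mod g = c})) \<le> int (card T)"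
proof -
  have "(\<Sum>c\<in>C. card {z \<in> T. z mod g = c}) = card (\<Union>c\<in>C. {z \<in> T. z mod g = c})"
    using assms by (intro card_UN_disjoint[symmetric]) auto
  also have "\<dots> \<le> card T" using assms(1) by (intro card_mono) auto
  finally have "int (\<Sum>c\<in>C. card {z \<in> T. z mod g = c}) \<le> int (card T)" by (rule of_nat_mono)
  then show ?thesis by simp
qed

lemma sz_classes:
  assumes g: "g > 0" and L: "L \<ge> 0" and C: "C \<subseteq> {0..<g}"
  shows "sz (g * L) {z. z mod g \<in> C} = int (card C) * L"
proof -
  have "per g {z. z mod g \<in> C}" by (simp add: per_def)
  then have "sz (g * L) {z. z mod g \<in> C} = L * sz g {z. z mod g \<in> C}" by (rule sz_mult[OF g _ L])
  moreover have "{z. z mod g \<in> C} \<inter> {0..<g} = C" using C by auto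
  ultimately show ?thesis by (simp add: sz_def)
qed

lemma per_dvd: assumes "g dvd N" shows "per N {z. z mod g \<in> C}"
proof -
  have "(z + N) mod g = z mod g" for z using assms by (auto simp: dvd_def)
  then show ?thesis by (simp add: per_def)
qed

text \<open>\<open>L_huge\<close> makes every error term below negligible: these are products of
  \<open>g + 1\<close> and \<open>b + g + 1\<close>, to be compared with the order \<open>L\<close>
  of the atom.\<close>

locale subgroup_atom = atom +
  fixes g L :: int
  assumes Xg: "X = {z. g dvd z}" and g_pos: "g > 0" and HL: "H = g * L"
    and L_huge: "1000 * ((g + 1) * ((g + 1) * (b + g + 1))) \<le> L"
begin

lemma L_big: "1000 * ((g + 1) * (b + g + 1)) \<le> L"
proof -
  have "1 * ((g + 1) * (b + g + 1)) \<le> (g + 1) * ((g + 1) * (b + g + 1))"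
    using g_pos b0 by (intro mult_right_mono mult_nonneg_nonneg) auto
  then show ?thesis using L_huge by linarith
qed

definition R where "R = (\<lambda>a. a mod g) ` A"
definition s where "s = int (card R)"
definition f where "f r = int (card {a \<in> A. a mod g = r})"
text \<open>The length \<open>L + 1\<close> is attained only by the class of \<open>0\<close>, which
  contains both \<open>0\<close> and \<open>H\<close>; for the other classes \<open>e\<close>
  exceeds the number of holes by one, which the error terms absorb.\<close>

definition e where "e r = L + 1 - f r"
definition h where "h = (\<Sum>r\<in>R. e r)"
definition R2 where "R2 = (\<lambda>(r,q). (r + q) mod g) ` (R \<times> R)"
definition Nc where "Nc c = int (card {z \<in> A + A. z mod g = c})"

lemma R_sub: "R \<subseteq> {0..<g}" using g_pos by (auto simp: R_def)
lemma finR: "finite R" using R_sub finite_subset by blast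
lemma R2_sub: "R2 \<subseteq> {0..<g}" using g_pos by (auto simp: R2_def)
lemma finR2: "finite R2" using R2_sub finite_subset by blast

lemma s_le: "s \<le> g"
proof -
  have "card R \<le> card {0..<g}" using R_sub by (intro card_mono) auto
  then show ?thesis using g_pos by (simp add: s_def)
qed

lemma R0: "0 \<in> R" using A0 by (auto simp: R_def image_iff intro: bexI[of _ 0])
lemma s1: "1 \<le> s" using R0 finR by (auto simp: s_def Suc_le_eq card_gt_0_iff)

lemma gH: "g dvd H" using HL by simp
lemma L_pos: "L > 0"
proof -
  have "0 \<le> (g + 1) * (b + g + 1)" using g_pos b0 by (intro mult_nonneg_nonneg) auto
  moreover have "L \<noteq> 0" using HL Hpos by auto
  ultimately show ?thesis using L_big by linarith
qed

lemma mod_dvd_H: "(z mod H) mod g = z mod g" using gH by (simp add: mod_mod_cancel)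

lemma XS: "X + S = {z. z mod g \<in> R}"
proof (intro set_eqI iffI)
  fix z assume "z \<in> X + S"
  then obtain u where u: "g dvd u" "z - u \<in> S" by (auto simp: in_plus Xg)
  have "z mod g = (z - u) mod g" using u(1) by (simp add: mod_eq_dvd_iff)
  also have "\<dots> = ((z - u) mod H) mod g" by (simp add: mod_dvd_H)
  finally show "z \<in> {z. z mod g \<in> R}" using u(2) by (auto simp: R_def S_def)
next
  fix z assume "z \<in> {z. z mod g \<in> R}"
  then obtain a where a: "a \<in> A" "z mod g = a mod g" by (auto simp: R_def)
  then have "z - a \<in> X" "a \<in> S" using A_sub_S by (auto simp: Xg mod_eq_dvd_iff)
  from plusI[OF this] show "z \<in> X + S" by simp
qed

lemma sz_classes_H: assumes "C \<subseteq> {0..<g}" shows "sz H {z. z mod g \<in> C} = int (card C) * L"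
  by (rule sz_classes[OF g_pos _ assms, of L, folded HL]) (use L_pos in simp)

lemma x_eq: "x = L"
proof -
  have e: "X = {z. z mod g \<in> {0}}" by (auto simp: Xg dvd_eq_mod_eq_0)
  show ?thesis unfolding x_def by (subst e, subst sz_classes_H) (use g_pos in auto)
qed

lemma sz_XS: "sz H (X + S) = s * L"
  unfolding XS s_def by (rule sz_classes_H[OF R_sub])

lemma kap_eq: "kap = (s - 1) * L"
  using sz_XS x_eq by (simp add: kap_def x_def algebra_simps)

lemma s_less: "s < g"
proof -
  have "s * L \<le> H - k" using X_adm sz_XS by (simp add: adm_def)
  then have "s * L < g * L" using k_pos HL by linarith
  then show ?thesis using L_pos by simp
qed

lemma s2: "2 \<le> s"
proof (rule ccontr)
  assume "\<not> 2 \<le> s"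
  then have "card R = 1" using s1 by (simp add: s_def)
  then have "R = {0}" using R0 by (metis card_1_singletonE singletonD)
  then have "g dvd a" if "a \<in> A" for a using that by (auto simp: R_def dvd_eq_mod_eq_0)
  then have "g dvd 1" by (rule gcdA)
  then show False using g_pos s_less s1 by (simp add: zdvd1_eq)
qed

lemma sum_f: "(\<Sum>r\<in>R. f r) = n + 1"
proof -
  have "(\<Sum>r\<in>R. card {a \<in> A. a mod g = r}) = card (\<Union>r\<in>R. {a \<in> A. a mod g = r})"
    using finR finA by (intro card_UN_disjoint[symmetric]) auto
  also have "(\<Union>r\<in>R. {a \<in> A. a mod g = r}) = A" by (auto simp: R_def)
  finally show ?thesis by (simp add: f_def n_def flip: of_nat_sum)
qed

lemma f_pos: "r \<in> R \<Longrightarrow> f r \<ge> 1"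
proof -
  assume "r \<in> R"
  then have "{a \<in> A. a mod g = r} \<noteq> {}" by (auto simp: R_def)
  then show ?thesis using finA by (simp add: f_def Suc_le_eq card_gt_0_iff)
qed

lemma e_nonneg: assumes "r \<in> R" shows "0 \<le> e r"
proof -
  have "{a \<in> A. a mod g = r} \<subseteq> (\<lambda>i. r + g * i) ` {0..L}"
  proof
    fix a assume a: "a \<in> {a \<in> A. a mod g = r}"
    then have a': "0 \<le> a" "a \<le> g * L" using A_sub HL by auto
    have "a div g \<le> (g * L) div g" using a' g_pos by (intro zdiv_mono1) auto
    then have "0 \<le> a div g" "a div g \<le> L" using a' g_pos by (auto simp: pos_imp_zdiv_nonneg_iff)
    moreover have "a = r + g * (a div g)" using a by (metis (mono_tags, lifting) mem_Collect_eq mod_mult_div_eq)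
    ultimately show "a \<in> (\<lambda>i. r + g * i) ` {0..L}" by (metis atLeastAtMost_iff image_eqI)
  qed
  then have "card {a \<in> A. a mod g = r} \<le> card ((\<lambda>i. r + g * i) ` {0..L})" by (intro card_mono) auto
  also have "\<dots> = card {0..L}" using g_pos by (simp add: card_image inj_on_def)
  finally show ?thesis using L_pos by (simp add: e_def f_def)
qed

lemma h_eq: "h = s * (L + 1) - n - 1"
  using sum_f by (simp add: h_def e_def sum_subtractf s_def)

lemma h_le: "h \<le> L + b + s"
  using kap_le kap_eq h_eq by (simp add: algebra_simps)

text \<open>If \<open>R2\<close> is not everything, \<open>X + S\<close> is admissible, and
  minimality of \<open>kap\<close> tested on it reads \<open>|R2| \<ge> s + (s - 1)\<close> after
  division by \<open>L\<close>. If \<open>R2\<close> is everything, the bound on \<open>kap\<close>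
  and \<open>H_ge\<close> give \<open>2 * s - 2 < g\<close>.\<close>

lemma R2_card: "2 * s - 1 \<le> int (card R2)"
proof (cases "card R2 = card {0..<g}")
  case True
  have "2 * ((s - 1) * L) \<le> 2 * n - 2 + 2 * b" using kap_le kap_eq by simp
  moreover have "2 * ((s - 1) * L) = (2 * s - 2) * L" by (simp add: algebra_simps)
  ultimately have "(2 * s - 2) * L < g * L" using H_ge b0 HL by linarith
  then have "2 * s - 2 < g" using L_pos by simp
  then show ?thesis using True g_pos by simp
next
  case False
  have lt: "int (card R2) < g" using card_mono[OF _ R2_sub] False g_pos by simp
  have YS: "(X + S) + S = {z. z mod g \<in> R2}"
  proof (intro set_eqI iffI)
    fix z assume "z \<in> (X + S) + S"
    then obtain u where u: "u mod g \<in> R" "z - u \<in> S" unfolding XS by (auto simp: in_plus)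
    have "(z - u) mod g = ((z - u) mod H) mod g" by (simp add: mod_dvd_H)
    then have "(z - u) mod g \<in> R" using u(2) by (auto simp: R_def S_def)
    then have "(u mod g + (z - u) mod g) mod g \<in> R2" using u(1) by (auto simp: R2_def)
    then show "z \<in> {z. z mod g \<in> R2}" by (simp add: mod_simps)
  next
    fix z assume "z \<in> {z. z mod g \<in> R2}"
    then obtain r a where ra: "r \<in> R" "a \<in> A" "z mod g = (r + a mod g) mod g" by (auto simp: R2_def R_def)
    have rr: "r mod g = r" using ra(1) R_sub by auto
    have "(z - a) mod g = (z mod g - a mod g) mod g" by (simp add: mod_simps)
    also have "\<dots> = r" using ra(3) rr by (simp add: mod_simps)
    finally have "z - a \<in> X + S" using ra(1) XS by simp
    then have "(z - a) + a \<in> (X + S) + S" using ra(2) A_sub_S by (intro plusI) auto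
    then show "z \<in> (X + S) + S" by simp
  qed
  have szYS: "sz H ((X + S) + S) = int (card R2) * L"
    unfolding YS by (rule sz_classes_H[OF R2_sub])
  have "(int (card R2) + 1) * L \<le> g * L" using lt L_pos by (intro mult_right_mono) auto
  then have le: "sz H ((X + S) + S) \<le> H - L" using szYS HL by (simp only: distrib_right mult_1)
  have kL: "k \<le> L" using X_adm x_eq by (simp add: adm_def x_def)
  have "adm (X + S)"
    unfolding adm_def
  proof (intro conjI)
    show "per H (X + S)" by (rule per_plus[OF perX])
    have "1 * L \<le> s * L" using s1 L_pos by (intro mult_right_mono) auto
    then show "k \<le> sz H (X + S)" using sz_XS kL by simp
    show "sz H (X + S + S) \<le> H - k" using le kL by simp
  qed
  then have "s * L + (s - 1) * L \<le> int (card R2) * L"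
    using adm_kap[of "X + S"] sz_XS kap_eq szYS by simp
  then have "(2 * s - 1) * L \<le> int (card R2) * L" by (simp add: algebra_simps)
  then show ?thesis using L_pos by simp
qed

lemma Nc_ge: assumes "r \<in> R" "v \<in> R" shows "f r + f v - 1 \<le> Nc ((r + v) mod g)"
proof -
  let ?P = "{a \<in> A. a mod g = r}" and ?Q = "{a \<in> A. a mod g = v}"
  have ne: "?P \<noteq> {}" "?Q \<noteq> {}" using assms by (auto simp: R_def)
  have "?P + ?Q \<subseteq> {z \<in> A + A. z mod g = (r + v) mod g}"
  proof
    fix z assume "z \<in> ?P + ?Q"
    then obtain u where u: "u \<in> A" "u mod g = r" "z - u \<in> A" "(z - u) mod g = v" by (auto simp: in_plus)
    have "z mod g = (u mod g + (z - u) mod g) mod g" by (simp add: mod_simps)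
    then show "z \<in> {z \<in> A + A. z mod g = (r + v) mod g}" using u plusI[OF u(1,3)] by simp
  qed
  then have "card (?P + ?Q) \<le> card {z \<in> A + A. z mod g = (r + v) mod g}"
    using finite_set_plus[OF finA finA] by (intro card_mono) auto
  moreover have "card ?P + card ?Q \<le> card (?P + ?Q) + 1" using ne finA by (intro card_plus_ge) auto
  ultimately have "card ?P + card ?Q \<le> card {z \<in> A + A. z mod g = (r + v) mod g} + 1" by simp
  from of_nat_mono[OF this, where 'a = int] show ?thesis by (simp add: f_def Nc_def)
qed

lemma Nc_ge_e: "r \<in> R \<Longrightarrow> v \<in> R \<Longrightarrow> 2 * L + 1 - e r - e v \<le> Nc ((r + v) mod g)"
  using Nc_ge[of r v] by (simp add: e_def)

lemma sum_Nc: assumes "C \<subseteq> {0..<g}" shows "(\<Sum>c\<in>C. Nc c) \<le> 3 * n + b"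
proof -
  have "finite C" using assms finite_subset by blast
  then have "(\<Sum>c\<in>C. Nc c) \<le> int (card (A + A))" unfolding Nc_def using finA
    by (intro sum_card_classes_le finite_set_plus) auto
  then show ?thesis using cardAA by (simp add: n_def)
qed

section \<open>Atoms meeting at least three classes\<close>

lemma n_eq: "n = s * L + s - h - 1" using h_eq by (simp add: algebra_simps)

text \<open>By \<open>h_le\<close> the holes amount to little more than one class. With
  \<open>r0\<close> the fullest class, the \<open>s\<close> classes of \<open>r0 + R\<close> contain
  \<open>2 * L\<close> sums each up to holes. The further classes, at least \<open>s - 1\<close>,
  are rich as well, except possibly twice the emptiest class \<open>r1\<close>. Comparison with
  \<open>3 * n + b\<close> forces \<open>r1\<close> to carry almost all holes.\<close>

lemma nearly_empty_class:
  assumes s3: "3 \<le> s"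
  obtains r1 where "r1 \<in> R" "L - 4 * ((g + 1) * (b + g + 1)) \<le> e r1"
    "h - e r1 \<le> 5 * ((g + 1) * (b + g + 1))" "L - (b + g + 1) \<le> h"
proof -
  define G where "G = b + g + 1"
  define W where "W = (g + 1) * G"
  have G1: "G \<ge> 1" using b0 g_pos by (simp add: G_def)
  have GW: "G \<le> W" "s * G \<le> W - G"
  proof -
    have "1 * G \<le> (g + 1) * G" using g_pos G1 by (intro mult_right_mono) auto
    then show "G \<le> W" by (simp add: W_def)
    have "s * G \<le> g * G" using s_le G1 by (intro mult_right_mono) auto
    then show "s * G \<le> W - G" by (simp add: W_def algebra_simps)
  qed
  have LW: "1000 * W \<le> L" using L_big by (simp add: W_def G_def)
  have neR: "R \<noteq> {}" using R0 by auto
  obtain r0 where r0: "r0 \<in> R" "\<And>r. r \<in> R \<Longrightarrow> e r0 \<le> e r"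
    using finR neR by (metis (mono_tags, lifting) arg_min_if_finite(1) arg_min_least)
  define v where "v = e r0"
  obtain r1 where r1: "r1 \<in> R" "\<And>r. r \<in> R \<Longrightarrow> e r \<le> e r1"
    using arg_min_if_finite(1)[OF finR neR, of "\<lambda>r. - e r"] arg_min_least[OF finR neR, of _ "\<lambda>r. - e r"]
    by (metis neg_le_iff_le)
  define w where "w = e r1"
  have v0: "0 \<le> v" using e_nonneg r0(1) by (simp add: v_def)
  have two: "e r + e q \<le> h - (s - 2) * v" if rq: "r \<in> R" "q \<in> R" "r \<noteq> q" for r q
  proof -
    have "h = e r + (e q + (\<Sum>i\<in>R - {r} - {q}. e i))"
      unfolding h_def using finR rq by (simp add: sum.remove[of R r] sum.remove[of "R - {r}" q])
    moreover have "(\<Sum>i\<in>R - {r} - {q}. v) \<le> (\<Sum>i\<in>R - {r} - {q}. e i)" using r0 by (intro sum_mono) (auto simp: v_def)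
    moreover have "int (card (R - {r} - {q})) = s - 2" using finR rq s2 by (simp add: s_def card_Diff_singleton of_nat_diff)
    ultimately show ?thesis by simp
  qed
  have one: "e r \<le> h - (s - 1) * v" if rR: "r \<in> R" for r
  proof -
    have "h = e r + (\<Sum>i\<in>R - {r}. e i)" unfolding h_def using finR rR by (simp add: sum.remove[of R r])
    moreover have "(\<Sum>i\<in>R - {r}. v) \<le> (\<Sum>i\<in>R - {r}. e i)" using r0 by (intro sum_mono) (auto simp: v_def)
    moreover have "int (card (R - {r})) = s - 1" using finR rR s2 by (simp add: s_def card_Diff_singleton of_nat_diff)
    ultimately show ?thesis by simp
  qed
  define F where "F = (\<lambda>r. (r0 + r) mod g) ` R"
  have injF: "inj_on (\<lambda>r. (r0 + r) mod g) R"
  proof (rule inj_onI)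
    fix r q assume rq: "r \<in> R" "q \<in> R" "(r0 + r) mod g = (r0 + q) mod g"
    then have "g dvd r - q" by (simp add: mod_eq_dvd_iff)
    moreover have "r \<in> {0..<g}" "q \<in> {0..<g}" using rq R_sub by auto
    then have "\<bar>r - q\<bar> < g" by auto
    ultimately show "r = q" using dvd_imp_le_int[of "r - q" g] by fastforce
  qed
  have cF: "int (card F) = s" unfolding F_def using injF by (simp add: card_image s_def)
  have F_sub: "F \<subseteq> R2" using r0(1) by (auto simp: F_def R2_def)
  have sumF: "s * (2 * L + 1) - s * v - h \<le> (\<Sum>c\<in>F. Nc c)"
  proof -
    have "(\<Sum>r\<in>R. 2 * L + 1 - v - e r) \<le> (\<Sum>r\<in>R. Nc ((r0 + r) mod g))"
      using Nc_ge_e[OF r0(1)] by (intro sum_mono) (simp add: v_def)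
    also have "\<dots> = (\<Sum>c\<in>F. Nc c)" unfolding F_def using injF by (simp add: sum.reindex)
    moreover have "(\<Sum>r\<in>R. 2 * L + 1 - v - e r) = s * (2 * L + 1) - s * v - h"
      by (simp add: sum_subtractf sum.distrib s_def h_def right_diff_distrib)
    ultimately show ?thesis by linarith
  qed
  define c1 where "c1 = (r1 + r1) mod g"
  define O' where "O' = R2 - F - {c1}"
  have finO: "finite O'" using finR2 by (simp add: O'_def)
  \<comment> \<open>Such a class is a sum of two distinct classes, or twice a class other than
    \<open>r1\<close>; the latter has no more holes than its pair with \<open>r1\<close>.\<close>
  have ordinary: "2 * L + 1 - h + (s - 2) * v \<le> Nc c" if c: "c \<in> O'" for c
  proof -
    obtain r q where rq: "r \<in> R" "q \<in> R" "c = (r + q) mod g" using c by (auto simp: O'_def R2_def)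
    have "e r + e q \<le> h - (s - 2) * v"
    proof (cases "r = q")
      case True
      then have "r \<noteq> r1" using c rq by (auto simp: O'_def c1_def)
      then show ?thesis using two[OF rq(1) r1(1)] r1(2)[OF rq(1)] True by simp
    qed (use two rq in auto)
    then show ?thesis using Nc_ge_e[OF rq(1,2)] rq(3) by simp
  qed
  have specw: "2 * L + 1 - 2 * w \<le> Nc c1" using Nc_ge_e[OF r1(1) r1(1)] by (simp add: c1_def w_def)
  have hG: "h \<le> L + G" using h_le s_le G_def by simp
  have ord0: "0 \<le> 2 * L + 1 - h + (s - 2) * v"
    using hG LW GW G1 s2 v0 by (smt (verit) mult_nonneg_nonneg)
  have sO: "s - 2 \<le> int (card O')" if "c1 \<in> R2 - F" using that R2_card cF F_sub finR2
    by (simp add: O'_def card_Diff_subset card_Diff_singleton finite_subset of_nat_diff)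
  have sO': "s - 1 \<le> int (card O')" if "c1 \<notin> R2 - F"
  proof -
    have "O' = R2 - F" using that by (auto simp: O'_def)
    then show ?thesis using R2_card cF F_sub finR2 card_mono[OF finR2 F_sub]
      by (simp add: card_Diff_subset finite_subset of_nat_diff)
  qed
  have sumO: "(s - 2) * (2 * L + 1 - h + (s - 2) * v) + min (2 * L + 1 - h + (s - 2) * v) (2 * L + 1 - 2 * w) \<le> (\<Sum>c\<in>R2 - F. Nc c)"
  proof (cases "c1 \<in> R2 - F")
    case True
    have "int (card O') * (2 * L + 1 - h + (s - 2) * v) \<le> (\<Sum>c\<in>O'. Nc c)"
      using sum_mono[of O' "\<lambda>_. 2 * L + 1 - h + (s - 2) * v" Nc] ordinary by simp
    moreover have "(s - 2) * (2 * L + 1 - h + (s - 2) * v) \<le> int (card O') * (2 * L + 1 - h + (s - 2) * v)"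
      by (intro mult_right_mono sO True ord0)
    moreover have "(\<Sum>c\<in>R2 - F. Nc c) = Nc c1 + (\<Sum>c\<in>O'. Nc c)"
      using True finR2 by (simp add: O'_def sum.remove)
    ultimately show ?thesis using specw by linarith
  next
    case False
    then have e: "O' = R2 - F" by (auto simp: O'_def)
    have "int (card O') * (2 * L + 1 - h + (s - 2) * v) \<le> (\<Sum>c\<in>O'. Nc c)"
      using sum_mono[of O' "\<lambda>_. 2 * L + 1 - h + (s - 2) * v" Nc] ordinary by simp
    moreover have "(s - 1) * (2 * L + 1 - h + (s - 2) * v) \<le> int (card O') * (2 * L + 1 - h + (s - 2) * v)"
      by (intro mult_right_mono sO' False ord0)
    moreover have "(s - 1) * (2 * L + 1 - h + (s - 2) * v) = (s - 2) * (2 * L + 1 - h + (s - 2) * v) + (2 * L + 1 - h + (s - 2) * v)"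
      by (simp add: algebra_simps)
    ultimately show ?thesis unfolding e by linarith
  qed
  have "(\<Sum>c\<in>R2. Nc c) = (\<Sum>c\<in>F. Nc c) + (\<Sum>c\<in>R2 - F. Nc c)"
    using sum.subset_diff[OF F_sub finR2, of Nc] by linarith
  then have total: "s * (2 * L + 1) - s * v - h + ((s - 2) * (2 * L + 1 - h + (s - 2) * v)
      + min (2 * L + 1 - h + (s - 2) * v) (2 * L + 1 - 2 * w)) \<le> 3 * (s * L + s - h - 1) + b"
    unfolding n_eq[symmetric] using sumF sumO sum_Nc[OF R2_sub] by linarith
  have ssub: "(s - 1) * v + w \<le> h" using one[OF r1(1)] by (simp add: w_def)
  have vw: "v \<le> w" using r0(2) r1(1) by (simp add: v_def w_def)
  have mn: "2 * L + 1 - 2 * h + 2 * (s - 1) * v \<le> min (2 * L + 1 - h + (s - 2) * v) (2 * L + 1 - 2 * w)"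
  proof -
    have "s * v \<le> h" using ssub vw by (simp add: algebra_simps)
    then show ?thesis using ssub by (simp add: algebra_simps)
  qed
  have A1: "(s - 2) * (L + (s - 1) * v - h) \<le> s + 1 + b"
  proof -
    have "s * (2 * L + 1) - s * v - h + ((s - 2) * (2 * L + 1 - h + (s - 2) * v)
        + (2 * L + 1 - 2 * h + 2 * (s - 1) * v)) \<le> 3 * (s * L + s - h - 1) + b"
      using total mn by linarith
    then show ?thesis by (simp add: algebra_simps)
  qed
  have A2: "L + (s - 1) * v \<le> h + s + 1 + b"
  proof (rule ccontr)
    define E where "E = L + (s - 1) * v - h"
    assume "\<not> ?thesis"
    then have E: "s + 2 + b \<le> E" by (simp add: E_def)
    then have "1 * E \<le> (s - 2) * E" using s3 b0 by (intro mult_right_mono) auto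
    moreover have "(s - 2) * E \<le> s + 1 + b" using A1 by (simp only: E_def)
    ultimately show False using E by linarith
  qed
  have sv: "0 \<le> (s - 1) * v" using s2 v0 by simp
  have hlow: "L - G \<le> h" using A2 sv s_less by (simp add: G_def)
  have svG: "s * v \<le> 4 * G"
  proof -
    have "(s - 1) * v \<le> 2 * G" using A2 hG s_less by (simp add: G_def)
    moreover have "s * v \<le> 2 * ((s - 1) * v)"
    proof -
      have "0 \<le> (s - 2) * v" using s2 v0 by simp
      then show ?thesis by (simp add: algebra_simps)
    qed
    ultimately show ?thesis by linarith
  qed
  have sL: "(s - 4) * h \<le> (s - 4) * L + s * G"
  proof -
    have "(s - 4) * (h - L) \<le> \<bar>s - 4\<bar> * \<bar>h - L\<bar>" by (simp add: abs_mult[symmetric])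
    also have "\<dots> \<le> s * G" using s2 hlow hG G1 by (intro mult_mono) auto
    finally show ?thesis by (simp add: algebra_simps)
  qed
  \<comment> \<open>Nonnegative multiples of \<open>v\<close> are dropped from \<open>total\<close>,
    and \<open>(s - 4) * h\<close> is replaced by \<open>(s - 4) * L\<close>, as \<open>h\<close> is
    within \<open>G\<close> of \<open>L\<close>.\<close>
  have A3: "2 * L \<le> max h (2 * w) + s * G + s * v + s + 1 + b"
  proof -
    have "0 \<le> (s - 2) * v" using s2 v0 by simp
    moreover have "0 \<le> (s - 2) * ((s - 2) * v)" using s2 v0 by simp
    moreover have "min (2 * L + 1 - h) (2 * L + 1 - 2 * w) = 2 * L + 1 - max h (2 * w)" by auto
    moreover have "min (2 * L + 1 - h) (2 * L + 1 - 2 * w) \<le> min (2 * L + 1 - h + (s - 2) * v) (2 * L + 1 - 2 * w)"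
      using \<open>0 \<le> (s - 2) * v\<close> by auto
    ultimately have "s * (2 * L + 1) - s * v - h + ((s - 2) * (2 * L + 1 - h) + (2 * L + 1 - max h (2 * w))) \<le> 3 * (s * L + s - h - 1) + b"
      using total by (simp add: algebra_simps)
    then show ?thesis using sL by (simp add: algebra_simps)
  qed
  have sG: "s + 1 + b \<le> 2 * G" using s_less b0 g_pos by (simp add: G_def)
  \<comment> \<open>Since \<open>h\<close> is at most \<open>L + G\<close>, the maximum in
    \<open>A3\<close> can only be \<open>2 * w\<close>.\<close>
  have "h < 2 * w" using A3 hG svG sG GW LW G1 by (simp add: max_def split: if_splits)
  then have w_big: "2 * L \<le> 2 * w + s * G + s * v + s + 1 + b" using A3 by (simp add: max_def)
  then have w4: "L - 4 * W \<le> w" using svG sG GW G1 by linarith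
  moreover have "h - w \<le> 5 * W" using w4 hG GW by linarith
  ultimately show ?thesis using that[OF r1(1)] hlow by (simp add: w_def W_def G_def)
qed


text \<open>Without \<open>r1\<close> there remain \<open>s - 1\<close> nearly full classes. A class
  of \<open>R' + R'\<close> has nearly \<open>2 * L\<close> sums, one only in \<open>r1 + R'\<close>
  nearly \<open>L\<close>, so the total gives \<open>2 * x2 + y1 \<le> 3 * s - 3\<close>. As
  \<open>R2_card\<close> gives \<open>x2 + y1 \<ge> 2 * s - 2\<close>, there are no more classes in
  \<open>R' + R'\<close> than in \<open>R'\<close>. So \<open>R'\<close> is a coset of a subgroup,
  and \<open>S\<close> is concentrated on it.\<close>

lemma several_classes:
  assumes s3: "3 \<le> s" shows "bi_covered A (int (card A) + b)"
proof -
  define G where "G = b + g + 1"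
  define W where "W = (g + 1) * G"
  have G1: "G \<ge> 1" using b0 g_pos by (simp add: G_def)
  have GW: "G \<le> W"
  proof -
    have "1 * G \<le> (g + 1) * G" using g_pos G1 by (intro mult_right_mono) auto
    then show "G \<le> W" by (simp add: W_def)
  qed
  have LW: "1000 * ((g + 1) * W) \<le> L" using L_huge by (simp add: W_def G_def)
  have sW: "s * W \<le> (g + 1) * W" using s_le GW G1 by (intro mult_right_mono) auto
  have W1: "1 * W \<le> s * W" using s1 GW G1 by (intro mult_right_mono) auto
  obtain r1 where r1: "r1 \<in> R" "L - 4 * W \<le> e r1" "h - e r1 \<le> 5 * W" "L - G \<le> h"
    using nearly_empty_class[OF s3] by (auto simp: W_def G_def)
  define R' where "R' = R - {r1}"
  have finR': "finite R'" using finR by (simp add: R'_def)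
  have cR': "int (card R') = s - 1" using finR r1(1) s1 by (simp add: R'_def s_def card_Diff_singleton of_nat_diff)
  have R'_sub: "R' \<subseteq> {0..<g}" using R_sub by (auto simp: R'_def)
  have e5: "e r \<le> 5 * W" if "r \<in> R'" for r
  proof -
    have "h = e r1 + (\<Sum>i\<in>R'. e i)" unfolding h_def R'_def using finR r1(1) by (simp add: sum.remove[of R r1])
    moreover have "e r \<le> (\<Sum>i\<in>R'. e i)" using that finR' e_nonneg by (intro member_le_sum) (auto simp: R'_def)
    ultimately show ?thesis using r1(3) by linarith
  qed
  define C2 where "C2 = (\<lambda>(r,u). (r + u) mod g) ` (R' \<times> R')"
  define C1 where "C1 = (\<lambda>r. (r1 + r) mod g) ` R' - C2"
  have fin: "finite C2" "finite C1" using finR' by (auto simp: C2_def C1_def)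
  have sub: "C2 \<subseteq> R2" "C1 \<subseteq> R2" using r1(1) by (auto simp: C2_def C1_def R2_def R'_def)
  have N2: "2 * L - 10 * W \<le> Nc c" if c: "c \<in> C2" for c
  proof -
    obtain r u where ru: "r \<in> R'" "u \<in> R'" "c = (r + u) mod g" using c by (auto simp: C2_def)
    then show ?thesis using Nc_ge_e[of r u] e5[OF ru(1)] e5[OF ru(2)] by (auto simp: R'_def)
  qed
  have N1: "L - 5 * W \<le> Nc c" if c: "c \<in> C1" for c
  proof -
    obtain r where r: "r \<in> R'" "c = (r1 + r) mod g" using c by (auto simp: C1_def)
    then have "f r1 + f r - 1 \<le> Nc c" using Nc_ge[OF r1(1), of r] by (auto simp: R'_def)
    then show ?thesis using f_pos[OF r1(1)] e5[OF r(1)] by (simp add: e_def)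
  qed
  define x2 y1 where "x2 = int (card C2)" and "y1 = int (card C1)"
  have "x2 * (2 * L - 10 * W) \<le> (\<Sum>c\<in>C2. Nc c)" using sum_mono[of C2 "\<lambda>_. 2 * L - 10 * W" Nc] N2 by (simp add: x2_def)
  moreover have "y1 * (L - 5 * W) \<le> (\<Sum>c\<in>C1. Nc c)" using sum_mono[of C1 "\<lambda>_. L - 5 * W" Nc] N1 by (simp add: y1_def)
  moreover have "(\<Sum>c\<in>C2. Nc c) + (\<Sum>c\<in>C1. Nc c) = (\<Sum>c\<in>C2 \<union> C1. Nc c)"
    using fin by (intro sum.union_disjoint[symmetric]) (auto simp: C1_def)
  moreover have "(\<Sum>c\<in>C2 \<union> C1. Nc c) \<le> 3 * n + b" using sub R2_sub by (intro sum_Nc) auto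
  moreover have "x2 * (2 * L - 10 * W) + y1 * (L - 5 * W) = (2 * x2 + y1) * (L - 5 * W)" by (simp add: algebra_simps)
  ultimately have tot: "(2 * x2 + y1) * (L - 5 * W) \<le> 3 * n + b" by linarith
  have nle: "3 * n + b \<le> (3 * s - 3) * L + 7 * G"
  proof -
    have "(3 * s - 3) * L = 3 * (s * L) - 3 * L" by (simp add: algebra_simps)
    moreover have "3 * s + b \<le> 4 * G" using s_less b0 g_pos by (simp add: G_def)
    ultimately show ?thesis using n_eq r1(4) by linarith
  qed
  have L5: "5 * W \<le> L" using LW sW W1 GW G1 by linarith
  have "2 * x2 + y1 \<le> 3 * s - 3"
  proof (rule ccontr)
    assume "\<not> ?thesis"
    then have "(3 * s - 2) * (L - 5 * W) \<le> (2 * x2 + y1) * (L - 5 * W)"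
      using L5 by (intro mult_right_mono) auto
    then have "(3 * s - 2) * (L - 5 * W) \<le> (3 * s - 3) * L + 7 * G" using tot nle by linarith
    then have "L \<le> 15 * (s * W) - 10 * W + 7 * G" by (simp add: algebra_simps)
    then show False using LW sW W1 GW G1 by linarith
  qed
  moreover have "2 * s - 1 \<le> x2 + y1 + 1"
  proof -
    have "R2 \<subseteq> C2 \<union> C1 \<union> {(r1 + r1) mod g}"
    proof
      fix c assume "c \<in> R2"
      then obtain r u where "r \<in> R" "u \<in> R" "c = (r + u) mod g" by (auto simp: R2_def)
      then show "c \<in> C2 \<union> C1 \<union> {(r1 + r1) mod g}"
        by (cases "r = r1"; cases "u = r1") (auto simp: C2_def C1_def R'_def add.commute)
    qed
    then have "card R2 \<le> card (C2 \<union> C1 \<union> {(r1 + r1) mod g})" using fin by (intro card_mono) auto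
    also have "\<dots> \<le> card C2 + card C1 + 1"
      using card_Un_le[of "C2 \<union> C1" "{(r1 + r1) mod g}"] card_Un_le[of C2 C1] by simp
    finally have "int (card R2) \<le> int (card C2 + card C1 + 1)" by (rule of_nat_mono)
    then show ?thesis using R2_card by (simp add: x2_def y1_def)
  qed
  ultimately have x2s: "x2 \<le> s - 1" by linarith
  define Y where "Y = {z. z mod g \<in> R'}"
  have perY: "per H Y" unfolding Y_def by (rule per_dvd[OF gH])
  have YY: "Y + Y = {z. z mod g \<in> C2}"
  proof (intro set_eqI iffI)
    fix z assume "z \<in> Y + Y"
    then obtain u where u: "u mod g \<in> R'" "(z - u) mod g \<in> R'" by (auto simp: in_plus Y_def)
    then have "(u mod g + (z - u) mod g) mod g \<in> C2" by (auto simp: C2_def)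
    then show "z \<in> {z. z mod g \<in> C2}" by (simp add: mod_simps)
  next
    fix z assume "z \<in> {z. z mod g \<in> C2}"
    then obtain r u where ru: "r \<in> R'" "u \<in> R'" "z mod g = (r + u) mod g" by (auto simp: C2_def)
    have m: "r mod g = r" "u mod g = u" using ru R'_sub by auto
    have "(z - r) mod g = (z mod g - r) mod g" by (simp add: mod_simps)
    also have "\<dots> = u" using ru(3) m by (simp add: mod_simps)
    finally have "r \<in> Y" "z - r \<in> Y" using ru m by (auto simp: Y_def)
    from plusI[OF this] show "z \<in> Y + Y" by simp
  qed
  have C2_sub: "C2 \<subseteq> {0..<g}" using g_pos by (auto simp: C2_def)
  have szY: "sz H Y = (s - 1) * L" unfolding Y_def using sz_classes_H[OF R'_sub] cR' by simp
  have szYY: "sz H (Y + Y) \<le> (s - 1) * L"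
    unfolding YY using sz_classes_H[OF C2_sub] x2s L_pos by (simp add: x2_def)
  have "R' \<noteq> {}" using cR' s2 by auto
  then obtain y where y: "y \<in> R'" by blast
  then have yY: "y \<in> Y" using R'_sub by (auto simp: Y_def)
  have sL0: "2 * L \<le> (s - 1) * L" using s3 L_pos by (intro mult_right_mono) auto
  have "2 * sz H (Y + Y) < 3 * sz H Y" using szY szYY sL0 L_pos by linarith
  then obtain K where K: "subgp K" "per H K" "Y \<subseteq> tr y K" "Y + Y = tr (2 * y) K"
    using three_halves[OF Hpos perY yY] yY by metis
  have szK: "sz H K \<le> (s - 1) * L" using szYY sz_tr[OF Hpos K(2), of "2 * y"] K(4) by simp
  then have YK: "Y = tr y K" using szY sz_tr[OF Hpos K(2), of y] K(3)
    by (intro sz_subset_eq[OF Hpos perY per_tr[OF K(2)]]) auto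
  then have szK: "sz H K = (s - 1) * L" using szY sz_tr[OF Hpos K(2), of y] by simp
  have "H \<in> K" using K(1,2) by (auto simp: per_def subgp_def dest: spec[of _ 0])
  then obtain g2 where g2: "g2 > 0" "g2 dvd H" "K = {z. g2 dvd z}"
    using subgp_multiples[OF K(1) _ Hpos] by metis
  have Hg2: "H div g2 = (s - 1) * L" using szK sz_multiples[OF g2(1,2) Hpos] g2(3) by simp
  have "g2 \<noteq> 1"
  proof
    assume "g2 = 1"
    then have "kap = H" using Hg2 kap_eq by simp
    then show False using kap_le H_ge n_pos b0 by linarith
  qed
  then have g2': "2 \<le> g2" using g2(1) by simp
  define m where "m = sz H {z \<in> S. g2 dvd z - y}"
  have mS: "{z \<in> S. g2 dvd z - y} = S - {z. z mod g = r1}"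
  proof -
    have "g2 dvd z - y \<longleftrightarrow> z \<in> Y" for z using YK g2(3) by simp
    moreover have "z mod g \<in> R" if "z \<in> S" for z
    proof -
      have "z mod g = (z mod H) mod g" by (simp add: mod_dvd_H)
      then show ?thesis using that by (auto simp: R_def S_def)
    qed
    ultimately show ?thesis by (auto simp: Y_def R'_def)
  qed
  have "sz H (S \<inter> {z. z mod g = r1}) \<le> f r1"
    unfolding sz_def f_def using finA by (intro of_nat_mono card_mono) (auto simp: S_def)
  then have "n - m \<le> f r1" using sz_Diff[of H S "{z. z mod g = r1}"] szS mS by (simp add: m_def)
  then have nm: "n - m \<le> 4 * W + 1" using r1(2) by (simp add: e_def)
  have n_low: "(s - 1) * L - G \<le> n"
  proof -
    have "(s - 1) * L = s * L - L" by (simp add: algebra_simps)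
    then show ?thesis using n_eq h_le g_pos unfolding G_def by linarith
  qed
  show ?thesis
  proof (rule one_coset[OF g2' g2(2), where c = y])
    show "2 \<le> H div g2" using Hg2 sL0 L_pos by linarith
    have "b \<le> G" using g_pos by (simp add: G_def)
    then show "100 * b \<le> H div g2" using Hg2 sL0 LW sW W1 GW L_pos by linarith
    show "99 * (H div g2) \<le> 100 * sz H {z \<in> S. g2 dvd z - y}"
      unfolding m_def[symmetric] Hg2 using nm n_low sL0 LW sW W1 GW L_pos G1 by linarith
    have "100 * n - 100 * m \<le> H div g2" unfolding Hg2 using nm sL0 LW sW W1 GW L_pos G1 by linarith
    then show "100 * (n - sz H {z \<in> S. g2 dvd z - y}) \<le> H div g2" unfolding m_def[symmetric] by (simp add: algebra_simps)
  qed
qed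

text \<open>The three sums of \<open>P\<close> and \<open>Q\<close> lie in distinct classes, and
  \<open>D\<close> contains \<open>S\<close> and the residues covered twice by sums from
  \<open>A1\<close>; this yields \<open>|P + P| + |P + Q| \<le> 2 * |P| + b\<close>. If
  \<open>P\<close> is more than half of \<open>X\<close>, then \<open>P + P\<close> contains
  \<open>X\<close> and \<open>P\<close> is nearly full. Otherwise \<open>P + P\<close> is a subgroup
  smaller than \<open>X\<close> with boundary at most \<open>kap\<close>, which an atom
  excludes.\<close>

lemma exactly_two_classes:
  assumes s2': "s = 2" shows "bi_covered A (int (card A) + b)"
proof -
  define P Q where "P = {z \<in> S. g dvd z}" and "Q = {z \<in> S. \<not> g dvd z}"
  have perX': "per H X" by (rule perX)
  have PX: "P = S \<inter> X" "Q = S - X" by (auto simp: P_def Q_def Xg)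
  have perPQ: "per H P" "per H Q" unfolding PX by (intro per_Int per_Diff perS perX)+
  define p0 p1 where "p0 = sz H P" and "p1 = sz H Q"
  have n01: "p0 + p1 = n" using sz_Diff[of H S X] szS by (simp add: p0_def p1_def PX)
  have "card R = 2" using s2' by (simp add: s_def)
  then obtain u v where uv: "R = {u, v}" "u \<noteq> v" by (auto simp: card_2_iff)
  define r where "r = (if u = 0 then v else u)"
  have r: "R = {0, r}" "r \<noteq> 0" using uv R0 by (auto simp: r_def)
  have rg: "0 < r" "r < g" using r R_sub by auto
  have Smod: "z mod g \<in> R" if "z \<in> S" for z
  proof -
    have "z mod g = (z mod H) mod g" by (simp add: mod_dvd_H)
    then show ?thesis using that by (auto simp: R_def S_def)
  qed
  have Qmod: "z mod g = r" if "z \<in> Q" for z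
    using that Smod[of z] r by (auto simp: Q_def dvd_eq_mod_eq_0)
  have Pmod: "z mod g = 0" if "z \<in> P" for z using that by (auto simp: P_def)
  have R2e: "R2 = {0, r, (r + r) mod g}" unfolding R2_def r(1) using rg by auto
  have "3 \<le> card R2" using R2_card s2' by simp
  then have rr: "(r + r) mod g \<noteq> 0" "(r + r) mod g \<noteq> r"
    unfolding R2e using rg by (auto simp: card_insert_if split: if_splits)
  obtain rA where rA: "rA \<in> A" "rA mod g = r" using r by (auto simp: R_def)
  have rAg: "\<not> g dvd rA" using rA rg by (auto simp: dvd_eq_mod_eq_0)
  have P0: "0 \<in> P" using S0 by (simp add: P_def)
  have QrA: "rA \<in> Q" using rA rAg A_sub_S by (auto simp: Q_def)
  have m_add: "(u + v) mod g = (u mod g + v mod g) mod g" for u v by (simp add: mod_simps)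
  have PPm: "z mod g = 0" if zz: "z \<in> P + P" for z
  proof -
    obtain u where "u \<in> P" "z - u \<in> P" using zz by (auto simp: in_plus)
    then show ?thesis using m_add[of u "z - u"] Pmod by simp
  qed
  have PQm: "z mod g = r" if zz: "z \<in> P + Q" for z
  proof -
    obtain u where "u \<in> P" "z - u \<in> Q" using zz by (auto simp: in_plus)
    then show ?thesis using m_add[of u "z - u"] Pmod Qmod rg by simp
  qed
  have QQm: "z mod g = (r + r) mod g" if zz: "z \<in> Q + Q" for z
  proof -
    obtain u where "u \<in> Q" "z - u \<in> Q" using zz by (auto simp: in_plus)
    then show ?thesis using m_add[of u "z - u"] Qmod by simp
  qed
  have subSS: "P + P \<subseteq> S + S" "P + Q \<subseteq> S + S" "Q + Q \<subseteq> S + S"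
    by (rule plus_mono; auto simp: P_def Q_def)+
  have "sz H (((P + P) \<union> (P + Q)) \<union> (Q + Q)) \<le> sz H (S + S)" using subSS by (intro sz_mono) auto
  moreover have "sz H (((P + P) \<union> (P + Q)) \<union> (Q + Q)) = sz H ((P + P) \<union> (P + Q)) + sz H (Q + Q)"
    using PPm PQm QQm rr by (intro sz_Un) (metis Int_emptyI UnE)
  moreover have "sz H ((P + P) \<union> (P + Q)) = sz H (P + P) + sz H (P + Q)"
    using PPm PQm r(2) by (intro sz_Un) (metis Int_emptyI)
  ultimately have SSge: "sz H (P + P) + sz H (P + Q) + sz H (Q + Q) \<le> sz H (S + S)" by simp
  define A1 where "A1 = {a \<in> A. \<not> g dvd a}"
  have finA1: "finite A1" using finA by (simp add: A1_def)
  have A1_ne: "A1 \<noteq> {}" using rA rAg by (auto simp: A1_def)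
  have A1H: "0 \<le> a" "a < H" if "a \<in> A1" for a
    using that A_sub gH by (auto simp: A1_def order_less_le)
  have "Q \<inter> {0..<H} = A1" using A1H A_sub_S S_iff by (auto simp: Q_def A1_def)
  then have cA1: "int (card A1) = p1" by (simp add: p1_def sz_def)
  define T where "T = A1 + A1"
  have T_sub: "T \<subseteq> {0..<2*H}"
  proof
    fix c assume "c \<in> T"
    then obtain u where u: "u \<in> A1" "c - u \<in> A1" by (auto simp: T_def in_plus)
    show "c \<in> {0..<2*H}" using A1H[OF u(1)] A1H[OF u(2)] by auto
  qed
  define D2 where "D2 = D \<inter> {z. z mod g = (r + r) mod g}"
  have A1Q: "A1 \<subseteq> Q" using A_sub_S by (auto simp: A1_def Q_def)
  have TQ: "T \<subseteq> Q + Q" unfolding T_def by (rule plus_mono[OF A1Q A1Q])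
  have W1: "{c. c mod H \<in> T \<or> c mod H + H \<in> T} \<subseteq> Q + Q"
    using TQ per_plus[OF perPQ(2), of Q] per_mod by (auto simp: per_def)
  have W2: "{c. c mod H \<in> T \<and> c mod H + H \<in> T} \<subseteq> D2"
  proof
    fix c assume c: "c \<in> {c. c mod H \<in> T \<and> c mod H + H \<in> T}"
    have "T \<subseteq> A + A" unfolding T_def by (rule plus_mono) (auto simp: A1_def)
    then have "c \<in> D" using c by (auto simp: D_def)
    moreover have "c \<in> Q + Q" using c W1 by auto
    ultimately show "c \<in> D2" using QQm by (auto simp: D2_def)
  qed
  have "int (card T) = sz H {c. c mod H \<in> T \<or> c mod H + H \<in> T} + sz H {c. c mod H \<in> T \<and> c mod H + H \<in> T}"
    by (rule two_levels[OF T_sub Hpos])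
  also have "\<dots> \<le> sz H (Q + Q) + sz H D2" by (intro add_mono sz_mono W1 W2)
  finally have "int (card T) \<le> sz H (Q + Q) + sz H D2" .
  moreover have "card A1 + card A1 \<le> card T + 1" unfolding T_def by (rule card_plus_ge[OF finA1 finA1 A1_ne A1_ne])
  from of_nat_mono[OF this, where 'a = int] have "2 * p1 \<le> int (card T) + 1" using cA1 by simp
  ultimately have QQ: "2 * p1 - 1 \<le> sz H (Q + Q) + sz H D2" by linarith
  have "S \<inter> D2 = {}"
  proof -
    have False if "z \<in> S" "z \<in> D2" for z using Smod[OF that(1)] that(2) rr r by (auto simp: D2_def)
    then show ?thesis by blast
  qed
  then have "sz H (S \<union> D2) = n + sz H D2" using sz_Un[of S D2 H] szS by simp
  moreover have "sz H (S \<union> D2) \<le> sz H D" using S_sub_D by (intro sz_mono) (auto simp: D2_def)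
  ultimately have key: "sz H (P + P) + sz H (P + Q) \<le> 2 * p0 + b"
    using card_AA SSge QQ n01 by linarith
  have PQ0: "p0 \<le> sz H (P + Q)"
  proof -
    have "tr rA P \<subseteq> P + Q"
    proof
      fix z assume "z \<in> tr rA P"
      then have "(z - rA) + rA \<in> P + Q" using QrA by (intro plusI) auto
      then show "z \<in> P + Q" by simp
    qed
    then show ?thesis using sz_mono[of "tr rA P" "P + Q" H] sz_tr[OF Hpos perPQ(1)] by (simp add: p0_def)
  qed
  have PQ1: "p1 \<le> sz H (P + Q)"
  proof -
    have "Q \<subseteq> P + Q" using plusI[OF P0] by fastforce
    then show ?thesis using sz_mono[of Q "P + Q" H] by (simp add: p1_def)
  qed
  have szX: "sz H X = L" using x_eq by (simp add: x_def)
  have kapL: "kap = L" using kap_eq s2' by simp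
  have Lb: "1000 * b \<le> L"
  proof -
    define Z where "Z = (g + 1) * (b + g + 1)"
    have "1 * (b + g + 1) \<le> (g + 1) * (b + g + 1)" using g_pos b0 by (intro mult_right_mono) auto
    then have "b + g + 1 \<le> Z" by (simp add: Z_def)
    moreover have "1000 * Z \<le> L" using L_big by (simp add: Z_def)
    ultimately show ?thesis using g_pos b0 by linarith
  qed
  have Lg: "1000 \<le> L"
  proof -
    have "1 * 1 \<le> (g + 1) * (b + g + 1)" using g_pos b0 by (intro mult_mono) auto
    then show ?thesis using L_big by linarith
  qed
  show ?thesis
  proof (cases "2 * p0 > L")
    case True
    have "X \<subseteq> P + P"
    proof
      fix c assume c: "c \<in> X"
      have "{u. c - u \<in> P} \<subseteq> X"
      proof
        fix u assume "u \<in> {u. c - u \<in> P}"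
        then have "g dvd c" "g dvd c - u" using c by (auto simp: Xg P_def)
        then have "g dvd c - (c - u)" by (rule dvd_diff)
        then show "u \<in> X" by (simp add: Xg)
      qed
      then have "P \<inter> {u. c - u \<in> P} \<noteq> {}" using True sz_refl[OF Hpos perPQ(1), of c] szX
        by (intro sz_inter[where N = H and Z = X]) (auto simp: PX p0_def)
      then show "c \<in> P + P" by (auto simp: in_plus)
    qed
    then have "L \<le> sz H (P + P)" using sz_mono[of X "P + P" H] szX by simp
    then have "L - p0 \<le> b" using key PQ0 by linarith
    then have few: "100 * L - 100 * p0 \<le> L" using Lb b0 by linarith
    have HLg: "H div g = L" using HL g_pos by simp
    interpret two_classes H A b q g rA
    proof unfold_locales
      show "2 \<le> g" using rg by simp
      show "g dvd H" by (rule gH)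
      show "g dvd a \<or> g dvd a - rA" if "a \<in> A" for a
      proof -
        have "a mod g \<in> {0, r}" using that r by (auto simp: R_def)
        then show ?thesis using rA(2) by (auto simp: mod_eq_dvd_iff dvd_eq_mod_eq_0)
      qed
      show "rA \<in> A" "\<not> g dvd rA" using rA rAg by auto
      show "100 * (H div g - sz H {z \<in> S. g dvd z}) \<le> H div g"
        unfolding HLg using few by (simp add: p0_def P_def algebra_simps)
      show "100 * b \<le> H div g" unfolding HLg using Lb b0 by linarith
    qed
    show ?thesis by (rule conclusion)
  next
    case False
    have p1_ge: "L + 1 - b \<le> p0 + p1" using kap_le kapL n01 by linarith
    have PP: "p0 \<le> sz H (P + P)"
    proof -
      have "P \<subseteq> P + P" using plusI[OF P0] by fastforce
      then show ?thesis using sz_mono[of P "P + P" H] by (simp add: p0_def)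
    qed
    have PP2: "sz H (P + P) \<le> p0 + 2 * b" using key PQ1 p1_ge False by linarith
    have p0_ge: "2 * p0 \<ge> L + 1 - 2 * b" using key PQ1 PP p1_ge by linarith
    have "2 * sz H (P + P) < 3 * sz H P" using PP2 p0_ge Lb Lg unfolding p0_def[symmetric] by linarith
    then obtain K where K: "subgp K" "per H K" "P \<subseteq> tr 0 K" "P + P = tr (2 * 0) K"
      using three_halves[OF Hpos perPQ(1) P0] P0 by metis
    have trK: "tr 0 K = K" by (simp add: tr_def)
    have KP: "P \<subseteq> K" "P + P = K" using K(3,4) by (simp_all add: trK)
    have KX: "K \<subseteq> X"
    proof
      fix z assume "z \<in> K"
      then have "z mod g = 0" using PPm KP(2) by simp
      then show "z \<in> X" by (simp add: Xg dvd_eq_mod_eq_0)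
    qed
    have szK: "p0 \<le> sz H K" "sz H K \<le> p0 + 2 * b" using PP PP2 KP(2) by simp_all
    have KS: "K + S \<subseteq> K \<union> {z. z mod g \<in> {r}}"
    proof
      fix z assume "z \<in> K + S"
      then obtain u where u: "u \<in> K" "z - u \<in> S" by (auto simp: in_plus)
      show "z \<in> K \<union> {z. z mod g \<in> {r}}"
      proof (cases "z - u \<in> P")
        case True
        then have "u + (z - u) \<in> K" using u(1) KP(1) by (intro subgp_add[OF K(1)]) auto
        then show ?thesis by simp
      next
        case False
        then have "(z - u) mod g = r" using u(2) by (intro Qmod) (auto simp: P_def Q_def)
        moreover have "u mod g = 0" using u(1) KX by (auto simp: Xg)
        ultimately show ?thesis using m_add[of u "z - u"] rg by simp
      qed
    qed
    have "sz H {z. z mod g \<in> {r}} = L" using sz_classes_H[of "{r}"] rg by simp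
    then have "sz H (K \<union> {z. z mod g \<in> {r}}) \<le> sz H K + L" using sz_Un_le[of H K "{z. z mod g \<in> {r}}"] by simp
    then have KSle: "sz H (K + S) \<le> sz H K + L" using sz_mono[OF KS, of H] by linarith
    have "K + S \<subseteq> X + S" by (rule plus_mono[OF KX]) simp
    then have "sz H (K + S) \<le> H - k" using sz_mono[of "K + S" "X + S" H] X_adm by (simp add: adm_def)
    moreover have "k \<le> sz H K" using szK(1) p0_ge Lb Lg unfolding k_def by linarith
    ultimately have "adm K" using K(2) by (simp add: adm_def)
    then have "sz H X \<le> sz H K" using KSle kapL by (intro X_least) (auto simp: kap_def)
    then show ?thesis using szX szK(2) False Lb Lg by linarith
  qed
qed

lemma conclusion: "bi_covered A (int (card A) + b)"
  using s2 several_classes exactly_two_classes by (cases "s = 2") auto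

end

section \<open>Small atoms\<close>

text \<open>A context for refutation: the atom is small and the conclusion fails, so that
  \<open>one_coset\<close> excludes configurations. The bracket in \<open>x_tiny\<close> is the
  constant \<open>C5\<close> written out.\<close>

locale small_atom = atom +
  fixes c :: int
  assumes c_eq: "c = 1600 * q"
    and not_covered: "\<not> bi_covered A (int (card A) + b)"
    and x_tiny: "100 * c * ((8 * (6 * 2 ^ nat (16 * c)) + 32) * (4 * c)) * x \<le> H"
begin

text \<open>\<open>C3 * x\<close> will bound \<open>p\<close> on the multiples \<open>j * d\<close>;
  the exponent is the number of doublings in \<open>T_UNIV\<close>.\<close>

definition C3 where "C3 = (6::int) * 2 ^ nat (16 * c)"
text \<open>\<open>C5 * x\<close> will bound the number of holes; the last factor is the bound for
  \<open>y / x\<close>.\<close>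

definition C5 where "C5 = (8 * C3 + 32) * (4 * c)"

lemma c_ge: "c \<ge> 4800" using q_ge c_eq by simp
lemma x2: "x \<ge> 2" using x_ge b0 by simp
lemma C3_ge: "C3 \<ge> 6" by (simp add: C3_def)

lemma C5_ge: "C5 \<ge> 80 * (4 * c)"
  unfolding C5_def using C3_ge c_ge by (intro mult_right_mono) auto

lemma x_small: "100 * (c * (C5 * x)) \<le> H"
  using x_tiny by (simp add: C5_def C3_def algebra_simps)

lemma C5x: "C5 * x \<ge> 80 * (4 * c) * x" "C5 * x \<ge> 0" "C5 * x \<ge> x"
proof -
  show a: "C5 * x \<ge> 80 * (4 * c) * x" using C5_ge x2 by (intro mult_right_mono) auto
  have "1 * x \<le> 80 * (4 * c) * x" using c_ge x2 by (intro mult_right_mono) auto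
  then show "C5 * x \<ge> x" "C5 * x \<ge> 0" using a x2 by auto
qed

lemma cx_le: "320 * (c * x) \<le> C5 * x" using C5x(1) by (simp add: algebra_simps)

lemma cC5x: "c * (C5 * x) \<ge> 4800 * (C5 * x)" using c_ge C5x(2) by (intro mult_right_mono) auto

text \<open>If \<open>p t\<close> were at most \<open>t / c\<close>, a turn of about
  \<open>H / t\<close> steps would lose at most \<open>n / 400\<close> elements, by
  \<open>c = 1600 * q\<close> and \<open>H \<le> q * n\<close>. As \<open>|D|\<close> is close to
  \<open>n\<close>, the set \<open>E\<close> left by \<open>rotation\<close> has doubling below 3/2,
  so \<open>S\<close> is concentrated on a coset and \<open>one_coset\<close> applies.\<close>

lemma rotation_growth:
  assumes t: "1 \<le> t" "2 * t \<le> H" shows "t < c * p t"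
proof (rule ccontr)
  assume "\<not> t < c * p t"
  then have pt: "1600 * q * p t \<le> t" using c_eq by simp
  obtain E where E: "per H E" "E \<subseteq> S" "n - 2 * (H div t + 2) * p t \<le> sz H E" "sz H (E + E) \<le> 2 * sz H D - sz H E"
    using rotation[OF t] by blast
  define J where "J = H div t + 2"
  have J0: "J \<ge> 0" using t by (simp add: J_def pos_imp_zdiv_nonneg_iff)
  have "J * t \<le> 2 * H"
  proof -
    have "H div t * t \<le> H" using t by (simp add: minus_mod_eq_div_mult[symmetric])
    then show ?thesis using t by (simp add: J_def algebra_simps)
  qed
  moreover have "J * (1600 * q * p t) \<le> J * t" using pt J0 by (intro mult_left_mono) auto
  ultimately have "q * (1600 * (J * p t)) \<le> q * (2 * n)" using H_le by (simp add: algebra_simps)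
  then have "1600 * (J * p t) \<le> 2 * n" using q_ge by (simp add: mult_le_cancel_left)
  then have Jp: "400 * (2 * J * p t) \<le> n" by simp
  have "q * (1600 * x) \<le> q * n"
  proof -
    have "0 \<le> c * x" using c_ge x2 by simp
    then have "c * x \<le> C5 * x" using cx_le by linarith
    then have "c * x \<le> H" using x_small cC5x C5x(2) by linarith
    then show ?thesis using H_le c_eq by (simp add: algebra_simps)
  qed
  then have xn: "1600 * x \<le> n" using q_ge by (simp add: mult_le_cancel_left)
  have szE: "400 * n - n \<le> 400 * sz H E" using E(3) Jp unfolding J_def[symmetric] by linarith
  have szEE: "sz H (E + E) \<le> 2 * n + 4 * x - sz H E" using E(4) szD_le x_ge by linarith
  have "sz H E \<ge> 1" using szE n_pos by linarith
  then have "E \<noteq> {}" by auto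
  then obtain y where y: "y \<in> E" by blast
  have "2 * sz H (E + E) < 3 * sz H E" using szE szEE xn x2 by linarith
  then obtain K where K: "subgp K" "per H K" "E \<subseteq> tr y K" "E + E = tr (2 * y) K"
    using three_halves[OF Hpos E(1) y] y by metis
  have szK: "sz H K = sz H (E + E)" using K(4) sz_tr[OF Hpos K(2)] by simp
  have szK': "sz H E \<le> sz H K" using sz_mono[OF K(3), of H] sz_tr[OF Hpos K(2)] by simp
  have "H \<in> K" using K(1,2) by (auto simp: per_def subgp_def dest: spec[of _ 0])
  then obtain g where g: "g > 0" "g dvd H" "K = {z. g dvd z}"
    using subgp_multiples[OF K(1) _ Hpos] by metis
  have Hg: "H div g = sz H K" using sz_multiples[OF g(1,2) Hpos] g(3) by simp
  define m where "m = sz H {z \<in> S. g dvd z - y}"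
  have "E \<subseteq> {z \<in> S. g dvd z - y}" using E(2) K(3) g(3) by auto
  then have mE: "sz H E \<le> m" unfolding m_def by (rule sz_mono)
  have "g \<noteq> 1"
  proof
    assume "g = 1"
    then show False using Hg szK szEE szE H_ge b0 xn n_pos by simp
  qed
  then have g2: "2 \<le> g" using g(1) by simp
  have "bi_covered A (int (card A) + b)"
  proof (rule one_coset[OF g2 g(2), where c = y])
    show "2 \<le> H div g" using Hg szK' szE xn x2 by linarith
    show "100 * b \<le> H div g" using Hg szK' szE xn x2 x_ge by linarith
    show "99 * (H div g) \<le> 100 * sz H {z \<in> S. g dvd z - y}"
      unfolding m_def[symmetric] using Hg szK szEE szE mE xn n_pos by linarith
    have "100 * n - 100 * m \<le> H div g" using Hg szK' szE mE n_pos by linarith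
    then show "100 * (n - sz H {z \<in> S. g dvd z - y}) \<le> H div g"
      unfolding m_def[symmetric] by (simp add: algebra_simps)
  qed
  then show False using not_covered by simp
qed

section \<open>The atom inside a short interval\<close>

definition X0 where "X0 = {v \<in> X. \<bar>v\<bar> < 2 * c * x}"

lemma cx_nonneg: "0 \<le> c * x" using c_ge x2 by simp

lemma cx_H: "8 * c * x \<le> H"
proof -
  have "8 * (c * x) \<le> H" using cx_le x_small cC5x C5x(2) cx_nonneg by linarith
  then show ?thesis by (simp only: mult.assoc)
qed

text \<open>The representative \<open>v\<close> of least absolute value satisfies
  \<open>|v| < c * p v\<close> by \<open>rotation_growth\<close>, and \<open>p v\<close> is at most
  \<open>2 * x\<close>, as \<open>v\<close> and \<open>0\<close> are in the atom.\<close>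

lemma X0_cover: assumes "u \<in> X" shows "\<exists>v\<in>X0. H dvd u - v"
proof -
  define v where "v = (if 2 * (u mod H) \<le> H then u mod H else u mod H - H)"
  have b: "0 \<le> u mod H" "u mod H < H" using Hpos by auto
  have d: "H dvd u - v" unfolding v_def by (auto simp: mod_eq_dvd_iff[symmetric])
  then have vX: "v \<in> X" using per_cong[OF perX d] assms by simp
  have "\<bar>v\<bar> < 2 * c * x"
  proof (cases "v = 0")
    case True
    then show ?thesis using c_ge x2 by simp
  next
    case False
    then have "1 \<le> \<bar>v\<bar>" "2 * \<bar>v\<bar> \<le> H" using b by (auto simp: v_def)
    then have "\<bar>v\<bar> < c * p \<bar>v\<bar>" by (rule rotation_growth)
    also have "p \<bar>v\<bar> = p v" using p_minus[of v] by (simp add: abs_if)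
    also have "c * p v \<le> c * (2 * x)" using p_X[OF vX X0] x_ge c_ge by (intro mult_left_mono) auto
    finally show ?thesis by (simp add: mult.assoc mult.left_commute)
  qed
  then show ?thesis using vX d by (auto simp: X0_def)
qed

lemma finX0: "finite X0" by (rule finite_subset[of _ "{- (2*c*x)..2*c*x}"]) (auto simp: X0_def)

lemma X0_zero: "0 \<in> X0" using X0 c_ge x2 by (simp add: X0_def)

lemma injX0: "inj_on (\<lambda>v. v mod H) X0"
proof (rule inj_onI)
  fix u v assume uv: "u \<in> X0" "v \<in> X0" "u mod H = v mod H"
  then have "H dvd u - v" by (simp add: mod_eq_dvd_iff)
  moreover have "\<bar>u - v\<bar> < H" using uv cx_H c_ge x2 by (auto simp: X0_def)
  ultimately show "u = v" using dvd_imp_le_int[of "u - v" H] by fastforce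
qed

lemma cardX0: "int (card X0) = x"
proof (rule antisym)
  show "int (card X0) \<le> x" unfolding x_def by (rule sz_ge(1)[OF Hpos perX _ injX0]) (auto simp: X0_def)
  show "x \<le> int (card X0)" unfolding x_def by (rule sz_le[OF Hpos finX0 X0_cover])
qed

definition X1 where "X1 = (\<lambda>v. v - Min X0) ` X0"
definition M where "M = Max X1"

lemma finX1: "finite X1" using finX0 by (simp add: X1_def)
lemma cardX1: "int (card X1) = x" using cardX0 by (simp add: X1_def card_image)
lemma X1_zero: "0 \<in> X1"
proof -
  have "Min X0 \<in> X0" using finX0 X0_zero by (intro Min_in) auto
  then show ?thesis unfolding X1_def by (intro image_eqI[of _ _ "Min X0"]) auto
qed
lemma X1_nonneg: "v \<in> X1 \<Longrightarrow> 0 \<le> v" using finX0 by (auto simp: X1_def)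
lemma M_in: "M \<in> X1" unfolding M_def using finX1 X1_zero by (intro Max_in) auto
lemma X1_le: "v \<in> X1 \<Longrightarrow> v \<le> M" unfolding M_def using finX1 by simp

lemma M_less: "M < 4 * c * x"
proof -
  have m: "Min X0 \<in> X0" using finX0 X0_zero by (intro Min_in) auto
  obtain v where v: "v \<in> X0" "M = v - Min X0" using M_in by (auto simp: X1_def)
  have "\<bar>v\<bar> < 2 * c * x" "\<bar>Min X0\<bar> < 2 * c * x" using v(1) m unfolding X0_def by blast+
  then show ?thesis using v(2) by linarith
qed

lemma M_pos: "1 \<le> M"
proof (rule ccontr)
  assume "\<not> 1 \<le> M"
  then have "X1 \<subseteq> {0}" using X1_nonneg X1_le by force
  then have "card X1 \<le> 1" using card_mono[of "{0}" X1] by simp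
  then show False using cardX1 x2 by linarith
qed

lemma p_X1: "u \<in> X1 \<Longrightarrow> v \<in> X1 \<Longrightarrow> p (u - v) \<le> 2 * x"
proof -
  assume "u \<in> X1" "v \<in> X1"
  then obtain u' v' where "u' \<in> X" "v' \<in> X" "u - v = u' - v'" by (auto simp: X1_def X0_def)
  then show ?thesis using p_X[of u' v'] x_ge by simp
qed

text \<open>The elements that \<open>X1\<close> adds to \<open>S\<close>. There are fewer than
  \<open>2 * x\<close> of them, which is the budget of the packing arguments below.\<close>

definition Nw where "Nw = (S + X1) - S"

lemma perNw: "per H Nw" unfolding Nw_def by (intro per_Diff per_plus perS)

lemma szNw: "sz H Nw \<le> x + b - 1"
proof -
  have sub: "S \<subseteq> S + X1" using plusI[OF _ X1_zero] by fastforce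
  have "tr (Min X0) (S + X1) \<subseteq> X + S"
  proof
    fix z assume "z \<in> tr (Min X0) (S + X1)"
    then obtain s v where sv: "s \<in> S" "v \<in> X0" "z - Min X0 = s + (v - Min X0)"
      by (auto simp: X1_def elim!: set_plus_elim)
    then have "z = v + s" by simp
    moreover have "v \<in> X" using sv(2) by (simp add: X0_def)
    ultimately show "z \<in> X + S" using plusI[of v X s S] sv(1) by simp
  qed
  then have "sz H (tr (Min X0) (S + X1)) \<le> sz H (X + S)" by (rule sz_mono)
  then have "sz H (S + X1) \<le> sz H (X + S)" using sz_tr[OF Hpos per_plus[OF perS]] by simp
  then show ?thesis using kap_le sub szS unfolding Nw_def
    by (subst sz_Diff) (simp add: Int_absorb1 kap_def x_def)
qed

definition d where "d = Gcd X1"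
definition y where "y = M div d"

lemma d_dvd: "v \<in> X1 \<Longrightarrow> d dvd v" by (simp add: d_def)
lemma d_pos: "d \<ge> 1"
proof -
  have "d \<noteq> 0" using d_dvd[OF M_in] M_pos by auto
  moreover have "d \<ge> 0" by (simp add: d_def)
  ultimately show ?thesis by simp
qed
lemma M_eq: "M = d * y" using d_dvd[OF M_in] by (simp add: y_def)
lemma y_pos: "y \<ge> 1"
proof -
  have "0 < d * y" using M_eq M_pos by simp
  then have "0 < y" using d_pos zero_less_mult_pos[of d y] by simp
  then show ?thesis by simp
qed

definition X2 where "X2 = {i. d * i \<in> X1}"

lemma X1_X2: "X1 = (\<lambda>i. d * i) ` X2"
proof (intro set_eqI iffI)
  fix v assume v: "v \<in> X1"
  obtain i where "v = d * i" using d_dvd[OF v] by (rule dvdE)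
  then show "v \<in> (\<lambda>i. d * i) ` X2" using v unfolding X2_def by blast
qed (auto simp: X2_def)
lemma X2_bounds: "i \<in> X2 \<Longrightarrow> 0 \<le> i \<and> i \<le> y"
proof -
  assume i: "i \<in> X2"
  then have "d * i \<in> X1" by (simp add: X2_def)
  then have "0 \<le> d * i" "d * i \<le> d * y" using X1_nonneg X1_le M_eq by (simp, metis)
  then show ?thesis using d_pos by (simp add: zero_le_mult_iff)
qed
lemma X2_0: "0 \<in> X2" using X1_zero by (simp add: X2_def)
lemma X2_y: "y \<in> X2" unfolding X2_def mem_Collect_eq M_eq[symmetric] by (rule M_in)
lemma finX2: "finite X2" by (rule finite_subset[of _ "{0..y}"]) (use X2_bounds in auto)
lemma cardX2: "int (card X2) = x"
proof -
  have "card X1 = card ((\<lambda>i. d * i) ` X2)" by (rule arg_cong[OF X1_X2])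
  also have "\<dots> = card X2" by (rule card_image) (use d_pos in \<open>simp add: inj_on_def\<close>)
  finally show ?thesis using cardX1 by simp
qed

lemma y_ge: "x - 1 \<le> y"
proof -
  have "card X2 \<le> card {0..y}" using X2_bounds by (intro card_mono) auto
  then show ?thesis using cardX2 y_pos by simp
qed

lemma y_le: "y < 4 * c * x"
proof -
  have "1 * y \<le> d * y" using d_pos y_pos by (intro mult_right_mono) auto
  then show ?thesis using M_eq M_less by simp
qed

text \<open>\<open>M = d * y\<close> is below \<open>4 * c * x\<close>, while
  \<open>y \<ge> x - 1 \<ge> x / 2\<close>.\<close>

lemma d_le: "d < 8 * c"
proof (rule ccontr)
  assume "\<not> d < 8 * c"
  then have "8 * c * (x - 1) \<le> d * y" using y_ge x2 c_ge by (intro mult_mono) auto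
  then have "8 * c * (x - 1) < 4 * c * x" using M_eq M_less by simp
  then have "4 * c * x < 4 * c * 2" by (simp add: algebra_simps)
  then show False using c_ge x2 by simp
qed

lemma gcdX2: assumes "\<And>i. i \<in> X2 \<Longrightarrow> g dvd i" shows "g dvd 1"
proof -
  have "d * g dvd d" unfolding d_def
  proof (rule Gcd_greatest)
    fix v assume "v \<in> X1"
    then obtain i where "v = d * i" "i \<in> X2" using X1_X2 by auto
    then show "Gcd X1 * g dvd v" using assms by (auto simp: d_def[symmetric] intro: mult_dvd_mono)
  qed
  then have "d * g dvd d * 1" by simp
  then show ?thesis using d_pos by (simp only: dvd_mult_cancel_left) auto
qed

text \<open>Iterated doublings of \<open>X2\<close> modulo \<open>y\<close>. Once they exhaust all
  residues, every multiple of \<open>d\<close> is a sum of few elements of \<open>X1\<close> up to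
  multiples of \<open>M\<close>, which is itself an almost period.\<close>

primrec T :: "nat \<Rightarrow> int set" where
  "T 0 = {z. \<exists>i\<in>X2. y dvd z - i}"
| "T (Suc j) = T j + T j"

lemma perT: "per y (T j)"
proof (induction j)
  case 0
  have "y dvd (z + y) - i \<longleftrightarrow> y dvd z - i" for z i
  proof -
    have "(z + y) - i = (z - i) + y" by simp
    then show ?thesis by (simp only: dvd_add_left_iff dvd_refl)
  qed
  then show ?case by (simp add: per_def)
qed (simp add: per_plus)

lemma T_zero: "0 \<in> T j"
proof (induction j)
  case 0
  show ?case using X2_0 by auto
next
  case (Suc j)
  then show ?case using plusI[of 0 "T j" 0 "T j"] by simp
qed

lemma T_mono: "T j \<subseteq> T (Suc j)" using plusI[OF _ T_zero] by fastforce

lemma X2_T: "X2 \<subseteq> T j"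
proof (induction j)
  case 0
  show ?case
  proof
    fix i assume "i \<in> X2"
    moreover have "y dvd i - i" by simp
    ultimately show "i \<in> T 0" unfolding T.simps by blast
  qed
next
  case (Suc j)
  then show ?case using T_mono by blast
qed

lemma szT0: "x - 1 \<le> sz y (T 0)"
proof -
  have y0: "y > 0" using y_pos by simp
  have "int (card (X2 - {y})) \<le> sz y (T 0)"
  proof (rule sz_ge(1)[OF y0 perT])
    show "X2 - {y} \<subseteq> T 0" using X2_T by blast
    have "X2 - {y} \<subseteq> {0..<0 + y}" using X2_bounds by force
    then show "inj_on (\<lambda>z. z mod y) (X2 - {y})" by (rule inj_on_subset[OF inj_mod_window[OF y0]])
  qed
  then show ?thesis using cardX2 X2_y finX2 x2 by (simp add: card_Diff_singleton of_nat_diff)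
qed

text \<open>Doubling below 3/2 makes \<open>T (Suc j)\<close> a subgroup. It contains
  \<open>X2\<close>, whose elements have greatest common divisor 1.\<close>

lemma T_grow: "T (Suc j) = UNIV \<or> 3 * sz y (T j) \<le> 2 * sz y (T (Suc j))"
proof (cases "2 * sz y (T j + T j) < 3 * sz y (T j)")
  case True
  have y0: "y > 0" using y_pos by simp
  obtain K where K: "subgp K" "per y K" "T j + T j = tr (2 * 0) K"
    using three_halves[OF y0 perT T_zero True] T_zero by metis
  have TK: "T (Suc j) = K" using K(3) by (simp add: tr_def)
  have "y \<in> K" using K(1,2) by (auto simp: per_def subgp_def dest: spec[of _ 0])
  then obtain g where g: "g > 0" "K = {z. g dvd z}"
    using subgp_multiples[OF K(1) _ y0] by metis
  have "g dvd 1" using X2_T[of "Suc j"] TK g(2) by (intro gcdX2) auto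
  then have "K = UNIV" using g by auto
  then show ?thesis using TK by simp
qed simp

lemma T_power: "(\<exists>i\<le>j. T i = UNIV) \<or> 3 ^ j * (x - 1) \<le> 2 ^ j * sz y (T j)"
proof (induction j)
  case 0
  show ?case using szT0 by simp
next
  case (Suc j)
  show ?case
  proof (cases "\<exists>i\<le>Suc j. T i = UNIV")
    case False
    then have "3 ^ j * (x - 1) \<le> 2 ^ j * sz y (T j)" using Suc.IH le_SucI by blast
    then have "3 * (3 ^ j * (x - 1)) \<le> 3 * (2 ^ j * sz y (T j))" by simp
    also have "\<dots> = 2 ^ j * (3 * sz y (T j))" by simp
    also have "\<dots> \<le> 2 ^ j * (2 * sz y (T (Suc j)))"
      using T_grow[of j] False by (intro mult_left_mono) auto
    finally show ?thesis by (simp only: power_Suc mult.assoc mult.left_commute) simp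
  qed simp
qed

text \<open>\<open>T 0\<close> has at least \<open>x - 1\<close> residues out of fewer than
  \<open>4 * c * x\<close>, a proportion above \<open>1 / (8 * c)\<close>. Bernoulli's inequality
  for powers of 3/2 shows that \<open>16 * c\<close> doublings are enough.\<close>

lemma T_UNIV: "\<exists>i\<le>nat (16 * c). T i = UNIV"
proof (rule ccontr)
  assume no: "\<not> ?thesis"
  define j where "j = nat (16 * c)"
  have y0: "y > 0" using y_pos by simp
  have bern: "2 ^ i * (2 + int i) \<le> 2 * 3 ^ i" for i
  proof (induction i)
    case (Suc i)
    have "2 ^ Suc i * (2 + int (Suc i)) \<le> 3 * (2 ^ i * (2 + int i))" by (simp add: algebra_simps)
    also have "\<dots> \<le> 3 * (2 * 3 ^ i)" using Suc by (intro mult_left_mono) auto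
    finally show ?case by simp
  qed simp
  have "3 ^ j * (x - 1) \<le> 2 ^ j * sz y (T j)" using T_power[of j] no by (auto simp: j_def)
  also have "\<dots> \<le> 2 ^ j * y" using sz_le_N[OF y0] by (intro mult_left_mono) auto
  finally have a: "2 * 3 ^ j * (x - 1) \<le> 2 ^ j * (2 * y)" by simp
  have b2: "2 ^ j * (2 + int j) * (x - 1) \<le> 2 * 3 ^ j * (x - 1)"
    using bern[of j] x2 by (intro mult_right_mono) auto
  have "2 ^ j * ((2 + int j) * (x - 1)) \<le> 2 ^ j * (2 * y)"
    using order_trans[OF b2 a] by (simp only: mult.assoc)
  moreover have "(0::int) < 2 ^ j" by simp
  ultimately have "(2 + int j) * (x - 1) \<le> 2 * y" by (rule mult_left_le_imp_le)
  moreover have "int j = 16 * c" using c_ge by (simp add: j_def)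
  ultimately have "2 * x - 2 + 16 * (c * x) - 16 * c \<le> 2 * y" by (simp add: algebra_simps)
  moreover have "c * 2 \<le> c * x" using c_ge x2 by (intro mult_left_mono) auto
  moreover have "y < 4 * (c * x)" using y_le by (simp add: algebra_simps)
  ultimately show False using x2 by linarith
qed

lemma p_mult: "p (i * t) \<le> \<bar>i\<bar> * p t"
proof -
  have nn: "p (int j * t) \<le> int j * p t" for j
  proof (induction j)
    case 0
    show ?case by (simp add: p_def tr_def)
  next
    case (Suc j)
    have "int (Suc j) * t = int j * t + t" by (simp add: algebra_simps)
    then show ?case using p_add[of "int j * t" t] Suc by (simp add: algebra_simps)
  qed
  show ?thesis
  proof (cases "i \<ge> 0")
    case True
    then show ?thesis using nn[of "nat i"] by simp
  next
    case False
    then show ?thesis using nn[of "nat (- i)"] p_minus[of "i * t"] by simp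
  qed
qed

lemma T_p: "z \<in> T j \<Longrightarrow> \<exists>w. 0 \<le> w \<and> w \<le> 2 ^ j * y \<and> y dvd z - w \<and> p (d * w) \<le> 2 ^ j * (2 * x)"
proof (induction j arbitrary: z)
  case 0
  then obtain i where i: "i \<in> X2" "y dvd z - i" by auto
  have "p (d * i - 0) \<le> 2 * x" using i(1) X1_zero by (intro p_X1) (auto simp: X2_def)
  then show ?case using i X2_bounds[OF i(1)] by (intro exI[of _ i]) auto
next
  case (Suc j)
  then obtain u where u: "u \<in> T j" "z - u \<in> T j" by (auto simp: in_plus)
  obtain w1 where w1: "0 \<le> w1" "w1 \<le> 2 ^ j * y" "y dvd u - w1" "p (d * w1) \<le> 2 ^ j * (2 * x)" using Suc.IH[OF u(1)] by blast
  obtain w2 where w2: "0 \<le> w2" "w2 \<le> 2 ^ j * y" "y dvd z - u - w2" "p (d * w2) \<le> 2 ^ j * (2 * x)" using Suc.IH[OF u(2)] by blast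
  have "y dvd (u - w1) + (z - u - w2)" using w1(3) w2(3) by (rule dvd_add)
  then have "y dvd z - (w1 + w2)" by (simp add: algebra_simps)
  moreover have "p (d * (w1 + w2)) \<le> 2 ^ Suc j * (2 * x)"
    using p_add[of "d * w1" "d * w2"] w1(4) w2(4) by (simp add: algebra_simps)
  ultimately show ?case using w1 w2 by (intro exI[of _ "w1 + w2"]) auto
qed

text \<open>Modulo \<open>y\<close>, \<open>j\<close> is congruent to some \<open>w\<close> obtained
  from \<open>X2\<close> by few doublings, so \<open>j * d = d * w + l * M\<close>. Both terms have
  small \<open>p\<close>, the second because \<open>M\<close> is in \<open>X1\<close> and
  \<open>|l|\<close> is at most \<open>2 ^ i\<close>.\<close>

lemma p_multiples: assumes j: "0 \<le> j" "j \<le> y" shows "p (j * d) \<le> C3 * x"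
proof -
  obtain i where i: "i \<le> nat (16 * c)" "T i = UNIV" using T_UNIV by blast
  obtain w where w: "0 \<le> w" "w \<le> 2 ^ i * y" "y dvd j - w" "p (d * w) \<le> 2 ^ i * (2 * x)"
    using T_p[of j i] i(2) by auto
  obtain l where l: "j - w = y * l" using w(3) by auto
  have "y * (- l) \<le> y * 2 ^ i" using l w(2) j by (simp add: algebra_simps)
  have y0: "0 < y" using y_pos by simp
  have l1: "- l \<le> 2 ^ i" using \<open>y * (- l) \<le> y * 2 ^ i\<close> mult_le_cancel_left_pos[OF y0] by blast
  have "y * l \<le> y * 1" using l w(1) j by simp
  then have l2: "l \<le> 1" using mult_le_cancel_left_pos[OF y0] by blast
  have "(1::int) \<le> 2 ^ i" by simp
  then have "\<bar>l\<bar> \<le> 2 ^ i" using l1 l2 by linarith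
  have e: "j * d = d * w + l * M" using l M_eq by (simp add: algebra_simps)
  have pM: "p M \<le> 2 * x" using p_X1[OF M_in X1_zero] by simp
  have "p (l * M) \<le> \<bar>l\<bar> * p M" by (rule p_mult)
  also have "\<dots> \<le> 2 ^ i * (2 * x)" using pM \<open>\<bar>l\<bar> \<le> 2 ^ i\<close> p_nonneg x2 by (intro mult_mono) auto
  finally have "p (j * d) \<le> 2 ^ i * (4 * x)" unfolding e using p_add[of "d * w" "l * M"] w(4) by linarith
  also have "\<dots> \<le> 2 ^ nat (16 * c) * (6 * x)" using i(1) x2 by (intro mult_mono power_increasing) auto
  finally show ?thesis by (simp add: C3_def algebra_simps)
qed

end

section \<open>Holes and right ends along the step d\<close>

context small_atom begin

text \<open>Complementary to \<open>right_end\<close>: moving along \<open>d\<close> from a point of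
  \<open>S\<close>, each place outside \<open>S\<close> is such a hole until a right end is passed
  (\<open>hole_in_chain\<close>). Holes turn out to be few, and right ends unique modulo
  \<open>H\<close>.\<close>

definition Hl where
  "Hl = {z. z \<notin> S \<and> (\<exists>i\<in>{1..y}. z - i * d \<in> S) \<and> (\<exists>i\<in>{1..y}. z + i * d \<in> S)}"

definition right_end where
  "right_end e \<longleftrightarrow> e \<in> S \<and> (\<forall>i\<in>{1..y}. e + i * d \<notin> S)"

definition before where "before z = int (card {i\<in>{1..y}. z - i * d \<in> S})"
definition after where "after z = int (card {i\<in>{1..y}. z + i * d \<in> S})"

lemma S_shift: "z + H \<in> S \<longleftrightarrow> z \<in> S" using perS by (simp add: per_def)
lemma S_shift2: "z + H - v \<in> S \<longleftrightarrow> z - v \<in> S" "z + H + v \<in> S \<longleftrightarrow> z + v \<in> S"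
  using S_shift[of "z - v"] S_shift[of "z + v"] by (simp_all add: algebra_simps)

lemma finite_steps [simp]: "finite {i. 1 \<le> i \<and> i \<le> y \<and> P i}"
  by (rule finite_subset[of _ "{1..y}"]) auto

text \<open>Double counting of the pairs of \<open>z\<close> in \<open>W\<close> and
  \<open>i\<close> with \<open>z - f i\<close> in \<open>S\<close>: each \<open>z\<close> has at
  least \<open>x / 4\<close> partners, and for fixed \<open>i\<close> there are at most
  \<open>p (f i)\<close> pairs.\<close>

lemma sum_count:
  assumes f: "\<And>i. i \<in> {1..y} \<Longrightarrow> p (f i) \<le> C3 * x" and W: "W \<inter> S = {}"
    and r: "\<And>z. z \<in> W \<Longrightarrow> x \<le> 4 * int (card {i\<in>{1..y}. z - f i \<in> S})"
  shows "sz H W \<le> 4 * (y * C3)"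
proof -
  have "x * sz H W = (\<Sum>z\<in>{0..<H}. x * of_bool (z \<in> W))" by (simp only: sz_sum sum_distrib_left)
  also have "\<dots> \<le> (\<Sum>z\<in>{0..<H}. 4 * (\<Sum>i\<in>{1..y}. of_bool (z - f i \<in> S \<and> z \<notin> S)))"
  proof (rule sum_mono)
    fix z
    have "(\<Sum>i\<in>{1..y}. of_bool (z - f i \<in> S)::int) = int (card {i\<in>{1..y}. z - f i \<in> S})"
      by (simp add: of_bool_def sum.If_cases Int_def)
    moreover have "z \<in> W \<Longrightarrow> z \<notin> S" using W by blast
    ultimately show "x * of_bool (z \<in> W) \<le> 4 * (\<Sum>i\<in>{1..y}. of_bool (z - f i \<in> S \<and> z \<notin> S))"
      using r[of z] by (cases "z \<in> W") (auto simp del: atLeastAtMost_iff intro!: sum_nonneg)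
  qed
  also have "\<dots> = 4 * (\<Sum>z\<in>{0..<H}. \<Sum>i\<in>{1..y}. of_bool (z - f i \<in> S \<and> z \<notin> S))"
    by (rule sum_distrib_left[symmetric])
  also have "(\<Sum>z\<in>{0..<H}. \<Sum>i\<in>{1..y}. of_bool (z - f i \<in> S \<and> z \<notin> S)) =
      (\<Sum>i\<in>{1..y}. \<Sum>z\<in>{0..<H}. of_bool (z - f i \<in> S \<and> z \<notin> S) :: int)" by (rule sum.swap)
  also have "\<dots> = (\<Sum>i\<in>{1..y}. p (f i))" by (simp add: p_def sz_sum tr_def)
  also have "4 * (\<Sum>i\<in>{1..y}. p (f i)) \<le> 4 * (\<Sum>i\<in>{1..y}. C3 * x)" using f by (intro mult_left_mono sum_mono) auto
  also have "\<dots> = x * (4 * (y * C3))" using y_pos by simp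
  finally have "x * sz H W \<le> x * (4 * (y * C3))" .
  then show ?thesis by (rule mult_left_le_imp_le) (use x2 in linarith)
qed

lemma dense_before: "sz H {z. z \<notin> S \<and> x \<le> 4 * before z} \<le> 4 * (y * C3)"
  by (rule sum_count[where f = "\<lambda>i. i * d"]) (auto simp: before_def p_multiples)

lemma dense_after: "sz H {z. z \<notin> S \<and> x \<le> 4 * after z} \<le> 4 * (y * C3)"
proof (rule sum_count[where f = "\<lambda>i. - (i * d)"])
  show "p (- (i * d)) \<le> C3 * x" if "i \<in> {1..y}" for i
  proof -
    have "p (- (i * d)) = p (i * d)" by (rule p_minus)
    then show ?thesis using p_multiples[of i] that by auto
  qed
qed (auto simp: after_def)

lemma multiple_in_X1: "v \<in> X1 \<Longrightarrow> \<exists>j. 0 \<le> j \<and> j \<le> y \<and> v = j * d"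
  using X1_X2 X2_bounds by (auto simp: mult.commute)

lemma X1_diff: assumes "v \<in> X1" "v' \<in> X1" shows "\<bar>v - v'\<bar> < H"
proof -
  have "4 * c * x = 4 * (c * x)" by simp
  then show ?thesis
    using X1_nonneg[OF assms(1)] X1_nonneg[OF assms(2)] X1_le[OF assms(1)] X1_le[OF assms(2)] M_less cx_H cx_nonneg
    by linarith
qed

definition Q where "Q = {s \<in> S. 4 * after s < x}"

text \<open>Pairwise far apart elements of \<open>Q\<close> contribute disjoint sets of new elements to \<open>S + X1\<close>.\<close>

lemma separated_card:
  assumes F: "finite F" "F \<subseteq> Q"
    and sep: "\<And>u v j. u \<in> F \<Longrightarrow> v \<in> F \<Longrightarrow> \<bar>j\<bar> \<le> y \<Longrightarrow> H dvd u - v - j * d \<Longrightarrow> u = v"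
  shows "card F \<le> 8"
proof -
  define Nq where "Nq s = (\<lambda>v. s + v) ` {v \<in> X1. s + v \<notin> S}" for s
  have finN: "finite (Nq s)" for s using finX1 by (simp add: Nq_def)
  \<comment> \<open>At most \<open>1 + after s\<close> elements of \<open>X1\<close> keep
    \<open>s\<close> inside \<open>S\<close>, and \<open>after s\<close> is below
    \<open>x / 4\<close>. With fewer than \<open>2 * x\<close> elements in \<open>Nw\<close> this
    leads to the bound 8.\<close>
  have big: "x \<le> 4 * int (card (Nq s))" if s: "s \<in> F" for s
  proof -
    have sS: "s \<in> S" "4 * after s < x" using s F by (auto simp: Q_def)
    have "{v \<in> X1. s + v \<in> S} \<subseteq> insert 0 ((\<lambda>i. i * d) ` {i\<in>{1..y}. s + i * d \<in> S})"
    proof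
      fix v assume v: "v \<in> {v \<in> X1. s + v \<in> S}"
      then obtain j where "0 \<le> j" "j \<le> y" "v = j * d" using multiple_in_X1 by blast
      then show "v \<in> insert 0 ((\<lambda>i. i * d) ` {i\<in>{1..y}. s + i * d \<in> S})" using v by (cases "j = 0") auto
    qed
    then have "card {v \<in> X1. s + v \<in> S} \<le> card (insert 0 ((\<lambda>i. i * d) ` {i\<in>{1..y}. s + i * d \<in> S}))"
      by (intro card_mono) auto
    also have "\<dots> \<le> Suc (card ((\<lambda>i. i * d) ` {i\<in>{1..y}. s + i * d \<in> S}))" by (rule card_insert_le_m1) simp_all
    also have "\<dots> \<le> Suc (card {i\<in>{1..y}. s + i * d \<in> S})" by (intro Suc_le_mono[THEN iffD2] card_image_le) simp
    finally have "int (card {v \<in> X1. s + v \<in> S}) \<le> 1 + after s" by (simp add: after_def)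
    moreover have "card X1 = card {v \<in> X1. s + v \<in> S} + card {v \<in> X1. s + v \<notin> S}"
      using finX1 by (subst card_Un_disjoint[symmetric]) (auto intro: arg_cong[where f = card])
    moreover have "card (Nq s) = card {v \<in> X1. s + v \<notin> S}" by (simp add: Nq_def card_image)
    ultimately show ?thesis using cardX1 sS(2) x2 by linarith
  qed
  have inj: "inj_on (\<lambda>z. z mod H) (\<Union>s\<in>F. Nq s)"
  proof (rule inj_onI)
    fix z z' assume z: "z \<in> (\<Union>s\<in>F. Nq s)" "z' \<in> (\<Union>s\<in>F. Nq s)" "z mod H = z' mod H"
    then obtain s v s' v' where s: "s \<in> F" "s' \<in> F" "v \<in> X1" "v' \<in> X1" "z = s + v" "z' = s' + v'" by (auto simp: Nq_def)
    obtain j j' where j: "0 \<le> j" "j \<le> y" "v = j * d" "0 \<le> j'" "j' \<le> y" "v' = j' * d"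
      using multiple_in_X1[OF s(3)] multiple_in_X1[OF s(4)] by blast
    have dv: "H dvd z - z'" using z(3) by (simp add: mod_eq_dvd_iff)
    have "z - z' = s - s' - (j' - j) * d" using s j by (simp add: algebra_simps)
    then have "s = s'" using dv j by (intro sep[OF s(1,2), of "j' - j"]) auto
    moreover have "\<bar>v - v'\<bar> < H" using X1_diff s(3,4) by blast
    ultimately show "z = z'" using dv s dvd_imp_le_int[of "v - v'" H] by fastforce
  qed
  have disj: "Nq s \<inter> Nq s' = {}" if "s \<in> F" "s' \<in> F" "s \<noteq> s'" for s s'
  proof -
    have False if "z \<in> Nq s" "z \<in> Nq s'" for z
    proof -
      obtain v where v1: "v \<in> X1" "z = s + v" using \<open>z \<in> Nq s\<close> by (auto simp: Nq_def)
      obtain v' where v2: "v' \<in> X1" "z = s' + v'" using \<open>z \<in> Nq s'\<close> by (auto simp: Nq_def)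
      note v = v1(1) v2(1) v1(2) v2(2)
      obtain j j' where j: "0 \<le> j" "j \<le> y" "v = j * d" "0 \<le> j'" "j' \<le> y" "v' = j' * d"
        using multiple_in_X1[OF v(1)] multiple_in_X1[OF v(2)] by blast
      have "s - s' - (j' - j) * d = 0" using v j by (simp add: algebra_simps)
      then have "s = s'" using \<open>s \<in> F\<close> \<open>s' \<in> F\<close> j by (intro sep[of s s' "j' - j"]) auto
      then show False using \<open>s \<noteq> s'\<close> by simp
    qed
    then show ?thesis by blast
  qed
  have "(\<Union>s\<in>F. Nq s) \<subseteq> Nw" using F by (auto simp: Nq_def Nw_def Q_def intro!: plusI)
  then have "int (card (\<Union>s\<in>F. Nq s)) \<le> sz H Nw" by (rule sz_ge(1)[OF Hpos perNw _ inj])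
  moreover have "card (\<Union>s\<in>F. Nq s) = (\<Sum>s\<in>F. card (Nq s))" using F(1) finN disj by (intro card_UN_disjoint) auto
  moreover have "int (card F) * x \<le> (\<Sum>s\<in>F. 4 * int (card (Nq s)))" using sum_mono[of F "\<lambda>_. x"] big by simp
  ultimately have "int (card F) * x \<le> 4 * sz H Nw" by (simp add: sum_distrib_left[symmetric])
  then have "int (card F) * x \<le> 8 * x" using szNw x_ge by linarith
  then show ?thesis using x2 by simp
qed

text \<open>A maximal separated subset \<open>F\<close> of \<open>Q\<close> has at most 8 elements,
  and all of \<open>Q\<close> is within \<open>y\<close> steps of it. For a hole with few points of
  \<open>S\<close> around it, the nearest earlier point \<open>s\<close> of \<open>S\<close> is in
  \<open>Q\<close>, because what follows \<open>s\<close> also follows the hole. So the hole is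
  between \<open>- y\<close> and \<open>2 * y\<close> steps from \<open>F\<close>.\<close>

lemma sparse_holes: "sz H {z \<in> Hl. 4 * before z < x \<and> 4 * after z < x} \<le> 8 * (3 * y + 1)"
proof -
  define ok where "ok F \<longleftrightarrow> F \<subseteq> Q \<inter> {0..<H} \<and> (\<forall>u\<in>F. \<forall>v\<in>F. \<forall>j. \<bar>j\<bar> \<le> y \<longrightarrow> H dvd u - v - j * d \<longrightarrow> u = v)" for F
  have finok: "finite F" if "ok F" for F using that finite_subset[of F "{0..<H}"] by (auto simp: ok_def)
  have ok8: "card F \<le> 8" if F: "ok F" for F
    by (rule separated_card[OF finok[OF F]]) (use F in \<open>auto simp: ok_def\<close>)
  have "ok {}" by (simp add: ok_def)
  moreover have "card F < 9" if "ok F" for F using ok8[OF that] by linarith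
  ultimately obtain F where F: "ok F" "\<And>F'. ok F' \<Longrightarrow> card F' \<le> card F"
    using ex_has_greatest_nat[of ok "{}" card 9] by blast
  have perQ: "per H Q" unfolding per_def Q_def after_def using S_shift S_shift2 by simp
  have near: "\<exists>u\<in>F. \<exists>j. \<bar>j\<bar> \<le> y \<and> H dvd s - u - j * d" if s: "s \<in> Q" for s
  proof (rule ccontr)
    assume no: "\<not> ?thesis"
    define s' where "s' = s mod H"
    have s': "s' \<in> Q \<inter> {0..<H}" using s per_mod[OF perQ] Hpos by (simp add: s'_def)
    have ds: "H dvd s - s'" by (simp add: s'_def mod_eq_dvd_iff[symmetric])
    have n1: "\<not> H dvd s' - u - j * d" if "u \<in> F" "\<bar>j\<bar> \<le> y" for u j
    proof
      assume "H dvd s' - u - j * d"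
      then have "H dvd (s - s') + (s' - u - j * d)" using ds by (intro dvd_add)
      then show False using no that by (auto simp: algebra_simps)
    qed
    have n2: "\<not> H dvd u - s' - j * d" if "u \<in> F" "\<bar>j\<bar> \<le> y" for u j
    proof
      assume "H dvd u - s' - j * d"
      then have "H dvd - (u - s' - j * d)" by (simp only: dvd_minus_iff)
      then have "H dvd s' - u - (- j) * d" by (simp add: algebra_simps)
      then show False using n1[of u "- j"] that by simp
    qed
    have "s' \<notin> F" using n1[of s' 0] y_pos by auto
    moreover have "ok (insert s' F)" using F(1) s' n1 n2 unfolding ok_def by blast
    ultimately show False using F(2)[of "insert s' F"] finok[OF F(1)] by simp
  qed
  define G where "G = (\<lambda>(u, j). u + j * d) ` (F \<times> {- y..2 * y})"
  have finG: "finite G" using finok[OF F(1)] by (simp add: G_def)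
  have "sz H {z \<in> Hl. 4 * before z < x \<and> 4 * after z < x} \<le> int (card G)"
  proof (rule sz_le[OF Hpos finG])
    fix z assume z: "z \<in> {z \<in> Hl. 4 * before z < x \<and> 4 * after z < x}"
    define I where "I = {i\<in>{1..y}. z - i * d \<in> S}"
    have I: "finite I" "I \<noteq> {}" using z by (auto simp: I_def Hl_def)
    define i where "i = Min I"
    have i: "i \<in> I" "\<And>j. j \<in> I \<Longrightarrow> i \<le> j" using I by (auto simp: i_def)
    define s where "s = z - i * d"
    have sS: "s \<in> S" using i(1) by (simp add: I_def s_def)
    have zS: "z \<notin> S" using z by (simp add: Hl_def)
    have "{j\<in>{1..y}. s + j * d \<in> S} \<subseteq> (\<lambda>j. j + i) ` {j\<in>{1..y}. z + j * d \<in> S}"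
    proof
      fix j assume j: "j \<in> {j\<in>{1..y}. s + j * d \<in> S}"
      have e: "s + j * d = z - (i - j) * d" by (simp add: s_def algebra_simps)
      have "\<not> j < i"
      proof
        assume "j < i"
        then have "i - j \<in> I" using j e i(1) by (auto simp: I_def)
        then show False using i(2)[of "i - j"] j by auto
      qed
      moreover have "j \<noteq> i" using j e zS by auto
      ultimately have "j - i \<in> {j\<in>{1..y}. z + j * d \<in> S}" using j e i(1) by (auto simp: I_def algebra_simps)
      then show "j \<in> (\<lambda>j. j + i) ` {j\<in>{1..y}. z + j * d \<in> S}" by (intro image_eqI[of _ _ "j - i"]) auto
    qed
    then have "card {j\<in>{1..y}. s + j * d \<in> S} \<le> card ((\<lambda>j. j + i) ` {j\<in>{1..y}. z + j * d \<in> S})"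
      by (intro card_mono) auto
    also have "\<dots> \<le> card {j\<in>{1..y}. z + j * d \<in> S}" by (intro card_image_le) auto
    finally have "card {j\<in>{1..y}. s + j * d \<in> S} \<le> card {j\<in>{1..y}. z + j * d \<in> S}" .
    then have "s \<in> Q" using sS z by (auto simp: Q_def after_def)
    then obtain u j where u: "u \<in> F" "\<bar>j\<bar> \<le> y" "H dvd s - u - j * d" using near by blast
    have "H dvd z - (u + (i + j) * d)" using u(3) by (simp add: s_def algebra_simps)
    moreover have "u + (i + j) * d \<in> G"
      unfolding G_def using u i(1) by (intro image_eqI[of _ _ "(u, i + j)"]) (auto simp: I_def)
    ultimately show "\<exists>f\<in>G. H dvd z - f" by blast
  qed
  moreover have "card G \<le> card (F \<times> {- y..2 * y})" unfolding G_def using finok[OF F(1)] by (intro card_image_le) auto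
  then have "int (card G) \<le> int (card F * card {- y..2 * y})"
    by (simp only: card_cartesian_product of_nat_le_iff)
  then have "int (card G) \<le> int (card F) * (3 * y + 1)" using y_pos by (simp add: algebra_simps)
  moreover have "int (card F) * (3 * y + 1) \<le> 8 * (3 * y + 1)" using ok8[OF F(1)] y_pos by (intro mult_right_mono) auto
  ultimately show ?thesis by linarith
qed

lemma holes_le: "sz H Hl \<le> C5 * x"
proof -
  let ?P = "{z. z \<notin> S \<and> x \<le> 4 * before z}" and ?Q = "{z. z \<notin> S \<and> x \<le> 4 * after z}"
    and ?R = "{z \<in> Hl. 4 * before z < x \<and> 4 * after z < x}"
  have "Hl \<subseteq> (?P \<union> ?Q) \<union> ?R" by (auto simp: Hl_def)
  then have "sz H Hl \<le> sz H ((?P \<union> ?Q) \<union> ?R)" by (rule sz_mono)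
  also have "\<dots> \<le> 8 * (y * C3) + 8 * (3 * y + 1)"
    using sz_Un_le[of H "?P \<union> ?Q" ?R] sz_Un_le[of H ?P ?Q] dense_before dense_after sparse_holes by linarith
  also have "\<dots> \<le> (8 * C3 + 32) * y" using y_pos by (simp add: algebra_simps)
  also have "\<dots> \<le> (8 * C3 + 32) * (4 * c * x)" using y_le C3_ge by (intro mult_left_mono) auto
  finally show ?thesis by (simp only: C5_def mult.assoc)
qed

text \<open>A right end plus the nonzero elements of \<open>X1\<close> gives \<open>x - 1\<close>
  elements of \<open>Nw\<close>, and two right ends give disjoint sets. As \<open>Nw\<close> has at
  most \<open>x + b - 1\<close> elements, this would force \<open>x \<le> b + 1\<close>.\<close>

lemma right_end_unique:
  assumes e: "right_end e" "right_end e'" shows "H dvd e - e'"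
proof (rule ccontr)
  assume no: "\<not> H dvd e - e'"
  define F where "F = (\<lambda>v. e + v) ` (X1 - {0})"
  define F' where "F' = (\<lambda>v. e' + v) ` (X1 - {0})"
  have new: "r + v \<in> Nw" if r: "right_end r" "v \<in> X1 - {0}" for r v
  proof -
    obtain j where j: "0 \<le> j" "j \<le> y" "v = j * d" using multiple_in_X1 r(2) by blast
    then have "j \<in> {1..y}" using r(2) by (cases "j = 0") auto
    then show ?thesis using r j by (auto simp: Nw_def right_end_def intro!: plusI)
  qed
  have cross: "\<not> H dvd (e + v) - (e' + v')" if v: "v \<in> X1" "v' \<in> X1" for v v'
  proof
    assume dv: "H dvd (e + v) - (e' + v')"
    obtain j j' where j: "0 \<le> j" "j \<le> y" "v = j * d" "0 \<le> j'" "j' \<le> y" "v' = j' * d"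
      using multiple_in_X1[OF v(1)] multiple_in_X1[OF v(2)] by blast
    consider "j = j'" | "j > j'" | "j < j'" by linarith
    then show False
    proof cases
      case 1
      then show False using dv no j by simp
    next
      case 2
      have "(e + v) - (e' + v') = (e + (j - j') * d) - e'" using j by (simp add: algebra_simps)
      then have "e + (j - j') * d \<in> S" using dv per_cong[OF perS] e(2) by (metis right_end_def)
      then show False using e(1) 2 j by (auto simp: right_end_def dest: bspec[of _ _ "j - j'"])
    next
      case 3
      have "(e + v) - (e' + v') = e - (e' + (j' - j) * d)" using j by (simp add: algebra_simps)
      then have "e' + (j' - j) * d \<in> S" using dv per_cong[OF perS] e(1) by (metis right_end_def)
      then show False using e(2) 3 j by (auto simp: right_end_def dest: bspec[of _ _ "j' - j"])
    qed
  qed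
  have same: "v = v'" if "v \<in> X1" "v' \<in> X1" "H dvd v - v'" for v v'
  proof -
    have "\<bar>v - v'\<bar> < H" using X1_diff that(1,2) by blast
    then show ?thesis using dvd_imp_le_int[of "v - v'" H] that(3) by fastforce
  qed
  have inj: "inj_on (\<lambda>z. z mod H) (F \<union> F')"
  proof (rule inj_onI)
    fix z z' assume z: "z \<in> F \<union> F'" "z' \<in> F \<union> F'" "z mod H = z' mod H"
    have dv: "H dvd z - z'" using z(3) by (simp add: mod_eq_dvd_iff)
    have dv': "H dvd z' - z" using dv by (simp only: dvd_diff_commute)
    show "z = z'" using z(1,2) dv dv' cross same unfolding F_def F'_def by fastforce
  qed
  have disj: "F \<inter> F' = {}"
  proof -
    have False if "z \<in> F" "z \<in> F'" for z
    proof -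
      obtain v where "v \<in> X1" "z = e + v" using \<open>z \<in> F\<close> by (auto simp: F_def)
      moreover obtain v' where "v' \<in> X1" "z = e' + v'" using \<open>z \<in> F'\<close> by (auto simp: F'_def)
      ultimately show False using cross[of v v'] by simp
    qed
    then show ?thesis by blast
  qed
  have "F \<union> F' \<subseteq> Nw" using new e by (auto simp: F_def F'_def)
  then have "int (card (F \<union> F')) \<le> sz H Nw" by (rule sz_ge(1)[OF Hpos perNw _ inj])
  moreover have "card (F \<union> F') = card F + card F'" using disj finX1 by (intro card_Un_disjoint) (auto simp: F_def F'_def)
  moreover have "int (card F) = x - 1" "int (card F') = x - 1"
    using cardX1 X1_zero finX1 x2 by (simp_all add: F_def F'_def card_image card_Diff_singleton of_nat_diff)
  ultimately show False using szNw x_ge by linarith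
qed

text \<open>The nearest earlier point of \<open>S\<close> is no right end, so a point of
  \<open>S\<close> follows it within \<open>y\<close> steps. That point lies beyond
  \<open>z\<close>, which is thus enclosed.\<close>

lemma hole_in_chain:
  assumes z: "z \<notin> S" "s \<in> S" "z = s + i * d" "i \<ge> 1"
    and no: "\<And>j. 1 \<le> j \<Longrightarrow> j \<le> i \<Longrightarrow> \<not> right_end (z - j * d)"
  shows "z \<in> Hl"
proof -
  define m where "m = (LEAST m. m \<ge> 1 \<and> z - int m * d \<in> S)"
  have ex: "nat i \<ge> 1 \<and> z - int (nat i) * d \<in> S" using z by auto
  have m: "m \<ge> 1" "z - int m * d \<in> S"
    using LeastI[of "\<lambda>m. m \<ge> 1 \<and> z - int m * d \<in> S", OF ex] by (auto simp: m_def)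
  have least: "z - j * d \<notin> S" if "1 \<le> j" "j < int m" for j
    using not_less_Least[of "nat j" "\<lambda>m. m \<ge> 1 \<and> z - int m * d \<in> S"] that by (auto simp: m_def)
  have "m \<le> nat i" unfolding m_def by (rule Least_le) (rule ex)
  then have "\<not> right_end (z - int m * d)" using no[of "int m"] m(1) by simp
  then obtain j where j: "1 \<le> j" "j \<le> y" "z - int m * d + j * d \<in> S" using m(2) by (auto simp: right_end_def)
  have e: "z - int m * d + j * d = z - (int m - j) * d" by (simp add: algebra_simps)
  have "\<not> j < int m"
  proof
    assume "j < int m"
    then show False using least[of "int m - j"] j e by auto
  qed
  moreover have "j \<noteq> int m" using j(3) e z(1) by auto
  ultimately have jm: "j > int m" by simp
  have "z - int m * d \<in> S" "int m \<in> {1..y}" using m jm j by auto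
  moreover have "z + (j - int m) * d \<in> S" "j - int m \<in> {1..y}" using j e jm m(1) by (auto simp: algebra_simps)
  ultimately show ?thesis using z(1) unfolding Hl_def by blast
qed

definition g where "g = gcd d H"

lemma g_pos: "g \<ge> 1"
proof -
  have "g \<noteq> 0" using Hpos by (simp add: g_def)
  then show ?thesis using gcd_ge_0_int[of d H] unfolding g_def by linarith
qed
lemma g_dvd: "g dvd d" "g dvd H" by (auto simp: g_def)
lemma g_le: "g < 8 * c" using zdvd_imp_le[OF g_dvd(1)] d_pos d_le by linarith

text \<open>Modulo \<open>H\<close> the multiples of \<open>d\<close> are those of \<open>g\<close>,
  by Bezout; a multiple of \<open>H\<close> is added to make the number of steps positive.\<close>

lemma class_chain:
  assumes "s \<in> S" "g dvd z - s"
  shows "\<exists>s'\<in>S. \<exists>i\<ge>1. z = s' + i * d \<and> g dvd s' - s"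
proof -
  obtain u v where uv: "u * d + v * H = g" using bezout_int[of d H] by (auto simp: g_def)
  obtain l where l: "z - s = g * l" using assms(2) by auto
  define i0 where "i0 = u * l"
  define i where "i = i0 + H * (\<bar>i0\<bar> + 1)"
  have "1 * (\<bar>i0\<bar> + 1) \<le> H * (\<bar>i0\<bar> + 1)" using Hpos by (intro mult_right_mono) auto
  then have "i0 + (\<bar>i0\<bar> + 1) \<le> i" by (simp add: i_def)
  moreover have "0 \<le> i0 + \<bar>i0\<bar>" by simp
  ultimately have i1: "i \<ge> 1" by linarith
  define s' where "s' = z - i * d"
  have "z = s + i0 * d + (v * l) * H" using l uv[symmetric] by (simp add: i0_def algebra_simps)
  then have "s' - s = H * (v * l - (\<bar>i0\<bar> + 1) * d)" by (simp add: s'_def i_def algebra_simps)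
  then have Hs: "H dvd s' - s" by simp
  then have "s' \<in> S" using per_cong[OF perS] assms(1) by blast
  moreover have "g dvd s' - s" using Hs g_dvd(2) by (rule dvd_trans[rotated])
  ultimately show ?thesis using i1 by (intro bexI[of _ s'] exI[of _ i]) (auto simp: s'_def)
qed

end

section \<open>Missing sums modulo H and wrapping progressions\<close>

text \<open>Two families of holes in \<open>{0..m}\<close>: the differences \<open>l - t\<close>
  with \<open>t\<close> in \<open>Tv\<close>, at least \<open>|L| + |Tv| - 1\<close> in number, and
  \<open>L\<close> itself with the \<open>a - |Tv|\<close> holes below \<open>a\<close>. Adding the
  two bounds eliminates \<open>Tv\<close>.\<close>

lemma low_gap:
  fixes T L :: "int set"
  assumes T0: "0 \<in> T" and a: "1 \<le> a" and L: "L \<subseteq> {a..m}" "L \<inter> (T + T) = {}" "L \<noteq> {}"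
  shows "2 * int (card L) + a - 1 \<le> 2 * int (card ({0..m} - T))"
proof -
  define Tv where "Tv = T \<inter> {0..a - 1}"
  have fin: "finite L" "finite Tv" using L(1) finite_subset by (auto simp: Tv_def)
  have "L + uminus ` Tv \<subseteq> {0..m} - T"
  proof
    fix z assume "z \<in> L + uminus ` Tv"
    then obtain l t where lt: "l \<in> L" "t \<in> Tv" "z = l - t" by (auto simp: set_plus_def)
    have "z \<notin> T" using plusI[of t T z T] lt L(2) by (auto simp: Tv_def)
    then show "z \<in> {0..m} - T" using lt L(1) by (force simp: Tv_def)
  qed
  then have "card (L + uminus ` Tv) \<le> card ({0..m} - T)" by (intro card_mono) auto
  moreover have "card L + card (uminus ` Tv) \<le> card (L + uminus ` Tv) + 1"
    using fin L(3) T0 a by (intro card_plus_ge) (auto simp: Tv_def)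
  ultimately have 1: "card L + card Tv \<le> card ({0..m} - T) + 1" by (simp add: card_image)
  have LT: "L \<inter> T = {}" using L(2) plusI[OF T0, of _ T] by fastforce
  have am: "a \<le> m" using L(1,3) by fastforce
  have "card (L \<union> ({0..a - 1} - T)) \<le> card ({0..m} - T)"
    using LT L(1) a am by (intro card_mono) auto
  moreover have "card (L \<union> ({0..a - 1} - T)) = card L + card ({0..a - 1} - T)"
    using L(1) fin by (intro card_Un_disjoint) auto
  moreover have "card {0..a - 1} = card Tv + card ({0..a - 1} - T)"
    unfolding Tv_def Int_commute[of T] by (subst card_Un_disjoint[symmetric]) (simp_all add: Int_Diff_Un Int_Diff_disjoint)
  moreover have "int (card {0..a - 1}) = a" using a by simp
  ultimately show ?thesis using 1 by linarith
qed

text \<open>Elements missing from \<open>T + T\<close> modulo \<open>H\<close>, when \<open>2 * l\<close> exceeds \<open>H\<close>: near either end of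
  \<open>{0..2 * l}\<close> each of them forces holes of \<open>T\<close>, and the residues that are covered twice only help.\<close>

lemma fold_bound:
  fixes T U :: "int set"
  assumes T: "T \<subseteq> {0..l}" "0 \<in> T" "l \<in> T" and lH: "l < H" "H \<le> 2 * l"
    and h: "4 * int (card ({0..l} - T)) \<le> l"
    and U: "U \<subseteq> {0..<H}" "\<And>u. u \<in> U \<Longrightarrow> u \<notin> T + T" "\<And>u. u \<in> U \<Longrightarrow> u + H \<notin> T + T" "U \<noteq> {}"
  shows "2 * int (card U) + (2 * l - H) \<le> 2 * int (card ({0..l} - T))"
proof -
  \<comment> \<open>The residues \<open>0..v\<close> are those with two lifts \<open>u\<close> and
    \<open>u + H\<close> in \<open>{0..2 * l}\<close>.\<close>
  define v where "v = 2 * l - H"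
  define w where "w = int (card ({0..l} - T))"
  define T' where "T' = (\<lambda>t. l - t) ` T"
  have v: "0 \<le> v" "v < l" using lH by (auto simp: v_def)
  have T'_iff: "z \<in> T' \<longleftrightarrow> l - z \<in> T" for z by (auto simp: T'_def image_iff intro: bexI[of _ "l - z"])
  have T': "0 \<in> T'" "l \<in> T'" using T by (auto simp: T'_iff)
  have refl: "2 * l - z \<notin> T + T \<Longrightarrow> z \<notin> T' + T'" for z
  proof
    assume no: "2 * l - z \<notin> T + T" and "z \<in> T' + T'"
    then obtain s t where "s \<in> T" "t \<in> T" "z = (l - s) + (l - t)" by (auto simp: T'_def set_plus_def)
    then have "2 * l - z = s + t" by simp
    then show False using plusI \<open>s \<in> T\<close> \<open>t \<in> T\<close> no by metis
  qed
  define L1 where "L1 = U \<inter> {v + 1..l}"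
  \<comment> \<open>Missing sums above \<open>l\<close> are reflected to \<open>2 * l - u\<close>,
    missing sums of \<open>T'\<close> near its lower end; under the same reflection the upper lift
    \<open>u + H\<close> of an element of \<open>U0\<close> becomes \<open>v - u\<close>.\<close>
  define R1 where "R1 = (\<lambda>u. 2 * l - u) ` (U \<inter> {l + 1..<H})"
  define U0 where "U0 = U \<inter> {0..v}"
  define R0 where "R0 = (\<lambda>u. v - u) ` U0"
  have finU: "finite U" using U(1) finite_subset by blast
  have fin: "finite L1" "finite R1" "finite U0" "finite R0" using finU by (auto simp: L1_def R1_def U0_def R0_def)
  have Ueq: "U = (L1 \<union> U0) \<union> (U \<inter> {l + 1..<H})" using U(1) v lH by (auto simp: L1_def U0_def)
  have "card U = card (L1 \<union> U0) + card (U \<inter> {l + 1..<H})"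
    by (subst Ueq, subst card_Un_disjoint) (use fin finU v in \<open>auto simp: L1_def U0_def\<close>)
  moreover have "card (L1 \<union> U0) = card L1 + card U0"
    using fin by (intro card_Un_disjoint) (auto simp: L1_def U0_def)
  moreover have "card (U \<inter> {l + 1..<H}) = card R1" by (simp add: R1_def card_image inj_on_def)
  ultimately have cU: "card U = card L1 + card U0 + card R1" by simp
  have R_no: "z \<notin> T' + T'" "0 \<le> z" "z \<le> l" if "z \<in> R1 \<union> R0" for z
  proof -
    have "(\<exists>u. u \<in> U \<and> l + 1 \<le> u \<and> u < H \<and> z = 2 * l - u) \<or> (\<exists>u. u \<in> U \<and> 0 \<le> u \<and> u \<le> v \<and> z = v - u)"
      using that by (auto simp: R1_def R0_def U0_def)
    then consider u where "u \<in> U" "l + 1 \<le> u" "u < H" "z = 2 * l - u" | u where "u \<in> U" "0 \<le> u" "u \<le> v" "z = v - u"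
      by blast
    then have "z \<notin> T' + T' \<and> 0 \<le> z \<and> z \<le> l"
    proof cases
      case 1
      then show ?thesis using refl[of z] U(2)[of u] lH by auto
    next
      case 2
      then have "2 * l - z = u + H" by (simp add: v_def)
      then have "z \<notin> T' + T'" using U(3)[OF 2(1)] by (intro refl) simp
      then show ?thesis using 2 v by auto
    qed
    then show "z \<notin> T' + T'" "0 \<le> z" "z \<le> l" by auto
  qed
  have L_no: "z \<notin> T + T" "0 \<le> z" "z \<le> l" if "z \<in> L1 \<union> U0" for z
    using that U v by (auto simp: L1_def U0_def)
  have low: "z \<le> 2 * w - 1" if z: "z \<in> L1 \<union> U0" for z
  proof -
    have "card ({0..z} - T) \<le> card ({0..l} - T)" using L_no[OF z] by (intro card_mono) auto
    then show ?thesis using missing_low[OF L_no(2)[OF z] L_no(1)[OF z]] by (simp add: w_def)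
  qed
  have high: "z \<le> 2 * w - 1" if z: "z \<in> R1 \<union> R0" for z
  proof -
    have "card ({0..z} - T') = card ((\<lambda>i. l - i) ` ({0..z} - T'))" by (simp add: card_image inj_on_def)
    also have "\<dots> \<le> card ({0..l} - T)"
      using R_no(3)[OF z] by (intro card_mono) (auto simp: T'_iff)
    finally show ?thesis using missing_low[OF R_no(2)[OF z] R_no(1)[OF z]] by (simp add: w_def)
  qed
  define m where "m = 2 * w - 1"
  have "card ({0..m} - T) + card ({0..m} - T') \<le> card ({0..l} - T)"
  proof -
    have "card ({0..m} - T') = card ((\<lambda>i. l - i) ` ({0..m} - T'))" by (simp add: card_image inj_on_def)
    moreover have "card ({0..m} - T) + card ((\<lambda>i. l - i) ` ({0..m} - T')) =
        card (({0..m} - T) \<union> (\<lambda>i. l - i) ` ({0..m} - T'))"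
      using h by (intro card_Un_disjoint[symmetric]) (auto simp: m_def w_def T'_iff)
    moreover have "\<dots> \<le> card ({0..l} - T)"
      using h by (intro card_mono) (auto simp: m_def w_def T'_iff)
    ultimately show ?thesis by simp
  qed
  then have ww: "int (card ({0..m} - T)) + int (card ({0..m} - T')) \<le> w" unfolding w_def by linarith
  have "2 * int (card U) + v \<le> 2 * w"
  proof (cases "U0 = {}")
    case True
    have "2 * int (card L1) + v \<le> 2 * int (card ({0..m} - T))" if "L1 \<noteq> {}"
      using low_gap[OF T(2), of "v + 1" L1 m] that low L_no(1) v by (force simp: L1_def m_def)
    moreover have "2 * int (card R1) + v \<le> 2 * int (card ({0..m} - T'))" if "R1 \<noteq> {}"
    proof -
      have "R1 \<subseteq> {v + 1..m}" using high by (auto simp: R1_def m_def v_def)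
      then show ?thesis using low_gap[OF T'(1), of "v + 1" R1 m] that R_no(1) v by force
    qed
    moreover have "L1 \<noteq> {} \<or> R1 \<noteq> {}" using cU U(4) finU True by (metis add.right_neutral card_0_eq card.empty)
    ultimately show ?thesis using ww cU True v by (cases "L1 = {}"; cases "R1 = {}") auto
  next
    case False
    \<comment> \<open>The largest missing residue with two lifts splits the work:
      \<open>low_gap\<close> applies with \<open>a = us\<close> below and with
      \<open>a = v - us\<close> after reflection, and these thresholds add up to
      \<open>v\<close>.\<close>
    define us where "us = Max U0"
    have us: "us \<in> U0" "\<And>u. u \<in> U0 \<Longrightarrow> u \<le> us" using fin False by (auto simp: us_def)
    have us0: "0 \<le> us" "us \<le> v" "us \<in> U" using us(1) by (auto simp: U0_def)
    have "us \<noteq> 0" using U(2)[OF us0(3)] plusI[OF T(2) T(2)] by auto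
    moreover have "us \<noteq> v" using U(3)[OF us0(3)] plusI[OF T(3) T(3)] by (auto simp: v_def)
    ultimately have us1: "1 \<le> us" "1 \<le> v - us" using us0 by auto
    have "insert us L1 \<subseteq> {us..m}" using low us(1) us0 by (auto simp: L1_def m_def)
    moreover have "insert us L1 \<inter> (T + T) = {}" using L_no(1) us(1) by auto
    ultimately have "2 * int (card (insert us L1)) + us - 1 \<le> 2 * int (card ({0..m} - T))"
      by (intro low_gap[OF T(2) us1(1)]) auto
    moreover have "us \<notin> L1" using us0 by (auto simp: L1_def)
    ultimately have 1: "2 * int (card L1) + us + 1 \<le> 2 * int (card ({0..m} - T))" using fin by simp
    have "R1 \<union> R0 \<subseteq> {v - us..m}"
    proof
      fix z assume z: "z \<in> R1 \<union> R0"
      have "v - us \<le> z" using z us(2) us0 by (auto simp: R1_def R0_def v_def)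
      then show "z \<in> {v - us..m}" using high[OF z] by (simp add: m_def)
    qed
    moreover have "(R1 \<union> R0) \<inter> (T' + T') = {}" using R_no(1) by auto
    moreover have "R1 \<union> R0 \<noteq> {}" using False by (auto simp: R0_def)
    ultimately have "2 * int (card (R1 \<union> R0)) + (v - us) - 1 \<le> 2 * int (card ({0..m} - T'))"
      by (intro low_gap[OF T'(1) us1(2)]) auto
    moreover have "card (R1 \<union> R0) = card R1 + card R0"
      using fin by (intro card_Un_disjoint) (auto simp: R1_def R0_def U0_def v_def)
    moreover have "card R0 = card U0" by (simp add: R0_def card_image inj_on_def)
    ultimately show ?thesis using 1 ww cU by simp
  qed
  then show ?thesis by (simp add: v_def w_def)
qed

text \<open>If a progression with few holes wraps around, the two terms next to the wrapping point give
  many residues outside the set with two representations.\<close>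

lemma wrapping_progression:
  fixes A T :: "int set"
  assumes A: "0 \<in> A" "H \<in> A" and H: "0 < H" and d: "2 \<le> d" "coprime d H"
    and idx: "\<And>z. z mod H \<in> A \<longleftrightarrow> (\<exists>t\<in>T. H dvd z - t * d)"
    and T: "T \<subseteq> {-j0..j1}" "0 \<in> T" "j1 \<in> T" and j0: "0 \<le> j0"
    and h: "int (card ({-j0..j1} - T)) \<le> h"
    and big: "4 * (d * (h + 3)) \<le> H" and span: "8 * (j0 + j1 + 3) \<le> 5 * H"
    and wrap: "H \<le> j1 * d"
  obtains E where "inj_on (\<lambda>z. z mod H) E" "H div (4 * d) - 2 * h \<le> int (card E)"
    "\<And>c. c \<in> E \<Longrightarrow> c mod H \<notin> A \<and> c mod H \<in> A + A \<and> c mod H + H \<in> A + A"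
proof -
  have finT: "finite T" using T(1) finite_subset by blast
  define Tl where "Tl = {t\<in>T. t * d < H}"
  define Tr where "Tr = {t\<in>T. H \<le> t * d}"
  have ne: "finite Tl" "finite Tr" "0 \<in> Tl" "j1 \<in> Tr" using finT T H wrap by (auto simp: Tl_def Tr_def)
  have ne': "Tl \<noteq> {}" "Tr \<noteq> {}" using ne by auto
  \<comment> \<open>\<open>al\<close> and \<open>be\<close> are the last index before and the first
    one after the wrapping point. The indices between them are holes, so they are at most
    \<open>h + 1\<close> apart.\<close>
  define al where "al = Max Tl"
  define be where "be = Min Tr"
  have al: "al \<in> Tl" "\<And>t. t \<in> Tl \<Longrightarrow> t \<le> al" using ne ne' by (auto simp: al_def)
  have be: "be \<in> Tr" "\<And>t. t \<in> Tr \<Longrightarrow> be \<le> t" using ne ne' by (auto simp: be_def)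
  have ald: "al * d < H" "al \<in> T" "0 \<le> al" using al(1) al(2)[OF ne(3)] by (auto simp: Tl_def)
  have bed: "H \<le> be * d" "be \<in> T" using be(1) by (auto simp: Tr_def)
  have ab: "al < be"
  proof -
    have "al * d < be * d" using ald bed by linarith
    then show ?thesis using d by simp
  qed
  have bj: "be \<le> j1" using be(2)[OF ne(4)] .
  define w where "w = be - al"
  have "{al + 1..be - 1} \<subseteq> {-j0..j1} - T"
  proof
    fix t assume t: "t \<in> {al + 1..be - 1}"
    have "t \<notin> T" using al(2)[of t] be(2)[of t] t by (cases "t * d < H") (auto simp: Tl_def Tr_def)
    then show "t \<in> {-j0..j1} - T" using t ald(3) j0 bj by auto
  qed
  then have "card {al + 1..be - 1} \<le> card ({-j0..j1} - T)" by (intro card_mono) auto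
  then have wh: "w \<le> h + 1" using h ab by (simp add: w_def)
  have w1: "1 \<le> w" using ab by (simp add: w_def)
  have "w * d \<le> (h + 1) * d" using wh d by (intro mult_right_mono) auto
  moreover have "d * (h + 3) = (h + 1) * d + 2 * d" by (simp add: algebra_simps)
  ultimately have wd: "4 * (w * d) + 8 * d \<le> H" using big by linarith
  have wd0: "w * d > 0" using w1 d by simp
  \<comment> \<open>From \<open>u\<close> on, \<open>be + i\<close> exceeds \<open>j1\<close>, so
    the sum gets an index outside \<open>T\<close>.\<close>
  define u where "u = j1 - be + 1"
  \<comment> \<open>The start is moved until its residue is in the lower half of the circle, so that
    \<open>l\<close> further steps and then \<open>w\<close> more do not wrap around.\<close>
  have "\<exists>m\<ge>0. 2 * (d * m) \<le> H + 2 * d \<and> 2 * (((u + m) * d) mod H) \<le> H"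
  proof (cases "2 * ((u * d) mod H) \<le> H")
    case True
    then show ?thesis using H d by (intro exI[of _ 0]) auto
  next
    case False
    define r where "r = (u * d) mod H"
    have r: "0 \<le> r" "r < H" "H < 2 * r" using H False by (auto simp: r_def)
    define m where "m = (H - r) div d + 1"
    have "(H - r) = (H - r) div d * d + (H - r) mod d" "0 \<le> (H - r) mod d" "(H - r) mod d < d" using d by auto
    moreover have "d * m = (H - r) div d * d + d" by (simp add: m_def algebra_simps)
    ultimately have m: "d * m \<le> H - r + d" "H - r < d * m" by linarith+
    have m0: "0 \<le> m" using r d by (simp add: m_def pos_imp_zdiv_nonneg_iff)
    have "((u + m) * d) mod H = (u * d + d * m) mod H" by (simp add: algebra_simps)
    also have "\<dots> = (r + d * m) mod H" by (simp add: r_def mod_add_left_eq)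
    also have "\<dots> = (if r + d * m < H then r + d * m else r + d * m - H)"
      by (rule mod_below_twice) (use m r wd wd0 d in linarith)+
    also have "\<dots> = r + d * m - H" using m by simp
    finally show ?thesis using m m0 r wd wd0 by (intro exI[of _ m]) auto
  qed
  then obtain m where m: "0 \<le> m" "2 * (d * m) \<le> H + 2 * d" "2 * (((u + m) * d) mod H) \<le> H" by blast
  define u' where "u' = u + m"
  define l where "l = H div (4 * d)"
  have "l * (4 * d) \<le> H" unfolding l_def using H d by (metis div_mult_mod_eq le_add_same_cancel1 mult_pos_pos pos_mod_sign zero_less_numeral less_le_trans)
  then have l4: "4 * (d * l) \<le> H" by (simp add: algebra_simps)
  have l0: "0 \<le> l" using H d by (simp add: l_def pos_imp_zdiv_nonneg_iff)
  have "d * (m + l + w) < d * be"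
  proof -
    have "d * (m + l + w) = d * m + d * l + w * d" "d * be = be * d" by (simp_all add: algebra_simps)
    then show ?thesis using m l4 wd bed d by linarith
  qed
  then have fit: "m + l + w < be" using d by simp
  define G where "G = {i\<in>{u'..<u' + l}. i \<in> T \<and> i + w \<in> T}"
  have rng: "-j0 \<le> i" "i \<le> j1" "-j0 \<le> i + w" "i + w \<le> j1" if "i \<in> {u'..<u' + l}" for i
    using that fit j0 w1 m(1) bj by (auto simp: u'_def u_def)
  have "{u'..<u' + l} \<subseteq> G \<union> (({-j0..j1} - T) \<union> (\<lambda>t. t - w) ` ({-j0..j1} - T))"
  proof
    fix i assume i: "i \<in> {u'..<u' + l}"
    have "i \<in> (\<lambda>t. t - w) ` ({-j0..j1} - T)" if "i + w \<notin> T" using that rng[OF i] by (intro image_eqI[of _ _ "i + w"]) auto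
    then show "i \<in> G \<union> (({-j0..j1} - T) \<union> (\<lambda>t. t - w) ` ({-j0..j1} - T))" using i rng[OF i] by (auto simp: G_def)
  qed
  then have "card {u'..<u' + l} \<le> card (G \<union> (({-j0..j1} - T) \<union> (\<lambda>t. t - w) ` ({-j0..j1} - T)))"
    using finT finite_subset[of G T] by (intro card_mono) (auto simp: G_def)
  also have "\<dots> \<le> card G + card (({-j0..j1} - T) \<union> (\<lambda>t. t - w) ` ({-j0..j1} - T))" by (rule card_Un_le)
  also have "\<dots> \<le> card G + (card ({-j0..j1} - T) + card ((\<lambda>t. t - w) ` ({-j0..j1} - T)))"
    by (intro add_left_mono card_Un_le)
  also have "card ((\<lambda>t. t - w) ` ({-j0..j1} - T)) = card ({-j0..j1} - T)" by (simp add: card_image inj_on_def)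
  finally have cG: "l - 2 * h \<le> int (card G)" using h l0 by simp
  define E where "E = (\<lambda>i. (be + i) * d) ` G"
  have in_A: "(t * d) mod H \<in> A" if "t \<in> T" for t using idx[of "t * d"] that by fastforce
  have cop: "H dvd i" if "H dvd i * d" for i
    using that d(2) by (simp add: coprime_dvd_mult_left_iff coprime_commute)
  have l8: "8 * l \<le> H"
  proof -
    have "2 * l \<le> d * l" using d l0 by (intro mult_right_mono) auto
    then show ?thesis using l4 by linarith
  qed
  have m4: "4 * m \<le> H + 4"
  proof (cases "m \<le> 1")
    case False
    then have "2 * (m - 1) \<le> d * (m - 1)" using d by (intro mult_right_mono) auto
    then show ?thesis using m(2) by (simp add: algebra_simps)
  qed (use H in linarith)
  have injG: "i = i'" if "i \<in> G" "i' \<in> G" "H dvd (be + i) * d - (be + i') * d" for i i'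
  proof -
    have e: "(be + i) * d - (be + i') * d = (i - i') * d" by (simp add: algebra_simps)
    have "H dvd i - i'" by (rule cop) (rule that(3)[unfolded e])
    moreover have "\<bar>i - i'\<bar> < H" using that(1,2) l8 H by (auto simp: G_def)
    ultimately have "i - i' = 0" using dvd_imp_le_int[of "i - i'" H] by linarith
    then show ?thesis by simp
  qed
  have "inj_on (\<lambda>z. z mod H) E"
  proof (rule inj_onI)
    fix z z' assume "z \<in> E" "z' \<in> E" "z mod H = z' mod H"
    then obtain i i' where i: "i \<in> G" "i' \<in> G" "z = (be + i) * d" "z' = (be + i') * d" by (auto simp: E_def)
    have "H dvd z - z'" using \<open>z mod H = z' mod H\<close> by (simp only: mod_eq_dvd_iff)
    then have "i = i'" unfolding i(3,4) by (rule injG[OF i(1,2)])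
    then show "z = z'" using i by simp
  qed
  moreover have "card E = card G"
    unfolding E_def
  proof (rule card_image, rule inj_onI)
    fix i i' assume "(be + i) * d = (be + i') * d"
    then show "i = i'" using d by simp
  qed
  then have "H div (4 * d) - 2 * h \<le> int (card E)" using cG by (simp add: l_def)
  moreover have "c mod H \<notin> A \<and> c mod H \<in> A + A \<and> c mod H + H \<in> A + A" if "c \<in> E" for c
  proof -
    obtain i where i: "i \<in> G" "c = (be + i) * d" using \<open>c \<in> E\<close> by (auto simp: E_def)
    have iT: "u' \<le> i" "i < u' + l" "i \<in> T" "i + w \<in> T" using i by (auto simp: G_def)
    define r0 where "r0 = (u' * d) mod H"
    have r0: "0 \<le> r0" "2 * r0 \<le> H" using H m(3) by (auto simp: r0_def u'_def)
    define s where "s = (i - u') * d"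
    have "s \<le> (l - 1) * d" unfolding s_def using iT d by (intro mult_right_mono) auto
    moreover have "(l - 1) * d = d * l - d" by (simp add: algebra_simps)
    ultimately have s: "s \<le> d * l - d" by linarith
    have s0: "0 \<le> s" using iT d by (simp add: s_def)
    define r where "r = r0 + s"
    have r: "0 \<le> r" "r + w * d < H" using r0 s s0 l4 wd d by (auto simp: r_def)
    have im: "(i * d) mod H = r"
    proof -
      have "i * d = u' * d + s" by (simp add: s_def algebra_simps)
      then have "(i * d) mod H = (r0 + s) mod H" by (simp add: r0_def mod_add_left_eq)
      then show ?thesis using r wd0 by (simp add: r_def)
    qed
    have rA: "r \<in> A" using in_A[OF iT(3)] im by simp
    have rwA: "r + w * d \<in> A"
    proof -
      have "((i + w) * d) mod H = (i * d + w * d) mod H" by (simp add: algebra_simps)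
      also have "\<dots> = (r + w * d) mod H" by (simp only: im[symmetric] mod_add_left_eq)
      also have "\<dots> = r + w * d" using r wd0 by simp
      finally show ?thesis using in_A[OF iT(4)] by simp
    qed
    have "(al * d) mod H = al * d" using ald d by simp
    then have alA: "al * d \<in> A" using in_A[OF ald(2)] by simp
    have bw: "be * d = al * d + w * d" by (simp add: w_def algebra_simps)
    then have bw': "be * d - H < w * d" using ald by linarith
    have "(be * d - H) mod H = be * d - H" by (rule mod_pos_pos_trivial) (use bed bw' r in linarith)+
    moreover have "(be * d - H) mod H = (be * d) mod H" using mod_add_self2[of "be * d - H" H] by simp
    ultimately have beA: "be * d - H \<in> A" using in_A[OF bed(2)] by simp
    have "c mod H = (be * d + i * d) mod H" by (simp add: i algebra_simps)
    also have "\<dots> = (be * d + r) mod H" by (simp only: im[symmetric] mod_add_right_eq)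
    also have "\<dots> = (be * d - H + r) mod H"
      using mod_add_self2[of "be * d - H + r" H] by (simp add: algebra_simps)
    also have "\<dots> = be * d - H + r" by (rule mod_pos_pos_trivial) (use bed bw' r in linarith)+
    finally have cm: "c mod H = (be * d - H) + r" .
    have cm': "c mod H + H = al * d + (r + w * d)" using cm bw by simp
    have "c mod H \<in> A + A" "c mod H + H \<in> A + A"
      unfolding cm' by (simp only: cm, rule plusI[OF beA rA], rule plusI[OF alA rwA])
    moreover have "c mod H \<notin> A"
    proof
      assume "c mod H \<in> A"
      then obtain t where t: "t \<in> T" "H dvd c - t * d" using idx[of c] by blast
      have e: "c - t * d = (be + i - t) * d" by (simp add: i algebra_simps)
      have "H dvd be + i - t" by (rule cop) (rule t(2)[unfolded e])
      moreover have "-j0 \<le> t" "t \<le> j1" using t T(1) by auto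
      then have "0 < be + i - t" "be + i - t < H"
        using iT m(1) m4 l8 span by (auto simp: u'_def u_def)
      ultimately show False using zdvd_imp_le by fastforce
    qed
    ultimately show ?thesis by blast
  qed
  ultimately show ?thesis by (rule that)
qed

text \<open>Nonnegative indices are placed upwards from \<open>0\<close> and nonpositive ones
  downwards from \<open>H\<close>; index \<open>0\<close> serves both, whence
  \<open>j0 + j1 + 2\<close>. Sums of different kinds differ by multiples of \<open>H\<close> on top
  of index differences below \<open>H\<close>; since \<open>d\<close> is coprime to
  \<open>H\<close>, they cannot coincide.\<close>

lemma progression_bi_covered:
  assumes H: "0 < H" and d: "1 \<le> d" "coprime d H" and j: "0 \<le> j0" "0 \<le> j1" "j0 * d < H" "j1 * d < H" "2 * j0 + 2 * j1 < H"
    and A: "A \<subseteq> {0..H}" "0 \<in> A" "H \<in> A" and idx: "\<And>a. a \<in> A \<Longrightarrow> \<exists>t. -j0 \<le> t \<and> t \<le> j1 \<and> H dvd a - t * d"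
    and m: "j0 + j1 + 2 \<le> m"
  shows "bi_covered A m"
proof -
  define I where "I = prog d 0 (j1 + 1)"
  define J where "J = prog d (H - j0 * d) (j0 + 1)"
  have I: "\<exists>s. 0 \<le> s \<and> s \<le> j1 \<and> z = s * d" if "z \<in> I" for z using that by (auto simp: I_def prog_def)
  have I': "s * d \<in> I" if "0 \<le> s" "s \<le> j1" for s using that by (auto simp: I_def prog_def)
  have J: "\<exists>s. -j0 \<le> s \<and> s \<le> 0 \<and> z = H + s * d" if "z \<in> J" for z
  proof -
    obtain i where i: "0 \<le> i" "i < j0 + 1" "z = H - j0 * d + i * d" using \<open>z \<in> J\<close> by (auto simp: J_def prog_def)
    then show ?thesis by (intro exI[of _ "i - j0"]) (auto simp: algebra_simps)
  qed
  have J': "H + s * d \<in> J" if "-j0 \<le> s" "s \<le> 0" for s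
    using that unfolding J_def prog_def by (auto simp: algebra_simps intro!: exI[of _ "j0 + s"])
  have apart: False if "s * d = s' * d + i * H" "1 \<le> i" "s - s' < H" "s' - s < H" for s s' i
  proof -
    have e: "(s - s') * d = H * i" using that(1) by (simp add: algebra_simps)
    then have "H dvd (s - s') * d" by simp
    then have "H dvd s - s'" using d(2) by (simp add: coprime_dvd_mult_left_iff coprime_commute)
    then have "s - s' = 0" using that(3,4) dvd_imp_le_int[of "s - s'" H] by linarith
    then show False using e that(2) H by simp
  qed
  have II: "\<exists>s. 0 \<le> s \<and> s \<le> 2 * j1 \<and> z = s * d" if "z \<in> I + I" for z
  proof -
    obtain u v where "u \<in> I" "v \<in> I" "z = u + v" using \<open>z \<in> I + I\<close> by (auto simp: set_plus_def)
    then obtain s t where "0 \<le> s" "s \<le> j1" "u = s * d" "0 \<le> t" "t \<le> j1" "v = t * d" using I by blast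
    then show ?thesis using \<open>z = u + v\<close> by (intro exI[of _ "s + t"]) (auto simp: algebra_simps)
  qed
  have IJ: "\<exists>s. -j0 \<le> s \<and> s \<le> j1 \<and> z = H + s * d" if "z \<in> I + J" for z
  proof -
    obtain u v where "u \<in> I" "v \<in> J" "z = u + v" using \<open>z \<in> I + J\<close> by (auto simp: set_plus_def)
    then obtain s t where "0 \<le> s" "s \<le> j1" "u = s * d" "-j0 \<le> t" "t \<le> 0" "v = H + t * d" using I J by blast
    then show ?thesis using \<open>z = u + v\<close> by (intro exI[of _ "s + t"]) (auto simp: algebra_simps)
  qed
  have JJ: "\<exists>s. -(2 * j0) \<le> s \<and> s \<le> 0 \<and> z = 2 * H + s * d" if "z \<in> J + J" for z
  proof -
    obtain u v where "u \<in> J" "v \<in> J" "z = u + v" using \<open>z \<in> J + J\<close> by (auto simp: set_plus_def)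
    then obtain s t where "-j0 \<le> s" "s \<le> 0" "u = H + s * d" "-j0 \<le> t" "t \<le> 0" "v = H + t * d" using J by blast
    then show ?thesis using \<open>z = u + v\<close> by (intro exI[of _ "s + t"]) (auto simp: algebra_simps)
  qed
  have "(I + I) \<inter> (I + J) = {}"
  proof -
    have False if z: "z \<in> I + I" "z \<in> I + J" for z
    proof -
      obtain s t where "0 \<le> s" "s \<le> 2 * j1" "z = s * d" "-j0 \<le> t" "t \<le> j1" "z = H + t * d" using II[OF z(1)] IJ[OF z(2)] by blast
      then show False using j by (intro apart[of s t 1]) linarith+
    qed
    then show ?thesis by blast
  qed
  moreover have "(I + I) \<inter> (J + J) = {}"
  proof -
    have False if z: "z \<in> I + I" "z \<in> J + J" for z
    proof -
      obtain s t where "0 \<le> s" "s \<le> 2 * j1" "z = s * d" "-(2 * j0) \<le> t" "t \<le> 0" "z = 2 * H + t * d" using II[OF z(1)] JJ[OF z(2)] by blast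
      then show False using j by (intro apart[of s t 2]) linarith+
    qed
    then show ?thesis by blast
  qed
  moreover have "(I + J) \<inter> (J + J) = {}"
  proof -
    have False if z: "z \<in> I + J" "z \<in> J + J" for z
    proof -
      obtain s t where "-j0 \<le> s" "s \<le> j1" "z = H + s * d" "-(2 * j0) \<le> t" "t \<le> 0" "z = 2 * H + t * d" using IJ[OF z(1)] JJ[OF z(2)] by blast
      then show False using j by (intro apart[of s t 1]) linarith+
    qed
    then show ?thesis by blast
  qed
  moreover have HJ: "H \<in> J" using J'[of 0] j by simp
  moreover have "0 \<in> I" using I'[of 0] j by simp
  moreover have "A \<subseteq> I \<union> J"
  proof
    fix a assume a: "a \<in> A"
    obtain t i where t: "-j0 \<le> t" "t \<le> j1" "a - t * d = H * i" using idx[OF a] by (auto simp: dvd_def)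
    have a': "0 \<le> a" "a \<le> H" using a A by auto
    show "a \<in> I \<union> J"
    proof (cases "a = H")
      case True
      then show ?thesis using HJ by simp
    next
      case False
      show ?thesis
      proof (cases "0 \<le> t")
        case True
        have "t * d \<le> j1 * d" using t d by (intro mult_right_mono) auto
        moreover have "0 \<le> t * d" using True d by simp
        ultimately have "\<bar>a - t * d\<bar> < H" using a' False j by auto
        then have "a - t * d = 0" using t(3) dvd_imp_le_int[of "a - t * d" H] by fastforce
        then show ?thesis using I'[OF True t(2)] by simp
      next
        case tn: False
        have "(- j0) * d \<le> t * d" using t d by (intro mult_right_mono) auto
        moreover have "t * d < 0" using tn d by (simp add: mult_neg_pos)
        ultimately have "\<bar>a - (H + t * d)\<bar> < H" using a' False j by auto
        moreover have "a - (H + t * d) = H * (i - 1)" using t(3) by (simp add: algebra_simps)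
        ultimately have "a - (H + t * d) = 0" using dvd_imp_le_int[of "a - (H + t * d)" H] by fastforce
        then show ?thesis using J'[of t] t(1) tn by simp
      qed
    qed
  qed
  moreover have "A \<inter> I \<noteq> {}" "A \<inter> J \<noteq> {}" using \<open>0 \<in> I\<close> HJ A(2,3) by blast+
  moreover have "0 \<le> H - j0 * d" "1 \<le> j1 + 1" "1 \<le> j0 + 1" "(j1 + 1) + (j0 + 1) \<le> m" using j m by linarith+
  ultimately have core: "1 \<le> d \<and> 0 \<le> (0::int) \<and> 0 \<le> H - j0 * d \<and> 1 \<le> j1 + 1 \<and> 1 \<le> j0 + 1 \<and> (j1 + 1) + (j0 + 1) \<le> m \<and>
     A \<subseteq> I \<union> J \<and> A \<inter> I \<noteq> {} \<and> A \<inter> J \<noteq> {} \<and> (I + I) \<inter> (I + J) = {} \<and> (I + I) \<inter> (J + J) = {} \<and> (I + J) \<inter> (J + J) = {}"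
    using d(1) by blast
  show ?thesis unfolding bi_covered_def
    by (rule exI[of _ d], rule exI[of _ 0], rule exI[of _ "j1 + 1"], rule exI[of _ "H - j0 * d"],
        rule exI[of _ "j0 + 1"], rule core[unfolded I_def J_def])
qed

section \<open>S as a single progression modulo H\<close>

context small_atom begin

definition eps where "eps = C5 * x"

lemma eps: "100 * (c * eps) \<le> H" "4800 * eps \<le> c * eps" "1000 * x \<le> eps" "c \<le> eps" "c \<le> c * eps" "d * eps \<le> 8 * (c * eps)"
proof -
  show "100 * (c * eps) \<le> H" using x_small by (simp add: eps_def)
  show "4800 * eps \<le> c * eps" using cC5x by (simp add: eps_def)
  have "c * 1 \<le> c * x" "4800 * x \<le> c * x" using c_ge x2 by (auto intro: mult_left_mono mult_right_mono)
  then show 1: "1000 * x \<le> eps" "c \<le> eps" using cx_le x2 unfolding eps_def by linarith+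
  then have "0 \<le> eps" using x2 by linarith
  then have "d * eps \<le> 8 * c * eps" using d_le by (intro mult_right_mono) auto
  then show "d * eps \<le> 8 * (c * eps)" by (simp only: mult.assoc)
  have "1 \<le> eps" using 1 x2 by linarith
  then have "c * 1 \<le> c * eps" using c_ge by (intro mult_left_mono) auto
  then show "c \<le> c * eps" by simp
qed

text \<open>\<open>W\<close> collects the elements of \<open>S\<close> in classes without a right
  end; there every place outside \<open>S\<close> is a hole, so these classes are full up to
  \<open>eps\<close>. Right ends being unique, the rest \<open>V\<close> lies in one class, and
  minimality of \<open>kap\<close> tested on the multiples of \<open>g\<close> makes
  \<open>V\<close> small. A multiple \<open>t\<close> of \<open>g\<close> near \<open>H / 2\<close>
  is then an almost period, against \<open>rotation_growth\<close>.\<close>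

lemma classes_have_right_end: assumes "s \<in> S" shows "\<exists>e. right_end e \<and> g dvd s - e"
proof (rule ccontr)
  assume no: "\<not> ?thesis"
  define W where "W = {s \<in> S. \<forall>e. right_end e \<longrightarrow> \<not> g dvd s - e}"
  define Wc where "Wc = {z. \<exists>s\<in>W. g dvd z - s}"
  have sW: "s \<in> W" using assms no by (auto simp: W_def)
  have sh: "g dvd z + H - e \<longleftrightarrow> g dvd z - e" for z e
    using dvd_add_left_iff[OF g_dvd(2), of "z - e"] by (simp add: algebra_simps)
  have perW: "per H W" unfolding per_def W_def using S_shift sh by simp
  have perWc: "per H Wc" unfolding per_def Wc_def using sh by simp
  have Wc_W: "z \<in> W" if "z \<in> Wc" "z \<in> S" for z
  proof -
    obtain r where r: "r \<in> W" "g dvd z - r" using \<open>z \<in> Wc\<close> by (auto simp: Wc_def)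
    have "\<not> g dvd z - e" if "right_end e" for e
    proof
      assume "g dvd z - e"
      then have "g dvd (z - e) - (z - r)" using r(2) by (rule dvd_diff)
      then show False using r(1) that by (auto simp: W_def)
    qed
    then show ?thesis using \<open>z \<in> S\<close> by (simp add: W_def)
  qed
  have Wc_Hl: "z \<in> Hl" if "z \<in> Wc" "z \<notin> S" for z
  proof -
    obtain r where r: "r \<in> W" "g dvd z - r" using \<open>z \<in> Wc\<close> by (auto simp: Wc_def)
    obtain s' i where s': "s' \<in> S" "i \<ge> 1" "z = s' + i * d" "g dvd s' - r" using class_chain[of r z] r by (auto simp: W_def)
    have "\<not> right_end (z - j * d)" for j
    proof
      assume re: "right_end (z - j * d)"
      have "g dvd j * d" using g_dvd(1) by (rule dvd_mult)
      then have "g dvd j * d - (z - r)" using r(2) by (rule dvd_diff)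
      then have "g dvd r - (z - j * d)" by (simp add: algebra_simps)
      then show False using r(1) re by (auto simp: W_def)
    qed
    then show ?thesis using hole_in_chain[OF \<open>z \<notin> S\<close> s'(1,3,2)] by blast
  qed
  have szWc: "sz H Wc \<le> sz H W + eps"
  proof -
    have "Wc \<subseteq> W \<union> Hl" using Wc_W Wc_Hl by blast
    then show ?thesis using sz_mono[of Wc "W \<union> Hl" H] sz_Un_le[of H W Hl] holes_le unfolding eps_def by linarith
  qed
  define V where "V = S - W"
  have WS: "W \<subseteq> S" by (auto simp: W_def)
  have szV: "sz H V = n - sz H W" using sz_Diff[of H S W] WS szS by (simp add: V_def Int_absorb1)
  have perV: "per H V" unfolding V_def by (rule per_Diff[OF perS perW])
  have g_eps: "16 * g \<le> H"
  proof -
    have "16 * g \<le> 128 * c" using g_le by simp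
    also have "\<dots> \<le> 4800 * eps" using eps(4) c_ge by linarith
    finally show ?thesis using eps(1,2,4) c_ge by linarith
  qed
  have V_small: "sz H V \<le> 2 * eps"
  proof (cases "V = {}")
    case True
    then show ?thesis using eps(3) x2 by simp
  next
    case False
    then obtain v e where v: "v \<in> V" "right_end e" "g dvd v - e" by (auto simp: V_def W_def)
    define Y where "Y = {z. g dvd z}"
    define hg where "hg = H div g"
    have szY: "sz H Y = hg" unfolding Y_def hg_def using sz_multiples[OF _ g_dvd(2) Hpos] g_pos by simp
    have perY: "per H Y" unfolding per_def Y_def using dvd_add_left_iff[OF g_dvd(2)] by simp
    have ghg: "g * hg = H" using g_dvd(2) by (simp add: hg_def)
    have "Y + S \<subseteq> Wc \<union> tr e Y"
    proof
      fix z assume "z \<in> Y + S"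
      then obtain u where "g dvd u" "z - u \<in> S" by (auto simp: in_plus Y_def)
      then obtain r where r: "g dvd z - r" "r \<in> S" by (metis diff_diff_eq2 add_diff_cancel_left')
      show "z \<in> Wc \<union> tr e Y"
      proof (cases "r \<in> W")
        case True
        then show ?thesis using r(1) by (auto simp: Wc_def)
      next
        case False
        then obtain e' where e': "right_end e'" "g dvd r - e'" using r(2) by (auto simp: W_def)
        have "g dvd e' - e" using right_end_unique[OF e'(1) v(2)] g_dvd(2) dvd_trans by blast
        then have "g dvd (z - r) + ((r - e') + (e' - e))" using r(1) e'(2) by (intro dvd_add)
        then show ?thesis by (simp add: Y_def)
      qed
    qed
    then have YS: "sz H (Y + S) \<le> sz H W + eps + hg"
      using sz_mono[of "Y + S" "Wc \<union> tr e Y" H] sz_Un_le[of H Wc "tr e Y"] szWc sz_tr[OF Hpos perY] szY by simp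
    have kx: "k \<le> x" using x_ge by (simp add: k_def)
    show ?thesis
    proof (cases "sz H (Y + S) \<le> H - k")
      case True
      have "k \<le> hg"
      proof (rule ccontr)
        assume "\<not> k \<le> hg"
        then have "g * hg < g * x" using kx g_pos by simp
        also have "g * x \<le> 8 * c * x" using g_le x2 by (intro mult_right_mono) auto
        finally show False using ghg cx_H by simp
      qed
      then have "adm Y" using True perY szY by (simp add: adm_def)
      from adm_kap[OF this] have "hg + kap \<le> sz H (Y + S)" by (simp only: szY)
      then show ?thesis using YS kap_ge szV eps(3) x2 by linarith
    next
      \<comment> \<open>Here \<open>g\<close> is at least 2, so \<open>hg\<close> is at most
        \<open>H / 2\<close>, and the large sum forces \<open>W\<close> alone to have nearly
        \<open>n\<close> elements.\<close>
      case big: False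
      have "g \<noteq> 1" using sW v(2) by (auto simp: W_def)
      then have "2 * hg \<le> g * hg" using g_pos szY sz_nonneg[of H Y] by (intro mult_right_mono) auto
      then have "2 * hg \<le> H" using ghg by linarith
      then show ?thesis using big YS szV H_ge b0 kx eps(3) x2 by linarith
    qed
  qed
  \<comment> \<open>Multiples of \<open>g\<close> preserve classes, so the translate of
    \<open>S\<close> leaves \<open>S\<close> only into holes or from \<open>V\<close>.\<close>
  define t where "t = g * (H div (2 * g))"
  have "p t \<le> 3 * eps"
  proof -
    have "tr t S - S \<subseteq> Hl \<union> tr t V"
    proof
      fix z assume z: "z \<in> tr t S - S"
      show "z \<in> Hl \<union> tr t V"
      proof (cases "z - t \<in> W")
        case True
        have "g dvd z - (z - t)" by (simp add: t_def)
        then have "z \<in> Wc" using True unfolding Wc_def by blast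
        then show ?thesis using Wc_Hl z by blast
      next
        case False
        then show ?thesis using z by (simp add: V_def)
      qed
    qed
    then have "p t \<le> sz H Hl + sz H (tr t V)" unfolding p_def using sz_mono[of "tr t S - S" "Hl \<union> tr t V" H] sz_Un_le[of H Hl "tr t V"] by linarith
    then show ?thesis using holes_le V_small sz_tr[OF Hpos perV, of t] unfolding eps_def by linarith
  qed
  then have "c * p t \<le> c * (3 * eps)" using c_ge by (intro mult_left_mono) auto
  also have "c * (3 * eps) = 3 * (c * eps)" by simp
  finally have "c * p t \<le> 3 * (c * eps)" .
  moreover have "2 * t \<le> H" "H < 2 * t + 2 * g"
  proof -
    have "H = 2 * g * (H div (2 * g)) + H mod (2 * g)" by simp
    moreover have "2 * g * (H div (2 * g)) = 2 * t" by (simp add: t_def)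
    moreover have "0 \<le> H mod (2 * g)" "H mod (2 * g) < 2 * g" using g_pos by auto
    ultimately show "2 * t \<le> H" "H < 2 * t + 2 * g" by linarith+
  qed
  moreover have "1 \<le> t" using \<open>H < 2 * t + 2 * g\<close> g_eps g_pos by linarith
  then have "t < c * p t" using \<open>2 * t \<le> H\<close> by (rule rotation_growth)
  ultimately show False using g_le eps(1,5) c_ge by linarith
qed

definition e0 where "e0 = (SOME e. right_end e)"

lemma e0: "right_end e0"
proof -
  obtain e where "right_end e" using classes_have_right_end[OF S0] by blast
  then show ?thesis unfolding e0_def by (rule someI)
qed

text \<open>All of \<open>S\<close> lies in the class of the unique right end. As \<open>0\<close>
  is in \<open>S\<close>, every element of \<open>A\<close> is a multiple of \<open>g\<close>, so
  \<open>g = 1\<close>.\<close>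

lemma cop: "coprime d H"
proof -
  have end_class: "g dvd s - e0" if "s \<in> S" for s
  proof -
    obtain e where e: "right_end e" "g dvd s - e" using classes_have_right_end[OF \<open>s \<in> S\<close>] by blast
    have "g dvd e - e0" using right_end_unique[OF e(1) e0] g_dvd(2) dvd_trans by blast
    then have "g dvd (s - e) + (e - e0)" using e(2) by (intro dvd_add)
    then show ?thesis by simp
  qed
  have "g dvd a" if "a \<in> A" for a
  proof -
    have "a \<in> S" using that A_sub_S by blast
    from dvd_diff[OF end_class[OF this] end_class[OF S0]] show ?thesis by simp
  qed
  then have "g dvd 1" by (rule gcdA)
  then have "gcd d H = 1" using g_pos unfolding g_def zdvd1_eq by linarith
  then show ?thesis by (simp only: coprime_iff_gcd_eq_1)
qed

lemma index_exists: "\<exists>j\<in>{0..<H}. H dvd z - (e - j * d)"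
proof -
  have "gcd d H = 1" using cop by (simp only: coprime_iff_gcd_eq_1)
  then obtain u v where uv: "u * d + v * H = 1" using bezout_int[of d H] by metis
  define j where "j = (u * (e - z)) mod H"
  have "H dvd u * (e - z) - j" by (simp add: j_def mod_eq_dvd_iff[symmetric])
  then obtain i where i: "u * (e - z) - j = H * i" by auto
  have "e - z = (u * d + v * H) * (e - z)" using uv by simp
  also have "\<dots> = (u * (e - z)) * d + H * (v * (e - z))" by (simp add: algebra_simps)
  also have "u * (e - z) = j + H * i" using i by simp
  also have "(j + H * i) * d + H * (v * (e - z)) = j * d + H * (i * d + v * (e - z))" by (simp add: algebra_simps)
  finally obtain w where "e - z = j * d + H * w" by blast
  then have "z - (e - j * d) = H * (- w)" by simp
  then show ?thesis using Hpos by (intro bexI[of _ j]) (auto simp: j_def)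
qed

lemma index_unique: assumes "H dvd i * d - j * d" "\<bar>i - j\<bar> < H" shows "i = j"
proof -
  have "H dvd (i - j) * d" using assms(1) by (simp only: left_diff_distrib)
  then have "H dvd i - j" using cop by (simp add: coprime_dvd_mult_left_iff coprime_commute)
  then have "i - j = 0" using assms(2) dvd_imp_le_int[of "i - j" H] by linarith
  then show ?thesis by simp
qed

lemma inj_index: assumes "\<And>i j. i \<in> F \<Longrightarrow> j \<in> F \<Longrightarrow> \<bar>i - j\<bar> < H"
  shows "inj_on (\<lambda>z. z mod H) ((\<lambda>j. e - j * d) ` F)" "inj_on (\<lambda>j. e - j * d) F"
proof -
  show "inj_on (\<lambda>z. z mod H) ((\<lambda>j. e - j * d) ` F)"
  proof (rule inj_onI)
    fix z z' assume "z \<in> (\<lambda>j. e - j * d) ` F" "z' \<in> (\<lambda>j. e - j * d) ` F" "z mod H = z' mod H"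
    then obtain i j where ij: "i \<in> F" "j \<in> F" "z = e - i * d" "z' = e - j * d" "H dvd z - z'" by (auto simp: mod_eq_dvd_iff)
    have "z - z' = j * d - i * d" using ij by simp
    then have "j = i" using ij assms by (intro index_unique) auto
    then show "z = z'" using ij by simp
  qed
  show "inj_on (\<lambda>j. e - j * d) F" using d_pos by (auto simp: inj_on_def)
qed

text \<open>Indices run backwards from the right end \<open>e0\<close>, because \<open>S\<close>
  stops after it.\<close>

definition T0 where "T0 = {j\<in>{0..<H}. e0 - j * d \<in> S}"
definition lam where "lam = Max T0"
definition nh where "nh = int (card ({0..lam} - T0))"

lemma T0: "finite T0" "0 \<in> T0" "lam \<in> T0" "T0 \<subseteq> {0..lam}" "lam < H" "0 \<le> lam"
proof -
  show f: "finite T0" by (rule finite_subset[of _ "{0..<H}"]) (auto simp: T0_def)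
  show z: "0 \<in> T0" using e0 Hpos by (simp add: T0_def right_end_def)
  show l: "lam \<in> T0" unfolding lam_def using f z by (intro Max_in) auto
  then show "lam < H" "0 \<le> lam" by (auto simp: T0_def)
  show "T0 \<subseteq> {0..lam}" using f by (auto simp: lam_def T0_def)
qed

lemma T0_index: "z \<in> S \<longleftrightarrow> (\<exists>j\<in>T0. H dvd z - (e0 - j * d))"
proof
  assume z: "z \<in> S"
  obtain j where j: "j \<in> {0..<H}" "H dvd z - (e0 - j * d)" using index_exists by blast
  then have "e0 - j * d \<in> S" using per_cong[OF perS] z by blast
  then show "\<exists>j\<in>T0. H dvd z - (e0 - j * d)" using j by (auto simp: T0_def)
next
  assume "\<exists>j\<in>T0. H dvd z - (e0 - j * d)"
  then show "z \<in> S" using per_cong[OF perS] by (auto simp: T0_def)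
qed

lemma cardT0: "int (card T0) = n"
proof (rule antisym)
  have "int (card ((\<lambda>j. e0 - j * d) ` T0)) \<le> sz H S"
    by (rule sz_ge(1)[OF Hpos perS]) (auto simp: T0_def intro!: inj_index)
  moreover have "card ((\<lambda>j. e0 - j * d) ` T0) = card T0" by (intro card_image inj_index(2)) (auto simp: T0_def)
  ultimately show "int (card T0) \<le> n" using szS by simp
  have "sz H S \<le> int (card ((\<lambda>j. e0 - j * d) ` T0))"
    by (rule sz_le[OF Hpos]) (use T0(1) T0_index in blast)+
  moreover have "card ((\<lambda>j. e0 - j * d) ` T0) \<le> card T0" by (rule card_image_le[OF T0(1)])
  ultimately show "n \<le> int (card T0)" using szS by simp
qed

lemma lam_eq: "lam + 1 = n + nh"
proof -
  have "card {0..lam} = card T0 + card ({0..lam} - T0)"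
    using card_Diff_subset[OF T0(1,4)] card_mono[OF _ T0(4)] by simp
  then show ?thesis using cardT0 T0(6) by (simp add: nh_def)
qed

text \<open>The chain from index \<open>lam\<close> down to index \<open>0\<close> reaches its only
  right end at the very end, so \<open>hole_in_chain\<close> turns each missing index into an
  element of \<open>Hl\<close>.\<close>

lemma nh_le: "0 \<le> nh" "nh \<le> eps"
proof -
  show "0 \<le> nh" by (simp add: nh_def)
  have per: "per H Hl" by (simp add: per_def Hl_def S_shift S_shift2)
  have "(\<lambda>j. e0 - j * d) ` ({0..lam} - T0) \<subseteq> Hl"
  proof
    fix z assume "z \<in> (\<lambda>j. e0 - j * d) ` ({0..lam} - T0)"
    then obtain j where j: "0 \<le> j" "j \<le> lam" "j \<notin> T0" "z = e0 - j * d" by auto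
    have zS: "z \<notin> S" using j T0(5) by (auto simp: T0_def)
    have "j \<noteq> lam" using j T0(3) by auto
    show "z \<in> Hl"
    proof (rule hole_in_chain[OF zS, of "e0 - lam * d" "lam - j"])
      show "e0 - lam * d \<in> S" using T0(3) by (simp add: T0_def)
      show "z = e0 - lam * d + (lam - j) * d" using j by (simp add: algebra_simps)
      show "lam - j \<ge> 1" using j \<open>j \<noteq> lam\<close> by simp
      fix i assume i: "1 \<le> i" "i \<le> lam - j"
      show "\<not> right_end (z - i * d)"
      proof
        assume "right_end (z - i * d)"
        then have "H dvd (z - i * d) - e0" using e0 by (rule right_end_unique)
        moreover have "(z - i * d) - e0 = 0 * d - (j + i) * d" using j by (simp add: algebra_simps)
        ultimately have "0 = j + i" using i j T0(5) by (intro index_unique) auto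
        then show False using i j by simp
      qed
    qed
  qed
  then have "int (card ((\<lambda>j. e0 - j * d) ` ({0..lam} - T0))) \<le> sz H Hl"
    by (rule sz_ge(1)[OF Hpos per _ inj_index(1)]) (use T0(5) in auto)
  moreover have "card ((\<lambda>j. e0 - j * d) ` ({0..lam} - T0)) = card ({0..lam} - T0)"
    by (intro card_image inj_index(2)) (use T0(5) in auto)
  ultimately show "nh \<le> eps" using holes_le by (simp add: nh_def eps_def)
qed

end

section \<open>No wrapping, and exact counts of holes\<close>

context small_atom begin

lemma new_in_D:
  assumes "inj_on (\<lambda>z. z mod H) E" "E \<subseteq> D - S" shows "int (card E) \<le> 2 * x"
proof -
  have "int (card E) \<le> sz H (D - S)" by (rule sz_ge(1)[OF Hpos per_Diff[OF perD perS] assms(2,1)])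
  also have "\<dots> = sz H D - n" using sz_Diff[of H D S] S_sub_D szS by (simp add: Int_absorb1)
  finally show ?thesis using szD_le x_ge by linarith
qed

lemma steps_long: "4 * (d * (nh + 3)) \<le> H" "H div (4 * d) - 2 * nh > 2 * x" "8 * (lam + 3) \<le> 5 * H"
proof -
  have e3: "3 \<le> eps" using eps(3) x2 by linarith
  have "d * (nh + 3) \<le> d * (2 * eps)" using nh_le e3 d_pos by (intro mult_left_mono) auto
  moreover have "d * (2 * eps) = 2 * (d * eps)" by simp
  ultimately show "4 * (d * (nh + 3)) \<le> H" using eps(1,5,6) c_ge by linarith
  have "(3 * eps) * (4 * d) = 12 * (d * eps)" by simp
  then have "(3 * eps) * (4 * d) \<le> H" using eps(1,5,6) c_ge by linarith
  then have "(3 * eps) * (4 * d) div (4 * d) \<le> H div (4 * d)" using d_pos by (intro zdiv_mono1) auto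
  then have "3 * eps \<le> H div (4 * d)" using d_pos by simp
  then show "H div (4 * d) - 2 * nh > 2 * x" using nh_le eps(3) x2 by linarith
  have "8 * (lam + 3) = 8 * lam + 24" by simp
  then show "8 * (lam + 3) \<le> 5 * H" using lam_eq nh_le H_ge b0 eps(1,2) e3 by linarith
qed

definition i0 where "i0 = (SOME j. j \<in> T0 \<and> H dvd 0 - (e0 - j * d))"

lemma i0: "i0 \<in> T0" "H dvd e0 - i0 * d" "0 \<le> i0" "i0 \<le> lam"
proof -
  have "\<exists>j. j \<in> T0 \<and> H dvd 0 - (e0 - j * d)" using T0_index[of 0] S0 by blast
  then have "i0 \<in> T0 \<and> H dvd 0 - (e0 - i0 * d)" unfolding i0_def by (rule someI_ex)
  then show "i0 \<in> T0" "H dvd e0 - i0 * d" by (simp_all only: diff_0 dvd_minus_iff)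
  then show "0 \<le> i0" "i0 \<le> lam" using T0(4) by auto
qed

text \<open>Indices recentred at the residue \<open>0\<close>: \<open>z\<close> has index
  \<open>t\<close> when it is congruent to \<open>t * d\<close>, so indices add as residues
  do.\<close>

definition Tc where "Tc = (\<lambda>j. i0 - j) ` T0"

lemma Tc: "Tc \<subseteq> {-(lam - i0)..i0}" "0 \<in> Tc" "i0 \<in> Tc" "-(lam - i0) \<in> Tc"
  "int (card ({-(lam - i0)..i0} - Tc)) = nh"
proof -
  show "Tc \<subseteq> {-(lam - i0)..i0}" "0 \<in> Tc" "i0 \<in> Tc" "-(lam - i0) \<in> Tc" using T0 i0(1) by (auto simp: Tc_def image_iff)
  have "{-(lam - i0)..i0} - Tc = (\<lambda>j. i0 - j) ` ({0..lam} - T0)"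
  proof
    show "{-(lam - i0)..i0} - Tc \<subseteq> (\<lambda>j. i0 - j) ` ({0..lam} - T0)"
    proof
      fix t assume "t \<in> {-(lam - i0)..i0} - Tc"
      then show "t \<in> (\<lambda>j. i0 - j) ` ({0..lam} - T0)" by (intro image_eqI[of _ _ "i0 - t"]) (auto simp: Tc_def image_iff)
    qed
  qed (auto simp: Tc_def)
  then show "int (card ({-(lam - i0)..i0} - Tc)) = nh" by (simp add: nh_def card_image inj_on_def)
qed

lemma Tc_index: "z \<in> S \<longleftrightarrow> (\<exists>t\<in>Tc. H dvd z - t * d)"
proof -
  have "H dvd z - (e0 - j * d) \<longleftrightarrow> H dvd z - (i0 - j) * d" for j
  proof -
    have e: "z - (i0 - j) * d = (z - (e0 - j * d)) + (e0 - i0 * d)" by (simp add: algebra_simps)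
    show ?thesis unfolding e dvd_add_left_iff[OF i0(2)] by (rule refl)
  qed
  then show ?thesis unfolding T0_index Tc_def by simp
qed

lemma d_ge_2: assumes "H \<le> j * d" "j \<le> lam" shows "2 \<le> d"
proof (rule ccontr)
  assume "\<not> 2 \<le> d"
  then have "d = 1" using d_pos by linarith
  then show False using assms T0(5) by simp
qed

text \<open>Wrapping would put more than \<open>2 * x\<close> residues into \<open>D\<close> outside
  \<open>S\<close>, against \<open>szD_le\<close>.\<close>

lemma no_wrap_right: "i0 * d < H"
proof (rule ccontr)
  assume "\<not> i0 * d < H"
  then have wr: "H \<le> i0 * d" by simp
  obtain E where E: "inj_on (\<lambda>z. z mod H) E" "H div (4 * d) - 2 * nh \<le> int (card E)"
    "\<And>c. c \<in> E \<Longrightarrow> c mod H \<notin> A \<and> c mod H \<in> A + A \<and> c mod H + H \<in> A + A"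
  proof (rule wrapping_progression[OF A0 AH Hpos d_ge_2[OF wr i0(4)] cop _ Tc(1-3)])
    show "z mod H \<in> A \<longleftrightarrow> (\<exists>t\<in>Tc. H dvd z - t * d)" for z using Tc_index[of z] by (simp add: S_def)
    show "0 \<le> lam - i0" using i0(4) by simp
    show "int (card ({-(lam - i0)..i0} - Tc)) \<le> nh" using Tc(5) by simp
    show "4 * (d * (nh + 3)) \<le> H" by (rule steps_long)
    show "8 * (lam - i0 + i0 + 3) \<le> 5 * H" using steps_long(3) by simp
    show "H \<le> i0 * d" by (rule wr)
  qed blast
  have "E \<subseteq> D - S" using E(3) by (auto simp: D_def S_def)
  then show False using new_in_D[OF E(1)] E(2) steps_long(2) by linarith
qed

text \<open>The reflection of \<open>a\<close> to \<open>H - a\<close> exchanges the two directions,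
  so the same count applies.\<close>

lemma no_wrap_left: "(lam - i0) * d < H"
proof (rule ccontr)
  assume "\<not> (lam - i0) * d < H"
  then have wr: "H \<le> (lam - i0) * d" by simp
  define A' where "A' = (\<lambda>a. H - a) ` A"
  define T' where "T' = uminus ` Tc"
  have A'_iff: "z mod H \<in> A' \<longleftrightarrow> - z \<in> S" for z
  proof (cases "z mod H = 0")
    case True
    then have "H dvd - z" by auto
    then have "- z \<in> S" using A0 by (simp add: S_def dvd_eq_mod_eq_0)
    moreover have "z mod H \<in> A'" unfolding True A'_def using AH by (intro image_eqI[of _ _ H]) auto
    ultimately show ?thesis by simp
  next
    case False
    then have "(- z) mod H = H - z mod H" by (simp add: zmod_zminus1_eq_if)
    then have "- z \<in> S \<longleftrightarrow> H - z mod H \<in> A" by (simp add: S_def)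
    moreover have "z mod H \<in> A' \<longleftrightarrow> H - z mod H \<in> A" by (auto simp: A'_def image_iff intro: bexI[of _ "H - z mod H"])
    ultimately show ?thesis by simp
  qed
  have T': "T' \<subseteq> {-i0..lam - i0}" "0 \<in> T'" "lam - i0 \<in> T'"
    using Tc by (auto simp: T'_def image_iff intro: bexI[of _ "-(lam - i0)"])
  have "2 \<le> d" using wr i0(3) by (intro d_ge_2[of "lam - i0"]) auto
  obtain E where E: "inj_on (\<lambda>z. z mod H) E" "H div (4 * d) - 2 * nh \<le> int (card E)"
    "\<And>c. c \<in> E \<Longrightarrow> c mod H \<notin> A' \<and> c mod H \<in> A' + A' \<and> c mod H + H \<in> A' + A'"
  proof (rule wrapping_progression[OF _ _ Hpos \<open>2 \<le> d\<close> cop _ T'(1-3) i0(3)])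
    show "0 \<in> A'" "H \<in> A'" using A0 AH by (auto simp: A'_def image_iff)
    show "z mod H \<in> A' \<longleftrightarrow> (\<exists>t\<in>T'. H dvd z - t * d)" for z
    proof -
      have "H dvd - z - t * d \<longleftrightarrow> H dvd z - (- t) * d" for t
        using dvd_minus_iff[of H "z - (- t) * d"] by (simp add: algebra_simps)
      then show ?thesis unfolding A'_iff Tc_index[of "- z"] T'_def by simp
    qed
    have "{-i0..lam - i0} - T' = uminus ` ({-(lam - i0)..i0} - Tc)"
    proof
      show "{-i0..lam - i0} - T' \<subseteq> uminus ` ({-(lam - i0)..i0} - Tc)"
      proof
        fix t assume "t \<in> {-i0..lam - i0} - T'"
        then show "t \<in> uminus ` ({-(lam - i0)..i0} - Tc)" by (intro image_eqI[of _ _ "- t"]) (auto simp: T'_def image_iff)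
      qed
    qed (auto simp: T'_def)
    then show "int (card ({-i0..lam - i0} - T')) \<le> nh" using Tc(5) by (simp add: card_image)
    show "4 * (d * (nh + 3)) \<le> H" by (rule steps_long)
    show "8 * (i0 + (lam - i0) + 3) \<le> 5 * H" using steps_long(3) by simp
    show "H \<le> (lam - i0) * d" by (rule wr)
  qed blast
  have "uminus ` E \<subseteq> D - S"
  proof
    fix z assume "z \<in> uminus ` E"
    then obtain e where e: "e \<in> E" "z = - e" by auto
    have no: "e mod H \<notin> A'" and two: "e mod H \<in> A' + A'" "e mod H + H \<in> A' + A'" using E(3)[OF e(1)] by auto
    have "0 \<in> A'" using AH by (auto simp: A'_def image_iff)
    then have "e mod H \<noteq> 0" using no by metis
    then have zm: "z mod H = H - e mod H" by (simp add: e zmod_zminus1_eq_if)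
    have r: "2 * H - v \<in> A + A" if v: "v \<in> A' + A'" for v
    proof -
      obtain s t where "s \<in> A" "t \<in> A" "v = (H - s) + (H - t)" using v by (auto simp: A'_def set_plus_def)
      then have "2 * H - v = s + t" by simp
      then show ?thesis using plusI[OF \<open>s \<in> A\<close> \<open>t \<in> A\<close>] by simp
    qed
    have "2 * H - (e mod H + H) = z mod H" "2 * H - e mod H = z mod H + H" using zm by linarith+
    then have "z mod H \<in> A + A" "z mod H + H \<in> A + A" using r[OF two(2)] r[OF two(1)] by metis+
    moreover have "z \<notin> S" using no A'_iff[of e] e by simp
    ultimately show "z \<in> D - S" by (simp add: D_def)
  qed
  moreover have "inj_on (\<lambda>z. z mod H) (uminus ` E)"
  proof (rule inj_onI)
    fix z z' assume "z \<in> uminus ` E" "z' \<in> uminus ` E" "z mod H = z' mod H"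
    then obtain e e' where e: "e \<in> E" "e' \<in> E" "z = - e" "z' = - e'" "H dvd z - z'" by (auto simp: mod_eq_dvd_iff)
    have "e' - e = z - z'" using e by simp
    then have "e' = e" using inj_modD[OF E(1) e(2,1)] e(5) by simp
    then show "z = z'" using e by simp
  qed
  ultimately have "int (card (uminus ` E)) \<le> 2 * x" by (intro new_in_D)
  moreover have "card (uminus ` E) = card E" by (simp add: card_image)
  ultimately show False using E(2) steps_long(2) by linarith
qed

lemma sum_index: "u \<in> T0 + T0 \<Longrightarrow> 2 * e0 - u * d \<in> S + S"
proof -
  assume "u \<in> T0 + T0"
  then obtain s t where st: "s \<in> T0" "t \<in> T0" "u = s + t" by (auto simp: set_plus_def)
  have e: "2 * e0 - u * d = (e0 - s * d) + (e0 - t * d)" using st by (simp add: algebra_simps)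
  show ?thesis unfolding e by (rule plusI) (use st in \<open>auto simp: T0_def\<close>)
qed

lemma four_nh: "4 * nh \<le> lam"
proof -
  have "1 \<le> eps" using eps(3) x2 by linarith
  have "1600 * (q * (100 * eps)) \<le> H" using eps(1) c_eq by simp
  then have "q * (160000 * eps) \<le> q * n" using H_le by simp
  then have "160000 * eps \<le> n" using q_ge by (simp add: mult_le_cancel_left)
  then show ?thesis using nh_le lam_eq \<open>1 \<le> eps\<close> by linarith
qed

text \<open>Otherwise \<open>fold_bound\<close>, applied to the residues \<open>U\<close> missing
  from \<open>S + S\<close> with \<open>|U| \<ge> H - (2 * n - 1 + b)\<close> and
  \<open>lam = n + nh - 1\<close>, would give \<open>H \<le> 2 * n + 2 * b\<close>, one less than
  \<open>H_ge\<close> allows.\<close>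

lemma lam_half: "2 * lam < H"
proof (rule ccontr)
  assume "\<not> 2 * lam < H"
  define U where "U = {u\<in>{0..<H}. 2 * e0 - u * d \<notin> S + S}"
  have finU: "finite U" by (rule finite_subset[of _ "{0..<H}"]) (auto simp: U_def)
  have perSS: "per H (S + S)" by (rule per_plus[OF perS])
  have "sz H (- (S + S)) \<le> int (card ((\<lambda>u. 2 * e0 - u * d) ` U))"
  proof (rule sz_le[OF Hpos])
    fix z assume z: "z \<in> - (S + S)"
    obtain j where j: "j \<in> {0..<H}" "H dvd z - (2 * e0 - j * d)" using index_exists by blast
    then have "2 * e0 - j * d \<notin> S + S" using per_cong[OF perSS j(2)] z by blast
    then show "\<exists>f\<in>(\<lambda>u. 2 * e0 - u * d) ` U. H dvd z - f" using j by (auto simp: U_def)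
  qed (use finU in simp)
  moreover have "card ((\<lambda>u. 2 * e0 - u * d) ` U) \<le> card U" by (rule card_image_le[OF finU])
  ultimately have cU: "H - sz H (S + S) \<le> int (card U)" using sz_Compl[OF Hpos, of "S + S"] by linarith
  then have "0 < int (card U)" using szSS H_ge b0 by linarith
  then have neU: "U \<noteq> {}" by auto
  have "2 * int (card U) + (2 * lam - H) \<le> 2 * nh" unfolding nh_def
  proof (rule fold_bound[OF T0(4,2,3,5)])
    show "H \<le> 2 * lam" using \<open>\<not> 2 * lam < H\<close> by simp
    show "4 * int (card ({0..lam} - T0)) \<le> lam" using four_nh by (simp add: nh_def)
    show "U \<subseteq> {0..<H}" by (auto simp: U_def)
    show "u \<notin> T0 + T0" if "u \<in> U" for u using that sum_index by (auto simp: U_def)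
    show "u + H \<notin> T0 + T0" if "u \<in> U" for u
    proof
      assume "u + H \<in> T0 + T0"
      then have s: "2 * e0 - (u + H) * d \<in> S + S" by (rule sum_index)
      have "H dvd (2 * e0 - u * d) - (2 * e0 - (u + H) * d)" by (simp add: algebra_simps)
      from per_cong[OF perSS this] show False using s \<open>u \<in> U\<close> by (simp add: U_def)
    qed
  qed (rule neU)
  then show False using cU szSS H_ge lam_eq by linarith
qed

text \<open>As \<open>2 * lam < H\<close>, sums of indices are determined by their residues, so
  \<open>|S + S| \<ge> |T0 + T0|\<close>. The end zones of \<open>double_card\<close> are disjoint
  and cost at most \<open>nh\<close>, whence
  \<open>2 * n - 1 + nh \<le> 2 * n - 1 + b\<close>.\<close>

lemma nh_le_b: "nh \<le> b"
proof -
  obtain n1 n2 where nn: "-1 \<le> n1" "-1 \<le> n2"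
    "n1 + 1 \<le> 2 * int (card ({0..n1} - T0))" "n2 + 1 \<le> 2 * int (card ({lam - n2..lam} - T0))"
    "n1 + 1 \<le> 2 * int (card ({0..lam} - T0))" "n2 + 1 \<le> 2 * int (card ({0..lam} - T0))"
    "2 * lam + 1 \<le> int (card (T0 + T0)) + int (card ({0..n1} - T0)) + int (card ({lam - n2..lam} - T0))"
    using double_card[OF T0(4,2,3)] four_nh unfolding nh_def by metis
  have n12: "n1 < 2 * nh" "n2 < 2 * nh" using nn(5,6) by (auto simp: nh_def)
  have "card ({0..n1} - T0) + card ({lam - n2..lam} - T0) = card (({0..n1} - T0) \<union> ({lam - n2..lam} - T0))"
    using n12 four_nh by (intro card_Un_disjoint[symmetric]) auto
  also have "\<dots> \<le> card ({0..lam} - T0)" using n12 four_nh by (intro card_mono) auto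
  finally have "int (card ({0..n1} - T0)) + int (card ({lam - n2..lam} - T0)) \<le> nh" by (simp add: nh_def)
  then have big: "2 * lam + 1 - nh \<le> int (card (T0 + T0))" using nn(7) by linarith
  have sub: "0 \<le> u \<and> u \<le> 2 * lam" if u: "u \<in> T0 + T0" for u
  proof -
    obtain s t where "s \<in> T0" "t \<in> T0" "u = s + t" using u by (auto simp: set_plus_def)
    moreover have "0 \<le> s" "s \<le> lam" "0 \<le> t" "t \<le> lam" using T0(4) \<open>s \<in> T0\<close> \<open>t \<in> T0\<close> by auto
    ultimately show ?thesis by simp
  qed
  have inj: "\<bar>i - j\<bar> < H" if "i \<in> T0 + T0" "j \<in> T0 + T0" for i j
    using sub[OF that(1)] sub[OF that(2)] lam_half by linarith
  have "int (card ((\<lambda>u. 2 * e0 - u * d) ` (T0 + T0))) \<le> sz H (S + S)"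
    by (rule sz_ge(1)[OF Hpos per_plus[OF perS] _ inj_index(1)[OF inj]]) (use sum_index in auto)
  moreover have "card ((\<lambda>u. 2 * e0 - u * d) ` (T0 + T0)) = card (T0 + T0)"
    by (intro card_image inj_index(2)[OF inj])
  ultimately show ?thesis using big szSS lam_eq by linarith
qed

lemma contradiction: False
proof -
  have "bi_covered A (int (card A) + b)"
  proof (rule progression_bi_covered[OF Hpos _ cop _ i0(3) no_wrap_left no_wrap_right _ A_sub A0 AH])
    show "1 \<le> d" using d_pos by simp
    show "0 \<le> lam - i0" using i0(4) by simp
    show "2 * (lam - i0) + 2 * i0 < H" using lam_half by simp
    show "lam - i0 + i0 + 2 \<le> int (card A) + b" using lam_eq nh_le_b by (simp add: n_def)
    fix a assume "a \<in> A"
    then obtain t where "t \<in> Tc" "H dvd a - t * d" using A_sub_S Tc_index by blast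
    moreover have "-(lam - i0) \<le> t \<and> t \<le> i0" using \<open>t \<in> Tc\<close> Tc(1) by auto
    ultimately show "\<exists>t. -(lam - i0) \<le> t \<and> t \<le> i0 \<and> H dvd a - t * d" by blast
  qed
  then show False using not_covered by blast
qed

end

section \<open>Choice of scale and the finite theorem\<close>

text \<open>The factor of \<open>x\<close> in \<open>x_tiny\<close> for
  \<open>c = 1600 * q\<close>.\<close>

definition small_scale :: "int \<Rightarrow> int" where
  "small_scale q = 100 * (1600 * q) * ((8 * (6 * 2 ^ nat (16 * (1600 * q))) + 32) * (4 * (1600 * q)))"

text \<open>One factor is spent because a subgroup atom has order above
  \<open>H / small_scale q\<close>, the other three on the cubic expression in its index.\<close>

definition scale :: "int \<Rightarrow> int" where
  "scale q = 1000 * (small_scale q * (small_scale q * (small_scale q * small_scale q)))"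

lemma small_scale_ge: assumes "q \<ge> 1" shows "small_scale q \<ge> 160000 * q"
proof -
  have "1 * 1 \<le> (8 * (6 * 2 ^ nat (16 * (1600 * q))) + 32) * (4 * (1600 * q))"
    using assms by (intro mult_mono) auto
  then have "100 * (1600 * q) * 1 \<le> small_scale q" unfolding small_scale_def using assms by (intro mult_left_mono) auto
  then show ?thesis by simp
qed

text \<open>If \<open>H \<ge> B * x\<close>, the atom is small. Otherwise \<open>x > H / B\<close>,
  so \<open>x * x\<close> exceeds \<open>2 * (b + 1) * H\<close> and the atom is a subgroup, of
  index below \<open>B\<close>.\<close>

theorem (in dense_sum) covered:
  assumes big: "scale q * (b + 1) \<le> H"
  shows "bi_covered A (int (card A) + b)"
proof (rule ccontr)
  assume not_covered: "\<not> ?thesis"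
  define B where "B = small_scale q"
  have B: "160000 * q \<le> B" "480000 \<le> B" using small_scale_ge[of q] q_ge by (auto simp: B_def)
  define B3 where "B3 = B * (B * B)"
  have B1: "B \<le> B * B" using mult_left_mono[of 1 B B] B by simp
  have B2: "B * B \<le> B3" unfolding B3_def using mult_left_mono[of 1 B "B * B"] B mult.commute by simp
  have B3b: "0 < B3 * (b + 1)" using B B1 B2 b0 by (intro mult_pos_pos) linarith+
  have B3B: "B3 * (b + 1) \<le> B * (B3 * (b + 1))"
    using mult_right_mono[of 1 B "B3 * (b + 1)"] B B3b by linarith
  have big': "1000 * (B * (B3 * (b + 1))) \<le> H"
    using big by (simp add: scale_def B_def[symmetric] B3_def algebra_simps)
  \<comment> \<open>For \<open>n \<le> b + 1\<close> the bound \<open>H \<le> q * n\<close> would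
    keep \<open>H\<close> below the scale.\<close>
  have kn: "k \<le> n"
  proof (rule ccontr)
    assume "\<not> k \<le> n"
    then have "q * n \<le> q * (b + 1)" using q_ge by (intro mult_left_mono) (auto simp: k_def)
    also have "\<dots> \<le> B * (b + 1)" using B b0 q_ge by (intro mult_right_mono) auto
    also have "\<dots> \<le> B3 * (b + 1)" using B1 B2 b0 by (intro mult_right_mono) auto
    also have "\<dots> \<le> B * (B3 * (b + 1))" by (rule B3B)
    finally have "q * n \<le> B * (B3 * (b + 1))" .
    then show False using big' H_le B3b B3B by linarith
  qed
  obtain X where X: "adm X" "0 \<in> X"
    "\<And>Y. adm Y \<Longrightarrow> sz H (X + S) - sz H X \<le> sz H (Y + S) - sz H Y"
    "\<And>Y. adm Y \<Longrightarrow> sz H (Y + S) - sz H Y \<le> sz H (X + S) - sz H X \<Longrightarrow> sz H X \<le> sz H Y"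
    using atom_exists[OF kn] by blast
  interpret atom H A b q X using X kn by unfold_locales
  have lt: "H < B * x"
  proof (rule ccontr)
    assume "\<not> H < B * x"
    then interpret small_atom H A b q X "1600 * q"
      using not_covered by unfold_locales (auto simp: B_def small_scale_def)
    show False by (rule contradiction)
  qed
  have "x * x > 2 * (b + 1) * H"
  proof (rule ccontr)
    assume "\<not> x * x > 2 * (b + 1) * H"
    then have "(B * B) * (x * x) \<le> (B * B) * (2 * (b + 1) * H)" by (intro mult_left_mono) auto
    also have "\<dots> = (2 * (B * B) * (b + 1)) * H" by (simp add: algebra_simps)
    also have "\<dots> \<le> H * H"
    proof (rule mult_right_mono)
      have "(B * B) * (b + 1) \<le> B3 * (b + 1)" using B2 b0 by (intro mult_right_mono) auto
      then have "2 * ((B * B) * (b + 1)) \<le> H" using big' B3b B3B by linarith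
      then show "2 * (B * B) * (b + 1) \<le> H" by (simp only: mult.assoc)
    qed (use Hpos in simp)
    also have "H * H < (B * x) * (B * x)" using lt Hpos by (intro mult_strict_mono) auto
    also have "\<dots> = (B * B) * (x * x)" by (simp add: algebra_simps)
    finally show False by simp
  qed
  then have "subgp X" by (rule small_or_subgroup)
  moreover have "H \<in> X" using perX X0 by (metis per_def add.left_neutral)
  ultimately obtain g where g: "g > 0" "g dvd H" "X = {z. g dvd z}" using subgp_multiples Hpos by metis
  define L where "L = H div g"
  have HL: "H = g * L" using g(2) by (simp add: L_def)
  have "sz H X = L" unfolding g(3) L_def by (rule sz_multiples[OF g(1,2) Hpos])
  then have xL: "x = L" unfolding x_def .
  have L0: "0 < L" using xL x_ge b0 by linarith
  have "g * L < B * L" using lt HL xL by simp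
  then have gB: "g < B" using L0 by simp
  have "(g + 1) * ((g + 1) * (b + g + 1)) \<le> B * (B * (B * (b + 1)))"
  proof (intro mult_mono)
    have "1 * b \<le> B * b" using B b0 by (intro mult_right_mono) auto
    moreover have "B * (b + 1) = B * b + B" by (simp add: algebra_simps)
    ultimately show "b + g + 1 \<le> B * (b + 1)" using gB by linarith
  qed (use gB g b0 B in auto)
  also have "\<dots> = B3 * (b + 1)" by (simp add: B3_def mult.assoc)
  finally have gg: "(g + 1) * ((g + 1) * (b + g + 1)) \<le> B3 * (b + 1)" .
  have "B * (1000 * (B3 * (b + 1))) \<le> B * L" using big' lt xL by simp
  then have "1000 * (B3 * (b + 1)) \<le> L" using B by simp
  then have "1000 * ((g + 1) * ((g + 1) * (b + g + 1))) \<le> L" using gg by linarith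
  then interpret subgroup_atom H A b q X g L using g HL by unfold_locales auto
  show False using conclusion not_covered by blast
qed

section \<open>Transfer\<close>

definition R_atom :: "real level1 list set" where "R_atom = {[Atom x] | x. True}"
definition R_nat :: "real level1 list set" where "R_nat = {[Atom (real n)] | n. True}"
definition R_int :: "real level1 list set" where "R_int = {[Atom (real_of_int m)] | m. True}"
definition R_eq :: "real level1 list set" where "R_eq = {[x, x] | x. True}"
definition R_mem :: "real level1 list set" where "R_mem = {[Atom x, SetOf X] | x X. x \<in> X}"
definition R_add :: "real level1 list set" where "R_add = {[Atom s, Atom t, Atom (s + t)] | s t. True}"
definition R_mult :: "real level1 list set" where "R_mult = {[Atom s, Atom t, Atom (s * t)] | s t. True}"
definition R_le :: "real level1 list set" where "R_le = {[Atom s, Atom t] | s t. s \<le> t}"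
definition R_card :: "real level1 list set" where "R_card = {[SetOf X, Atom (real (card X))] | X. finite X}"
definition R_gcd :: "real level1 list set" where "R_gcd = {[SetOf (real ` X), Atom (real (Gcd X))] | X. True}"

lemmas rel_defs = R_atom_def R_nat_def R_int_def R_eq_def R_mem_def R_add_def R_mult_def R_le_def R_card_def R_gcd_def

section \<open>First-order formulas and their meaning in a model\<close>

definition f_atom :: "nat \<Rightarrow> real level1 fm" where "f_atom i = FRel R_atom [i]"
definition f_nat :: "nat \<Rightarrow> real level1 fm" where "f_nat i = FRel R_nat [i]"
definition f_int :: "nat \<Rightarrow> real level1 fm" where "f_int i = FRel R_int [i]"
definition f_eq :: "nat \<Rightarrow> nat \<Rightarrow> real level1 fm" where "f_eq i j = FRel R_eq [i, j]"
definition f_mem :: "nat \<Rightarrow> nat \<Rightarrow> real level1 fm" where "f_mem i j = FRel R_mem [i, j]"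
definition f_add :: "nat \<Rightarrow> nat \<Rightarrow> nat \<Rightarrow> real level1 fm" where
  "f_add i j l = FRel R_add [i, j, l]"
definition f_mult :: "nat \<Rightarrow> nat \<Rightarrow> nat \<Rightarrow> real level1 fm" where
  "f_mult i j l = FRel R_mult [i, j, l]"
definition f_le :: "nat \<Rightarrow> nat \<Rightarrow> real level1 fm" where "f_le i j = FRel R_le [i, j]"
definition f_card :: "nat \<Rightarrow> nat \<Rightarrow> real level1 fm" where
  "f_card i j = FRel R_card [i, j]"
definition f_gcd :: "nat \<Rightarrow> nat \<Rightarrow> real level1 fm" where
  "f_gcd i j = FRel R_gcd [i, j]"

definition f_imp :: "'a fm \<Rightarrow> 'a fm \<Rightarrow> 'a fm" where "f_imp p q = FNot (FAnd p (FNot q))"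
definition f_or :: "'a fm \<Rightarrow> 'a fm \<Rightarrow> 'a fm" where "f_or p q = FNot (FAnd (FNot p) (FNot q))"
definition f_iff :: "'a fm \<Rightarrow> 'a fm \<Rightarrow> 'a fm" where "f_iff p q = FAnd (f_imp p q) (f_imp q p)"
definition f_exA :: "nat \<Rightarrow> real level1 fm \<Rightarrow> real level1 fm" where "f_exA i p = FEx i (FAnd (f_atom i) p)"
definition f_exS :: "nat \<Rightarrow> real level1 fm \<Rightarrow> real level1 fm" where "f_exS i p = FEx i (FAnd (FNot (f_atom i)) p)"
definition f_allA :: "nat \<Rightarrow> real level1 fm \<Rightarrow> real level1 fm" where "f_allA i p = FNot (f_exA i (FNot p))"
definition f_allS :: "nat \<Rightarrow> real level1 fm \<Rightarrow> real level1 fm" where "f_allS i p = FNot (f_exS i (FNot p))"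

fun f_allAs :: "nat list \<Rightarrow> real level1 fm \<Rightarrow> real level1 fm" where
  "f_allAs [] p = p" | "f_allAs (i # is) p = f_allA i (f_allAs is p)"
fun f_exAs :: "nat list \<Rightarrow> real level1 fm \<Rightarrow> real level1 fm" where
  "f_exAs [] p = p" | "f_exAs (i # is) p = f_exA i (f_exAs is p)"
fun f_conj :: "real level1 fm list \<Rightarrow> real level1 fm" where
  "f_conj [] = f_imp (f_atom 0) (f_atom 0)" | "f_conj [p] = p" | "f_conj (p # ps) = FAnd p (f_conj ps)"

lemma sat_connectives [simp]:
  "sat U J v (f_imp p q) \<longleftrightarrow> (sat U J v p \<longrightarrow> sat U J v q)"
  "sat U J v (f_or p q) \<longleftrightarrow> (sat U J v p \<or> sat U J v q)"
  "sat U J v (f_iff p q) \<longleftrightarrow> (sat U J v p \<longleftrightarrow> sat U J v q)"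
  by (auto simp: f_imp_def f_or_def f_iff_def)

text \<open>Both the standard and the nonstandard structure satisfy these assumptions, so the
  meaning of each formula is computed once and instantiated twice.\<close>

locale model =
  fixes U :: "'u::linordered_field level1 set" and J :: "real level1 list set \<Rightarrow> 'u level1 list set"
  assumes atom_U: "Atom x \<in> U"
    and J_atom: "[e] \<in> J R_atom \<longleftrightarrow> e \<in> range Atom"
    and J_eq: "e \<in> U \<Longrightarrow> e' \<in> U \<Longrightarrow> [e, e'] \<in> J R_eq \<longleftrightarrow> e = e'"
    and J_mem: "SetOf X \<in> U \<Longrightarrow> [Atom x, SetOf X] \<in> J R_mem \<longleftrightarrow> x \<in> X"
    and J_add: "[Atom x, Atom y, Atom z] \<in> J R_add \<longleftrightarrow> z = x + y"
    and J_mult: "[Atom x, Atom y, Atom z] \<in> J R_mult \<longleftrightarrow> z = x * y"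
    and J_le: "[Atom x, Atom y] \<in> J R_le \<longleftrightarrow> x \<le> y"
begin

definition "nats = {x. [Atom x] \<in> J R_nat}"
definition "ints = {x. [Atom x] \<in> J R_int}"
definition "elem x X \<longleftrightarrow> [Atom x, SetOf X] \<in> J R_mem"
definition "has_card X n \<longleftrightarrow> [SetOf X, Atom n] \<in> J R_card"
definition "has_gcd X n \<longleftrightarrow> [SetOf X, Atom n] \<in> J R_gcd"

lemma sat_quantifiers [simp]:
  "sat U J v (f_exA i p) \<longleftrightarrow> (\<exists>x. sat U J (v(i := Atom x)) p)"
  "sat U J v (f_exS i p) \<longleftrightarrow> (\<exists>X. SetOf X \<in> U \<and> sat U J (v(i := SetOf X)) p)"
  "sat U J v (f_allA i p) \<longleftrightarrow> (\<forall>x. sat U J (v(i := Atom x)) p)"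
  "sat U J v (f_allS i p) \<longleftrightarrow> (\<forall>X. SetOf X \<in> U \<longrightarrow> sat U J (v(i := SetOf X)) p)"
proof -
  have a: "[z] \<in> J R_atom \<longleftrightarrow> (\<exists>x. z = Atom x)" for z using J_atom by auto
  show A: "sat U J v (f_exA i p) \<longleftrightarrow> (\<exists>x. sat U J (v(i := Atom x)) p)" for p
    using atom_U by (auto simp: f_exA_def f_atom_def a)
  show S: "sat U J v (f_exS i p) \<longleftrightarrow> (\<exists>X. SetOf X \<in> U \<and> sat U J (v(i := SetOf X)) p)" for p
    unfolding f_exS_def f_atom_def by (simp add: a) (metis level1.exhaust level1.distinct(1))
  show "sat U J v (f_allA i p) \<longleftrightarrow> (\<forall>x. sat U J (v(i := Atom x)) p)" by (simp add: f_allA_def A)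
  show "sat U J v (f_allS i p) \<longleftrightarrow> (\<forall>X. SetOf X \<in> U \<longrightarrow> sat U J (v(i := SetOf X)) p)" by (simp add: f_allS_def S)
qed

lemma sat_simps:
  "v i = Atom x \<Longrightarrow> sat U J v (f_nat i) \<longleftrightarrow> x \<in> nats"
  "v i = Atom x \<Longrightarrow> sat U J v (f_int i) \<longleftrightarrow> x \<in> ints"
  "v i = Atom x \<Longrightarrow> v j = Atom y \<Longrightarrow> sat U J v (f_eq i j) \<longleftrightarrow> x = y"
  "v i = Atom x \<Longrightarrow> v j = SetOf X \<Longrightarrow> sat U J v (f_mem i j) \<longleftrightarrow> elem x X"
  "v i = Atom x \<Longrightarrow> v j = Atom y \<Longrightarrow> v l = Atom z \<Longrightarrow> sat U J v (f_add i j l) \<longleftrightarrow> z = x + y"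
  "v i = Atom x \<Longrightarrow> v j = Atom y \<Longrightarrow> v l = Atom z \<Longrightarrow> sat U J v (f_mult i j l) \<longleftrightarrow> z = x * y"
  "v i = Atom x \<Longrightarrow> v j = Atom y \<Longrightarrow> sat U J v (f_le i j) \<longleftrightarrow> x \<le> y"
  "v i = SetOf X \<Longrightarrow> v j = Atom y \<Longrightarrow> sat U J v (f_card i j) \<longleftrightarrow> has_card X y"
  "v i = SetOf X \<Longrightarrow> v j = Atom y \<Longrightarrow> sat U J v (f_gcd i j) \<longleftrightarrow> has_gcd X y"
  using J_eq[OF atom_U atom_U]
  by (simp_all add: f_nat_def f_int_def f_eq_def f_mem_def f_add_def f_mult_def f_le_def f_card_def f_gcd_def
      nats_def ints_def elem_def has_card_def has_gcd_def J_add J_mult J_le)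

end

text \<open>Variables 0 to 4 stand for the parameters \<open>0\<close>, \<open>1\<close>, \<open>3\<close>, \<open>q\<close> and \<open>scale q\<close>,
  variables from 40 on are bound locally.\<close>

definition f_range :: "nat \<Rightarrow> nat \<Rightarrow> real level1 fm" where
  "f_range i j = f_allA 40 (f_imp (f_mem 40 i) (f_conj [f_int 40, f_le 0 40, f_le 40 j]))"

definition f_sums :: "nat \<Rightarrow> nat \<Rightarrow> real level1 fm" where
  "f_sums i j = f_allA 40 (f_iff (f_mem 40 j) (f_exAs [41, 42] (f_conj [f_mem 41 i, f_mem 42 i, f_add 41 42 40])))"

definition f_prog :: "nat \<Rightarrow> nat \<Rightarrow> nat \<Rightarrow> nat \<Rightarrow> real level1 fm" where
  "f_prog a d l i = f_allA 40 (f_iff (f_mem 40 i) (f_exAs [41, 42]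
     (f_conj [f_nat 41, f_le 41 l, FNot (f_eq 41 l), f_mult 41 d 42, f_add a 42 40])))"

definition f_apart :: "nat \<Rightarrow> nat \<Rightarrow> nat \<Rightarrow> nat \<Rightarrow> real level1 fm" where
  "f_apart i j i' j' = f_allAs [40, 41, 42, 43, 44] (FNot (f_conj
     [f_mem 40 i, f_mem 41 j, f_mem 42 i', f_mem 43 j', f_add 40 41 44, f_add 42 43 44]))"

definition f_bi :: "nat \<Rightarrow> nat \<Rightarrow> real level1 fm" where
  "f_bi i m = f_exAs [30, 31, 32, 33, 34] (f_exS 35 (f_exS 36 (f_conj
     [f_nat 30, f_nat 31, f_nat 32, f_nat 33, f_nat 34, f_le 1 30, f_le 1 31, f_le 1 32,
      f_exA 37 (FAnd (f_add 31 32 37) (f_le 37 m)), f_prog 33 30 31 35, f_prog 34 30 32 36, f_card 35 31, f_card 36 32,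
      f_apart 35 35 35 36, f_apart 35 35 36 36, f_apart 35 36 36 36,
      f_allA 40 (f_imp (f_mem 40 i) (f_or (f_mem 40 35) (f_mem 40 36))),
      f_exA 40 (FAnd (f_mem 40 i) (f_mem 40 35)), f_exA 40 (FAnd (f_mem 40 i) (f_mem 40 36))])))"

text \<open>The variables 16, 18, 23, 24, 27 and 28 take the values \<open>H + 2\<close>, \<open>2|A| + 2b\<close>, \<open>3|A| + b\<close>,
  \<open>q|A|\<close>, \<open>scale q * (b + 1)\<close> and \<open>|A| + b\<close>.\<close>

definition f_main :: "real level1 fm" where
  "f_main = f_allS 10 (f_allS 15 (f_allAs [11, 12, 13, 14, 16, 17, 18, 19, 20, 21, 22, 23, 24, 25, 26, 27, 28]
     (f_imp (f_conj
       [f_nat 11, f_range 10 11, f_mem 0 10, f_mem 11 10, f_sums 10 15, f_card 10 13, f_card 15 14, f_gcd 10 1,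
        f_int 12, f_le 0 12,
        f_add 13 13 20, f_add 20 13 21, f_add 21 12 23, f_add 14 2 23,
        f_mult 3 13 24, f_add 11 3 25, f_le 25 24,
        f_add 12 1 26, f_mult 4 26 27, f_le 27 11,
        f_add 11 1 17, f_add 17 1 16, f_add 20 12 19, f_add 19 12 18, f_add 13 12 28])
      (f_or (f_le 16 18) (f_bi 10 28)))))"

text \<open>Together with \<open>f_unique\<close> it makes the descriptions in \<open>icard\<close>
  and \<open>igcd\<close> proper for internal sets in an interval; it also shows that the sumset of
  such a set is internal.\<close>

definition f_exist :: "real level1 fm" where
  "f_exist = f_allS 10 (f_allA 11 (f_imp (f_range 10 11)
     (f_conj [f_exA 12 (f_card 10 12), f_exA 12 (f_gcd 10 12), f_exS 15 (FAnd (f_sums 10 15) (f_exA 12 (f_card 15 12)))])))"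

definition f_unique :: "real level1 fm" where
  "f_unique = f_allS 10 (f_allAs [11, 12] (FAnd
     (f_imp (FAnd (f_card 10 11) (f_card 10 12)) (f_eq 11 12)) (f_imp (FAnd (f_gcd 10 11) (f_gcd 10 12)) (f_eq 11 12))))"

text \<open>Discreteness of the hypernaturals; by induction it yields that a hypernatural below a
  standard one is standard.\<close>

definition f_step :: "real level1 fm" where
  "f_step = f_allAs [10, 11, 12] (FAnd (f_imp (f_nat 10) (f_le 0 10))
     (f_imp (f_conj [f_nat 10, f_nat 11, f_add 11 1 12, f_le 10 12]) (f_or (f_le 10 11) (f_eq 10 12))))"

context model begin

lemmas sat_all = sat_simps f_main_def f_range_def f_sums_def f_prog_def f_apart_def f_bi_def f_exist_def f_unique_def f_step_def

definition val :: "'u \<Rightarrow> 'u \<Rightarrow> nat \<Rightarrow> 'u level1" where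
  "val q B = (\<lambda>_. Atom 0)(1 := Atom 1, 2 := Atom 3, 3 := Atom q, 4 := Atom B)"

lemma sat_step: "sat U J (val q B) f_step \<longleftrightarrow> (\<forall>x\<in>nats. 0 \<le> x \<and> (\<forall>y\<in>nats. x \<le> y + 1 \<longrightarrow> x \<le> y \<or> x = y + 1))"
  by (auto simp: sat_all val_def)

lemma sat_unique: "sat U J (val q B) f_unique \<longleftrightarrow> (\<forall>X. SetOf X \<in> U \<longrightarrow>
    (\<forall>m n. (has_card X m \<and> has_card X n \<longrightarrow> m = n) \<and> (has_gcd X m \<and> has_gcd X n \<longrightarrow> m = n)))"
  by (simp add: sat_all val_def)

definition "ranged X H \<longleftrightarrow> (\<forall>a. elem a X \<longrightarrow> a \<in> ints \<and> 0 \<le> a \<and> a \<le> H)"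
definition "sumset_of X Y \<longleftrightarrow> (\<forall>z. elem z Y \<longleftrightarrow> (\<exists>x y. elem x X \<and> elem y X \<and> z = x + y))"
definition "progr a d l I \<longleftrightarrow> (\<forall>z. elem z I \<longleftrightarrow> (\<exists>i\<in>nats. i \<le> l \<and> i \<noteq> l \<and> z = a + i * d))"
definition "apart P Q P' Q' \<longleftrightarrow> (\<forall>x y z w. elem x P \<longrightarrow> elem y Q \<longrightarrow> elem z P' \<longrightarrow> elem w Q' \<longrightarrow> x + y \<noteq> z + w)"
definition "bi X m \<longleftrightarrow> (\<exists>d l1 l2 a1 a2 I. SetOf I \<in> U \<and> (\<exists>K. SetOf K \<in> U \<and>
    d \<in> nats \<and> l1 \<in> nats \<and> l2 \<in> nats \<and> a1 \<in> nats \<and> a2 \<in> nats \<and> 1 \<le> d \<and> 1 \<le> l1 \<and> 1 \<le> l2 \<and>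
    l1 + l2 \<le> m \<and> progr a1 d l1 I \<and> progr a2 d l2 K \<and> has_card I l1 \<and> has_card K l2 \<and>
    apart I I I K \<and> apart I I K K \<and> apart I K K K \<and>
    (\<forall>a. elem a X \<longrightarrow> elem a I \<or> elem a K) \<and> (\<exists>a. elem a X \<and> elem a I) \<and> (\<exists>a. elem a X \<and> elem a K)))"

lemma sat_exist: "sat U J (val q B) f_exist \<longleftrightarrow> (\<forall>X H. SetOf X \<in> U \<longrightarrow> ranged X H \<longrightarrow>
    (\<exists>n. has_card X n) \<and> (\<exists>n. has_gcd X n) \<and> (\<exists>Y. SetOf Y \<in> U \<and> sumset_of X Y \<and> (\<exists>n. has_card Y n)))"
  by (auto simp: sat_all val_def ranged_def sumset_of_def)

lemma sat_prog:
  assumes "v i = Atom a" "v j = Atom d" "v l = Atom t" "v m = SetOf I" "i < 40" "j < 40" "l < 40" "m < 40"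
  shows "sat U J v (f_prog i j l m) \<longleftrightarrow> progr a d t I"
proof -
  have "i \<notin> {40, 41, 42}" "j \<notin> {40, 41, 42}" "l \<notin> {40, 41, 42}" "m \<notin> {40, 41, 42}" using assms by auto
  then show ?thesis using assms by (simp add: f_prog_def sat_simps progr_def Bex_def)
qed

lemma sat_apart:
  assumes "v i = SetOf P" "v j = SetOf Q" "v i' = SetOf P'" "v j' = SetOf Q'" "i < 40" "j < 40" "i' < 40" "j' < 40"
  shows "sat U J v (f_apart i j i' j') \<longleftrightarrow> apart P Q P' Q'"
proof -
  have "i \<notin> {40, 41, 42, 43, 44}" "j \<notin> {40, 41, 42, 43, 44}" "i' \<notin> {40, 41, 42, 43, 44}" "j' \<notin> {40, 41, 42, 43, 44}"
    using assms by auto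
  then show ?thesis using assms by (simp add: f_apart_def sat_simps apart_def) blast
qed

lemma sat_bi:
  assumes "v 1 = Atom 1" "v 10 = SetOf X" "v 28 = Atom m"
  shows "sat U J v (f_bi 10 28) \<longleftrightarrow> bi X m"
  unfolding bi_def using assms by (simp add: f_bi_def sat_simps sat_prog sat_apart)

text \<open>Free of subtraction: \<open>H + q \<le> q * N\<close> is the density bound
  \<open>Hq\<close>, and \<open>2 + H \<le> 2 * b + 2 * N\<close> is the first alternative of the
  conclusion.\<close>

definition "claim q B \<longleftrightarrow> (\<forall>X Y H b N N2. SetOf X \<in> U \<longrightarrow> SetOf Y \<in> U \<longrightarrow> H \<in> nats \<longrightarrow> ranged X H \<longrightarrow>
    elem 0 X \<longrightarrow> elem H X \<longrightarrow> sumset_of X Y \<longrightarrow> has_card X N \<longrightarrow> has_card Y N2 \<longrightarrow> has_gcd X 1 \<longrightarrow> b \<in> ints \<longrightarrow> 0 \<le> b \<longrightarrow>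
    3 * N + b = N2 + 3 \<longrightarrow> H + q \<le> q * N \<longrightarrow> B * (b + 1) \<le> H \<longrightarrow> 2 + H \<le> 2 * b + 2 * N \<or> bi X (N + b))"

lemma sat_main: "sat U J (val q B) f_main \<longleftrightarrow> claim q B"
proof -
  have bi: "sat U J v (f_bi 10 28) \<longleftrightarrow> bi X m" if "v 1 = Atom 1" "v 10 = SetOf X" "v 28 = Atom m" for v X m
    using that by (rule sat_bi)
  show ?thesis
    unfolding claim_def f_main_def val_def f_range_def f_sums_def ranged_def sumset_of_def
    by (simp add: sat_simps bi) blast
qed

end

interpretation std: model UNIV "\<lambda>R. R"
  by unfold_locales (auto simp: rel_defs)

lemma std_simps:
  "std.nats = range real" "std.ints = range real_of_int" "std.elem x X \<longleftrightarrow> x \<in> X"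
  "std.has_card X n \<longleftrightarrow> finite X \<and> n = real (card X)"
  "std.has_gcd X n \<longleftrightarrow> (\<exists>Z. X = real ` Z \<and> n = real (Gcd Z))"
  by (auto simp: std.nats_def std.ints_def std.elem_def std.has_card_def std.has_gcd_def rel_defs)

lemma std_sumset: "std.sumset_of X Y \<longleftrightarrow> Y = X + X"
proof -
  have "z \<in> X + X \<longleftrightarrow> (\<exists>x y. x \<in> X \<and> y \<in> X \<and> z = x + y)" for z by (auto simp: set_plus_def)
  then show ?thesis unfolding std.sumset_of_def std_simps by blast
qed

lemma std_step: "sat UNIV (\<lambda>R. R) (std.val q B) f_step"
  unfolding std.sat_step std_simps
proof (intro ballI conjI impI)
  fix x :: real assume "x \<in> range real"
  then show "0 \<le> x" by auto
  fix y :: real assume "y \<in> range real" "x \<le> y + 1"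
  then obtain i j where "x = real i" "y = real j" "real i \<le> real (Suc j)" using \<open>x \<in> range real\<close> by auto
  then have "i \<le> j \<or> i = Suc j" by linarith
  then show "x \<le> y \<or> x = y + 1" using \<open>x = real i\<close> \<open>y = real j\<close> by auto
qed

lemma std_unique: "sat UNIV (\<lambda>R. R) (std.val q B) f_unique"
  unfolding std.sat_unique std_simps by (auto simp: inj_image_eq_iff)

lemma ranged_finite:
  assumes "std.ranged X H" shows "finite X" "\<exists>Z. X = real ` Z"
proof -
  have X: "X \<subseteq> real_of_int ` {0..\<lfloor>H\<rfloor>}"
  proof
    fix a assume "a \<in> X"
    then obtain i where "a = real_of_int i" "0 \<le> a" "a \<le> H" using assms by (auto simp: std.ranged_def std_simps)
    then show "a \<in> real_of_int ` {0..\<lfloor>H\<rfloor>}" by (auto simp: le_floor_iff)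
  qed
  then show "finite X" by (rule finite_subset) simp
  have "X \<subseteq> range real"
  proof
    fix a assume "a \<in> X"
    then obtain i where "a = real_of_int i" "0 \<le> i" using X by auto
    then have "a = real (nat i)" by simp
    then show "a \<in> range real" by blast
  qed
  then show "\<exists>Z. X = real ` Z" by (auto simp: subset_image_iff)
qed

lemma std_exist: "sat UNIV (\<lambda>R. R) (std.val q B) f_exist"
  unfolding std.sat_exist
proof (intro allI impI conjI)
  fix X H assume r: "std.ranged X H"
  note f = ranged_finite[OF r]
  show "\<exists>n. std.has_card X n" "\<exists>n. std.has_gcd X n" using f by (auto simp: std_simps)
  have "finite (X + X)" using f(1) by (rule finite_set_plus) (rule f(1))
  then show "\<exists>Y. SetOf Y \<in> UNIV \<and> std.sumset_of X Y \<and> (\<exists>n. std.has_card Y n)" by (auto simp: std_sumset std_simps)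
qed

lemma std_prog:
  assumes "1 \<le> d" "0 \<le> a" "1 \<le> l"
  shows "std.progr (real_of_int a) (real_of_int d) (real_of_int l) (real_of_int ` prog d a l)"
    "std.has_card (real_of_int ` prog d a l) (real_of_int l)"
proof -
  have "z \<in> real_of_int ` prog d a l \<longleftrightarrow> (\<exists>i\<in>range real. i \<le> real_of_int l \<and> i \<noteq> real_of_int l \<and> z = real_of_int a + i * real_of_int d)" for z
  proof
    assume "z \<in> real_of_int ` prog d a l"
    then obtain i where i: "0 \<le> i" "i < l" "z = real_of_int (a + i * d)" by (auto simp: prog_def)
    then show "\<exists>i\<in>range real. i \<le> real_of_int l \<and> i \<noteq> real_of_int l \<and> z = real_of_int a + i * real_of_int d"
      by (intro bexI[of _ "real (nat i)"] rangeI) auto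
  next
    assume "\<exists>i\<in>range real. i \<le> real_of_int l \<and> i \<noteq> real_of_int l \<and> z = real_of_int a + i * real_of_int d"
    then obtain i :: nat where i: "real i \<le> real_of_int l" "real i \<noteq> real_of_int l" "z = real_of_int a + real i * real_of_int d" by auto
    have "int i < l" using i(1,2) by linarith
    moreover have "z = real_of_int (a + int i * d)" using i(3) by simp
    ultimately show "z \<in> real_of_int ` prog d a l"
      unfolding prog_def by (intro image_eqI[of _ _ "a + int i * d"]) auto
  qed
  then show "std.progr (real_of_int a) (real_of_int d) (real_of_int l) (real_of_int ` prog d a l)"
    by (simp add: std.progr_def std_simps)
  have "prog d a l = (\<lambda>i. a + i * d) ` {0..<l}" by (auto simp: prog_def)
  moreover have "inj_on (\<lambda>i. a + i * d) {0..<l}" using assms by (auto simp: inj_on_def)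
  ultimately have "card (prog d a l) = nat l" "finite (prog d a l)" by (simp_all add: card_image)
  then show "std.has_card (real_of_int ` prog d a l) (real_of_int l)" using assms by (simp add: std_simps card_image inj_on_def)
qed

lemma std_apart:
  assumes "(P + Q) \<inter> (P' + Q') = {}"
  shows "std.apart (real_of_int ` P) (real_of_int ` Q) (real_of_int ` P') (real_of_int ` Q')"
  unfolding std.apart_def std_simps
proof (intro allI impI notI)
  fix x y z w assume "x \<in> real_of_int ` P" "y \<in> real_of_int ` Q" "z \<in> real_of_int ` P'" "w \<in> real_of_int ` Q'" and e: "x + y = z + w"
  then obtain i j k l where i: "i \<in> P" "j \<in> Q" "k \<in> P'" "l \<in> Q'" "x = real_of_int i" "y = real_of_int j" "z = real_of_int k" "w = real_of_int l"
    by blast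
  then have "real_of_int (i + j) = real_of_int (k + l)" using e by simp
  then have "i + j = k + l" by (simp only: of_int_eq_iff)
  then show False using plusI[OF i(1,2)] plusI[OF i(3,4)] assms by auto
qed

lemma std_bi:
  assumes "bi_covered A m" shows "std.bi (real_of_int ` A) (real_of_int m)"
proof -
  obtain d a1 l1 a2 l2 where *: "1 \<le> d" "0 \<le> a1" "0 \<le> a2" "1 \<le> l1" "1 \<le> l2" "l1 + l2 \<le> m"
     "A \<subseteq> prog d a1 l1 \<union> prog d a2 l2" "A \<inter> prog d a1 l1 \<noteq> {}" "A \<inter> prog d a2 l2 \<noteq> {}"
     "(prog d a1 l1 + prog d a1 l1) \<inter> (prog d a1 l1 + prog d a2 l2) = {}"
     "(prog d a1 l1 + prog d a1 l1) \<inter> (prog d a2 l2 + prog d a2 l2) = {}"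
     "(prog d a1 l1 + prog d a2 l2) \<inter> (prog d a2 l2 + prog d a2 l2) = {}"
    using assms unfolding bi_covered_def by (elim exE conjE) (rule that)
  have nat: "real_of_int i \<in> std.nats" if "0 \<le> i" for i
  proof -
    have "real_of_int i = real (nat i)" using that by simp
    then show ?thesis unfolding std_simps by (rule range_eqI)
  qed
  define I K where "I = real_of_int ` prog d a1 l1" and "K = real_of_int ` prog d a2 l2"
  have le: "real_of_int l1 + real_of_int l2 \<le> real_of_int m" using *(6) by linarith
  have elems: "\<forall>a. std.elem a (real_of_int ` A) \<longrightarrow> std.elem a I \<or> std.elem a K"
    "\<exists>a. std.elem a (real_of_int ` A) \<and> std.elem a I" "\<exists>a. std.elem a (real_of_int ` A) \<and> std.elem a K"
  proof -
    obtain u v where "u \<in> A" "u \<in> prog d a1 l1" "v \<in> A" "v \<in> prog d a2 l2" using *(8,9) by blast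
    then show "\<exists>a. std.elem a (real_of_int ` A) \<and> std.elem a I" "\<exists>a. std.elem a (real_of_int ` A) \<and> std.elem a K"
      unfolding std_simps I_def K_def by (blast intro: imageI)+
    show "\<forall>a. std.elem a (real_of_int ` A) \<longrightarrow> std.elem a I \<or> std.elem a K"
      using *(7) unfolding std_simps I_def K_def by (blast intro: imageI)
  qed
  have ge1: "1 \<le> real_of_int d" "1 \<le> real_of_int l1" "1 \<le> real_of_int l2" using *(1-5) by simp_all
  have nats: "real_of_int d \<in> std.nats" "real_of_int l1 \<in> std.nats" "real_of_int l2 \<in> std.nats"
    "real_of_int a1 \<in> std.nats" "real_of_int a2 \<in> std.nats" by (rule nat, use *(1-5) in linarith)+
  note apart = std_apart[OF *(10), folded I_def K_def] std_apart[OF *(11), folded I_def K_def] std_apart[OF *(12), folded I_def K_def]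
  note progs = std_prog[OF *(1,2,4), folded I_def] std_prog[OF *(1,3,5), folded K_def]
  show ?thesis unfolding std.bi_def
    by (rule exI[of _ "real_of_int d"], rule exI[of _ "real_of_int l1"], rule exI[of _ "real_of_int l2"],
        rule exI[of _ "real_of_int a1"], rule exI[of _ "real_of_int a2"], rule exI[of _ I], rule conjI[OF UNIV_I],
        rule exI[of _ K], intro conjI UNIV_I; fact)
qed

lemma std_main: "sat UNIV (\<lambda>R. R) (std.val (real_of_int q) (real_of_int (scale q))) f_main"
  unfolding std.sat_main std.claim_def std_sumset
proof (intro allI impI)
  fix X Y :: "real set" and H b N N2
  assume H: "H \<in> std.nats" and r: "std.ranged X H" and X0: "std.elem 0 X" and XH: "std.elem H X" and Y: "Y = X + X"
    and N: "std.has_card X N" "std.has_card Y N2" and gcd: "std.has_gcd X 1" and b: "b \<in> std.ints" "0 \<le> b"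
    and NN: "3 * N + b = N2 + 3" and Hq: "H + real_of_int q \<le> real_of_int q * N"
    and big: "real_of_int (scale q) * (b + 1) \<le> H"
  define A where "A = {a. real_of_int a \<in> X}"
  have XA: "X = real_of_int ` A" using r by (auto simp: A_def std.ranged_def std_simps)
  obtain h where h: "H = real_of_int h" using H by (auto simp: std_simps) (metis of_int_of_nat_eq)
  obtain b' where b': "b = real_of_int b'" using b by (auto simp: std_simps)
  have NA: "N = real (card A)" using N(1) by (simp add: std_simps XA card_image inj_on_def)
  have "Y = real_of_int ` (A + A)" unfolding Y XA by (auto simp: set_plus_def image_iff) (metis of_int_add)+
  then have N2A: "N2 = real (card (A + A))" using N(2) by (simp add: std_simps card_image inj_on_def)
  have goal: "2 + H \<le> 2 * b + 2 * N \<or> bi_covered A (int (card A) + b')"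
  proof (cases "2 + H \<le> 2 * b + 2 * N")
    case False
    have "dense_sum h A b' q"
    proof
      show "A \<subseteq> {0..h}" using r by (auto simp: A_def h std.ranged_def std_simps)
      show "0 \<in> A" "h \<in> A" using X0 XH by (auto simp: A_def h std_simps)
      show "int (card (A + A)) = 3 * int (card A) - 3 + b'" using NN unfolding NA N2A b' by linarith
      show "0 \<le> b'" using b by (simp add: b')
      show "2 * int (card A) - 1 + 2 * b' \<le> h" using False unfolding NA b' h by linarith
      have "real_of_int (h + q) \<le> real_of_int (q * int (card A))" using Hq by (simp add: NA h)
      then have "h + q \<le> q * int (card A)" by (simp only: of_int_le_iff)
      then show "h \<le> q * (int (card A) - 1)" by (simp add: algebra_simps)
      fix g assume g: "\<And>a. a \<in> A \<Longrightarrow> g dvd a"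
      obtain Z where Z: "X = real ` Z" "Gcd Z = 1" using gcd by (auto simp: std_simps)
      have "nat \<bar>g\<bar> dvd z" if "z \<in> Z" for z
      proof -
        have "int z \<in> A" using that Z(1) by (simp add: A_def)
        from g[OF this] have "g dvd int z" .
        then show ?thesis by (simp add: nat_abs_dvd_iff)
      qed
      then have "nat \<bar>g\<bar> dvd Gcd Z" by (rule Gcd_greatest)
      then show "g dvd 1" using Z(2) by (simp add: nat_abs_dvd_iff)
    qed
    then interpret dense_sum h A b' q .
    have "real_of_int (scale q * (b' + 1)) \<le> real_of_int h" using big by (simp add: h b')
    then have "scale q * (b' + 1) \<le> h" by (simp only: of_int_le_iff)
    then show ?thesis using covered by blast
  qed simp
  then show "2 + H \<le> 2 * b + 2 * N \<or> std.bi X (N + b)"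
    using std_bi[of A "int (card A) + b'"] by (auto simp: NA b' XA)
qed

section \<open>Transfer to the nonstandard universe\<close>

locale universe =
  fixes emb :: "real level1 \<Rightarrow> 'r::linordered_field level1" and star :: "'r ext"
  assumes universe: "nonstandard_universe emb star"
begin

lemmas conjuncts = universe[unfolded nonstandard_universe_def, folded rel_defs]
lemmas parts =
  conjuncts[THEN conjunct1]
  conjuncts[THEN conjunct2, THEN conjunct1]
  conjuncts[THEN conjunct2, THEN conjunct2, THEN conjunct1]
  conjuncts[THEN conjunct2, THEN conjunct2, THEN conjunct2, THEN conjunct1]
  conjuncts[THEN conjunct2, THEN conjunct2, THEN conjunct2, THEN conjunct2, THEN conjunct1]
  conjuncts[THEN conjunct2, THEN conjunct2, THEN conjunct2, THEN conjunct2, THEN conjunct2, THEN conjunct1]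
  conjuncts[THEN conjunct2, THEN conjunct2, THEN conjunct2, THEN conjunct2, THEN conjunct2, THEN conjunct2, THEN conjunct1]
  conjuncts[THEN conjunct2, THEN conjunct2, THEN conjunct2, THEN conjunct2, THEN conjunct2, THEN conjunct2, THEN conjunct2, THEN conjunct1]
  conjuncts[THEN conjunct2, THEN conjunct2, THEN conjunct2, THEN conjunct2, THEN conjunct2, THEN conjunct2, THEN conjunct2, THEN conjunct2]

lemma transfer: "sat UNIV (\<lambda>R. R) v p \<longleftrightarrow> sat (internals star) star (\<lambda>i. emb (v i)) p"
  using parts(9) by (elim allE)

sublocale model "internals star" star
proof
  show atom: "Atom x \<in> internals star" for x using parts(3) by (rule subsetD) (rule rangeI)
  show "[e] \<in> star R_atom \<longleftrightarrow> e \<in> range Atom" for e using parts(2) by (elim allE)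
  show "e \<in> internals star \<Longrightarrow> e' \<in> internals star \<Longrightarrow> [e, e'] \<in> star R_eq \<longleftrightarrow> e = e'" for e e'
    by (rule bspec[OF bspec[OF parts(4)]])
  show "[Atom x, SetOf X] \<in> star R_mem \<longleftrightarrow> x \<in> X" if "SetOf X \<in> internals star" for x X
    using bspec[OF bspec[OF parts(5) atom] that] by simp
  show "[Atom x, Atom y, Atom z] \<in> star R_add \<longleftrightarrow> z = x + y" for x y z using parts(6) by (elim allE)
  show "[Atom x, Atom y, Atom z] \<in> star R_mult \<longleftrightarrow> z = x * y" for x y z using parts(7) by (elim allE)
  show "[Atom x, Atom y] \<in> star R_le \<longleftrightarrow> x \<le> y" for x y using parts(8) by (elim allE)
qed

lemma elem_iff: "SetOf X \<in> internals star \<Longrightarrow> elem x X \<longleftrightarrow> x \<in> X"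
  unfolding elem_def by (rule J_mem)

lemma nats_eq: "nats = hypernats star" by (simp only: nats_def hypernats_def R_nat_def)
lemma ints_eq: "ints = hyperints star" by (simp only: ints_def hyperints_def R_int_def)

text \<open>The value of \<open>emb\<close> on an atom, read as a field element; transfer makes it a
  ring homomorphism, so a standard natural number goes to \<open>of_nat\<close>.\<close>

definition hyper :: "real \<Rightarrow> 'r" where "hyper r = (SOME x. emb (Atom r) = Atom x)"

lemma emb_Atom: "emb (Atom r) = Atom (hyper r)"
proof -
  have "sat UNIV (\<lambda>R. R) (\<lambda>_. Atom r) (f_atom 0)" by (auto simp: f_atom_def R_atom_def)
  then have "sat (internals star) star (\<lambda>_. emb (Atom r)) (f_atom 0)" using transfer[of "\<lambda>_. Atom r"] by blast
  then have "\<exists>x. emb (Atom r) = Atom x" using J_atom[of "emb (Atom r)"] by (auto simp: f_atom_def)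
  then show ?thesis unfolding hyper_def by (rule someI_ex)
qed

lemma hyper_add: "hyper (s + t) = hyper s + hyper t"
proof -
  define v where "v = (\<lambda>i::nat. if i = 0 then Atom s else if i = 1 then Atom t else Atom (s + t))"
  have "sat UNIV (\<lambda>R. R) v (f_add 0 1 2)" by (simp add: v_def std.sat_simps)
  then have "sat (internals star) star (\<lambda>i. emb (v i)) (f_add 0 1 2)" using transfer by blast
  then show ?thesis by (simp add: v_def sat_simps emb_Atom)
qed

lemma hyper_mult: "hyper (s * t) = hyper s * hyper t"
proof -
  define v where "v = (\<lambda>i::nat. if i = 0 then Atom s else if i = 1 then Atom t else Atom (s * t))"
  have "sat UNIV (\<lambda>R. R) v (f_mult 0 1 2)" by (simp add: v_def std.sat_simps)
  then have "sat (internals star) star (\<lambda>i. emb (v i)) (f_mult 0 1 2)" using transfer by blast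
  then show ?thesis by (simp add: v_def sat_simps emb_Atom)
qed

lemma hyper_0: "hyper 0 = 0" using hyper_add[of 0 0] by simp

lemma hyper_1: "hyper 1 = 1"
proof -
  define v where "v = (\<lambda>i::nat. if i = 0 then Atom 0 else Atom (1::real))"
  have "\<not> sat UNIV (\<lambda>R. R) v (f_eq 0 1)" by (simp add: v_def std.sat_simps)
  then have "\<not> sat (internals star) star (\<lambda>i. emb (v i)) (f_eq 0 1)" using transfer by blast
  then have "hyper 1 \<noteq> 0" by (simp add: v_def sat_simps emb_Atom hyper_0)
  then show ?thesis using hyper_mult[of 1 1] by simp
qed

lemma hyper_of_nat: "hyper (real n) = of_nat n"
  by (induction n) (simp_all add: hyper_0 hyper_1 hyper_add)

lemma transfer_val:
  "sat UNIV (\<lambda>R. R) (std.val (real i) (real j)) p \<longleftrightarrow> sat (internals star) star (val (of_nat i) (of_nat j)) p"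
proof -
  have "hyper 3 = 3" using hyper_of_nat[of 3] by simp
  then have "(\<lambda>l. emb (std.val (real i) (real j) l)) = val (of_nat i) (of_nat j)"
    by (intro ext) (simp add: std.val_def val_def emb_Atom hyper_0 hyper_1 hyper_of_nat)
  then show ?thesis using transfer[of "std.val (real i) (real j)"] by simp
qed

lemma step: "x \<in> nats \<Longrightarrow> 0 \<le> x" "x \<in> nats \<Longrightarrow> y \<in> nats \<Longrightarrow> x \<le> y + 1 \<Longrightarrow> x \<le> y \<or> x = y + 1"
  using std_step[of "real 0" "real 0"] unfolding transfer_val sat_step by blast+

lemma unique: "SetOf X \<in> internals star \<Longrightarrow> has_card X m \<Longrightarrow> has_card X n \<Longrightarrow> m = n"
  "SetOf X \<in> internals star \<Longrightarrow> has_gcd X m \<Longrightarrow> has_gcd X n \<Longrightarrow> m = n"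
  using std_unique[of "real 0" "real 0"] unfolding transfer_val sat_unique by blast+

lemma exist:
  assumes "SetOf X \<in> internals star" "ranged X H"
  shows "\<exists>n. has_card X n" "\<exists>n. has_gcd X n" "\<exists>Y. SetOf Y \<in> internals star \<and> sumset_of X Y \<and> (\<exists>n. has_card Y n)"
  using std_exist[of "real 0" "real 0"] assms unfolding transfer_val sat_exist by blast+

lemma claim: "claim (of_nat i) (of_nat (nat (scale (int i))))"
proof -
  have "0 \<le> scale (int i)" by (simp add: scale_def small_scale_def)
  then have "sat UNIV (\<lambda>R. R) (std.val (real i) (real (nat (scale (int i))))) f_main" using std_main[of "int i"] by simp
  then show ?thesis unfolding transfer_val sat_main .
qed

lemma icard_eq: "SetOf X \<in> internals star \<Longrightarrow> has_card X n \<Longrightarrow> icard star X = n"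
  unfolding icard_def has_card_def[unfolded R_card_def, symmetric] using unique(1) by (intro the_equality)

lemma igcd_eq: "SetOf X \<in> internals star \<Longrightarrow> has_gcd X n \<Longrightarrow> igcd star X = n"
  unfolding igcd_def has_gcd_def[unfolded R_gcd_def, symmetric] using unique(2) by (intro the_equality)

lemma of_nat_hyper: "of_nat n \<in> nats"
proof -
  have "sat UNIV (\<lambda>R. R) (std.val (real n) (real 0)) (f_nat 3)"
    by (subst std.sat_simps(1)[of _ _ "real n"]) (simp_all add: std.val_def std_simps)
  then have "sat (internals star) star (val (of_nat n) (of_nat 0)) (f_nat 3)" unfolding transfer_val .
  then show ?thesis by (subst (asm) sat_simps(1)[of _ _ "of_nat n"]) (simp_all add: val_def)
qed

lemma bounded_standard: "x \<in> nats \<Longrightarrow> x \<le> of_nat n \<Longrightarrow> x \<in> \<nat>"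
proof (induction n)
  case 0
  then have "x = 0" using step(1)[of x] by simp
  then show ?case by simp
next
  case (Suc n)
  have "x \<le> of_nat n \<or> x = of_nat n + 1" using Suc.prems by (intro step(2) of_nat_hyper) (simp_all add: add.commute)
  then show ?case
  proof
    assume "x = of_nat n + 1"
    then have "x = of_nat (Suc n)" by simp
    then show ?thesis by (simp only: of_nat_in_Nats)
  qed (use Suc in blast)
qed

lemma hyperfinite_large: assumes "H \<in> hyperfinite_integers star" shows "of_nat n < H"
proof (rule ccontr)
  assume "\<not> of_nat n < H"
  then show False using bounded_standard[of H n] assms by (auto simp: hyperfinite_integers_def nats_eq)
qed

lemma progr_ap:
  assumes "SetOf I \<in> internals star" "progr a d l I" "d \<in> nats" "l \<in> nats" "a \<in> nats" "1 \<le> d" "1 \<le> l"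
  shows "is_ap star d l I"
proof -
  have "I = {a + i * d | i. i \<in> hypernats star \<and> i < l}"
    using assms(2) unfolding progr_def elem_iff[OF assms(1)] nats_eq by (auto simp: less_le)
  then show ?thesis using assms unfolding is_ap_def nats_eq by blast
qed

lemma apart_disjoint:
  assumes "SetOf P \<in> internals star" "SetOf Q \<in> internals star" "SetOf P' \<in> internals star" "SetOf Q' \<in> internals star"
    "apart P Q P' Q'"
  shows "(P + Q) \<inter> (P' + Q') = {}"
proof -
  have False if z: "z \<in> P + Q" "z \<in> P' + Q'" for z
  proof -
    obtain x y where "x \<in> P" "y \<in> Q" "z = x + y" using z(1) by (rule set_plus_elim)
    moreover obtain u w where "u \<in> P'" "w \<in> Q'" "z = u + w" using z(2) by (rule set_plus_elim)
    ultimately show False using assms(5) unfolding apart_def elem_iff[OF assms(1)] elem_iff[OF assms(2)]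
        elem_iff[OF assms(3)] elem_iff[OF assms(4)] by blast
  qed
  then show ?thesis by blast
qed

lemma bi_subset:
  assumes X: "SetOf X \<in> internals star" and b: "bi X m"
  shows "\<exists>k\<le>m. subset_of_bi_ap star X k"
proof -
  obtain d l1 l2 a1 a2 I K where "l1 + l2 \<le> m" "has_card I l1" "has_card K l2" "progr a1 d l1 I" "progr a2 d l2 K"
    "SetOf I \<in> internals star" "SetOf K \<in> internals star"
    "d \<in> nats" "l1 \<in> nats" "l2 \<in> nats" "a1 \<in> nats" "a2 \<in> nats" "1 \<le> d" "1 \<le> l1" "1 \<le> l2"
    "apart I I I K" "apart I I K K" "apart I K K K"
    "\<forall>a. elem a X \<longrightarrow> elem a I \<or> elem a K" "\<exists>a. elem a X \<and> elem a I" "\<exists>a. elem a X \<and> elem a K"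
    using b unfolding bi_def
    by (elim exE conjE) (rule that, assumption+, (rule exI, rule conjI, assumption, assumption)+)
  note * = this(6-15,1,4,5,2,3,16-21)
  have "is_bi_ap star d (l1 + l2) I K"
    unfolding is_bi_ap_def icard_eq[OF *(1,14)] icard_eq[OF *(2,15)]
    by (intro conjI refl exI[of _ l1] exI[of _ l2] progr_ap[OF *(1,12,3,4,6,8,9)] progr_ap[OF *(2,13,3,5,7,8,10)]
      apart_disjoint[OF *(1,1,1,2,16)] apart_disjoint[OF *(1,1,2,2,17)] apart_disjoint[OF *(1,2,2,2,18)])
  moreover have "X \<subseteq> I \<union> K" "X \<inter> I \<noteq> {}" "X \<inter> K \<noteq> {}"
    using *(19,20,21) unfolding elem_iff[OF X] elem_iff[OF *(1)] elem_iff[OF *(2)] by blast+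
  ultimately have "subset_of_bi_ap star X (l1 + l2)" unfolding subset_of_bi_ap_def by blast
  then show ?thesis using *(11) by blast
qed

end

theorem theorem1p7:
  fixes emb :: "real level1 \<Rightarrow> 'r::linordered_field level1"
    and star :: "real level1 list set \<Rightarrow> 'r level1 list set"
    and H b :: 'r
    and A :: "'r set"
  assumes "nonstandard_universe emb star" and "countably_saturated star"
    and "H \<in> hyperfinite_integers star"
    and "internal star A" and "A \<subseteq> interval star 0 H"
    and "is_min 0 A" and "is_max H A"
    and "much_less H 0 (icard star A)"
    and "igcd star A = 1"
    and "b \<in> hyperints star"
    and "icard star (A + A) = 3 * icard star A - 3 + b"
    and "0 \<le> b" and "near H b 0"
  shows "H + 1 \<le> 2 * icard star A - 1 + 2 * b \<or>
         (\<exists>k. k \<le> icard star A + b \<and> subset_of_bi_ap star A k)"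
proof -
  interpret universe emb star using assms(1) by unfold_locales
  have A: "SetOf A \<in> internals star" using assms(4) by (simp add: internal_def)
  note elem_A = elem_iff[OF A]
  have rA: "ranged A H" using assms(5) unfolding ranged_def elem_A interval_def ints_eq by blast
  obtain N where N: "has_card A N" using exist(1)[OF A rA] by blast
  have iN: "icard star A = N" by (rule icard_eq[OF A N])
  obtain G where G: "has_gcd A G" using exist(2)[OF A rA] by blast
  have gcd: "has_gcd A 1" using igcd_eq[OF A G] assms(9) G by simp
  obtain Y N2 where Y: "SetOf Y \<in> internals star" "sumset_of A Y" "has_card Y N2" using exist(3)[OF A rA] by blast
  have YA: "Y = A + A"
  proof -
    have "z \<in> A + A \<longleftrightarrow> (\<exists>x y. x \<in> A \<and> y \<in> A \<and> z = x + y)" for z by (auto simp: set_plus_def)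
    then show ?thesis using Y(2) unfolding sumset_of_def elem_A elem_iff[OF Y(1)] by blast
  qed
  have iN2: "icard star (A + A) = N2" using icard_eq[OF Y(1,3)] YA by simp
  have large: "of_nat n < H" for n using hyperfinite_large[OF assms(3)] .
  have H0: "0 < H" using large[of 0] by simp
  have Hnat: "H \<in> nats" using assms(3) by (auto simp: nats_eq hyperfinite_integers_def)
  have N0: "0 < N" and "\<not> near H 0 N" using assms(8) by (auto simp: much_less_def iN)
  \<comment> \<open>Failure of \<open>near\<close> supplies a standard \<open>m\<close> with
    \<open>N / H\<close> at least \<open>1 / m\<close>.\<close>
  then obtain m :: nat where m: "m > 0" "\<bar>N / H\<bar> \<ge> 1 / of_nat m"
    by (auto simp: near_def infinitesimal_def not_less)
  have m': "0 < (of_nat m :: 'r)" using m(1) by simp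
  have "1 / of_nat m \<le> N / H" using m(2) N0 H0 by simp
  then have mN: "H \<le> of_nat m * N" using m' H0 by (simp add: field_simps)
  \<comment> \<open>The density bound concerns \<open>N - 1\<close> instead of \<open>N\<close>;
    doubling \<open>m\<close> pays for the difference, since \<open>2 * m < H\<close>.\<close>
  define q where "q = 2 * m"
  have "of_nat q = (2 * of_nat m :: 'r)" by (simp add: q_def)
  moreover have "of_nat (2 * m) < H" by (rule large)
  ultimately have Hq: "H + of_nat q \<le> of_nat q * N" using mN by (simp add: algebra_simps)
  define B where "B = nat (scale (int q))"
  have Hb: "of_nat B * (b + 1) \<le> H"
  proof -
    \<comment> \<open>The denominator \<open>2 * B + 1\<close> leaves one half of \<open>H\<close>
      for \<open>B * b\<close> and the other half for \<open>B\<close>.\<close>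
    have "\<bar>(0 - b) / H\<bar> < 1 / of_nat (2 * B + 1)" 
      by (rule assms(13)[unfolded near_def infinitesimal_def, THEN spec, THEN mp]) simp
    moreover have "\<bar>(0 - b) / H\<bar> = b / H" using assms(12) H0 by simp
    ultimately have "b / H < 1 / of_nat (2 * B + 1)" by simp
    moreover have B1: "0 < (of_nat (2 * B + 1) :: 'r)" by (simp only: of_nat_0_less_iff)
    ultimately have "b * of_nat (2 * B + 1) < H" using H0 by (simp add: divide_less_eq less_divide_eq mult.commute)
    then have "2 * (of_nat B * b) + b < H" by (simp add: algebra_simps)
    moreover have "2 * of_nat B < H" using large[of "2 * B"] by simp
    ultimately show ?thesis using assms(12) by (simp add: algebra_simps)
  qed
  have "2 + H \<le> 2 * b + 2 * N \<or> bi A (N + b)"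
  proof -
    have "elem 0 A" "elem H A" using assms(6,7) unfolding elem_A is_min_def is_max_def by blast+
    moreover have "3 * N + b = N2 + 3" using assms(11) unfolding iN iN2 by simp
    moreover have "b \<in> ints" using assms(10) by (simp add: ints_eq)
    ultimately show ?thesis
      using claim[of q, folded B_def] A Y Hnat rA N gcd assms(12) Hq Hb unfolding claim_def by blast
  qed
  then show ?thesis
  proof
    assume "2 + H \<le> 2 * b + 2 * N"
    then show ?thesis unfolding iN by (simp add: algebra_simps)
  next
    assume "bi A (N + b)"
    then show ?thesis using bi_subset[OF A] unfolding iN by blast
  qed
qed

end
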